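(* Let either (i) $d=1$ and $q\in(4,\infty)$, or (ii) $d\ge 2$ and $q\in(2,\infty)$. Put $s=\frac d2-\frac2q$. If $1\le\beta<\frac q2$, then there is a finite constant $C$, depending only on $d,q,\beta$, such that $$\bigg\|\sum_j\lambda_j|Uf_j|^2\bigg\|_{L^{q/2}_tL^\infty_x(\mathbb R\times\mathbb R^d)}\le C\,\|\lambda\|_{\ell^\beta}$$ for all systems $(f_j)_j$ of orthonormal functions in $\dot H^s(\mathbb R^d)$ and all sequences $\lambda=(\lambda_j)_j\in\ell^\beta$ of complex scalars. Furthermore, the estimate fails when $\beta>\frac q2$, i.e. in that case no such finite constant $C$ exists.
   Context: $U$ denotes the Schrödinger propagator $Uf(t,x)=e^{it\Delta}f(x)$, $(t,x)\in\mathbb R\times\mathbb R^d$, i.e. for each fixed $t$ the Fourier multiplier operator with multiplier $e^{-it|\xi|^2}$ (changing the sign of $t$ makes no difference). $\dot H^s(\mathbb R^d)$ is the homogeneous Sobolev space, with inner product $\langle f,g\rangle_{\dot H^s}=\langle |D|^sf,|D|^sg\rangle_{L^2}$, where $|D|^s$ is the Fourier multiplier operator with multiplier $|\xi|^s$; thus $(f_j)_j$ is orthonormal in $\dot H^s$ iff $f_j=|D|^{-s}g_j$ with $(g_j)_j$ orthonormal in $L^2(\mathbb R^d)$. Systems may be finite or countably infinite. The mixed norm is $\|F\|_{L^{p}_tL^\infty_x}=\big\|\,\|F(t,\cdot)\|_{L^\infty_x(\mathbb R^d)}\big\|_{L^{p}_t(\mathbb R)}$. The exponents $\beta$ are taken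 in $[1,\infty]$. *)

theory Defs
  imports "HOL-Analysis.Analysis" "HOL-Probability.Essential_Supremum"
begin

section \<open>Schwartz functions and the Fourier transform of tempered functions\<close>

primrec iter_partial :: "'a::euclidean_space list \<Rightarrow> ('a \<Rightarrow> complex) \<Rightarrow> 'a \<Rightarrow> complex" where
  "iter_partial [] \<phi> = \<phi>"
| "iter_partial (b # bs) \<phi> = (\<lambda>x. frechet_derivative (iter_partial bs \<phi>) (at x) b)"

definition schwartz :: "('a::euclidean_space \<Rightarrow> complex) \<Rightarrow> bool" where
  "schwartz \<phi> \<longleftrightarrow>
     (\<forall>bs. set bs \<subseteq> Basis \<longrightarrow>
        (\<forall>x. iter_partial bs \<phi> differentiable (at x)) \<and>
        (\<forall>k::nat. \<exists>M. \<forall>x. norm x ^ k * cmod (iter_partial bs \<phi> x) \<le> M))"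

text \<open>No power of \<open>2 * pi\<close> is included: Fourier multiplier operators do not depend on
  a constant factor in the Fourier transform, and inner products are taken in physical space.\<close>

definition fourier :: "('a::euclidean_space \<Rightarrow> complex) \<Rightarrow> 'a \<Rightarrow> complex" where
  "fourier \<phi> \<xi> = (\<integral>x. cis (- (x \<bullet> \<xi>)) * \<phi> x \<partial>lborel)"

text \<open>Borel functions that act on Schwartz functions by an absolutely convergent integral;
  these are the tempered distributions given by a function. Equality of two of them as
  distributions is equality almost everywhere.\<close>

definition tempered_fun :: "('a::euclidean_space \<Rightarrow> complex) \<Rightarrow> bool" where
  "tempered_fun f \<longleftrightarrow> f \<in> borel_measurable borel \<and>
     (\<forall>\<phi>. schwartz \<phi> \<longrightarrow> integrable lborel (\<lambda>x. f x * \<phi> x))"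

definition has_fourier_transform ::
    "('a::euclidean_space \<Rightarrow> complex) \<Rightarrow> ('a \<Rightarrow> complex) \<Rightarrow> bool" where
  "has_fourier_transform f F \<longleftrightarrow> tempered_fun f \<and> tempered_fun F \<and>
     (\<forall>\<phi>. schwartz \<phi> \<longrightarrow>
        (\<integral>x. f x * fourier \<phi> x \<partial>lborel) = (\<integral>\<xi>. F \<xi> * \<phi> \<xi> \<partial>lborel))"

text \<open>\<open>fourier_multiplier m f g\<close>: \<open>g\<close> is (a representative of) the image of \<open>f\<close> under the
  Fourier multiplier operator with multiplier \<open>m\<close>.\<close>

definition fourier_multiplier ::
    "('a::euclidean_space \<Rightarrow> complex) \<Rightarrow> ('a \<Rightarrow> complex) \<Rightarrow> ('a \<Rightarrow> complex) \<Rightarrow> bool" where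
  "fourier_multiplier m f g \<longleftrightarrow>
     (\<exists>F. has_fourier_transform f F \<and> has_fourier_transform g (\<lambda>\<xi>. m \<xi> * F \<xi>))"

section \<open>Homogeneous Sobolev spaces and the Schroedinger propagator\<close>

definition abs_D_powr :: "real \<Rightarrow> ('a::euclidean_space \<Rightarrow> complex) \<Rightarrow> ('a \<Rightarrow> complex) \<Rightarrow> bool" where
  "abs_D_powr s = fourier_multiplier (\<lambda>\<xi>. of_real (norm \<xi> powr s))"

definition square_integrable :: "('a::euclidean_space \<Rightarrow> complex) \<Rightarrow> bool" where
  "square_integrable g \<longleftrightarrow> g \<in> borel_measurable borel \<and> integrable lborel (\<lambda>x. (cmod (g x))\<^sup>2)"

text \<open>Elements of the homogeneous Sobolev space are represented by functions. For
  \<open>0 < s < d/2\<close>, the only range used, this is no restriction: there \<open>|D|^(-s)\<close> maps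
  \<open>L^2\<close> into \<open>L^p\<close> with \<open>p = 2d/(d - 2s)\<close>.\<close>

definition orthonormal_hom_sobolev ::
    "real \<Rightarrow> nat set \<Rightarrow> (nat \<Rightarrow> 'a::euclidean_space \<Rightarrow> complex) \<Rightarrow> bool" where
  "orthonormal_hom_sobolev s J f \<longleftrightarrow>
     (\<exists>g. (\<forall>j\<in>J. abs_D_powr s (f j) (g j) \<and> square_integrable (g j)) \<and>
          (\<forall>i\<in>J. \<forall>j\<in>J. (\<integral>x. g i x * cnj (g j x) \<partial>lborel) = (if i = j then 1 else 0)))"

text \<open>\<open>schroedinger_evolution f u\<close>: \<open>u\<close> is a jointly measurable representative of \<open>U f\<close>.
  Any two of them agree, for each \<open>t\<close>, at almost every \<open>x\<close>.\<close>

definition schroedinger_evolution ::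
    "('a::euclidean_space \<Rightarrow> complex) \<Rightarrow> (real \<Rightarrow> 'a \<Rightarrow> complex) \<Rightarrow> bool" where
  "schroedinger_evolution f u \<longleftrightarrow>
     (\<lambda>(t, x). u t x) \<in> borel_measurable borel \<and>
     (\<forall>t. fourier_multiplier (\<lambda>\<xi>. cis (- (t * (norm \<xi>)\<^sup>2))) f (u t))"

section \<open>Norms with values in the extended nonnegative reals\<close>

text \<open>Only used with a positive exponent, for which \<open>\<infinity>\<close> to the power \<open>p\<close> is \<open>\<infinity>\<close>.\<close>

definition ennreal_powr :: "ennreal \<Rightarrow> real \<Rightarrow> ennreal" where
  "ennreal_powr x p = (if x = \<infinity> then \<infinity> else ennreal (enn2real x powr p))"

definition seq_lp_norm :: "ereal \<Rightarrow> nat set \<Rightarrow> (nat \<Rightarrow> complex) \<Rightarrow> ennreal" where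
  "seq_lp_norm \<beta> J c =
     (if \<beta> = \<infinity> then (SUP j\<in>J. ennreal (cmod (c j)))
      else ennreal_powr (\<Sum>\<^sub>\<infinity>j\<in>J. ennreal (cmod (c j) powr real_of_ereal \<beta>)) (1 / real_of_ereal \<beta>))"

definition Lp_Linf_norm :: "real \<Rightarrow> (real \<Rightarrow> 'a::euclidean_space \<Rightarrow> complex) \<Rightarrow> ennreal" where
  "Lp_Linf_norm p F =
     ennreal_powr
       (\<integral>\<^sup>+t. ennreal_powr (esssup lborel (\<lambda>x. ennreal (cmod (F t x)))) p \<partial>lborel) (1 / p)"

section \<open>The estimate for orthonormal systems\<close>

text \<open>A system is indexed by an arbitrary set \<open>J\<close> of natural numbers, so it may be finite or
  countably infinite. As \<open>infsum\<close> is \<open>0\<close> for a family that is not summable, the estimate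
  includes the (absolute) convergence of the series almost everywhere. This does not change
  for which constants the estimate holds: by monotone convergence, applied with \<open>\<bar>c j\<bar>\<close>,
  the bound for finite systems implies convergence and the bound for infinite ones.\<close>

definition orthonormal_maximal_estimate ::
    "'a::euclidean_space itself \<Rightarrow> real \<Rightarrow> real \<Rightarrow> ereal \<Rightarrow> real \<Rightarrow> bool" where
  "orthonormal_maximal_estimate _ s q \<beta> C \<longleftrightarrow>
     (\<forall>(J :: nat set) (f :: nat \<Rightarrow> 'a \<Rightarrow> complex) u (c :: nat \<Rightarrow> complex).
        orthonormal_hom_sobolev s J f \<longrightarrow>
        (\<forall>j\<in>J. schroedinger_evolution (f j) (u j)) \<longrightarrow>
        seq_lp_norm \<beta> J c < \<infinity> \<longrightarrow>
        (AE t in lborel. AE x in lborel. (\<lambda>j. c j * of_real ((cmod (u j t x))\<^sup>2)) summable_on J) \<and>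
        Lp_Linf_norm (q / 2) (\<lambda>t x. \<Sum>\<^sub>\<infinity>j\<in>J. c j * of_real ((cmod (u j t x))\<^sup>2))
          \<le> ennreal C * seq_lp_norm \<beta> J c)"

end

theory Submission
  imports Defs "HOL-Probability.Probability" "HOL-Real_Asymp.Real_Asymp"
begin

text \<open>Write \<open>p = q / 2\<close> and \<open>f\<^sub>j = |D|\<^sup>-\<^sup>s g\<^sub>j\<close>. It suffices to bound the \<open>p\<close>-th power of the maximal function
  of a finite system of \<open>N\<close> functions with unit coefficients by \<open>C N\<^sup>\<kappa>\<close> with \<open>\<beta> \<kappa> < p\<close>: the coefficients are split
  into dyadic levels, and the level \<open>2\<^sup>-\<^sup>l\<close> contains at most \<open>2\<^sup>(\<^sup>l\<^sup>+\<^sup>1\<^sup>)\<^sup>\<beta>\<close> of them.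

  Consider the set \<open>E\<close> of times at which the maximal function exceeds \<open>4 C\<^sub>0 R\<^sup>2\<^sup>/\<^sup>p\<close>, and linearise the supremum
  by a measurable choice \<open>x(t)\<close>. By Bessel's inequality the frequencies \<open>|\<xi>| \<le> R\<close> contribute at most
  \<open>C\<^sub>0 R\<^sup>2\<^sup>/\<^sup>p\<close> at every point, so the frequencies \<open>|\<xi>| > R\<close> are large on all of \<open>E\<close>. Their square integral
  over \<open>E\<close> is controlled by duality (\<open>TT\<^sup>*\<close>) and the decay \<open>|t|\<^sup>-\<^sup>a\<close> of the kernel, through the operator norm
  (\<open>\<kappa> = 1 / a\<close>), or, in one dimension, through the Hilbert-Schmidt norm (\<open>\<kappa> = 1 / (2 a)\<close>), where
  \<open>a > 1 / p\<close> is close to \<open>1 / p\<close>. A small power of \<open>R / |\<xi>|\<close> is spared, which makes the resulting bounds for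
  \<open>|E|\<close> summable over \<open>R\<close> in the layer cake formula.

  Above the critical exponent, functions whose Fourier transforms are the normalised indicators of the shells
  \<open>2\<^sup>j \<le> |\<xi>| < 2\<^sup>j\<^sup>+\<^sup>1\<close> with \<open>j < N\<close> all focus at the origin, so that the \<open>p\<close>-th power of the left-hand side is at
  least \<open>c N\<close>, whereas the norm of the coefficients is \<open>N\<^sup>1\<^sup>/\<^sup>\<beta>\<close>.\<close>

section \<open>Gaussian integrals and the Schroedinger kernel\<close>

text \<open>A larger decay exponent \<open>a\<close> gives a smaller \<open>\<kappa>\<close>, and
  \<open>\<beta> * \<kappa> < p\<close> decides how large \<open>a\<close> must be. The operator
  norm asks for a > \<beta>/p, so \<open>a\<close> may have to come close to 1; as the kernel decays
  at most at the rate d/2, this is possible for d \<ge> 2. In one dimension \<open>a\<close> stays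
  below 1/2 and the operator norm would stop at \<beta> = p/2. The Hilbert-Schmidt norm doubles the
  range, since it exploits orthogonality through Bessel's inequality; 1/p < a < 1/2 is where q > 4
  comes from. The strictness of \<open>\<beta> * \<kappa> < p\<close> pays for the sum over
  coefficient levels.

  Fourier transforms are given by duality with Schwartz functions. The upper bound tests them only
  with modulated Gaussians and translated heat kernels: a mollification of one function is then the
  transform of the other one damped by a Gaussian, and Fatou's lemma removes the regularisation.
  This yields Plancherel's inequality, which is what a Bessel system asks for; equality enters only
  for the explicit functions of the counterexample.\<close>

lemma nn_integral_lborel_affine:
  fixes f :: "'a::euclidean_space \<Rightarrow> ennreal"
  assumes "f \<in> borel_measurable borel" "c \<noteq> 0"
  shows "(\<integral>\<^sup>+x. f x \<partial>lborel) = ennreal (\<bar>c\<bar> ^ DIM('a)) * (\<integral>\<^sup>+x. f (t + c *\<^sub>R x) \<partial>lborel)"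
  using assms by (subst lborel_affine[OF assms(2), of t])
    (simp add: nn_integral_density nn_integral_distr nn_integral_cmult)

lemma integral_lborel_affine:
  fixes f :: "'a::euclidean_space \<Rightarrow> complex"
  assumes [measurable]: "f \<in> borel_measurable borel" and "c \<noteq> 0"
  shows "(\<integral>x. f x \<partial>lborel) = \<bar>c\<bar> ^ DIM('a) *\<^sub>R (\<integral>x. f (t + c *\<^sub>R x) \<partial>lborel)"
  by (subst lborel_affine[OF assms(2), of t])
    (simp add: integral_density integral_distr)

lemma integrable_lborel_affine:
  fixes f :: "'a::euclidean_space \<Rightarrow> complex"
  assumes f: "integrable lborel f" and c: "c \<noteq> 0"
  shows "integrable lborel (\<lambda>x. f (t + c *\<^sub>R x))"
proof -
  have m: "f \<in> borel_measurable borel"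
    using borel_measurable_integrable[OF f] by simp
  have "integrable (density (distr lborel borel (\<lambda>x. t + c *\<^sub>R x)) (\<lambda>x. ennreal (\<bar>c\<bar> ^ DIM('a)))) f"
    using f lborel_affine[OF c, of t] by simp
  hence "integrable lborel (\<lambda>x. \<bar>c\<bar> ^ DIM('a) *\<^sub>R f (t + c *\<^sub>R x))"
    using m by (simp add: integrable_density integrable_distr_eq)
  from integrable_scaleR_right[OF this, of "1 / \<bar>c\<bar> ^ DIM('a)"] show ?thesis
    using c by simp
qed

lemma borel_measurable_cis [measurable (raw)]:
  assumes "f \<in> borel_measurable M"
  shows "(\<lambda>x. cis (f x)) \<in> borel_measurable M"
  by (rule measurable_compose[OF assms]) (intro borel_measurable_continuous_onI continuous_intros)

lemma borel_measurable_cnj [measurable (raw)]: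
  assumes "f \<in> borel_measurable M"
  shows "(\<lambda>x. cnj (f x)) \<in> borel_measurable M"
  by (rule measurable_compose[OF assms]) (intro borel_measurable_continuous_onI continuous_intros)

text \<open>Tonelli's criterion, in the form that supplies the hypothesis of Fubini's theorem in all
  the exchanges of integrals below.\<close>

lemma (in pair_sigma_finite) integrable_pair_nn:
  fixes f :: "'a \<Rightarrow> 'b \<Rightarrow> complex"
  assumes [measurable]: "case_prod f \<in> borel_measurable (M1 \<Otimes>\<^sub>M M2)"
    and "(\<integral>\<^sup>+x. \<integral>\<^sup>+y. ennreal (cmod (f x y)) \<partial>M2 \<partial>M1) < \<infinity>"
  shows "integrable (M1 \<Otimes>\<^sub>M M2) (case_prod f)"
proof (rule integrableI_bounded)
  have "(\<integral>\<^sup>+z. ennreal (cmod (case_prod f z)) \<partial>(M1 \<Otimes>\<^sub>M M2)) = (\<integral>\<^sup>+x. \<integral>\<^sup>+y. ennreal (cmod (f x y)) \<partial>M2 \<partial>M1)"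
    by (subst M2.nn_integral_fst[symmetric]) simp_all
  thus "(\<integral>\<^sup>+z. ennreal (cmod (case_prod f z)) \<partial>(M1 \<Otimes>\<^sub>M M2)) < \<infinity>" using assms(2) by simp
qed fact

text \<open>The substitution by \<open>sqrt (2 * a)\<close> turns the Gaussian into a standard
  normal density, whose characteristic function is known.\<close>

lemma gauss_real:
  fixes a y :: real
  assumes "0 < a"
  shows "integrable lborel (\<lambda>x. exp (- a * x\<^sup>2))"
    and "(\<integral>x. cis (x * y) * of_real (exp (- a * x\<^sup>2)) \<partial>lborel)
           = of_real (sqrt (pi / a) * exp (- y\<^sup>2 / (4 * a)))"
proof -
  define c where "c = sqrt (2 * a)"
  have c: "c > 0" "c\<^sup>2 = 2 * a" using assms by (auto simp: c_def)
  have i0: "integrable lborel std_normal_density"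
    using integrable_std_normal_moment[of 0] by simp
  have "integrable lborel (\<lambda>x. std_normal_density (0 + c * x))"
    by (rule lborel_integrable_real_affine[OF i0]) (use c in auto)
  hence "integrable lborel (\<lambda>x. sqrt (2 * pi) * std_normal_density (0 + c * x))"
    by (rule integrable_mult_right)
  moreover have "(\<lambda>x. sqrt (2 * pi) * std_normal_density (0 + c * x)) = (\<lambda>x. exp (- a * x\<^sup>2))"
    by (auto simp: std_normal_density_def power_mult_distrib c)
  ultimately show "integrable lborel (\<lambda>x. exp (- a * x\<^sup>2))" by (simp only:)
  have "complex_of_real (exp (- (y / c)\<^sup>2 / 2)) = (CLINT x|std_normal_distribution. iexp (y / c * x))"
    using fun_cong[OF char_std_normal_distribution[unfolded char_def], of "y / c"] by simp
  also have "\<dots> = (CLBINT x. std_normal_density x *\<^sub>R iexp (y / c * x))"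
    by (subst integral_density) auto
  also have "\<dots> = \<bar>c\<bar> *\<^sub>R (CLBINT x. std_normal_density (0 + c * x) *\<^sub>R iexp (y / c * (0 + c * x)))"
    by (rule lborel_integral_real_affine) (use c in auto)
  also have "\<dots> = c *\<^sub>R (CLBINT x. of_real (1 / sqrt (2 * pi)) * (cis (x * y) * of_real (exp (- a * x\<^sup>2))))"
    using c by (auto simp: std_normal_density_def power_mult_distrib cis_conv_exp scaleR_conv_of_real mult_ac
         intro!: Bochner_Integration.integral_cong)
  also have "\<dots> = of_real (c / sqrt (2 * pi)) * (CLBINT x. cis (x * y) * of_real (exp (- a * x\<^sup>2)))"
    by (simp add: scaleR_conv_of_real)
  finally have "(CLBINT x. cis (x * y) * of_real (exp (- a * x\<^sup>2)))
     = of_real (sqrt (2 * pi) / c) * complex_of_real (exp (- (y / c)\<^sup>2 / 2))"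
    using c by (simp add: field_simps)
  moreover have "sqrt (2 * pi) / c = sqrt (pi / a)"
    unfolding c_def by (simp add: real_sqrt_mult real_sqrt_divide)
  moreover have "- (y / c)\<^sup>2 / 2 = - y\<^sup>2 / (4 * a)"
    by (simp add: power_divide c)
  ultimately show "(\<integral>x. cis (x * y) * of_real (exp (- a * x\<^sup>2)) \<partial>lborel)
           = of_real (sqrt (pi / a) * exp (- y\<^sup>2 / (4 * a)))"
    by simp
qed

lemma norm_power2_Basis: "(norm (x::'a::euclidean_space))\<^sup>2 = (\<Sum>b\<in>Basis. (x \<bullet> b)\<^sup>2)"
  unfolding power2_norm_eq_inner by (subst euclidean_inner) (simp add: power2_eq_square)

lemma cis_sum: "finite A \<Longrightarrow> cis (sum f A) = (\<Prod>x\<in>A. cis (f x))"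
  by (induction A rule: finite_induct) (auto simp: cis_mult[symmetric])

lemma prod_Basis_powr: 
  assumes "0 \<le> x" 
  shows "(\<Prod>b\<in>(Basis::'a::euclidean_space set). sqrt x) = x powr (DIM('a) / 2)"
proof (cases "x = 0")
  case False
  then show ?thesis using assms
    by (simp add: powr_half_sqrt[symmetric] powr_powr powr_realpow[symmetric])
qed simp

text \<open>Lebesgue measure is the image of a product of one-dimensional ones, and the modulated
  Gaussian is a product of functions of the single coordinates. Integrability of the Gaussian itself
  is the case of frequency 0.\<close>

lemma gauss_integrable_and_ft:
  fixes y :: "'a::euclidean_space"
  assumes a: "0 < a"
  shows "integrable lborel (\<lambda>x::'a. exp (- a * (norm x)\<^sup>2))"
    and "(\<integral>x. cis (x \<bullet> y) * of_real (exp (- a * (norm x)\<^sup>2)) \<partial>lborel)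
           = of_real ((pi / a) powr (DIM('a) / 2) * exp (- (norm y)\<^sup>2 / (4 * a)))"
proof -
  let ?g = "\<lambda>y x::real. cis (x * y) * complex_of_real (exp (- a * x\<^sup>2))"
  have ig: "integrable lborel (?g y)" for y
    by (rule Bochner_Integration.integrable_bound[OF gauss_real(1)[OF a]]) (auto simp: norm_mult)
  interpret product_sigma_finite "\<lambda>b::'a. lborel :: real measure" by standard
  let ?P = "\<Pi>\<^sub>M b\<in>(Basis::'a set). lborel :: real measure"
  have eq: "cis ((\<Sum>b\<in>Basis. f b *\<^sub>R b) \<bullet> y) * of_real (exp (- a * (norm (\<Sum>b\<in>Basis. f b *\<^sub>R b))\<^sup>2))
        = (\<Prod>b\<in>Basis. ?g (y \<bullet> b) (f b))" for f :: "'a \<Rightarrow> real" and y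
  proof -
    have 1: "((\<Sum>b\<in>Basis. f b *\<^sub>R b) \<bullet> y) = (\<Sum>b\<in>Basis. f b * (y \<bullet> b))"
      unfolding inner_sum_left inner_scaleR_left by (simp add: inner_commute)
    have 2: "(norm (\<Sum>b\<in>Basis. f b *\<^sub>R b))\<^sup>2 = (\<Sum>b\<in>Basis. (f b)\<^sup>2)"
      by (subst norm_power2_Basis) (simp add: inner_sum_left inner_Basis if_distrib sum.If_cases cong: if_cong)
    show ?thesis
      by (simp add: 1 2 cis_sum sum_distrib_left exp_sum sum_negf[symmetric] prod.distrib del: sum_negf)
  qed
  have ip: "integrable ?P (\<lambda>f. \<Prod>b\<in>Basis. ?g (y \<bullet> b) (f b))" for y
    by (rule product_integrable_prod) (use ig in auto)
  have int: "integrable lborel (\<lambda>x::'a. cis (x \<bullet> y) * of_real (exp (- a * (norm x)\<^sup>2)))" for y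
    using ip[of y] by (subst lborel_eq, subst integrable_distr_eq) (measurable, simp only: eq)
  from integrable_norm[OF int[of 0]]
  show "integrable lborel (\<lambda>x::'a. exp (- a * (norm x)\<^sup>2))" by (simp add: norm_mult)
  have "(\<integral>x. cis (x \<bullet> y) * of_real (exp (- a * (norm x)\<^sup>2)) \<partial>lborel)
      = (\<integral>f. (\<Prod>b\<in>Basis. ?g (y \<bullet> b) (f b)) \<partial>?P)"
    by (subst lborel_eq, subst integral_distr) (measurable, simp only: eq)
  also have "\<dots> = (\<Prod>b\<in>Basis. integral\<^sup>L lborel (?g (y \<bullet> b)))"
    by (rule product_integral_prod) (use ig in auto)
  also have "\<dots> = (\<Prod>b\<in>Basis. of_real (sqrt (pi / a) * exp (- (y \<bullet> b)\<^sup>2 / (4 * a))))"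
    by (intro prod.cong refl gauss_real(2)[OF a])
  also have "\<dots> = of_real ((\<Prod>b\<in>(Basis::'a set). sqrt (pi / a)) * (\<Prod>b\<in>Basis. exp (- (y \<bullet> b)\<^sup>2 / (4 * a))))"
    by (simp only: of_real_prod[symmetric] prod.distrib)
  also have "(\<Prod>b\<in>(Basis::'a set). sqrt (pi / a)) = (pi / a) powr (DIM('a) / 2)"
    by (rule prod_Basis_powr) (use a in auto)
  also have "(\<Prod>b\<in>Basis. exp (- (y \<bullet> b)\<^sup>2 / (4 * a))) = exp (- (norm y)\<^sup>2 / (4 * a))"
    by (subst norm_power2_Basis) (simp add: exp_sum[symmetric] sum_divide_distrib sum_negf)
  finally show "(\<integral>x. cis (x \<bullet> y) * of_real (exp (- a * (norm x)\<^sup>2)) \<partial>lborel)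
           = of_real ((pi / a) powr (DIM('a) / 2) * exp (- (norm y)\<^sup>2 / (4 * a)))" .
qed

lemma gauss_integral:
  assumes a: "0 < a"
  shows "(\<integral>x. exp (- a * (norm (x::'a::euclidean_space))\<^sup>2) \<partial>lborel) = (pi / a) powr (DIM('a) / 2)"
proof -
  have "of_real (\<integral>x. exp (- a * (norm (x::'a::euclidean_space))\<^sup>2) \<partial>lborel)
     = complex_of_real ((pi / a) powr (DIM('a) / 2))"
    using gauss_integrable_and_ft(2)[OF a, of "0::'a"] by simp
  thus ?thesis by (simp only: of_real_eq_iff)
qed

lemma gauss_nn_integral:
  assumes a: "0 < a"
  shows "(\<integral>\<^sup>+x. ennreal (exp (- a * (norm (x::'a::euclidean_space))\<^sup>2)) \<partial>lborel) = ennreal ((pi / a) powr (DIM('a) / 2))"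
  by (subst nn_integral_eq_integral) (use gauss_integrable_and_ft(1)[OF a] gauss_integral[OF a] in auto)

lemma integral_lborel_translate:
  fixes f :: "'a::euclidean_space \<Rightarrow> complex"
  assumes "f \<in> borel_measurable borel"
  shows "(\<integral>x. f (t + x) \<partial>lborel) = (\<integral>x. f x \<partial>lborel)"
  using integral_lborel_affine[OF assms, of 1 t] by simp

lemma nn_integral_lborel_translate:
  fixes f :: "'a::euclidean_space \<Rightarrow> ennreal"
  assumes "f \<in> borel_measurable borel"
  shows "(\<integral>\<^sup>+x. f (t + x) \<partial>lborel) = (\<integral>\<^sup>+x. f x \<partial>lborel)"
  using nn_integral_lborel_affine[OF assms, of 1 t] by simp

lemma nn_integral_lborel_reflect:
  fixes f :: "'a::euclidean_space \<Rightarrow> ennreal"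
  assumes "f \<in> borel_measurable borel"
  shows "(\<integral>\<^sup>+x. f (t - x) \<partial>lborel) = (\<integral>\<^sup>+x. f x \<partial>lborel)"
  using nn_integral_lborel_affine[OF assms, of "-1" t] by simp

text \<open>The squared modulus is \<open>\<integral>\<integral> cnj (G \<eta>) * G (\<eta> + u)\<close>; with \<open>\<eta> = v - u / 2\<close> the phase becomes linear in \<open>v\<close>, so that only
  Gaussians with a real exponent have to be integrated.\<close>

lemma gauss_kernel_bound:
  fixes x :: "'a::euclidean_space"
  assumes a: "0 < a"
  shows "cmod (\<integral>\<xi>. cis (x \<bullet> \<xi> - t * (norm \<xi>)\<^sup>2) * of_real (exp (- a * (norm \<xi>)\<^sup>2)) \<partial>lborel)
    \<le> (pi\<^sup>2 / (a\<^sup>2 + t\<^sup>2)) powr (DIM('a) / 4)" (is "cmod ?I \<le> _")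
proof -
  define G where "G \<xi> = cis (x \<bullet> \<xi> - t * (norm \<xi>)\<^sup>2) * complex_of_real (exp (- a * (norm \<xi>)\<^sup>2))" for \<xi> :: 'a
  have [measurable]: "G \<in> borel_measurable borel" unfolding G_def by measurable
  have nG: "cmod (G \<xi>) = exp (- a * (norm \<xi>)\<^sup>2)" for \<xi> by (simp add: G_def norm_mult)
  have nI: "(\<integral>\<^sup>+\<xi>. ennreal (cmod (G \<xi>)) \<partial>lborel) = ennreal ((pi / a) powr (DIM('a) / 2))"
    unfolding nG by (rule gauss_nn_integral[OF a])
  have split: "cnj (G (v - u /\<^sub>R 2)) * G (v - u /\<^sub>R 2 + u)
      = cis (x \<bullet> u) * of_real (exp (- (a/2) * (norm u)\<^sup>2)) * (cis (v \<bullet> (- (2 * t) *\<^sub>R u)) * of_real (exp (- (2*a) * (norm v)\<^sup>2)))" for u v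
  proof -
    have n1: "(norm (v - u /\<^sub>R 2))\<^sup>2 = (norm v)\<^sup>2 - v \<bullet> u + (norm u)\<^sup>2 / 4"
      by (simp add: power2_norm_eq_inner inner_simps inner_commute algebra_simps)
    have n2: "(norm (v - u /\<^sub>R 2 + u))\<^sup>2 = (norm v)\<^sup>2 + v \<bullet> u + (norm u)\<^sup>2 / 4"
      by (simp add: power2_norm_eq_inner inner_simps inner_commute algebra_simps)
    have c: "cis (- (x \<bullet> (v - u /\<^sub>R 2) - t * (norm (v - u /\<^sub>R 2))\<^sup>2)) * cis (x \<bullet> (v - u /\<^sub>R 2 + u) - t * (norm (v - u /\<^sub>R 2 + u))\<^sup>2)
        = cis (x \<bullet> u) * cis (v \<bullet> (- (2 * t) *\<^sub>R u))"
      unfolding cis_mult n1 n2 by (rule arg_cong[where f=cis]) (simp add: inner_simps algebra_simps)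
    have e: "exp (- a * (norm (v - u /\<^sub>R 2))\<^sup>2) * exp (- a * (norm (v - u /\<^sub>R 2 + u))\<^sup>2)
        = exp (- (a/2) * (norm u)\<^sup>2) * exp (- (2*a) * (norm v)\<^sup>2)"
      unfolding exp_add[symmetric] n1 n2 by (rule arg_cong[where f=exp]) (simp add: algebra_simps)
    have "cnj (G (v - u /\<^sub>R 2)) * G (v - u /\<^sub>R 2 + u) =
       (cis (- (x \<bullet> (v - u /\<^sub>R 2) - t * (norm (v - u /\<^sub>R 2))\<^sup>2)) * cis (x \<bullet> (v - u /\<^sub>R 2 + u) - t * (norm (v - u /\<^sub>R 2 + u))\<^sup>2))
       * of_real (exp (- a * (norm (v - u /\<^sub>R 2))\<^sup>2) * exp (- a * (norm (v - u /\<^sub>R 2 + u))\<^sup>2))"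
      unfolding G_def by (simp only: cis_cnj complex_cnj_mult complex_cnj_complex_of_real of_real_mult mult_ac)
    also have "\<dots> = cis (x \<bullet> u) * of_real (exp (- (a/2) * (norm u)\<^sup>2)) * (cis (v \<bullet> (- (2 * t) *\<^sub>R u)) * of_real (exp (- (2*a) * (norm v)\<^sup>2)))"
      unfolding c e by (simp only: of_real_mult mult_ac)
    finally show ?thesis .
  qed
  define inner where "inner u = (\<integral>\<eta>. cnj (G \<eta>) * G (\<eta> + u) \<partial>lborel)" for u
  \<comment> \<open>The phase left in \<open>v\<close> has the frequency
    \<open>- (2 * t) *\<^sub>R u\<close>. Its Gaussian transform adds
    \<open>t\<^sup>2 / (2 * a)\<close> to the coefficient \<open>a / 2\<close> of
    \<open>- (norm u)\<^sup>2\<close> in the exponent; this is the origin of the decay in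
    \<open>t\<close>.\<close>
  have inner_bd: "cmod (inner u) = (pi / (2*a)) powr (DIM('a) / 2) * exp (- ((a\<^sup>2 + t\<^sup>2) / (2 * a)) * (norm u)\<^sup>2)" for u
  proof -
    have "inner u = (\<integral>v. cnj (G (- (u /\<^sub>R 2) + v)) * G (- (u /\<^sub>R 2) + v + u) \<partial>lborel)"
      unfolding inner_def by (subst integral_lborel_translate[of _ "- (u /\<^sub>R 2)", symmetric]) simp_all
    also have "\<dots> = cis (x \<bullet> u) * of_real (exp (- (a/2) * (norm u)\<^sup>2)) *
       (\<integral>v. cis (v \<bullet> (- (2 * t) *\<^sub>R u)) * of_real (exp (- (2*a) * (norm v)\<^sup>2)) \<partial>lborel)"
      using split by (simp add: add.commute[of "- (u /\<^sub>R 2)"])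
    also have "(\<integral>v. cis (v \<bullet> (- (2 * t) *\<^sub>R u)) * of_real (exp (- (2*a) * (norm v)\<^sup>2)) \<partial>lborel)
       = of_real ((pi / (2*a)) powr (DIM('a) / 2) * exp (- (norm (- (2 * t) *\<^sub>R u))\<^sup>2 / (4 * (2*a))))"
      by (rule gauss_integrable_and_ft(2)) (use a in simp)
    finally have "cmod (inner u) = exp (- (a/2) * (norm u)\<^sup>2) * ((pi / (2*a)) powr (DIM('a) / 2) * exp (- (norm (- (2 * t) *\<^sub>R u))\<^sup>2 / (4 * (2*a))))"
      by (simp add: norm_mult abs_mult)
    also have "\<dots> = (pi / (2*a)) powr (DIM('a) / 2) * (exp (- (a/2) * (norm u)\<^sup>2) * exp (- (norm (- (2 * t) *\<^sub>R u))\<^sup>2 / (4 * (2*a))))"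
      by simp
    also have "exp (- (a/2) * (norm u)\<^sup>2) * exp (- (norm (- (2 * t) *\<^sub>R u))\<^sup>2 / (4 * (2*a))) = exp (- ((a\<^sup>2 + t\<^sup>2) / (2 * a)) * (norm u)\<^sup>2)"
      unfolding exp_add[symmetric] using a
      by (intro arg_cong[where f=exp]) (simp add: power_mult_distrib field_simps power2_eq_square)
    finally show ?thesis .
  qed
  have pos: "a\<^sup>2 + t\<^sup>2 > 0" using a by (simp add: add_pos_nonneg)
  have "integrable (lborel \<Otimes>\<^sub>M lborel) (\<lambda>(\<eta>, u). cnj (G \<eta>) * G (\<eta> + u))"
  proof (rule lborel_pair.integrable_pair_nn)
    have "(\<integral>\<^sup>+\<eta>. \<integral>\<^sup>+u. ennreal (cmod (cnj (G \<eta>) * G (\<eta> + u))) \<partial>lborel \<partial>lborel)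
       = (\<integral>\<^sup>+\<eta>. ennreal (cmod (G \<eta>)) * (\<integral>\<^sup>+u. ennreal (cmod (G (\<eta> + u))) \<partial>lborel) \<partial>lborel)"
      by (simp add: norm_mult ennreal_mult nn_integral_cmult)
    also have "\<dots> = (\<integral>\<^sup>+\<eta>. ennreal (cmod (G \<eta>)) * ennreal ((pi / a) powr (DIM('a) / 2)) \<partial>lborel)"
      by (subst nn_integral_lborel_translate[where f="\<lambda>u. ennreal (cmod (G u))"]) (simp_all add: nI)
    also have "\<dots> < \<infinity>" by (simp add: nn_integral_multc nI ennreal_mult_less_top)
    finally show "(\<integral>\<^sup>+\<eta>. \<integral>\<^sup>+u. ennreal (cmod (cnj (G \<eta>) * G (\<eta> + u))) \<partial>lborel \<partial>lborel) < \<infinity>" .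
  qed measurable
  from lborel_pair.Fubini_integral[OF this]
  have "(\<integral>u. inner u \<partial>lborel) = (\<integral>\<eta>. \<integral>u. cnj (G \<eta>) * G (\<eta> + u) \<partial>lborel \<partial>lborel)"
    by (simp add: inner_def)
  also have "\<dots> = (\<integral>\<eta>. cnj (G \<eta>) * (\<integral>u. G u \<partial>lborel) \<partial>lborel)"
    by (simp add: integral_lborel_translate)
  also have "\<dots> = cnj (\<integral>u. G u \<partial>lborel) * (\<integral>u. G u \<partial>lborel)"
    by simp
  finally have "(cmod (\<integral>u. G u \<partial>lborel))\<^sup>2 = cmod (\<integral>u. inner u \<partial>lborel)"
    by (simp add: norm_mult power2_eq_square)
  also have "\<dots> \<le> (\<integral>u. cmod (inner u) \<partial>lborel)" by (rule integral_norm_bound)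
  also have "\<dots> = (pi / (2*a)) powr (DIM('a) / 2) * (pi / ((a\<^sup>2 + t\<^sup>2) / (2 * a))) powr (DIM('a) / 2)"
    unfolding inner_bd using gauss_integral[of "(a\<^sup>2 + t\<^sup>2) / (2 * a)", where 'a='a] a pos by simp
  also have "\<dots> = (pi\<^sup>2 / (a\<^sup>2 + t\<^sup>2)) powr (DIM('a) / 2)"
    using a pos by (subst powr_mult[symmetric]) (simp_all add: field_simps power2_eq_square)
  also have "\<dots> = ((pi\<^sup>2 / (a\<^sup>2 + t\<^sup>2)) powr (DIM('a) / 4))\<^sup>2"
    using pos by (simp add: powr_powr powr_realpow[symmetric] field_simps flip: powr_numeral)
  finally show ?thesis unfolding G_def[symmetric] by (rule power2_le_imp_le) simp
qed

section \<open>Continuity of translation in the mean and the heat kernel\<close>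

text \<open>Fatou's lemma in the form in which every regularisation below is removed: a bound
  uniform in the parameter passes to the pointwise limit.\<close>

lemma nn_integral_le_of_tendsto:
  fixes u :: "nat \<Rightarrow> 'a \<Rightarrow> ennreal"
  assumes "\<And>n. u n \<in> borel_measurable M" "AE x in M. (\<lambda>n. u n x) \<longlonglongrightarrow> g x"
    and "\<And>n. (\<integral>\<^sup>+x. u n x \<partial>M) \<le> K"
  shows "(\<integral>\<^sup>+x. g x \<partial>M) \<le> K"
proof -
  have "(\<integral>\<^sup>+x. g x \<partial>M) = (\<integral>\<^sup>+x. liminf (\<lambda>n. u n x) \<partial>M)"
    by (rule nn_integral_cong_AE) (use assms(2) in \<open>auto elim!: eventually_mono dest: lim_imp_Liminf[rotated]\<close>)
  also have "\<dots> \<le> liminf (\<lambda>n. \<integral>\<^sup>+x. u n x \<partial>M)" by (rule nn_integral_liminf) fact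
  also have "\<dots> \<le> liminf (\<lambda>n::nat. K)" by (intro Liminf_mono) (use assms(3) in auto)
  finally show ?thesis by (simp add: Liminf_const)
qed

section \<open>The modulus of continuity of translations in L1\<close>

definition L1_shift :: "('a::euclidean_space \<Rightarrow> complex) \<Rightarrow> 'a \<Rightarrow> real" where
  "L1_shift w y = (\<integral>x. cmod (w (y + x) - w x) \<partial>lborel)"

lemma integrable_shift:
  fixes f :: "'a::euclidean_space \<Rightarrow> complex"
  shows "integrable lborel f \<Longrightarrow> integrable lborel (\<lambda>x. f (t + x))"
  using integrable_lborel_affine[of f 1 t] by simp

lemma integral_cmod_translate:
  fixes f :: "'a::euclidean_space \<Rightarrow> complex"
  assumes "f \<in> borel_measurable borel"
  shows "(\<integral>x. cmod (f (t + x)) \<partial>lborel) = (\<integral>x. cmod (f x) \<partial>lborel)"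
proof -
  have "complex_of_real (\<integral>x. cmod (f (t + x)) \<partial>lborel) = of_real (\<integral>x. cmod (f x) \<partial>lborel)"
    unfolding integral_complex_of_real[symmetric]
    by (rule integral_lborel_translate[of "\<lambda>x. of_real (cmod (f x))"]) (use assms in measurable)
  thus ?thesis by (simp only: of_real_eq_iff)
qed

text \<open>Translations preserve the L1 norm, so the error of replacing \<open>w\<close> by
  \<open>v\<close> enters twice, uniformly in \<open>y\<close>. Hence the functions with continuous
  translations are closed in L1.\<close>

lemma L1_shift_approx:
  assumes w: "integrable lborel w" and v: "integrable lborel v"
  shows "L1_shift w y \<le> 2 * (\<integral>x. cmod (w x - v x) \<partial>lborel) + L1_shift v y"
proof -
  have [measurable]: "w \<in> borel_measurable borel" "v \<in> borel_measurable borel"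
    using w v borel_measurable_integrable by fastforce+
  note i = integrable_shift[OF w] integrable_shift[OF v] w v

  have tri: "cmod (a - b) \<le> (cmod (a - c) + cmod (b - d)) + cmod (c - d)" for a b c d
    using norm_triangle_ineq[of "(a - c) - (b - d)" "c - d"] norm_triangle_ineq4[of "a - c" "b - d"] by simp
  have "L1_shift w y \<le> (\<integral>x. (cmod (w (y + x) - v (y + x)) + cmod (w x - v x)) + cmod (v (y + x) - v x) \<partial>lborel)"
    unfolding L1_shift_def
    by (intro integral_mono integrable_norm Bochner_Integration.integrable_add Bochner_Integration.integrable_diff i tri)
  also have "\<dots> = (\<integral>x. cmod (w (y + x) - v (y + x)) \<partial>lborel) + (\<integral>x. cmod (w x - v x) \<partial>lborel) + L1_shift v y"
    unfolding L1_shift_def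
    by (subst Bochner_Integration.integral_add,
        (intro integrable_norm Bochner_Integration.integrable_add Bochner_Integration.integrable_diff i)+)+ simp
  also have "(\<integral>x. cmod (w (y + x) - v (y + x)) \<partial>lborel) = (\<integral>x. cmod (w x - v x) \<partial>lborel)"
    by (rule integral_cmod_translate) measurable
  finally show ?thesis by simp
qed

lemma L1_shift_nonneg: "0 \<le> L1_shift w y"
  unfolding L1_shift_def by simp

lemma L1_shift_tendsto_approx:
  assumes w: "integrable lborel w"
    and appr: "\<And>e. 0 < e \<Longrightarrow> \<exists>v. integrable lborel v \<and> (\<integral>x. cmod (w x - v x) \<partial>lborel) < e \<and> (\<lambda>n. L1_shift v (y n)) \<longlonglongrightarrow> 0"
  shows "(\<lambda>n::nat. L1_shift w (y n)) \<longlonglongrightarrow> 0"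
proof (rule LIMSEQ_I)
  fix r :: real assume "0 < r"
  then obtain v where v: "integrable lborel v" "(\<integral>x. cmod (w x - v x) \<partial>lborel) < r / 4" "(\<lambda>n. L1_shift v (y n)) \<longlonglongrightarrow> 0"
    using appr[of "r / 4"] by auto
  from LIMSEQ_D[OF v(3), of "r / 2"] \<open>0 < r\<close> obtain N where "\<forall>n\<ge>N. norm (L1_shift v (y n) - 0) < r / 2"
    by auto
  hence N: "L1_shift v (y n) < r / 2" if "n \<ge> N" for n
    using that L1_shift_nonneg[of v "y n"] by auto
  show "\<exists>no. \<forall>n\<ge>no. norm (L1_shift w (y n) - 0) < r"
  proof (intro exI allI impI)
    fix n assume "n \<ge> N"
    with N[OF this] v(2) L1_shift_approx[OF w v(1), of "y n"] L1_shift_nonneg[of w "y n"]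
    show "norm (L1_shift w (y n) - 0) < r" by simp
  qed
qed

text \<open>The modulus of a difference is the difference itself plus twice its negative part. The
  difference of the two indicators has integral zero by translation invariance. The negative part is
  dominated by the indicator of \<open>U\<close> and tends to zero at every point, because a point
  of the open set \<open>U\<close> stays in \<open>U\<close> under small shifts.\<close>

lemma L1_shift_indicator_open:
  fixes U :: "'a::euclidean_space set" and c :: complex
  assumes U: "open U" and fin: "emeasure lborel U < \<infinity>" and y: "y \<longlonglongrightarrow> 0"
  shows "(\<lambda>n::nat. L1_shift (\<lambda>x. indicat_real U x *\<^sub>R c) (y n)) \<longlonglongrightarrow> 0"
proof -
  let ?f = "indicat_real U"
  have Ub [measurable]: "U \<in> sets borel" using U by simp
  have i0: "integrable lborel ?f" using fin by (simp add: integrable_real_indicator)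
  have iy: "integrable lborel (\<lambda>x. ?f (y + x))" for y
  proof -
    have "integrable lborel (\<lambda>x. complex_of_real (?f (y + x)))"
      by (rule integrable_shift[of "\<lambda>x. complex_of_real (?f x)"]) (use i0 in simp)
    from integrable_norm[OF this] show ?thesis by simp
  qed
  have "(\<integral>x. ?f (y + x) \<partial>lborel) = (\<integral>x. ?f x \<partial>lborel)" for y
    using integral_cmod_translate[of "\<lambda>x. complex_of_real (?f x)" y] by simp
  note eqi = this
  have eq: "L1_shift (\<lambda>x. ?f x *\<^sub>R c) (y n) = cmod c * (2 * (\<integral>x. max 0 (?f x - ?f (y n + x)) \<partial>lborel))" for n
  proof -
    have im: "integrable lborel (\<lambda>x. max 0 (?f x - ?f (y n + x)))"
      by (rule Bochner_Integration.integrable_bound[OF i0]) (auto simp: indicator_def)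
    have "L1_shift (\<lambda>x. ?f x *\<^sub>R c) (y n) = (\<integral>x. cmod c * ((?f (y n + x) - ?f x) + 2 * max 0 (?f x - ?f (y n + x))) \<partial>lborel)"
      unfolding L1_shift_def by (rule Bochner_Integration.integral_cong) (auto simp: indicator_def)
    also have "\<dots> = cmod c * ((\<integral>x. ?f (y n + x) \<partial>lborel) - (\<integral>x. ?f x \<partial>lborel) + 2 * (\<integral>x. max 0 (?f x - ?f (y n + x)) \<partial>lborel))"
      using im i0 iy[of "y n"] by simp
    finally show ?thesis by (simp add: eqi)
  qed
  have "(\<lambda>n. \<integral>x. max 0 (?f x - ?f (y n + x)) \<partial>lborel) \<longlonglongrightarrow> (\<integral>x. 0 \<partial>(lborel::'a measure))"
  proof (rule integral_dominated_convergence[where w="?f"])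
    show "AE x in lborel. (\<lambda>n. max 0 (?f x - ?f (y n + x))) \<longlonglongrightarrow> 0"
    proof (rule AE_I2)
      fix x
      show "(\<lambda>n. max 0 (?f x - ?f (y n + x))) \<longlonglongrightarrow> 0"
      proof (cases "x \<in> U")
        case True
        have "(\<lambda>n. y n + x) \<longlonglongrightarrow> 0 + x" by (intro tendsto_intros y)
        with True U have "\<forall>\<^sub>F n in sequentially. y n + x \<in> U"
          by (auto dest!: topological_tendstoD)
        hence "\<forall>\<^sub>F n in sequentially. max 0 (?f x - ?f (y n + x)) = 0"
          by eventually_elim (auto simp: True)
        thus ?thesis by (rule tendsto_eventually)
      qed (auto intro!: tendsto_eventually always_eventually simp: indicator_def)
    qed
  qed (use i0 in \<open>auto simp: indicator_def\<close>)
  from tendsto_mult_left[OF tendsto_mult_left[OF this, of 2], of "cmod c"] show ?thesis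
    unfolding eq by simp
qed

text \<open>Induction over integrable functions. Indicators of measurable sets are reduced to those
  of open sets by outer regularity.\<close>

lemma L1_shift_tendsto:
  fixes w :: "'a::euclidean_space \<Rightarrow> complex" and y :: "nat \<Rightarrow> 'a"
  assumes w: "integrable lborel w" and y: "y \<longlonglongrightarrow> 0"
  shows "(\<lambda>n. L1_shift w (y n)) \<longlonglongrightarrow> 0"
  using w
proof (induction rule: integrable_induct)
  case (base A c)
  have A: "A \<in> sets borel" using base by simp
  have iA: "integrable lborel (\<lambda>x. indicat_real A x *\<^sub>R c)" using base by simp
  show ?case
  proof (rule L1_shift_tendsto_approx[OF iA])
    fix e :: real assume e: "0 < e"
    \<comment> \<open>The summand 1 in the denominator also covers \<open>c = 0\<close>.\<close>
    define d where "d = e / (cmod c + 1)"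
    have d: "d > 0" "cmod c * d < e" using e by (auto simp: d_def field_simps add_pos_nonneg)
    obtain U where U: "open U" "A \<subseteq> U" "emeasure lborel (U - A) < ennreal d"
      using outer_regular_lborel[OF A d(1)] by blast
    have [measurable]: "U \<in> sets borel" using U by simp
    note [measurable] = A
    have "emeasure lborel U = emeasure lborel A + emeasure lborel (U - A)"
      using U by (subst plus_emeasure) (auto simp: Un_absorb1)
    also have "\<dots> < \<infinity>" using base U(3) by (auto simp: ennreal_add_less_top intro: less_trans)
    finally have finU: "emeasure lborel U < \<infinity>" .
    have iU: "integrable lborel (\<lambda>x. indicat_real U x *\<^sub>R c)" using finU by simp
    have "(\<integral>x. cmod (indicat_real A x *\<^sub>R c - indicat_real U x *\<^sub>R c) \<partial>lborel) = (\<integral>x. indicat_real (U - A) x * cmod c \<partial>lborel)"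
      by (rule Bochner_Integration.integral_cong) (use U(2) in \<open>auto simp: indicator_def\<close>)
    also have "\<dots> = measure lborel (U - A) * cmod c" by simp
    also have "measure lborel (U - A) \<le> d"
      unfolding measure_def using U(3) d(1) by (intro enn2real_leI) auto
    finally have "(\<integral>x. cmod (indicat_real A x *\<^sub>R c - indicat_real U x *\<^sub>R c) \<partial>lborel) < e"
      using d(2) by (simp add: mult.commute mult_right_mono order.strict_trans1)
    thus "\<exists>v. integrable lborel v \<and> (\<integral>x. cmod (indicat_real A x *\<^sub>R c - v x) \<partial>lborel) < e \<and> (\<lambda>n. L1_shift v (y n)) \<longlonglongrightarrow> 0"
      using iU L1_shift_indicator_open[OF U(1) finU y] by blast
  qed
next
  case (add f g)
  show ?case
  proof (rule tendsto_sandwich[OF _ _ tendsto_const])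
    show "\<forall>\<^sub>F n in sequentially. 0 \<le> L1_shift (\<lambda>x. f x + g x) (y n)" by (simp add: L1_shift_nonneg)
    show "\<forall>\<^sub>F n in sequentially. L1_shift (\<lambda>x. f x + g x) (y n) \<le> L1_shift f (y n) + L1_shift g (y n)"
    proof (rule always_eventually, rule allI)
      fix n
      have tri: "cmod (a + b - (c + d)) \<le> cmod (a - c) + cmod (b - d)" for a b c d
        using norm_triangle_ineq[of "a - c" "b - d"] by (simp add: algebra_simps)
      have "L1_shift (\<lambda>x. f x + g x) (y n) \<le> (\<integral>x. cmod (f (y n + x) - f x) + cmod (g (y n + x) - g x) \<partial>lborel)"
        unfolding L1_shift_def using add
        by (intro integral_mono integrable_norm Bochner_Integration.integrable_add Bochner_Integration.integrable_diff integrable_shift tri) auto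
      also have "\<dots> = L1_shift f (y n) + L1_shift g (y n)"
        unfolding L1_shift_def using add
        by (intro Bochner_Integration.integral_add integrable_norm Bochner_Integration.integrable_diff integrable_shift) auto
      finally show "L1_shift (\<lambda>x. f x + g x) (y n) \<le> L1_shift f (y n) + L1_shift g (y n)" .
    qed
    show "(\<lambda>n. L1_shift f (y n) + L1_shift g (y n)) \<longlonglongrightarrow> 0"
      using tendsto_add[OF add(3,4)] by simp
  qed
next
  case (lim f s)
  have "(\<lambda>i. \<integral>x. cmod (f x - s i x) \<partial>lborel) \<longlonglongrightarrow> (\<integral>x. 0 \<partial>(lborel::'a measure))"
  proof (rule integral_dominated_convergence[where w="\<lambda>x. 3 * cmod (f x)"])
    show "AE x in lborel. (\<lambda>i. cmod (f x - s i x)) \<longlonglongrightarrow> 0"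
    proof (rule AE_I2)
      fix x :: 'a
      have "(\<lambda>i. cmod (f x - s i x)) \<longlonglongrightarrow> cmod (f x - f x)"
        by (intro tendsto_intros lim(2)) simp
      thus "(\<lambda>i. cmod (f x - s i x)) \<longlonglongrightarrow> 0" by simp
    qed
    fix i show "AE x in lborel. norm (cmod (f x - s i x)) \<le> 3 * cmod (f x)"
    proof (rule AE_I2)
      fix x show "norm (cmod (f x - s i x)) \<le> 3 * cmod (f x)"
        using lim(3)[of x i] norm_triangle_ineq4[of "f x" "s i x"] by simp
    qed
  qed (use lim in \<open>auto\<close>)
  hence L: "(\<lambda>i. \<integral>x. cmod (f x - s i x) \<partial>lborel) \<longlonglongrightarrow> 0" by simp
  show ?case
  proof (rule L1_shift_tendsto_approx[OF lim(4)])
    fix e :: real assume "0 < e"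
    from LIMSEQ_D[OF L this] obtain i where "(\<integral>x. cmod (f x - s i x) \<partial>lborel) < e" by auto
    thus "\<exists>v. integrable lborel v \<and> (\<integral>x. cmod (f x - v x) \<partial>lborel) < e \<and> (\<lambda>n. L1_shift v (y n)) \<longlonglongrightarrow> 0"
      using lim by blast
  qed
qed


text \<open>The heat kernel at time \<open>\<epsilon>\<close>, a probability density. Its transform
  is \<open>exp (- \<epsilon> * (norm \<xi>)\<^sup>2)\<close>, so mollifying by it on one side of
  the Fourier transform is Gaussian damping on the other.\<close>

definition heat :: "real \<Rightarrow> 'a::euclidean_space \<Rightarrow> real" where
  "heat \<epsilon> y = (4 * pi * \<epsilon>) powr (- (DIM('a) / 2)) * exp (- (norm y)\<^sup>2 / (4 * \<epsilon>))"

lemma heat_nonneg: "0 \<le> heat \<epsilon> y"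
  by (simp add: heat_def)

lemma borel_measurable_heat [measurable]: "heat \<epsilon> \<in> borel_measurable borel"
  unfolding heat_def by measurable

lemma heat_minus [simp]: "heat \<epsilon> (- y) = heat \<epsilon> y"
  by (simp add: heat_def)

lemma heat_integral:
  assumes "0 < \<epsilon>"
  shows "integrable lborel (heat \<epsilon> :: 'a::euclidean_space \<Rightarrow> real)"
    and "(\<integral>\<^sup>+y. ennreal (heat \<epsilon> (y::'a)) \<partial>lborel) = 1"
proof -
  have h: "heat \<epsilon> = (\<lambda>y::'a. (4 * pi * \<epsilon>) powr (- (DIM('a) / 2)) * exp (- (1 / (4 * \<epsilon>)) * (norm y)\<^sup>2))"
    by (auto simp: heat_def)
  have p: "1 / (4 * \<epsilon>) > 0" using assms by simp
  show i: "integrable lborel (heat \<epsilon> :: 'a \<Rightarrow> real)"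
    unfolding h using gauss_integrable_and_ft(1)[OF p] by (intro integrable_mult_right)
  have "(\<integral>y. heat \<epsilon> (y::'a) \<partial>lborel) = (4 * pi * \<epsilon>) powr (- (DIM('a) / 2)) * (pi / (1 / (4 * \<epsilon>))) powr (DIM('a) / 2)"
    unfolding h using gauss_integral[OF p, where 'a='a] by simp
  also have "pi / (1 / (4 * \<epsilon>)) = 4 * pi * \<epsilon>" by simp
  also have "(4 * pi * \<epsilon>) powr (- (DIM('a) / 2)) * (4 * pi * \<epsilon>) powr (DIM('a) / 2) = 1"
    using assms by (simp add: powr_minus field_simps)
  finally show "(\<integral>\<^sup>+y. ennreal (heat \<epsilon> (y::'a)) \<partial>lborel) = 1"
    by (subst nn_integral_eq_integral[OF i]) (simp_all add: heat_nonneg)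
qed

lemma heat_scale:
  assumes "0 < \<epsilon>"
  shows "sqrt \<epsilon> ^ DIM('a) * heat \<epsilon> (sqrt \<epsilon> *\<^sub>R (v::'a::euclidean_space)) = heat 1 v"
proof -
  have "sqrt \<epsilon> ^ DIM('a) = \<epsilon> powr (DIM('a) / 2)"
    using assms by (simp add: powr_half_sqrt[symmetric] powr_powr powr_realpow[symmetric])
  moreover have "(4 * pi * \<epsilon>) powr (- (DIM('a) / 2)) = (4 * pi) powr (- (DIM('a) / 2)) * \<epsilon> powr (- (DIM('a) / 2))"
    using assms by (simp add: powr_mult)
  ultimately show ?thesis
    using assms by (simp add: heat_def power_mult_distrib powr_minus)
qed

lemma nn_integral_shift_L1_shift:
  fixes w :: "'a::euclidean_space \<Rightarrow> complex"
  assumes w: "integrable lborel w"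
  shows "(\<integral>\<^sup>+x. ennreal (cmod (w (y + x) - w x)) \<partial>lborel) = ennreal (L1_shift w y)"
  unfolding L1_shift_def
  by (rule nn_integral_eq_integral) (auto intro!: integrable_norm Bochner_Integration.integrable_diff integrable_shift w)

text \<open>Integration in \<open>x\<close> first and the scaling z = sqrt(\<epsilon>) v leave an
  average of the L1 modulus of continuity at sqrt(\<epsilon>) v over a fixed density. It tends to
  zero by dominated convergence, the modulus being at most twice the L1 norm.\<close>

lemma heat_mollify_L1:
  fixes w :: "'a::euclidean_space \<Rightarrow> complex"
  assumes w: "integrable lborel w" and e: "\<And>n::nat. 0 < \<epsilon> n" "\<epsilon> \<longlonglongrightarrow> 0"
  shows "(\<lambda>n. \<integral>\<^sup>+x. (\<integral>\<^sup>+z. ennreal (cmod (w (z + x) - w x)) * ennreal (heat (\<epsilon> n) z) \<partial>lborel) \<partial>lborel) \<longlonglongrightarrow> 0"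
proof -
  have [measurable]: "w \<in> borel_measurable borel" using w borel_measurable_integrable by fastforce
  have eq: "(\<integral>\<^sup>+x. (\<integral>\<^sup>+z. ennreal (cmod (w (z + x) - w x)) * ennreal (heat (\<epsilon> n) z) \<partial>lborel) \<partial>lborel)
     = (\<integral>\<^sup>+v. ennreal (heat 1 v * L1_shift w (sqrt (\<epsilon> n) *\<^sub>R v)) \<partial>lborel)" for n
  proof -
    have "(\<integral>\<^sup>+x. (\<integral>\<^sup>+z. ennreal (cmod (w (z + x) - w x)) * ennreal (heat (\<epsilon> n) z) \<partial>lborel) \<partial>lborel)
        = (\<integral>\<^sup>+z. (\<integral>\<^sup>+x. ennreal (cmod (w (z + x) - w x)) * ennreal (heat (\<epsilon> n) z) \<partial>lborel) \<partial>lborel)"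
      by (rule lborel_pair.Fubini') measurable
    also have "\<dots> = (\<integral>\<^sup>+z. ennreal (L1_shift w z) * ennreal (heat (\<epsilon> n) z) \<partial>lborel)"
      by (simp add: nn_integral_multc nn_integral_shift_L1_shift[OF w])
    also have "\<dots> = ennreal (\<bar>sqrt (\<epsilon> n)\<bar> ^ DIM('a)) *
        (\<integral>\<^sup>+v. ennreal (L1_shift w (0 + sqrt (\<epsilon> n) *\<^sub>R v)) * ennreal (heat (\<epsilon> n) (0 + sqrt (\<epsilon> n) *\<^sub>R v)) \<partial>lborel)"
      by (rule nn_integral_lborel_affine) (use e(1)[of n] in \<open>auto simp: L1_shift_def\<close>)
    also have "\<dots> = (\<integral>\<^sup>+v. ennreal (\<bar>sqrt (\<epsilon> n)\<bar> ^ DIM('a)) *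
        (ennreal (L1_shift w (0 + sqrt (\<epsilon> n) *\<^sub>R v)) * ennreal (heat (\<epsilon> n) (0 + sqrt (\<epsilon> n) *\<^sub>R v))) \<partial>lborel)"
      by (subst nn_integral_cmult) (simp_all add: L1_shift_def)
    also have "\<dots> = (\<integral>\<^sup>+v. ennreal (heat 1 v * L1_shift w (sqrt (\<epsilon> n) *\<^sub>R v)) \<partial>lborel)"
    proof (rule nn_integral_cong)
      fix v :: 'a
      show "ennreal (\<bar>sqrt (\<epsilon> n)\<bar> ^ DIM('a)) *
        (ennreal (L1_shift w (0 + sqrt (\<epsilon> n) *\<^sub>R v)) * ennreal (heat (\<epsilon> n) (0 + sqrt (\<epsilon> n) *\<^sub>R v)))
        = ennreal (heat 1 v * L1_shift w (sqrt (\<epsilon> n) *\<^sub>R v))"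
        using e(1)[of n] heat_scale[OF e(1)[of n], of v]
        by (simp add: ennreal_mult[symmetric] L1_shift_nonneg heat_nonneg mult_ac)
    qed
    finally show ?thesis .
  qed
  have bd: "L1_shift w y \<le> 2 * (\<integral>x. cmod (w x) \<partial>lborel)" for y
    using L1_shift_approx[OF w, of "\<lambda>_. 0" y] by (simp add: L1_shift_def)
  have "(\<lambda>n. \<integral>\<^sup>+v. ennreal (heat 1 v * L1_shift w (sqrt (\<epsilon> n) *\<^sub>R v)) \<partial>lborel) \<longlonglongrightarrow> (\<integral>\<^sup>+v. 0 \<partial>(lborel::'a measure))"
  proof (rule nn_integral_dominated_convergence[where w="\<lambda>v. ennreal (heat 1 v * (2 * (\<integral>x. cmod (w x) \<partial>lborel)))"])
    show "AE v in lborel. (\<lambda>n. ennreal (heat 1 v * L1_shift w (sqrt (\<epsilon> n) *\<^sub>R (v::'a)))) \<longlonglongrightarrow> 0"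
    proof (rule AE_I2)
      fix v :: 'a
      have "(\<lambda>n. sqrt (\<epsilon> n) *\<^sub>R v) \<longlonglongrightarrow> sqrt 0 *\<^sub>R v"
        by (intro tendsto_intros e)
      hence "(\<lambda>n. heat 1 v * L1_shift w (sqrt (\<epsilon> n) *\<^sub>R v)) \<longlonglongrightarrow> heat 1 v * 0"
        by (intro tendsto_mult tendsto_const L1_shift_tendsto[OF w]) simp
      thus "(\<lambda>n. ennreal (heat 1 v * L1_shift w (sqrt (\<epsilon> n) *\<^sub>R v))) \<longlonglongrightarrow> 0"
        using tendsto_ennrealI by fastforce
    qed
    show "(\<integral>\<^sup>+v. ennreal (heat 1 v * (2 * (\<integral>x. cmod (w x) \<partial>lborel))) \<partial>(lborel::'a measure)) < \<infinity>"
      using heat_integral(2)[of 1, where 'a='a]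
      by (simp add: ennreal_mult heat_nonneg nn_integral_multc ennreal_mult_less_top)
    show "AE v in lborel. ennreal (heat 1 v * L1_shift w (sqrt (\<epsilon> n) *\<^sub>R v)) \<le> ennreal (heat 1 v * (2 * (\<integral>x. cmod (w x) \<partial>lborel)))" for n
      by (intro AE_I2 ennreal_leI mult_left_mono bd heat_nonneg)
  qed (simp_all add: L1_shift_def)
  thus ?thesis unfolding eq by simp
qed

text \<open>The mollifications converge in L1, hence almost everywhere along a subsequence.\<close>

lemma heat_mollify_AE:
  fixes w :: "'a::euclidean_space \<Rightarrow> complex"
  assumes w: "integrable lborel w" and e: "\<And>n::nat. 0 < \<epsilon> n" "\<epsilon> \<longlonglongrightarrow> 0"
  shows "\<exists>r. strict_mono r \<and> (AE x in lborel. (\<lambda>n. \<integral>y. w y * of_real (heat (\<epsilon> (r n)) (y - x)) \<partial>lborel) \<longlonglongrightarrow> w x)"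
proof -
  have [measurable]: "w \<in> borel_measurable borel" using w borel_measurable_integrable by fastforce
  have bdh: "heat (\<epsilon> n) y \<le> (4 * pi * \<epsilon> n) powr (- (real DIM('a) / 2))" for n and y :: 'a
    unfolding heat_def using e(1)[of n] by (intro mult_left_le) auto
  define m where "m n x = (\<integral>y. w y * of_real (heat (\<epsilon> n) (y - x)) \<partial>lborel)" for n x
  have [measurable]: "m n \<in> borel_measurable borel" for n unfolding m_def by measurable
  have mx: "m n x = (\<integral>z. w (x + z) * of_real (heat (\<epsilon> n) z) \<partial>lborel)" for n x
    unfolding m_def by (subst integral_lborel_translate[of _ x, symmetric]) simp_all
  have dom: "ennreal (cmod (m n x - w x)) \<le> (\<integral>\<^sup>+z. ennreal (cmod (w (z + x) - w x)) * ennreal (heat (\<epsilon> n) z) \<partial>lborel)" for n x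
  proof -
    have ih: "integrable lborel (\<lambda>z::'a. w x * of_real (heat (\<epsilon> n) z))"
      using heat_integral(1)[OF e(1)[of n]] by (intro integrable_mult_right integrable_of_real)
    have iw: "integrable lborel (\<lambda>z. w (x + z) * of_real (heat (\<epsilon> n) z))"
    proof (rule Bochner_Integration.integrable_bound)
      show "integrable lborel (\<lambda>z. cmod (w (x + z)) * (4 * pi * \<epsilon> n) powr (- (real DIM('a) / 2)))"
        by (intro integrable_mult_left integrable_norm integrable_shift w)
    qed (use bdh[of n] in \<open>auto simp: norm_mult heat_nonneg intro!: mult_left_mono\<close>)
    have "(\<integral>z. heat (\<epsilon> n) (z::'a) \<partial>lborel) = 1"
      using heat_integral[OF e(1)[of n], where 'a='a] nn_integral_eq_integral[OF heat_integral(1)[OF e(1)[of n], where 'a='a]]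
      by (simp add: heat_nonneg)
    hence "m n x - w x = (\<integral>z. w (x + z) * of_real (heat (\<epsilon> n) z) \<partial>lborel) - (\<integral>z. w x * of_real (heat (\<epsilon> n) (z::'a)) \<partial>lborel)"
      unfolding mx by simp
    also have "\<dots> = (\<integral>z. w (x + z) * of_real (heat (\<epsilon> n) z) - w x * of_real (heat (\<epsilon> n) z) \<partial>lborel)"
      by (rule Bochner_Integration.integral_diff[symmetric]) fact+
    finally have "ennreal (cmod (m n x - w x)) \<le> (\<integral>\<^sup>+z. ennreal (cmod (w (x + z) * of_real (heat (\<epsilon> n) z) - w x * of_real (heat (\<epsilon> n) z))) \<partial>lborel)"
      by (simp only:) (intro integral_norm_bound_ennreal Bochner_Integration.integrable_diff ih iw)
    also have "\<dots> = (\<integral>\<^sup>+z. ennreal (cmod (w (z + x) - w x)) * ennreal (heat (\<epsilon> n) z) \<partial>lborel)"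
      by (intro nn_integral_cong)
        (simp add: left_diff_distrib[symmetric] norm_mult heat_nonneg ennreal_mult add.commute)
    finally show ?thesis .
  qed
  have "(\<lambda>n. \<integral>\<^sup>+x. ennreal (cmod (m n x - w x)) \<partial>lborel) \<longlonglongrightarrow> 0"
    by (rule tendsto_sandwich[OF _ _ tendsto_const heat_mollify_L1[OF w e]])
       (auto intro!: always_eventually nn_integral_mono dom)
  hence lim0: "(\<lambda>n. \<integral>\<^sup>+x. ennreal (cmod (m n x - w x)) \<partial>lborel) \<longlonglongrightarrow> 0" .
  \<comment> \<open>The distances to the limit are known to be finite only eventually, whereas
    \<open>tendsto_L1_AE_subseq\<close> asks for integrability of every member; the first
    \<open>N\<close> members are dropped.\<close>
  hence "\<forall>\<^sub>F n in sequentially. (\<integral>\<^sup>+x. ennreal (cmod (m n x - w x)) \<partial>lborel) < \<infinity>"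
    by (intro order_tendstoD(2)[OF lim0]) simp
  then obtain N where N: "\<And>n. n \<ge> N \<Longrightarrow> (\<integral>\<^sup>+x. ennreal (cmod (m n x - w x)) \<partial>lborel) < \<infinity>"
    by (auto simp: eventually_sequentially)
  have int: "integrable lborel (\<lambda>x. m (n + N) x - w x)" for n
    by (rule integrableI_bounded) (use N[of "n + N"] in auto)
  have "(\<lambda>n. LINT x|lborel. norm (m (n + N) x - w x)) \<longlonglongrightarrow> 0"
  proof -
    have "(\<lambda>n. \<integral>\<^sup>+x. ennreal (cmod (m (n + N) x - w x)) \<partial>lborel) \<longlonglongrightarrow> 0"
      using lim0 by (rule LIMSEQ_ignore_initial_segment)
    hence "(\<lambda>n. ennreal (LINT x|lborel. norm (m (n + N) x - w x))) \<longlonglongrightarrow> ennreal 0"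
      using int by (simp add: nn_integral_eq_integral)
    thus ?thesis by (subst (asm) tendsto_ennreal_iff) auto
  qed
  from tendsto_L1_AE_subseq[OF int this] obtain r where
    r: "strict_mono r" "AE x in lborel. (\<lambda>n. m (r n + N) x - w x) \<longlonglongrightarrow> 0" by auto
  show ?thesis
  proof (intro exI conjI)
    show "strict_mono (\<lambda>n. r n + N)" using r(1) by (auto simp: strict_mono_def)
    show "AE x in lborel. (\<lambda>n. \<integral>y. w y * of_real (heat (\<epsilon> (r n + N)) (y - x)) \<partial>lborel) \<longlonglongrightarrow> w x"
      using r(2) by eventually_elim (simp add: m_def[symmetric] LIM_zero_cancel)
  qed
qed

section \<open>Plancherel inequalities by Gaussian regularisation\<close>

lemma heat_ft:
  assumes "0 < \<eta>"
  shows "(\<integral>y. cis (y \<bullet> z) * of_real (exp (- \<eta> * (norm y)\<^sup>2)) \<partial>lborel)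
    = of_real ((2 * pi) ^ DIM('a) * heat \<eta> (z::'a::euclidean_space))"
proof -
  have "(pi / \<eta>) powr (DIM('a) / 2) = (2 * pi) ^ DIM('a) * (4 * pi * \<eta>) powr (- (DIM('a) / 2))"
  proof -
    have "(2 * pi) ^ DIM('a) = (4 * pi\<^sup>2) powr (DIM('a) / 2)"
    proof -
      have "(2 * pi) ^ DIM('a) = (2 * pi) powr (2 * (DIM('a) / 2))"
        by (simp add: powr_realpow)
      also have "\<dots> = ((2 * pi) powr 2) powr (DIM('a) / 2)" by (simp only: powr_powr)
      also have "(2 * pi) powr 2 = 4 * pi\<^sup>2" by (simp add: powr_numeral power_mult_distrib)
      finally show ?thesis .
    qed
    moreover have "4 * pi\<^sup>2 = (4 * pi * \<eta>) * (pi / \<eta>)" using assms by (simp add: power2_eq_square)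
    ultimately have "(2 * pi) ^ DIM('a) = (4 * pi * \<eta>) powr (DIM('a) / 2) * (pi / \<eta>) powr (DIM('a) / 2)"
      using assms by (simp only: powr_mult)
    thus ?thesis using assms by (simp add: powr_minus field_simps)
  qed
  thus ?thesis
    using gauss_integrable_and_ft(2)[OF assms, of z] by (simp add: heat_def mult_ac)
qed

text \<open>With a Gaussian damping in \<open>y\<close>, expanding the square gives a double
  integral of \<open>D\<close> against (2 pi)^d times a heat kernel in x - x'. Schur's test bounds
  it independently of the damping, which Fatou's lemma then removes. The sign
  \<open>\<sigma>\<close> covers the transform and its inverse.\<close>

lemma ft_L2_bound:
  fixes D :: "'a::euclidean_space \<Rightarrow> complex"
  assumes D: "integrable lborel D" and \<sigma>: "\<sigma>\<^sup>2 = (1::real)"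
  shows "(\<integral>\<^sup>+y. ennreal ((cmod (\<integral>x. D x * cis (\<sigma> * (x \<bullet> y)) \<partial>lborel))\<^sup>2) \<partial>lborel)
    \<le> ennreal ((2 * pi) ^ DIM('a)) * (\<integral>\<^sup>+x. ennreal ((cmod (D x))\<^sup>2) \<partial>lborel)"
proof -
  have [measurable]: "D \<in> borel_measurable borel" using D borel_measurable_integrable by fastforce
  define F where "F y = (\<integral>x. D x * cis (\<sigma> * (x \<bullet> y)) \<partial>lborel)" for y
  have [measurable]: "F \<in> borel_measurable borel" unfolding F_def by measurable
  define K where "K = (\<integral>x. cmod (D x) \<partial>lborel)"
  have FK: "cmod (F y) \<le> K" for y
    unfolding F_def K_def by (rule order_trans[OF integral_norm_bound]) (simp add: norm_mult)
  have Dnn: "(\<integral>\<^sup>+x. ennreal (cmod (D x)) \<partial>lborel) = ennreal K"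
    unfolding K_def by (rule nn_integral_eq_integral) (use D in auto)
  let ?N = "\<integral>\<^sup>+x. ennreal ((cmod (D x))\<^sup>2) \<partial>lborel"
  have main: "(\<integral>\<^sup>+y. ennreal ((cmod (F y))\<^sup>2 * exp (- \<eta> * (norm y)\<^sup>2)) \<partial>lborel) \<le> ennreal ((2 * pi) ^ DIM('a)) * ?N"
    if \<eta>: "0 < \<eta>" for \<eta>
  proof -
    define g where "g y = exp (- \<eta> * (norm (y::'a))\<^sup>2)" for y
    have [measurable]: "g \<in> borel_measurable borel" unfolding g_def by measurable
    have g0: "0 \<le> g y" for y by (simp add: g_def)
    have ig: "integrable lborel g" unfolding g_def by (rule gauss_integrable_and_ft(1)[OF \<eta>])
    have gnn: "(\<integral>\<^sup>+y. ennreal (g y) \<partial>lborel) < \<infinity>"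
      unfolding g_def gauss_nn_integral[OF \<eta>] by simp
    have i1: "integrable lborel (\<lambda>y. (cmod (F y))\<^sup>2 * g y)"
    proof (rule Bochner_Integration.integrable_bound)
      show "integrable lborel (\<lambda>y. K\<^sup>2 * g y)" using ig by simp
      show "AE y in lborel. norm ((cmod (F y))\<^sup>2 * g y) \<le> norm (K\<^sup>2 * g y)"
        using FK by (auto simp: g0 intro!: mult_right_mono power_mono)
    qed measurable
    have inner: "(\<integral>y. of_real (g y) * cnj (F y) * cis (\<sigma> * (x \<bullet> y)) \<partial>lborel)
        = (\<integral>x'. cnj (D x') * of_real ((2 * pi) ^ DIM('a) * heat \<eta> (x - x')) \<partial>lborel)" for x
    proof -
      have "integrable (lborel \<Otimes>\<^sub>M lborel) (\<lambda>(y, x'). of_real (g y) * cnj (D x') * cis (\<sigma> * ((x - x') \<bullet> y)))"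
      proof (rule lborel_pair.integrable_pair_nn)
        show "(\<integral>\<^sup>+y. \<integral>\<^sup>+x'. ennreal (cmod (of_real (g y) * cnj (D x') * cis (\<sigma> * ((x - x') \<bullet> y)))) \<partial>lborel \<partial>lborel) < \<infinity>"
          using gnn by (simp add: norm_mult g0 ennreal_mult nn_integral_cmult nn_integral_multc Dnn ennreal_mult_less_top)
      qed measurable
      from lborel_pair.Fubini_integral[OF this]
      have "(\<integral>y. \<integral>x'. of_real (g y) * cnj (D x') * cis (\<sigma> * ((x - x') \<bullet> y)) \<partial>lborel \<partial>lborel)
        = (\<integral>x'. \<integral>y. of_real (g y) * cnj (D x') * cis (\<sigma> * ((x - x') \<bullet> y)) \<partial>lborel \<partial>lborel)" by simp
      moreover have "(\<integral>x'. of_real (g y) * cnj (D x') * cis (\<sigma> * ((x - x') \<bullet> y)) \<partial>lborel) = of_real (g y) * cnj (F y) * cis (\<sigma> * (x \<bullet> y))" for y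
      proof -
        have "of_real (g y) * cnj (D x') * cis (\<sigma> * ((x - x') \<bullet> y)) = of_real (g y) * cis (\<sigma> * (x \<bullet> y)) * cnj (D x' * cis (\<sigma> * (x' \<bullet> y)))" for x'
          by (simp add: inner_diff_left right_diff_distrib cis_divide[symmetric] cis_cnj divide_inverse cis_inverse mult_ac)
        hence "(\<integral>x'. of_real (g y) * cnj (D x') * cis (\<sigma> * ((x - x') \<bullet> y)) \<partial>lborel) = of_real (g y) * cis (\<sigma> * (x \<bullet> y)) * (\<integral>x'. cnj (D x' * cis (\<sigma> * (x' \<bullet> y))) \<partial>lborel)"
          by (simp only: integral_mult_right_zero)
        also have "(\<integral>x'. cnj (D x' * cis (\<sigma> * (x' \<bullet> y))) \<partial>lborel) = cnj (F y)"
          unfolding F_def by (rule Bochner_Integration.integral_cnj)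
        finally show ?thesis by (simp add: mult_ac)
      qed
      moreover have "(\<integral>y. of_real (g y) * cnj (D x') * cis (\<sigma> * ((x - x') \<bullet> y)) \<partial>lborel) = cnj (D x') * of_real ((2 * pi) ^ DIM('a) * heat \<eta> (x - x'))" for x'
      proof -
        have "of_real (g y) * cnj (D x') * cis (\<sigma> * ((x - x') \<bullet> y)) = cnj (D x') * (cis (y \<bullet> (\<sigma> *\<^sub>R (x - x'))) * of_real (exp (- \<eta> * (norm y)\<^sup>2)))" for y
          by (simp add: g_def inner_commute mult_ac)
        hence "(\<integral>y. of_real (g y) * cnj (D x') * cis (\<sigma> * ((x - x') \<bullet> y)) \<partial>lborel) = cnj (D x') * (\<integral>y. cis (y \<bullet> (\<sigma> *\<^sub>R (x - x'))) * of_real (exp (- \<eta> * (norm y)\<^sup>2)) \<partial>lborel)"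
          by (simp only: integral_mult_right_zero)
        also have "\<dots> = cnj (D x') * of_real ((2 * pi) ^ DIM('a) * heat \<eta> (\<sigma> *\<^sub>R (x - x')))"
          by (subst heat_ft[OF \<eta>]) (rule refl)
        also have "heat \<eta> (\<sigma> *\<^sub>R (x - x')) = heat \<eta> (x - x')"
          by (simp add: heat_def power_mult_distrib \<sigma>)
        finally show ?thesis .
      qed
      ultimately show ?thesis by simp
    qed
    have i2: "integrable (lborel \<Otimes>\<^sub>M lborel) (\<lambda>(y, x). of_real (g y) * cnj (F y) * (D x * cis (\<sigma> * (x \<bullet> y))))"
    proof (rule lborel_pair.integrable_pair_nn)
      have "(\<integral>\<^sup>+y. \<integral>\<^sup>+x. ennreal (cmod (of_real (g y) * cnj (F y) * (D x * cis (\<sigma> * (x \<bullet> y))))) \<partial>lborel \<partial>lborel)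
        = (\<integral>\<^sup>+y. ennreal (g y) * ennreal (cmod (F y)) * ennreal K \<partial>lborel)"
        by (simp add: norm_mult g0 ennreal_mult nn_integral_cmult Dnn)
      also have "\<dots> \<le> (\<integral>\<^sup>+y. ennreal (g y) * (ennreal K * ennreal K) \<partial>lborel)"
        by (intro nn_integral_mono) (auto simp: mult.assoc intro!: mult_left_mono mult_right_mono ennreal_leI FK)
      also have "\<dots> < \<infinity>" using gnn by (simp add: nn_integral_multc ennreal_mult_less_top)
      finally show "(\<integral>\<^sup>+y. \<integral>\<^sup>+x. ennreal (cmod (of_real (g y) * cnj (F y) * (D x * cis (\<sigma> * (x \<bullet> y))))) \<partial>lborel \<partial>lborel) < \<infinity>" .
    qed measurable
    have "complex_of_real (\<integral>y. (cmod (F y))\<^sup>2 * g y \<partial>lborel) = (\<integral>y. of_real (g y) * cnj (F y) * F y \<partial>lborel)"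
      unfolding integral_complex_of_real[symmetric]
      by (intro Bochner_Integration.integral_cong refl) (simp add: complex_norm_square mult_ac del: of_real_power)
    also have "\<dots> = (\<integral>y. \<integral>x. of_real (g y) * cnj (F y) * (D x * cis (\<sigma> * (x \<bullet> y))) \<partial>lborel \<partial>lborel)"
      by (simp add: F_def)
    also have "\<dots> = (\<integral>x. \<integral>y. of_real (g y) * cnj (F y) * (D x * cis (\<sigma> * (x \<bullet> y))) \<partial>lborel \<partial>lborel)"
      using lborel_pair.Fubini_integral[OF i2] by simp
    also have "\<dots> = (\<integral>x. D x * (\<integral>y. of_real (g y) * cnj (F y) * cis (\<sigma> * (x \<bullet> y)) \<partial>lborel) \<partial>lborel)"
      unfolding integral_mult_right_zero[symmetric] by (simp add: mult_ac)
    also have "\<dots> = (\<integral>x. D x * (\<integral>x'. cnj (D x') * of_real ((2 * pi) ^ DIM('a) * heat \<eta> (x - x')) \<partial>lborel) \<partial>lborel)"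
      unfolding inner ..
    finally have J: "(\<integral>y. (cmod (F y))\<^sup>2 * g y \<partial>lborel)
       = cmod (\<integral>x. D x * (\<integral>x'. cnj (D x') * of_real ((2 * pi) ^ DIM('a) * heat \<eta> (x - x')) \<partial>lborel) \<partial>lborel)"
      by (metis (no_types, lifting) Bochner_Integration.integral_nonneg abs_of_nonneg g0 mult_nonneg_nonneg norm_of_real zero_le_power2)
    have hs: "(\<integral>\<^sup>+x'. ennreal (heat \<eta> (x - x')) \<partial>lborel) = 1" for x :: 'a
      using nn_integral_lborel_reflect[of "\<lambda>z. ennreal (heat \<eta> z)" x] heat_integral(2)[OF \<eta>, where 'a='a] by simp
    have hs': "(\<integral>\<^sup>+x. ennreal (heat \<eta> (x - x')) \<partial>lborel) = 1" for x' :: 'a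
      using nn_integral_lborel_translate[of "\<lambda>z. ennreal (heat \<eta> z)" "-x'"] heat_integral(2)[OF \<eta>, where 'a='a] by simp
    have "ennreal (\<integral>y. (cmod (F y))\<^sup>2 * g y \<partial>lborel)
       \<le> (\<integral>\<^sup>+x. ennreal (cmod (D x * (\<integral>x'. cnj (D x') * of_real ((2 * pi) ^ DIM('a) * heat \<eta> (x - x')) \<partial>lborel))) \<partial>lborel)"
      unfolding J by (cases "integrable lborel (\<lambda>x. D x * (\<integral>x'. cnj (D x') * of_real ((2 * pi) ^ DIM('a) * heat \<eta> (x - x')) \<partial>lborel))")
        (auto simp: not_integrable_integral_eq intro: integral_norm_bound_ennreal)
    also have "\<dots> \<le> (\<integral>\<^sup>+x. \<integral>\<^sup>+x'. ennreal (cmod (D x)) * ennreal (cmod (D x')) * (ennreal ((2 * pi) ^ DIM('a)) * ennreal (heat \<eta> (x - x'))) \<partial>lborel \<partial>lborel)"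
    proof (rule nn_integral_mono)
      fix x :: 'a
      have "ennreal (cmod (\<integral>x'. cnj (D x') * of_real ((2 * pi) ^ DIM('a) * heat \<eta> (x - x')) \<partial>lborel))
         \<le> (\<integral>\<^sup>+x'. ennreal (cmod (cnj (D x') * of_real ((2 * pi) ^ DIM('a) * heat \<eta> (x - x')))) \<partial>lborel)"
        by (cases "integrable lborel (\<lambda>x'. cnj (D x') * complex_of_real ((2 * pi) ^ DIM('a) * heat \<eta> (x - x')))")
          (auto simp: not_integrable_integral_eq simp del: of_real_mult intro: integral_norm_bound_ennreal)
      also have "\<dots> = (\<integral>\<^sup>+x'. ennreal (cmod (D x')) * (ennreal ((2 * pi) ^ DIM('a)) * ennreal (heat \<eta> (x - x'))) \<partial>lborel)"
        by (intro nn_integral_cong) (simp add: norm_mult heat_nonneg ennreal_mult norm_power)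
      finally show "ennreal (cmod (D x * (\<integral>x'. cnj (D x') * of_real ((2 * pi) ^ DIM('a) * heat \<eta> (x - x')) \<partial>lborel)))
         \<le> (\<integral>\<^sup>+x'. ennreal (cmod (D x)) * ennreal (cmod (D x')) * (ennreal ((2 * pi) ^ DIM('a)) * ennreal (heat \<eta> (x - x'))) \<partial>lborel)"
        by (simp add: norm_mult ennreal_mult mult.assoc nn_integral_cmult mult_left_mono)
    qed
    \<comment> \<open>The inequality between the means is Schur's test here: both marginals of the
      heat kernel have mass one, by \<open>hs\<close> and \<open>hs'\<close>.\<close>
    also have "\<dots> \<le> (\<integral>\<^sup>+x. \<integral>\<^sup>+x'. (ennreal ((cmod (D x))\<^sup>2 / 2) + ennreal ((cmod (D x'))\<^sup>2 / 2)) * (ennreal ((2 * pi) ^ DIM('a)) * ennreal (heat \<eta> (x - x'))) \<partial>lborel \<partial>lborel)"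
    proof (intro nn_integral_mono mult_right_mono)
      fix x x' :: 'a
      have "cmod (D x) * cmod (D x') \<le> (cmod (D x))\<^sup>2 / 2 + (cmod (D x'))\<^sup>2 / 2"
        using sum_squares_bound[of "cmod (D x)" "cmod (D x')"] by simp
      thus "ennreal (cmod (D x)) * ennreal (cmod (D x')) \<le> ennreal ((cmod (D x))\<^sup>2 / 2) + ennreal ((cmod (D x'))\<^sup>2 / 2)"
        by (simp add: ennreal_mult[symmetric] ennreal_plus[symmetric] del: ennreal_plus)
    qed simp
    also have "\<dots> = (\<integral>\<^sup>+x. \<integral>\<^sup>+x'. ennreal ((cmod (D x))\<^sup>2 / 2) * (ennreal ((2 * pi) ^ DIM('a)) * ennreal (heat \<eta> (x - x'))) \<partial>lborel \<partial>lborel)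
      + (\<integral>\<^sup>+x. \<integral>\<^sup>+x'. ennreal ((cmod (D x'))\<^sup>2 / 2) * (ennreal ((2 * pi) ^ DIM('a)) * ennreal (heat \<eta> (x - x'))) \<partial>lborel \<partial>lborel)"
      by (simp add: distrib_right nn_integral_add)
    also have "(\<integral>\<^sup>+x. \<integral>\<^sup>+x'. ennreal ((cmod (D x))\<^sup>2 / 2) * (ennreal ((2 * pi) ^ DIM('a)) * ennreal (heat \<eta> (x - x'))) \<partial>lborel \<partial>lborel)
      = (\<integral>\<^sup>+x. ennreal ((cmod (D x))\<^sup>2 / 2) * ennreal ((2 * pi) ^ DIM('a)) \<partial>lborel)"
      by (simp add: nn_integral_cmult hs)
    also have "(\<integral>\<^sup>+x. \<integral>\<^sup>+x'. ennreal ((cmod (D x'))\<^sup>2 / 2) * (ennreal ((2 * pi) ^ DIM('a)) * ennreal (heat \<eta> (x - x'))) \<partial>lborel \<partial>lborel)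
      = (\<integral>\<^sup>+x'. \<integral>\<^sup>+x. ennreal ((cmod (D x'))\<^sup>2 / 2) * (ennreal ((2 * pi) ^ DIM('a)) * ennreal (heat \<eta> (x - x'))) \<partial>lborel \<partial>lborel)"
      by (rule lborel_pair.Fubini') measurable
    also have "\<dots> = (\<integral>\<^sup>+x. ennreal ((cmod (D x))\<^sup>2 / 2) * ennreal ((2 * pi) ^ DIM('a)) \<partial>lborel)"
      by (simp add: nn_integral_cmult hs')
    also have "(\<integral>\<^sup>+x. ennreal ((cmod (D x))\<^sup>2 / 2) * ennreal ((2 * pi) ^ DIM('a)) \<partial>lborel) + (\<integral>\<^sup>+x. ennreal ((cmod (D x))\<^sup>2 / 2) * ennreal ((2 * pi) ^ DIM('a)) \<partial>lborel)
      = (\<integral>\<^sup>+x. ennreal ((cmod (D x))\<^sup>2) * ennreal ((2 * pi) ^ DIM('a)) \<partial>lborel)"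
      by (subst nn_integral_add[symmetric]) (auto intro!: nn_integral_cong simp: distrib_right[symmetric] ennreal_plus[symmetric] simp del: ennreal_plus)
    also have "\<dots> = ennreal ((2 * pi) ^ DIM('a)) * ?N"
      by (simp add: nn_integral_multc mult.commute)
    finally show ?thesis
      using i1 by (subst nn_integral_eq_integral) (auto simp: g_def)
  qed
  show ?thesis unfolding F_def[symmetric]
  proof (rule nn_integral_le_of_tendsto)
    fix n :: nat
    show "(\<integral>\<^sup>+y. ennreal ((cmod (F y))\<^sup>2 * exp (- (1 / Suc n) * (norm y)\<^sup>2)) \<partial>lborel) \<le> ennreal ((2 * pi) ^ DIM('a)) * ?N"
      by (rule main) simp
  next
    show "AE y in lborel. (\<lambda>n. ennreal ((cmod (F y))\<^sup>2 * exp (- (1 / Suc n) * (norm y)\<^sup>2))) \<longlonglongrightarrow> ennreal ((cmod (F y))\<^sup>2)"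
    proof (rule AE_I2)
      fix y
      have "(\<lambda>n. 1 / real (Suc n)) \<longlonglongrightarrow> 0" using LIMSEQ_inverse_real_of_nat by (simp add: inverse_eq_divide)
      hence "(\<lambda>n. (cmod (F y))\<^sup>2 * exp (- (1 / Suc n) * (norm y)\<^sup>2)) \<longlonglongrightarrow> (cmod (F y))\<^sup>2 * exp (- 0 * (norm y)\<^sup>2)"
        by (intro tendsto_intros)
      thus "(\<lambda>n. ennreal ((cmod (F y))\<^sup>2 * exp (- (1 / Suc n) * (norm y)\<^sup>2))) \<longlonglongrightarrow> ennreal ((cmod (F y))\<^sup>2)"
        by (intro tendsto_ennrealI) simp
    qed
  qed measurable
qed


section \<open>Transforms of functions controlled only through Gaussians\<close>

lemma integrable_square_mult_gauss:
  fixes A :: "'a::euclidean_space \<Rightarrow> complex"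
  assumes [measurable]: "A \<in> borel_measurable borel" and A: "(\<integral>\<^sup>+x. ennreal ((cmod (A x))\<^sup>2) \<partial>lborel) < \<infinity>"
    and e: "0 < \<epsilon>"
  shows "integrable lborel (\<lambda>x. A x * of_real (exp (- \<epsilon> * (norm x)\<^sup>2)))"
proof (rule Bochner_Integration.integrable_bound)
  have "integrable lborel (\<lambda>x. (cmod (A x))\<^sup>2)"
    by (rule integrableI_bounded) (use A in auto)
  thus "integrable lborel (\<lambda>x. (cmod (A x))\<^sup>2 + exp (- \<epsilon> * (norm x)\<^sup>2))"
    by (intro Bochner_Integration.integrable_add gauss_integrable_and_ft(1)[OF e])
  show "AE x in lborel. cmod (A x * of_real (exp (- \<epsilon> * (norm x)\<^sup>2))) \<le> norm ((cmod (A x))\<^sup>2 + exp (- \<epsilon> * (norm x)\<^sup>2))"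
  proof (rule AE_I2)
    fix x :: 'a
    let ?b = "exp (- \<epsilon> * (norm x)\<^sup>2)"
    have b: "0 \<le> ?b" "?b \<le> 1" using e by auto
    have "cmod (A x) * ?b \<le> (cmod (A x))\<^sup>2 + ?b\<^sup>2"
      using sum_squares_bound[of "cmod (A x)" ?b] mult_nonneg_nonneg[OF norm_ge_zero[of "A x"] b(1)] by linarith
    also have "?b\<^sup>2 \<le> ?b" using b by (simp add: power2_eq_square mult_left_le)
    finally show "cmod (A x * of_real ?b) \<le> norm ((cmod (A x))\<^sup>2 + ?b)"
      by (simp add: norm_mult)
  qed
qed measurable

lemma integrable_mult_heat:
  fixes B :: "'a::euclidean_space \<Rightarrow> complex"
  assumes [measurable]: "B \<in> borel_measurable borel"
    and iB: "\<And>a. 0 < a \<Longrightarrow> integrable lborel (\<lambda>x. B x * of_real (exp (- a * (norm x)\<^sup>2)))"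
    and e: "0 < \<epsilon>"
  shows "integrable lborel (\<lambda>y. B y * of_real (heat \<epsilon> (y - x)))"
proof (rule Bochner_Integration.integrable_bound)
  \<comment> \<open>By \<open>(norm y)\<^sup>2 \<le> 2 * (norm (y - x))\<^sup>2 + 2 * (norm
    x)\<^sup>2\<close>, moving the centre from \<open>x\<close> to the origin halves the coefficient
    in the exponent and costs a factor that depends on \<open>x\<close> alone.\<close>
  let ?C = "(4 * pi * \<epsilon>) powr (- (real DIM('a) / 2)) * exp ((norm x)\<^sup>2 / (4 * \<epsilon>))"
  show "integrable lborel (\<lambda>y. of_real ?C * (B y * of_real (exp (- (1 / (8 * \<epsilon>)) * (norm y)\<^sup>2))))"
    by (intro integrable_mult_right iB) (use e in simp)
  show "AE y in lborel. cmod (B y * of_real (heat \<epsilon> (y - x))) \<le> cmod (of_real ?C * (B y * of_real (exp (- (1 / (8 * \<epsilon>)) * (norm y)\<^sup>2))))"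
  proof (rule AE_I2)
    fix y :: 'a
    have "(norm y)\<^sup>2 = (norm (y - x + x))\<^sup>2" by simp
    also have "\<dots> \<le> (norm (y - x) + norm x)\<^sup>2" by (intro power_mono norm_triangle_ineq) simp
    also have "\<dots> \<le> 2 * (norm (y - x))\<^sup>2 + 2 * (norm x)\<^sup>2"
      using sum_squares_bound[of "norm (y - x)" "norm x"] by (simp add: power2_sum)
    finally have "- (norm (y - x))\<^sup>2 / (4 * \<epsilon>) \<le> (norm x)\<^sup>2 / (4 * \<epsilon>) + - (1 / (8 * \<epsilon>)) * (norm y)\<^sup>2"
      using e by (simp add: field_simps)
    hence "exp (- (norm (y - x))\<^sup>2 / (4 * \<epsilon>)) \<le> exp ((norm x)\<^sup>2 / (4 * \<epsilon>)) * exp (- (1 / (8 * \<epsilon>)) * (norm y)\<^sup>2)"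
      by (simp only: exp_add[symmetric] exp_le_cancel_iff)
    hence "heat \<epsilon> (y - x) \<le> ?C * exp (- (1 / (8 * \<epsilon>)) * (norm y)\<^sup>2)"
      unfolding heat_def mult.assoc by (rule mult_left_mono) simp
    from mult_left_mono[OF this norm_ge_zero[of "B y"]]
    show "cmod (B y * of_real (heat \<epsilon> (y - x))) \<le> cmod (of_real ?C * (B y * of_real (exp (- (1 / (8 * \<epsilon>)) * (norm y)\<^sup>2))))"
      by (simp add: norm_mult heat_nonneg mult_ac)
  qed
qed measurable

text \<open>Here \<open>norm (y - x) \<ge> norm y / 2\<close>, so the exponent is at least
  \<open>(norm y)\<^sup>2 / (16 * \<epsilon>)\<close>. One half of it is at least
  \<open>r\<^sup>2 / (8 * \<epsilon>)\<close> and yields smallness as \<open>\<epsilon>\<close>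
  tends to 0; the other half is kept as a fixed Gaussian weight, using
  \<open>\<epsilon> \<le> 1\<close>.\<close>

lemma heat_tail_bound:
  fixes x y :: "'a::euclidean_space"
  assumes e: "0 < \<epsilon>" "\<epsilon> \<le> 1" and r: "norm x \<le> r" "2 * r \<le> norm y"
  shows "heat \<epsilon> (y - x) \<le> (4 * pi * \<epsilon>) powr (- (real DIM('a) / 2)) * exp (- r\<^sup>2 / (8 * \<epsilon>)) * exp (- (1/32) * (norm y)\<^sup>2)"
proof -
  have r0: "0 \<le> r" using r(1) norm_ge_zero order_trans by blast
  have "norm y \<le> norm (y - x) + norm x" using norm_triangle_ineq[of "y - x" x] by simp
  hence "norm y / 2 \<le> norm (y - x)" using r by simp
  hence "(norm y / 2)\<^sup>2 \<le> (norm (y - x))\<^sup>2" by (intro power_mono) auto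
  hence 1: "(norm y)\<^sup>2 / 4 \<le> (norm (y - x))\<^sup>2" by (simp add: power_divide)
  have "(2 * r)\<^sup>2 \<le> (norm y)\<^sup>2" using r r0 by (intro power_mono) auto
  hence 2: "4 * r\<^sup>2 \<le> (norm y)\<^sup>2" by (simp add: power_mult_distrib)
  have a: "- (norm (y - x))\<^sup>2 / (4 * \<epsilon>) \<le> - ((norm y)\<^sup>2 / 4) / (4 * \<epsilon>)"
    using 1 e by (intro divide_right_mono) auto
  have b: "- ((norm y)\<^sup>2 / 4) / (4 * \<epsilon>) = - (norm y)\<^sup>2 / (32 * \<epsilon>) + - (norm y)\<^sup>2 / (32 * \<epsilon>)" by simp
  have c: "- (norm y)\<^sup>2 / (32 * \<epsilon>) \<le> - (4 * r\<^sup>2) / (32 * \<epsilon>)"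
    using 2 e by (intro divide_right_mono) auto
  have d: "- (norm y)\<^sup>2 / (32 * \<epsilon>) \<le> - (1/32) * (norm y)\<^sup>2"
    using e mult_right_mono[of \<epsilon> 1 "(norm y)\<^sup>2"] by (simp add: field_simps)
  have "- (norm (y - x))\<^sup>2 / (4 * \<epsilon>) \<le> - r\<^sup>2 / (8 * \<epsilon>) + - (1/32) * (norm y)\<^sup>2"
    using a b c d by simp
  hence "exp (- (norm (y - x))\<^sup>2 / (4 * \<epsilon>)) \<le> exp (- r\<^sup>2 / (8 * \<epsilon>)) * exp (- (1/32) * (norm y)\<^sup>2)"
    by (simp only: exp_add[symmetric] exp_le_cancel_iff)
  thus ?thesis unfolding heat_def mult.assoc by (rule mult_left_mono) simp
qed

text \<open>The function \<open>B\<close> is merely integrable against Gaussians. Cut off at the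
  radius \<open>2 * r\<close> it is integrable and \<open>heat_mollify_AE\<close> applies; the rest
  changes the mollification inside the ball of radius \<open>r\<close> by at most
  \<open>\<tau> n * K\<close>, where \<open>\<tau>\<close> tends to 0.\<close>

lemma heat_mollify_AE_ball:
  fixes B :: "'a::euclidean_space \<Rightarrow> complex"
  assumes [measurable]: "B \<in> borel_measurable borel"
    and iB: "\<And>a. 0 < a \<Longrightarrow> integrable lborel (\<lambda>x. B x * of_real (exp (- a * (norm x)\<^sup>2)))"
    and r: "0 < r"
  shows "\<exists>\<epsilon>. (\<forall>n::nat. 0 < \<epsilon> n) \<and>
     (AE x in lborel. norm x < r \<longrightarrow> (\<lambda>n. \<integral>y. B y * of_real (heat (\<epsilon> n) (y - x)) \<partial>lborel) \<longlonglongrightarrow> B x)"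
proof -
  define \<epsilon> where "\<epsilon> n = 1 / real (Suc n)" for n
  have e: "0 < \<epsilon> n" "\<epsilon> n \<le> 1" for n by (auto simp: \<epsilon>_def)
  have el: "\<epsilon> \<longlonglongrightarrow> 0" unfolding \<epsilon>_def using LIMSEQ_inverse_real_of_nat by (simp add: inverse_eq_divide)
  define w where "w x = (if norm x < 2 * r then B x else 0)" for x
  have [measurable]: "w \<in> borel_measurable borel" unfolding w_def by measurable
  have iw: "integrable lborel w"
  proof (rule Bochner_Integration.integrable_bound)
    show "integrable lborel (\<lambda>x. of_real (exp ((2 * r)\<^sup>2)) * (B x * of_real (exp (- 1 * (norm x)\<^sup>2))))"
      by (intro integrable_mult_right iB) simp
    show "AE x in lborel. cmod (w x) \<le> cmod (of_real (exp ((2 * r)\<^sup>2)) * (B x * of_real (exp (- 1 * (norm x)\<^sup>2))))"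
    proof (rule AE_I2)
      fix x :: 'a
      show "cmod (w x) \<le> cmod (of_real (exp ((2 * r)\<^sup>2)) * (B x * of_real (exp (- 1 * (norm x)\<^sup>2))))"
      proof (cases "norm x < 2 * r")
        case True
        hence "(norm x)\<^sup>2 \<le> (2 * r)\<^sup>2" by (intro power_mono) auto
        hence "1 \<le> exp ((2 * r)\<^sup>2) * exp (- 1 * (norm x)\<^sup>2)" by (simp add: exp_add[symmetric])
        from mult_left_mono[OF this norm_ge_zero[of "B x"]] show ?thesis
          using True by (simp add: w_def norm_mult mult_ac)
      qed (simp add: w_def)
    qed
  qed measurable
  obtain \<rho> where \<rho>: "strict_mono \<rho>" "AE x in lborel. (\<lambda>n. \<integral>y. w y * of_real (heat (\<epsilon> (\<rho> n)) (y - x)) \<partial>lborel) \<longlonglongrightarrow> w x"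
    using heat_mollify_AE[OF iw e(1) el] by blast
  define \<tau> where "\<tau> n = (4 * pi * \<epsilon> n) powr (- (real DIM('a) / 2)) * exp (- r\<^sup>2 / (8 * \<epsilon> n))" for n
  have \<tau>: "\<tau> \<longlonglongrightarrow> 0"
  proof -
    define d where "d = real DIM('a) / 2"
    define q where "q = r\<^sup>2"
    have "d > 0" "q > 0" using r by (auto simp: d_def q_def)
    thus ?thesis unfolding \<tau>_def \<epsilon>_def d_def[symmetric] q_def[symmetric] by real_asymp
  qed
  define K where "K = (\<integral>y. cmod (B y * of_real (exp (- (1/32) * (norm y)\<^sup>2))) \<partial>lborel)"
  have tail: "cmod ((\<integral>y. B y * of_real (heat (\<epsilon> n) (y - x)) \<partial>lborel) - (\<integral>y. w y * of_real (heat (\<epsilon> n) (y - x)) \<partial>lborel)) \<le> \<tau> n * K"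
    if x: "norm x < r" for x n
  proof -
    have i1: "integrable lborel (\<lambda>y. w y * of_real (heat (\<epsilon> n) (y - x)))"
      by (rule Bochner_Integration.integrable_bound[OF integrable_mult_heat[OF _ iB e(1)]])
         (auto simp: w_def norm_mult)
    have i2: "integrable lborel (\<lambda>y. B y * of_real (heat (\<epsilon> n) (y - x)))"
      by (intro integrable_mult_heat iB e(1)) auto
    have "(\<integral>y. B y * of_real (heat (\<epsilon> n) (y - x)) \<partial>lborel) - (\<integral>y. w y * of_real (heat (\<epsilon> n) (y - x)) \<partial>lborel)
       = (\<integral>y. B y * of_real (heat (\<epsilon> n) (y - x)) - w y * of_real (heat (\<epsilon> n) (y - x)) \<partial>lborel)"
      by (rule Bochner_Integration.integral_diff[symmetric, OF i2 i1])
    also have "cmod \<dots> \<le> (\<integral>y. cmod (B y * of_real (heat (\<epsilon> n) (y - x)) - w y * of_real (heat (\<epsilon> n) (y - x))) \<partial>lborel)"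
      by (rule integral_norm_bound)
    also have "\<dots> \<le> (\<integral>y. \<tau> n * cmod (B y * of_real (exp (- (1/32) * (norm y)\<^sup>2))) \<partial>lborel)"
    proof (rule integral_mono)
      show "integrable lborel (\<lambda>y. cmod (B y * of_real (heat (\<epsilon> n) (y - x)) - w y * of_real (heat (\<epsilon> n) (y - x))))"
        by (intro integrable_norm Bochner_Integration.integrable_diff[OF i2 i1])
      show "integrable lborel (\<lambda>y. \<tau> n * cmod (B y * of_real (exp (- (1/32) * (norm y)\<^sup>2))))"
        by (intro integrable_mult_right integrable_norm iB) simp
      fix y :: 'a
      show "cmod (B y * of_real (heat (\<epsilon> n) (y - x)) - w y * of_real (heat (\<epsilon> n) (y - x))) \<le> \<tau> n * cmod (B y * of_real (exp (- (1/32) * (norm y)\<^sup>2)))"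
      proof (cases "norm y < 2 * r")
        case False
        have "heat (\<epsilon> n) (y - x) \<le> \<tau> n * exp (- (1/32) * (norm y)\<^sup>2)"
          unfolding \<tau>_def by (rule heat_tail_bound) (use e x False in auto)
        from mult_left_mono[OF this norm_ge_zero[of "B y"]] False show ?thesis
          by (simp add: w_def norm_mult heat_nonneg mult_ac)
      qed (simp add: w_def \<tau>_def)
    qed
    finally show ?thesis by (simp add: K_def)
  qed
  show ?thesis
  proof (intro exI conjI allI)
    show "0 < \<epsilon> (\<rho> n)" for n by (rule e)
    show "AE x in lborel. norm x < r \<longrightarrow> (\<lambda>n. \<integral>y. B y * of_real (heat (\<epsilon> (\<rho> n)) (y - x)) \<partial>lborel) \<longlonglongrightarrow> B x"
      using \<rho>(2)
    proof (eventually_elim, intro impI)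
      fix x assume l: "(\<lambda>n. \<integral>y. w y * of_real (heat (\<epsilon> (\<rho> n)) (y - x)) \<partial>lborel) \<longlonglongrightarrow> w x" and x: "norm x < r"
      have "(\<lambda>n. \<tau> (\<rho> n) * K) \<longlonglongrightarrow> 0 * K"
        using LIMSEQ_subseq_LIMSEQ[OF \<tau> \<rho>(1)] by (intro tendsto_intros) (simp add: o_def)
      hence "(\<lambda>n. \<tau> (\<rho> n) * K) \<longlonglongrightarrow> 0" by simp
      hence "(\<lambda>n. (\<integral>y. B y * of_real (heat (\<epsilon> (\<rho> n)) (y - x)) \<partial>lborel) - (\<integral>y. w y * of_real (heat (\<epsilon> (\<rho> n)) (y - x)) \<partial>lborel)) \<longlonglongrightarrow> 0"
        by (rule Lim_null_comparison[rotated]) (intro always_eventually allI tail x)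
      from tendsto_add[OF this l] have "(\<lambda>n. \<integral>y. B y * of_real (heat (\<epsilon> (\<rho> n)) (y - x)) \<partial>lborel) \<longlonglongrightarrow> w x" by simp
      moreover have "w x = B x" using x r by (simp add: w_def)
      ultimately show "(\<lambda>n. \<integral>y. B y * of_real (heat (\<epsilon> (\<rho> n)) (y - x)) \<partial>lborel) \<longlonglongrightarrow> B x" by simp
    qed
  qed
qed

text \<open>The hypothesis \<open>eq\<close> says in regularised form that \<open>c\<close> times
  \<open>B\<close> is the transform of \<open>A\<close>. By \<open>ft_L2_bound\<close> the
  mollifications of \<open>B\<close> are bounded in L2 uniformly in \<open>\<epsilon>\<close>. They
  converge to \<open>B\<close> almost everywhere on each ball along a sequence, so Fatou's lemma
  gives the bound on balls and then everywhere. That \<open>B\<close> is in L2 is thus a conclusion.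
  The cases c = 1 and c = (2 pi)^d correspond to the two directions of the transform.\<close>

lemma gauss_plancherel_bound:
  fixes A B :: "'a::euclidean_space \<Rightarrow> complex"
  assumes [measurable]: "A \<in> borel_measurable borel" "B \<in> borel_measurable borel"
    and A: "(\<integral>\<^sup>+x. ennreal ((cmod (A x))\<^sup>2) \<partial>lborel) < \<infinity>"
    and iB: "\<And>a. 0 < a \<Longrightarrow> integrable lborel (\<lambda>x. B x * of_real (exp (- a * (norm x)\<^sup>2)))"
    and \<sigma>: "\<sigma>\<^sup>2 = (1::real)" and c: "0 \<le> c"
    and eq: "\<And>\<epsilon> y. 0 < \<epsilon> \<Longrightarrow> (\<integral>x. A x * of_real (exp (- \<epsilon> * (norm x)\<^sup>2)) * cis (\<sigma> * (x \<bullet> y)) \<partial>lborel)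
       = of_real c * (\<integral>x. B x * of_real (heat \<epsilon> (x - y)) \<partial>lborel)"
  shows "ennreal (c\<^sup>2) * (\<integral>\<^sup>+x. ennreal ((cmod (B x))\<^sup>2) \<partial>lborel)
    \<le> ennreal ((2 * pi) ^ DIM('a)) * (\<integral>\<^sup>+x. ennreal ((cmod (A x))\<^sup>2) \<partial>lborel)" (is "_ \<le> ?K")
proof -
  have moll: "(\<integral>\<^sup>+y. ennreal ((cmod (of_real c * (\<integral>x. B x * of_real (heat \<epsilon> (x - y)) \<partial>lborel)))\<^sup>2) \<partial>lborel) \<le> ?K"
    if e: "0 < \<epsilon>" for \<epsilon>
  proof -
    have "(\<integral>\<^sup>+y. ennreal ((cmod (of_real c * (\<integral>x. B x * of_real (heat \<epsilon> (x - y)) \<partial>lborel)))\<^sup>2) \<partial>lborel)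
       \<le> ennreal ((2 * pi) ^ DIM('a)) * (\<integral>\<^sup>+x. ennreal ((cmod (A x * of_real (exp (- \<epsilon> * (norm x)\<^sup>2))))\<^sup>2) \<partial>lborel)"
      unfolding eq[OF e, symmetric]
      by (rule ft_L2_bound[OF integrable_square_mult_gauss[OF _ A e] \<sigma>]) measurable
    also have "\<dots> \<le> ?K"
    proof (intro mult_left_mono nn_integral_mono ennreal_leI power_mono)
      fix x :: 'a
      show "cmod (A x * of_real (exp (- \<epsilon> * (norm x)\<^sup>2))) \<le> cmod (A x)"
        using e by (auto simp: norm_mult intro!: mult_left_le)
    qed auto
    finally show ?thesis .
  qed
  have ball: "(\<integral>\<^sup>+x. ennreal (c\<^sup>2) * (ennreal ((cmod (B x))\<^sup>2) * indicator {x. norm x < r} x) \<partial>lborel) \<le> ?K" if r: "0 < r" for r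
  proof -
    obtain \<epsilon> where e: "\<And>n::nat. 0 < \<epsilon> n"
      "AE x in lborel. norm x < r \<longrightarrow> (\<lambda>n. \<integral>y. B y * of_real (heat (\<epsilon> n) (y - x)) \<partial>lborel) \<longlonglongrightarrow> B x"
      using heat_mollify_AE_ball[OF assms(2) iB r] by blast
    show ?thesis
    proof (rule nn_integral_le_of_tendsto)
      fix n
      let ?u = "\<lambda>x. ennreal ((cmod (of_real c * (\<integral>y. B y * of_real (heat (\<epsilon> n) (y - x)) \<partial>lborel)))\<^sup>2) * indicator {x. norm x < r} x"
      show "?u \<in> borel_measurable lborel" by measurable
      have "(\<integral>\<^sup>+x. ?u x \<partial>lborel) \<le> (\<integral>\<^sup>+x. ennreal ((cmod (of_real c * (\<integral>y. B y * of_real (heat (\<epsilon> n) (y - x)) \<partial>lborel)))\<^sup>2) \<partial>lborel)"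
        by (intro nn_integral_mono) (auto simp: indicator_def)
      also have "\<dots> \<le> ?K" by (rule moll[OF e(1)])
      finally show "(\<integral>\<^sup>+x. ?u x \<partial>lborel) \<le> ?K" .
    next
      show "AE x in lborel. (\<lambda>n. ennreal ((cmod (of_real c * (\<integral>y. B y * of_real (heat (\<epsilon> n) (y - x)) \<partial>lborel)))\<^sup>2) * indicator {x. norm x < r} x)
         \<longlonglongrightarrow> ennreal (c\<^sup>2) * (ennreal ((cmod (B x))\<^sup>2) * indicator {x. norm x < r} x)"
        using e(2)
      proof eventually_elim
        fix x assume l: "norm x < r \<longrightarrow> (\<lambda>n. \<integral>y. B y * of_real (heat (\<epsilon> n) (y - x)) \<partial>lborel) \<longlonglongrightarrow> B x"
        show "(\<lambda>n. ennreal ((cmod (of_real c * (\<integral>y. B y * of_real (heat (\<epsilon> n) (y - x)) \<partial>lborel)))\<^sup>2) * indicator {x. norm x < r} x)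
         \<longlonglongrightarrow> ennreal (c\<^sup>2) * (ennreal ((cmod (B x))\<^sup>2) * indicator {x. norm x < r} x)"
        proof (cases "norm x < r")
          case True
          with l have "(\<lambda>n. (cmod (of_real c * (\<integral>y. B y * of_real (heat (\<epsilon> n) (y - x)) \<partial>lborel)))\<^sup>2) \<longlonglongrightarrow> (cmod (of_real c * B x))\<^sup>2"
            by (intro tendsto_intros) auto
          from tendsto_ennrealI[OF this] True show ?thesis
            by (simp add: norm_mult power_mult_distrib ennreal_mult)
        qed simp
      qed
    qed
  qed
  have "(\<integral>\<^sup>+x. ennreal (c\<^sup>2) * ennreal ((cmod (B x))\<^sup>2) \<partial>lborel) \<le> ?K"
  proof (rule nn_integral_le_of_tendsto)
    fix n :: nat
    show "(\<integral>\<^sup>+x. ennreal (c\<^sup>2) * (ennreal ((cmod (B x))\<^sup>2) * indicator {x. norm x < real (Suc n)} x) \<partial>lborel) \<le> ?K"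
      by (rule ball) simp
  next
    show "AE x in lborel. (\<lambda>n. ennreal (c\<^sup>2) * (ennreal ((cmod (B x))\<^sup>2) * indicator {x. norm x < real (Suc n)} x))
        \<longlonglongrightarrow> ennreal (c\<^sup>2) * ennreal ((cmod (B x))\<^sup>2)"
    proof (rule AE_I2)
      fix x :: 'a
      obtain N where N: "norm x < real N" using reals_Archimedean2 by blast
      have "\<forall>\<^sub>F n in sequentially. ennreal (c\<^sup>2) * (ennreal ((cmod (B x))\<^sup>2) * indicator {x. norm x < real (Suc n)} x) = ennreal (c\<^sup>2) * ennreal ((cmod (B x))\<^sup>2)"
        using eventually_ge_at_top[of N] by eventually_elim (use N in \<open>auto simp: indicator_def\<close>)
      thus "(\<lambda>n. ennreal (c\<^sup>2) * (ennreal ((cmod (B x))\<^sup>2) * indicator {x. norm x < real (Suc n)} x))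
        \<longlonglongrightarrow> ennreal (c\<^sup>2) * ennreal ((cmod (B x))\<^sup>2)" by (rule tendsto_eventually)
    qed
  qed measurable
  thus ?thesis by (simp add: nn_integral_cmult)
qed

section \<open>Radial integrals, Riesz potentials and Bessel systems\<close>

lemma dyadic_scale:
  fixes r :: real assumes "1 < r"
  shows "\<exists>k::nat. 2 ^ k < r \<and> r \<le> 2 ^ Suc k"
proof -
  obtain n where n: "r < 2 ^ n" using real_arch_pow[of 2 r] by auto
  define m where "m = (LEAST n. r \<le> 2 ^ n)"
  have m: "r \<le> 2 ^ m" unfolding m_def by (rule LeastI[of _ n]) (use n in simp)
  have "m \<noteq> 0" using m assms by (cases m) auto
  then obtain k where k: "m = Suc k" by (cases m) auto
  have "\<not> r \<le> 2 ^ k" using not_less_Least[of k "\<lambda>n. r \<le> 2 ^ n"] k m_def by auto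
  thus ?thesis using m k by (intro exI[of _ k]) auto
qed

lemma dyadic_scale':
  fixes r :: real assumes "1 \<le> r"
  shows "\<exists>k::nat. 2 ^ k \<le> r \<and> r < 2 ^ Suc k"
proof -
  obtain n where n: "r < 2 ^ n" using real_arch_pow[of 2 r] by auto
  define m where "m = (LEAST n. r < 2 ^ n)"
  have m: "r < 2 ^ m" unfolding m_def by (rule LeastI[of _ n]) (use n in simp)
  have "m \<noteq> 0" using m assms by (cases m) auto
  then obtain k where k: "m = Suc k" by (cases m) auto
  have "\<not> r < 2 ^ k" using not_less_Least[of k "\<lambda>n. r < 2 ^ n"] k m_def by auto
  thus ?thesis using m k by (intro exI[of _ k]) auto
qed

lemma suminf_ennreal_geometric:
  assumes "0 \<le> c" "0 \<le> x" "x < 1"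
  shows "(\<Sum>k. ennreal (c * x ^ k)) = ennreal (c / (1 - x))"
proof -
  have "(\<lambda>k. c * x ^ k) sums (c * (1 / (1 - x)))"
    by (intro sums_mult geometric_sums) (use assms in auto)
  thus ?thesis using assms by (subst suminf_ennreal_eq) auto
qed

lemma pow2_powr: "((2::real) ^ k) powr y = 2 powr (real k * y)"
proof -
  have "(2::real) ^ k = 2 powr real k" by (simp add: powr_realpow)
  thus ?thesis by (simp only: powr_powr)
qed

text \<open>On the shell between R/2^(k+1) and R/2^k the integrand is at most the value of the power
  at the inner radius, and the shell lies in a ball of known volume. The resulting series is
  geometric with ratio 2^(\<alpha> - d) < 1.\<close>

lemma nn_integral_norm_powr_cball:
  assumes \<alpha>: "0 \<le> \<alpha>" "\<alpha> < real DIM('a::euclidean_space)"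
  shows "\<exists>C>0. \<forall>R>0. (\<integral>\<^sup>+x. ennreal (norm x powr (- \<alpha>)) * indicator (cball (0::'a) R) x \<partial>lborel) \<le> ennreal (C * R powr (real DIM('a) - \<alpha>))"
proof -
  define d where "d = real DIM('a)"
  define V where "V = unit_ball_vol d"
  have V: "V > 0" by (simp add: V_def d_def)
  define q where "q = (2::real) powr (\<alpha> - d)"
  have q: "0 < q" "q < 1" using \<alpha> powr_less_mono[of "\<alpha> - d" 0 2] by (simp_all add: q_def d_def)
  define C where "C = 2 powr \<alpha> * V / (1 - q)"
  have C: "C > 0" using V q by (simp add: C_def)
  have "(\<integral>\<^sup>+x. ennreal (norm x powr (- \<alpha>)) * indicator (cball (0::'a) R) x \<partial>lborel) \<le> ennreal (C * R powr (d - \<alpha>))"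
    if R: "R > 0" for R
  proof -
    define u where "u k x = ennreal ((R / 2 ^ Suc k) powr (- \<alpha>)) * indicator (cball (0::'a) (R / 2 ^ k)) x" for k x
    have [measurable]: "u k \<in> borel_measurable borel" for k
    unfolding u_def by (intro borel_measurable_times_ennreal borel_measurable_const borel_measurable_indicator borel_closed closed_cball)
    have "(\<integral>\<^sup>+x. ennreal (norm x powr (- \<alpha>)) * indicator (cball (0::'a) R) x \<partial>lborel) \<le> (\<integral>\<^sup>+x. (\<Sum>k. u k x) \<partial>lborel)"
    proof (rule nn_integral_mono)
      fix x :: 'a
      show "ennreal (norm x powr (- \<alpha>)) * indicator (cball 0 R) x \<le> (\<Sum>k. u k x)"
      proof (cases "x \<noteq> 0 \<and> norm x \<le> R")
        case True
        hence "\<exists>k::nat. 2 ^ k \<le> R / norm x \<and> R / norm x < 2 ^ Suc k"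
          by (intro dyadic_scale') simp
        then obtain k :: nat where k: "2 ^ k \<le> R / norm x" "R / norm x < 2 ^ Suc k" by blast
        have n0: "0 < norm x" using True by simp
        have k1: "R / 2 ^ Suc k \<le> norm x" using k(2) n0 by (simp add: field_simps)
        have k2: "norm x \<le> R / 2 ^ k" using k(1) n0 by (simp add: field_simps)
        have "norm x powr (- \<alpha>) \<le> (R / 2 ^ Suc k) powr (- \<alpha>)"
          using k1 \<alpha>(1) R by (intro powr_mono2') simp_all
        hence "ennreal (norm x powr (- \<alpha>)) * indicator (cball 0 R) x \<le> u k x"
          using k2 True by (simp add: u_def ennreal_leI)
        also have "\<dots> \<le> (\<Sum>k. u k x)" using sum_le_suminf[of "\<lambda>k. u k x" "{k}"] by simp
        finally show ?thesis .
      qed (auto simp: indicator_def)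
    qed
    also have "\<dots> = (\<Sum>k. \<integral>\<^sup>+x. u k x \<partial>lborel)" by (rule nn_integral_suminf) measurable
    also have "\<dots> = (\<Sum>k. ennreal ((2 powr \<alpha> * V * R powr (d - \<alpha>)) * q ^ k))"
    proof (rule suminf_cong)
      fix k
      have "(\<integral>\<^sup>+x. u k x \<partial>lborel) = ennreal ((R / 2 ^ Suc k) powr (- \<alpha>)) * ennreal (V * (R / 2 ^ k) ^ DIM('a))"
        unfolding u_def V_def d_def using R
        by (subst nn_integral_cmult_indicator) (simp_all add: emeasure_cball)
      also have "\<dots> = ennreal ((R / 2 ^ Suc k) powr (- \<alpha>) * (V * (R / 2 ^ k) ^ DIM('a)))"
        using V R by (simp add: ennreal_mult)
      also have "(R / 2 ^ Suc k) powr (- \<alpha>) * (V * (R / 2 ^ k) ^ DIM('a)) = (2 powr \<alpha> * V * R powr (d - \<alpha>)) * q ^ k"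
      proof -
        have "(R / 2 ^ k) ^ DIM('a) = (R / 2 ^ k) powr d" using R by (simp add: d_def powr_realpow)
        moreover have "(R / 2 ^ Suc k) powr (- \<alpha>) = 2 powr \<alpha> * (R / 2 ^ k) powr (- \<alpha>)"
        proof -
          have "R / 2 ^ Suc k = (1/2) * (R / 2 ^ k)" by simp
          hence "(R / 2 ^ Suc k) powr (- \<alpha>) = (1/2) powr (- \<alpha>) * (R / 2 ^ k) powr (- \<alpha>)"
            using R by (simp only: powr_mult)
          also have "(1/2) powr (- \<alpha>) = 2 powr \<alpha>" by (simp add: powr_minus powr_divide)
          finally show ?thesis .
        qed
        moreover have "(R / 2 ^ k) powr (- \<alpha>) * (R / 2 ^ k) powr d = (R / 2 ^ k) powr (d - \<alpha>)"
          by (simp add: powr_add[symmetric])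
        moreover have "(R / 2 ^ k) powr (d - \<alpha>) = R powr (d - \<alpha>) * q ^ k"
        proof -
          have "q ^ k = inverse ((2 ^ k) powr (d - \<alpha>))"
            unfolding pow2_powr powr_minus[symmetric] by (simp add: q_def powr_power algebra_simps)
          moreover have "(R / 2 ^ k) powr (d - \<alpha>) = R powr (d - \<alpha>) / (2 ^ k) powr (d - \<alpha>)"
            using R by (simp add: powr_divide)
          ultimately show ?thesis by (simp only: divide_inverse)
        qed
        ultimately show ?thesis by (simp add: mult_ac)
      qed
      finally show "(\<integral>\<^sup>+x. u k x \<partial>lborel) = ennreal ((2 powr \<alpha> * V * R powr (d - \<alpha>)) * q ^ k)" .
    qed
    also have "\<dots> = ennreal (2 powr \<alpha> * V * R powr (d - \<alpha>) / (1 - q))"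
      by (rule suminf_ennreal_geometric) (use V q in auto)
    also have "2 powr \<alpha> * V * R powr (d - \<alpha>) / (1 - q) = C * R powr (d - \<alpha>)" by (simp add: C_def)
    finally show ?thesis .
  qed
  thus ?thesis using C unfolding d_def by blast
qed

text \<open>The same decomposition into shells, now outwards, with the ratio 2^(d - \<alpha>) <
  1.\<close>

lemma nn_integral_norm_powr_outside:
  assumes \<alpha>: "real DIM('a::euclidean_space) < \<alpha>"
  shows "(\<integral>\<^sup>+x. ennreal (norm x powr (- \<alpha>)) * indicator {x::'a. 1 < norm x} x \<partial>lborel) < \<infinity>"
proof -
  define d where "d = real DIM('a)"
  define V where "V = unit_ball_vol d"
  have V: "V > 0" by (simp add: V_def d_def)
  define q where "q = (2::real) powr (d - \<alpha>)"
  have q: "0 < q" "q < 1" using \<alpha> powr_less_mono[of "d - \<alpha>" 0 2] by (simp_all add: q_def d_def)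
  define u where "u k x = ennreal ((2 ^ k) powr (- \<alpha>)) * indicator (cball (0::'a) (2 ^ Suc k)) x" for k x
  have [measurable]: "u k \<in> borel_measurable borel" for k
    unfolding u_def by (intro borel_measurable_times_ennreal borel_measurable_const borel_measurable_indicator borel_closed closed_cball)
  have "(\<integral>\<^sup>+x. ennreal (norm x powr (- \<alpha>)) * indicator {x::'a. 1 < norm x} x \<partial>lborel) \<le> (\<integral>\<^sup>+x. (\<Sum>k. u k x) \<partial>lborel)"
  proof (rule nn_integral_mono)
    fix x :: 'a
    show "ennreal (norm x powr (- \<alpha>)) * indicator {x::'a. 1 < norm x} x \<le> (\<Sum>k. u k x)"
    proof (cases "1 < norm x")
      case True
      then obtain k :: nat where k: "2 ^ k < norm x" "norm x \<le> 2 ^ Suc k" using dyadic_scale by blast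
      have "norm x powr (- \<alpha>) \<le> (2 ^ k) powr (- \<alpha>)"
        using k(1) \<alpha> True by (intro powr_mono2') simp_all
      hence "ennreal (norm x powr (- \<alpha>)) * indicator {x::'a. 1 < norm x} x \<le> u k x"
        using k True by (simp add: u_def ennreal_leI)
      also have "\<dots> \<le> (\<Sum>k. u k x)" using sum_le_suminf[of "\<lambda>k. u k x" "{k}"] by simp
      finally show ?thesis .
    qed simp
  qed
  also have "\<dots> = (\<Sum>k. \<integral>\<^sup>+x. u k x \<partial>lborel)" by (rule nn_integral_suminf) measurable
  also have "\<dots> = (\<Sum>k. ennreal ((2 powr d * V) * q ^ k))"
  proof (rule suminf_cong)
    fix k
    have "(\<integral>\<^sup>+x. u k x \<partial>lborel) = ennreal ((2 ^ k) powr (- \<alpha>)) * ennreal (V * (2 ^ Suc k) ^ DIM('a))"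
      unfolding u_def V_def d_def
      by (subst nn_integral_cmult_indicator) (simp_all add: emeasure_cball)
    also have "\<dots> = ennreal ((2 ^ k) powr (- \<alpha>) * (V * (2 ^ Suc k) ^ DIM('a)))"
      using V by (simp add: ennreal_mult)
    also have "(2 ^ k) powr (- \<alpha>) * (V * (2 ^ Suc k) ^ DIM('a)) = (2 powr d * V) * q ^ k"
    proof -
      have "(2 ^ Suc k :: real) ^ DIM('a) = 2 powr (Suc k * d)" unfolding d_def
        by (metis of_nat_mult power_mult powr_realpow zero_less_numeral)
      moreover have "q ^ k = 2 powr (k * (d - \<alpha>))" by (simp add: powr_power q_def mult.commute)
      moreover have "2 powr (k * (-\<alpha>)) * 2 powr (Suc k * d) = 2 powr d * 2 powr (k * (d - \<alpha>))"
        unfolding powr_add[symmetric] by (simp add: algebra_simps)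
      ultimately show ?thesis unfolding pow2_powr by (metis mult.assoc mult.left_commute mult.commute)
    qed
    finally show "(\<integral>\<^sup>+x. u k x \<partial>lborel) = ennreal ((2 powr d * V) * q ^ k)" .
  qed
  also have "\<dots> = ennreal (2 powr d * V / (1 - q))"
    by (rule suminf_ennreal_geometric) (use V q in auto)
  also have "\<dots> < \<infinity>" by simp
  finally show ?thesis .
qed

text \<open>The integral is split at the distance \<open>l = measure lborel E\<close>, where both
  parts are of the order \<open>l powr (1 - a)\<close>: the near part lies in an interval of radius
  \<open>l\<close>, and on the far part the kernel is at most \<open>l powr (- a)\<close>. Null sets
  are separated because this radius would vanish.\<close>

lemma riesz_potential_bound:
  assumes a: "0 < a" "a < 1"
  shows "\<exists>C>0. \<forall>E t. E \<in> sets borel \<and> emeasure lborel E < \<infinity> \<longrightarrow>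
     (\<integral>\<^sup>+t'. ennreal (\<bar>t - t'\<bar> powr (- a)) * indicator E t' \<partial>lborel) \<le> ennreal (C * measure lborel E powr (1 - a))"
proof -
  obtain C where C: "C > 0" "\<And>R. R > 0 \<Longrightarrow> (\<integral>\<^sup>+x. ennreal (norm x powr (- a)) * indicator (cball (0::real) R) x \<partial>lborel) \<le> ennreal (C * R powr (1 - a))"
    using nn_integral_norm_powr_cball[of a, where 'a=real] a by auto
  have "(\<integral>\<^sup>+t'. ennreal (\<bar>t - t'\<bar> powr (- a)) * indicator E t' \<partial>lborel) \<le> ennreal ((C + 1) * measure lborel E powr (1 - a))"
    if E [measurable]: "E \<in> sets borel" and fin: "emeasure lborel E < \<infinity>" for E t
  proof -
    define l where "l = measure lborel E"
    have l: "emeasure lborel E = ennreal l" unfolding l_def using fin by (simp add: emeasure_eq_ennreal_measure)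
    have [measurable]: "(\<lambda>t'. indicator (cball 0 l) (t - t') :: ennreal) \<in> borel_measurable borel"
      by (rule measurable_compose[of "\<lambda>t'. t - t'" borel borel]; (intro borel_measurable_indicator borel_closed closed_cball | measurable))
    show ?thesis
    proof (cases "l = 0")
      case True
      hence "E \<in> null_sets lborel" using l by (auto simp: null_sets_def)
      hence "AE t' in lborel. ennreal (\<bar>t - t'\<bar> powr (- a)) * indicator E t' = 0"
        by (auto dest!: AE_not_in elim!: eventually_mono)
      thus ?thesis by (subst nn_integral_0_iff_AE[THEN iffD2]) auto
    next
      case False
      hence l0: "l > 0" by (simp add: l_def less_le)
      have "(\<integral>\<^sup>+t'. ennreal (\<bar>t - t'\<bar> powr (- a)) * indicator E t' \<partial>lborel)
         \<le> (\<integral>\<^sup>+t'. ennreal (norm (t - t') powr (- a)) * indicator (cball 0 l) (t - t') + ennreal (l powr (- a)) * indicator E t' \<partial>lborel)"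
      proof (rule nn_integral_mono)
        fix t'
        show "ennreal (\<bar>t - t'\<bar> powr (- a)) * indicator E t' \<le> ennreal (norm (t - t') powr (- a)) * indicator (cball 0 l) (t - t') + ennreal (l powr (- a)) * indicator E t'"
        proof (cases "\<bar>t - t'\<bar> \<le> l")
          case False
          hence "\<bar>t - t'\<bar> powr (- a) \<le> l powr (- a)" using l0 a by (intro powr_mono2') auto
          thus ?thesis using False by (auto simp: indicator_def intro: ennreal_leI)
        qed (auto simp: indicator_def)
      qed
      also have "\<dots> = (\<integral>\<^sup>+t'. ennreal (norm (t - t') powr (- a)) * indicator (cball 0 l) (t - t') \<partial>lborel) + ennreal (l powr (- a)) * ennreal l"
        by (subst nn_integral_add) (simp_all add: nn_integral_cmult_indicator l)
      also have "(\<integral>\<^sup>+t'. ennreal (norm (t - t') powr (- a)) * indicator (cball 0 l) (t - t') \<partial>lborel) = (\<integral>\<^sup>+t'. ennreal (norm (t'::real) powr (- a)) * indicator (cball 0 l) t' \<partial>lborel)"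
        by (rule nn_integral_lborel_reflect[of "\<lambda>t'::real. ennreal (norm t' powr (- a)) * indicator (cball 0 l) t'"])
          (intro borel_measurable_times_ennreal borel_measurable_indicator borel_closed closed_cball, measurable)
      also have "\<dots> \<le> ennreal (C * l powr (1 - a))" by (rule C(2)[OF l0])
      also have "ennreal (l powr (- a)) * ennreal l = ennreal (l powr (1 - a))"
        using l0 by (simp add: ennreal_mult[symmetric] powr_diff powr_minus divide_inverse mult.commute)
      also have "ennreal (C * l powr (1 - a)) + ennreal (l powr (1 - a)) = ennreal ((C + 1) * l powr (1 - a))"
        using C(1) by (subst ennreal_plus[symmetric]) (auto simp: algebra_simps)
      finally show ?thesis by (simp add: l_def)
    qed
  qed
  thus ?thesis using C(1) by (intro exI[of _ "C + 1"]) auto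
qed

text \<open>Synthesis from coefficients has norm at most 1: the half of orthonormality in L2 that
  survives an inequality in place of Plancherel's identity.\<close>

definition bessel_system :: "nat set \<Rightarrow> (nat \<Rightarrow> 'a::euclidean_space \<Rightarrow> complex) \<Rightarrow> bool" where
  "bessel_system J e \<longleftrightarrow> finite J \<and> (\<forall>j\<in>J. e j \<in> borel_measurable borel) \<and>
     (\<forall>a. (\<integral>\<^sup>+x. ennreal ((cmod (\<Sum>j\<in>J. a j * e j x))\<^sup>2) \<partial>lborel) \<le> ennreal (\<Sum>j\<in>J. (cmod (a j))\<^sup>2))"

lemma bessel_systemD:
  assumes "bessel_system J e"
  shows "finite J" "j \<in> J \<Longrightarrow> e j \<in> borel_measurable borel"
    "(\<integral>\<^sup>+x. ennreal ((cmod (\<Sum>j\<in>J. a j * e j x))\<^sup>2) \<partial>lborel) \<le> ennreal (\<Sum>j\<in>J. (cmod (a j))\<^sup>2)"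
    "j \<in> J \<Longrightarrow> (\<integral>\<^sup>+x. ennreal ((cmod (e j x))\<^sup>2) \<partial>lborel) \<le> 1"
proof -
  show *: "finite J" "j \<in> J \<Longrightarrow> e j \<in> borel_measurable borel"
    "(\<integral>\<^sup>+x. ennreal ((cmod (\<Sum>j\<in>J. a j * e j x))\<^sup>2) \<partial>lborel) \<le> ennreal (\<Sum>j\<in>J. (cmod (a j))\<^sup>2)" for a
    using assms by (auto simp: bessel_system_def)
  assume j: "j \<in> J"
  have "(\<Sum>i\<in>J. (if i = j then 1 else 0) * e i x) = e j x" for x
    using *(1) j by (simp add: if_distrib[of "\<lambda>c. c * _"] cong: if_cong)
  moreover have "(\<Sum>i\<in>J. (cmod (if i = j then 1 else 0))\<^sup>2) = 1"
    using *(1) j by (simp add: if_distrib[of cmod] if_distrib[of "\<lambda>c. c\<^sup>2"] cong: if_cong)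
  ultimately show "(\<integral>\<^sup>+x. ennreal ((cmod (e j x))\<^sup>2) \<partial>lborel) \<le> 1"
    using *(3)[of "\<lambda>i. if i = j then 1 else 0"] by simp
qed

section \<open>Cauchy-Schwarz and duality for Bessel systems\<close>

lemma integrable_mult_L2:
  fixes f g :: "'b \<Rightarrow> complex"
  assumes [measurable]: "f \<in> borel_measurable M" "g \<in> borel_measurable M"
    and "(\<integral>\<^sup>+x. ennreal ((cmod (f x))\<^sup>2) \<partial>M) < \<infinity>" "(\<integral>\<^sup>+x. ennreal ((cmod (g x))\<^sup>2) \<partial>M) < \<infinity>"
  shows "integrable M (\<lambda>x. f x * g x)"
proof (rule integrableI_bounded)
  have "(\<integral>\<^sup>+x. ennreal (cmod (f x * g x)) \<partial>M)\<^sup>2 = (\<integral>\<^sup>+x. ennreal (cmod (f x)) * ennreal (cmod (g x)) \<partial>M)\<^sup>2"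
    by (simp add: norm_mult ennreal_mult)
  also have "\<dots> \<le> (\<integral>\<^sup>+x. (ennreal (cmod (f x)))\<^sup>2 \<partial>M) * (\<integral>\<^sup>+x. (ennreal (cmod (g x)))\<^sup>2 \<partial>M)"
    by (rule Cauchy_Schwarz_nn_integral) measurable
  also have "\<dots> < \<infinity>" using assms(3,4) by (simp add: ennreal_power ennreal_mult_less_top)
  finally show "(\<integral>\<^sup>+x. ennreal (cmod (f x * g x)) \<partial>M) < \<infinity>"
    by (auto simp: power2_eq_square less_top[symmetric] ennreal_mult_eq_top_iff)
qed measurable

lemma cauchy_schwarz_integral:
  fixes f g :: "'b \<Rightarrow> complex"
  assumes [measurable]: "f \<in> borel_measurable M" "g \<in> borel_measurable M"
  shows "ennreal ((cmod (\<integral>x. f x * g x \<partial>M))\<^sup>2) \<le> (\<integral>\<^sup>+x. ennreal ((cmod (f x))\<^sup>2) \<partial>M) * (\<integral>\<^sup>+x. ennreal ((cmod (g x))\<^sup>2) \<partial>M)"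
proof (cases "integrable M (\<lambda>x. f x * g x)")
  case True
  have "ennreal ((cmod (\<integral>x. f x * g x \<partial>M))\<^sup>2) = (ennreal (cmod (\<integral>x. f x * g x \<partial>M)))\<^sup>2"
    by (simp add: ennreal_power)
  also have "\<dots> \<le> (\<integral>\<^sup>+x. ennreal (cmod (f x * g x)) \<partial>M)\<^sup>2"
    by (intro power_mono integral_norm_bound_ennreal True) simp
  also have "\<dots> = (\<integral>\<^sup>+x. ennreal (cmod (f x)) * ennreal (cmod (g x)) \<partial>M)\<^sup>2"
    by (simp add: norm_mult ennreal_mult)
  also have "\<dots> \<le> (\<integral>\<^sup>+x. (ennreal (cmod (f x)))\<^sup>2 \<partial>M) * (\<integral>\<^sup>+x. (ennreal (cmod (g x)))\<^sup>2 \<partial>M)"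
    by (rule Cauchy_Schwarz_nn_integral) measurable
  finally show ?thesis by (simp add: ennreal_power)
qed (simp add: not_integrable_integral_eq)

text \<open>Duality: with the conjugates of the pairings as coefficients, the left-hand side
  \<open>T\<close> is itself a pairing of \<open>\<psi>\<close> with a synthesised function of
  squared norm at most \<open>T\<close>. Cauchy-Schwarz gives \<open>T\<^sup>2 \<le> T * ?P\<close>,
  and the finite \<open>T\<close> cancels. The pairing is bilinear, without a conjugate on
  \<open>\<psi>\<close>.\<close>

lemma bessel_inequality:
  fixes e :: "nat \<Rightarrow> 'a::euclidean_space \<Rightarrow> complex"
  assumes e: "bessel_system J e" and [measurable]: "\<psi> \<in> borel_measurable borel"
  shows "ennreal (\<Sum>j\<in>J. (cmod (\<integral>x. e j x * \<psi> x \<partial>lborel))\<^sup>2) \<le> (\<integral>\<^sup>+x. ennreal ((cmod (\<psi> x))\<^sup>2) \<partial>lborel)" (is "_ \<le> ?P")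
proof (cases "?P < \<infinity>")
  case True
  note eD = bessel_systemD[OF e]
  have [measurable]: "(\<lambda>x. \<Sum>j\<in>J. a j * e j x) \<in> borel_measurable borel" for a
    using eD(2) by (intro borel_measurable_sum borel_measurable_times) auto
  define c where "c j = (\<integral>x. e j x * \<psi> x \<partial>lborel)" for j
  define T where "T = (\<Sum>j\<in>J. (cmod (c j))\<^sup>2)"
  have T0: "T \<ge> 0" by (simp add: T_def sum_nonneg)
  have int: "integrable lborel (\<lambda>x. e j x * \<psi> x)" if "j \<in> J" for j
    by (rule integrable_mult_L2) (use eD(2,4)[OF that] True in \<open>auto intro: le_less_trans\<close>)
  have "complex_of_real T = (\<Sum>j\<in>J. cnj (c j) * c j)"
    unfolding T_def of_real_sum by (intro sum.cong refl) (simp add: complex_norm_square mult.commute del: of_real_power)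
  also have "\<dots> = (\<Sum>j\<in>J. \<integral>x. cnj (c j) * (e j x * \<psi> x) \<partial>lborel)"
    by (simp add: c_def)
  also have "\<dots> = (\<integral>x. (\<Sum>j\<in>J. cnj (c j) * (e j x * \<psi> x)) \<partial>lborel)"
    by (rule Bochner_Integration.integral_sum[symmetric]) (intro integrable_mult_right int)
  also have "\<dots> = (\<integral>x. (\<Sum>j\<in>J. cnj (c j) * e j x) * \<psi> x \<partial>lborel)"
    by (simp add: sum_distrib_right mult.assoc)
  finally have "T = cmod (\<integral>x. (\<Sum>j\<in>J. cnj (c j) * e j x) * \<psi> x \<partial>lborel)"
    using T0 by (metis abs_of_nonneg norm_of_real)
  hence "ennreal (T\<^sup>2) = ennreal ((cmod (\<integral>x. (\<Sum>j\<in>J. cnj (c j) * e j x) * \<psi> x \<partial>lborel))\<^sup>2)" by simp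
  also have "\<dots> \<le> (\<integral>\<^sup>+x. ennreal ((cmod (\<Sum>j\<in>J. cnj (c j) * e j x))\<^sup>2) \<partial>lborel) * ?P"
    by (rule cauchy_schwarz_integral) measurable
  also have "\<dots> \<le> ennreal T * ?P"
    using eD(3)[of "\<lambda>j. cnj (c j)"] by (intro mult_right_mono) (auto simp: T_def)
  finally have *: "ennreal T * ennreal T \<le> ennreal T * ?P"
    using T0 by (simp add: power2_eq_square ennreal_mult)
  have "ennreal T \<le> ?P"
  proof (cases "T = 0")
    case False
    hence "ennreal T \<noteq> 0" using T0 by auto
    with * show ?thesis using ennreal_mult_le_mult_iff[of "ennreal T"] by simp
  qed simp
  thus ?thesis by (simp add: T_def c_def)
qed (simp add: not_less top_unique)

section \<open>The duality argument for orthonormal systems\<close>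

lemma norm_integral_le_nn_integral:
  fixes f :: "'b \<Rightarrow> complex"
  shows "ennreal (cmod (\<integral>x. f x \<partial>M)) \<le> (\<integral>\<^sup>+x. ennreal (cmod (f x)) \<partial>M)"
  by (cases "integrable M f") (auto simp: not_integrable_integral_eq intro: integral_norm_bound_ennreal)

text \<open>The square is expanded into a double integral over times, and the modulus is taken only
  after the integration in \<open>x\<close>, so that cancellation in the kernel is kept. It is
  applied both to a single frequency variable and to pairs of frequencies.\<close>

lemma square_integral_le:
  fixes F :: "'b \<Rightarrow> 'c \<Rightarrow> complex"
  assumes N: "finite_measure N" and P: "finite_measure P"
    and [measurable]: "case_prod F \<in> borel_measurable (N \<Otimes>\<^sub>M P)"
    and C: "\<And>t x. cmod (F t x) \<le> C"
  shows "(\<integral>\<^sup>+x. ennreal ((cmod (\<integral>t. F t x \<partial>N))\<^sup>2) \<partial>P)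
     \<le> (\<integral>\<^sup>+t. \<integral>\<^sup>+t'. ennreal (cmod (\<integral>x. F t x * cnj (F t' x) \<partial>P)) \<partial>N \<partial>N)"
proof -
  interpret N: finite_measure N by fact
  interpret P: finite_measure P by fact
  interpret NP: pair_sigma_finite N P ..
  interpret NPf: finite_measure "N \<Otimes>\<^sub>M P"
    by (rule finite_measure_pair_measure) fact+
  have [measurable (raw)]: "(\<lambda>y. F (f y) (g y)) \<in> borel_measurable M" if "f \<in> M \<rightarrow>\<^sub>M N" "g \<in> M \<rightarrow>\<^sub>M P" for f g M
    using measurable_compose[OF measurable_Pair[OF that] assms(3)] by simp
  have C0: "0 \<le> C" using C norm_ge_zero order_trans by blast
  define G where "G x = (\<integral>t. F t x \<partial>N)" for x
  have [measurable]: "G \<in> borel_measurable P" unfolding G_def by measurable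
  define D where "D = C * measure N (space N)"
  have intF: "integrable N (\<lambda>t. F t x)" if "x \<in> space P" for x
    by (rule N.integrable_const_bound[where B=C]) (use that C in auto)
  have GD: "cmod (G x) \<le> D" for x
  proof -
    have "cmod (G x) \<le> (\<integral>t. cmod (F t x) \<partial>N)" unfolding G_def by (rule integral_norm_bound)
    also have "\<dots> \<le> (\<integral>t. C \<partial>N)" by (rule integral_mono') (use C C0 in auto)
    finally show ?thesis by (simp add: D_def mult.commute)
  qed
  have i1: "integrable (N \<Otimes>\<^sub>M P) (\<lambda>(t, x). F t x * cnj (G x))"
    by (rule NPf.integrable_const_bound[where B="C * D"])
       (auto simp: norm_mult intro!: AE_I2 mult_mono C GD C0)
  have inner: "(\<integral>x. F t x * cnj (G x) \<partial>P) = (\<integral>t'. \<integral>x. F t x * cnj (F t' x) \<partial>P \<partial>N)" if t: "t \<in> space N" for t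
  proof -
    have i2: "integrable (N \<Otimes>\<^sub>M P) (\<lambda>(t', x). F t x * cnj (F t' x))"
      by (rule NPf.integrable_const_bound[where B="C * C"])
         (use t in \<open>auto simp: norm_mult intro!: AE_I2 mult_mono C C0\<close>)
    have "(\<integral>x. F t x * cnj (G x) \<partial>P) = (\<integral>x. \<integral>t'. F t x * cnj (F t' x) \<partial>N \<partial>P)"
      unfolding G_def by simp
    thus ?thesis using NP.Fubini_integral[OF i2] by simp
  qed
  have iG: "integrable P (\<lambda>x. (cmod (G x))\<^sup>2)"
    by (rule P.integrable_const_bound[where B="D\<^sup>2"]) (auto intro!: AE_I2 power_mono GD)
  have "complex_of_real (\<integral>x. (cmod (G x))\<^sup>2 \<partial>P) = (\<integral>x. G x * cnj (G x) \<partial>P)"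
    unfolding integral_complex_of_real[symmetric]
    by (intro Bochner_Integration.integral_cong refl) (simp add: complex_norm_square del: of_real_power)
  also have "\<dots> = (\<integral>x. \<integral>t. F t x * cnj (G x) \<partial>N \<partial>P)" by (simp add: G_def)
  also have "\<dots> = (\<integral>t. \<integral>x. F t x * cnj (G x) \<partial>P \<partial>N)"
    using NP.Fubini_integral[OF i1] by simp
  also have "\<dots> = (\<integral>t. \<integral>t'. \<integral>x. F t x * cnj (F t' x) \<partial>P \<partial>N \<partial>N)"
    by (intro Bochner_Integration.integral_cong refl inner)
  finally have eq: "complex_of_real (\<integral>x. (cmod (G x))\<^sup>2 \<partial>P) = (\<integral>t. \<integral>t'. \<integral>x. F t x * cnj (F t' x) \<partial>P \<partial>N \<partial>N)" .
  have "(\<integral>\<^sup>+x. ennreal ((cmod (G x))\<^sup>2) \<partial>P) = ennreal (\<integral>x. (cmod (G x))\<^sup>2 \<partial>P)"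
    by (rule nn_integral_eq_integral[OF iG]) simp
  also have "\<dots> = ennreal (cmod (complex_of_real (\<integral>x. (cmod (G x))\<^sup>2 \<partial>P)))"
    by (simp del: of_real_power)
  also have "\<dots> \<le> (\<integral>\<^sup>+t. ennreal (cmod (\<integral>t'. \<integral>x. F t x * cnj (F t' x) \<partial>P \<partial>N)) \<partial>N)"
    unfolding eq by (rule norm_integral_le_nn_integral)
  also have "\<dots> \<le> (\<integral>\<^sup>+t. \<integral>\<^sup>+t'. ennreal (cmod (\<integral>x. F t x * cnj (F t' x) \<partial>P)) \<partial>N \<partial>N)"
    by (intro nn_integral_mono norm_integral_le_nn_integral)
  finally show ?thesis by (simp add: G_def)
qed

text \<open>The multiplier is factored as \<open>\<tau> \<mu>\<close>: the kernel is known only for \<open>\<mu>\<^sup>2\<close>, where it is bounded by \<open>kk (t - t')\<close>, and \<open>\<tau>\<close> is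
  absorbed into \<open>e j\<close>. The phase \<open>ch t\<close> contains the linearising function \<open>x(t)\<close>.\<close>

locale tt_star =
  fixes J :: "nat set" and e :: "nat \<Rightarrow> 'a::euclidean_space \<Rightarrow> complex"
    and \<tau> \<mu> :: "'a \<Rightarrow> real" and T :: real
    and ch :: "real \<Rightarrow> 'a \<Rightarrow> complex" and E :: "real set" and kk :: "real \<Rightarrow> ennreal"
  assumes e: "bessel_system J e"
    and \<tau>_meas [measurable]: "\<tau> \<in> borel_measurable borel" and \<tau>: "\<And>\<xi>. 0 \<le> \<tau> \<xi>" "\<And>\<xi>. \<tau> \<xi> \<le> T"
    and \<mu>_meas [measurable]: "\<mu> \<in> borel_measurable borel"
    and \<mu>: "(\<integral>\<^sup>+\<xi>. ennreal ((\<mu> \<xi>)\<^sup>2) \<partial>lborel) < \<infinity>"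
    and ch_meas [measurable]: "case_prod ch \<in> borel_measurable (borel \<Otimes>\<^sub>M borel)" and ch: "\<And>t \<xi>. cmod (ch t \<xi>) \<le> 1"
    and E_meas [measurable]: "E \<in> sets borel" and E: "emeasure lborel E < \<infinity>"
    and kk_meas [measurable]: "kk \<in> borel_measurable borel" and kk_sym: "\<And>u. kk (- u) = kk u"
    and kk: "\<And>t t'. ennreal (cmod (\<integral>\<xi>. of_real ((\<mu> \<xi>)\<^sup>2) * (cnj (ch t \<xi>) * ch t' \<xi>) \<partial>lborel)) \<le> kk (t - t')"
begin

definition N :: "real measure" where "N = density lborel (indicator E)"
definition P :: "'a measure" where "P = density lborel (\<lambda>\<xi>. ennreal ((\<mu> \<xi>)\<^sup>2))"
text \<open>The function \<open>w j\<close> is the image of \<open>e j\<close> under the operator A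
  with kernel \<open>\<tau> * \<mu> * ch\<close>. Let B be the operator with kernel
  \<open>\<mu> * ch\<close>; then \<open>\<mu> * g j\<close> is the adjoint of B applied to
  \<open>w j\<close>, on the times in \<open>E\<close>.\<close>

definition w :: "nat \<Rightarrow> real \<Rightarrow> complex" where
  "w j t = (\<integral>\<xi>. e j \<xi> * of_real (\<tau> \<xi> * \<mu> \<xi>) * ch t \<xi> \<partial>lborel)"
definition g :: "nat \<Rightarrow> 'a \<Rightarrow> complex" where
  "g j \<xi> = (\<integral>t. cnj (ch t \<xi>) * w j t \<partial>N)"

lemma sets_N [measurable_cong, simp]: "sets N = sets borel" and sets_P [measurable_cong, simp]: "sets P = sets borel"
  by (simp_all add: N_def P_def)

lemma finite_N: "finite_measure N"
  by (rule finite_measureI) (use E in \<open>simp add: N_def emeasure_density\<close>)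

lemma finite_P: "finite_measure P"
  by (rule finite_measureI) (use \<mu> in \<open>simp add: P_def emeasure_density\<close>)

sublocale N: finite_measure N by (rule finite_N)
sublocale P: finite_measure P by (rule finite_P)
sublocale NL: pair_sigma_finite N "lborel :: 'a measure" ..
sublocale NP: pair_sigma_finite N P ..
sublocale NN: pair_sigma_finite N N ..
sublocale PP: pair_sigma_finite P P ..

lemma ch_measurable [measurable (raw)]:
  assumes "f \<in> borel_measurable M" "h \<in> borel_measurable M"
  shows "(\<lambda>y. ch (f y) (h y)) \<in> borel_measurable M"
  using measurable_compose[OF measurable_Pair[OF assms] ch_meas] by simp

lemma e_measurable: "j \<in> J \<Longrightarrow> e j \<in> borel_measurable borel"
  using bessel_systemD(2)[OF e] .

lemma \<tau>e_L2: 
  assumes j: "j \<in> J"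
  shows "(\<integral>\<^sup>+\<xi>. ennreal ((cmod (e j \<xi> * of_real (\<tau> \<xi>)))\<^sup>2) \<partial>lborel) < \<infinity>"
proof -
  note [measurable] = e_measurable[OF j]
  have "(\<integral>\<^sup>+\<xi>. ennreal ((cmod (e j \<xi> * of_real (\<tau> \<xi>)))\<^sup>2) \<partial>lborel) \<le> (\<integral>\<^sup>+\<xi>. ennreal ((cmod (e j \<xi>))\<^sup>2) * ennreal (T\<^sup>2) \<partial>lborel)"
  proof (intro nn_integral_mono)
    fix \<xi> :: 'a
    have "(\<tau> \<xi>)\<^sup>2 \<le> T\<^sup>2" using \<tau> by (intro power_mono) auto
    thus "ennreal ((cmod (e j \<xi> * of_real (\<tau> \<xi>)))\<^sup>2) \<le> ennreal ((cmod (e j \<xi>))\<^sup>2) * ennreal (T\<^sup>2)"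
      by (simp add: norm_mult power_mult_distrib ennreal_mult[symmetric] mult_left_mono)
  qed
  also have "\<dots> \<le> 1 * ennreal (T\<^sup>2)"
    using mult_right_mono[OF bessel_systemD(4)[OF e j], of "ennreal (T\<^sup>2)"]
    by (subst nn_integral_multc) auto
  also have "\<dots> < \<infinity>" by simp
  finally show ?thesis .
qed

lemma integrable_e\<tau>\<mu>:
  assumes j: "j \<in> J"
  shows "integrable lborel (\<lambda>\<xi>. e j \<xi> * of_real (\<tau> \<xi> * \<mu> \<xi>))"
proof -
  note [measurable] = e_measurable[OF j]
  have "integrable lborel (\<lambda>\<xi>. (e j \<xi> * of_real (\<tau> \<xi>)) * complex_of_real (\<mu> \<xi>))"
    by (rule integrable_mult_L2) (use \<tau>e_L2[OF j] \<mu> in auto)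
  thus ?thesis by (simp add: mult_ac)
qed

definition W :: "nat \<Rightarrow> real" where "W j = (\<integral>\<xi>. cmod (e j \<xi> * of_real (\<tau> \<xi> * \<mu> \<xi>)) \<partial>lborel)"

lemma w_bound: 
  assumes j: "j \<in> J" shows "cmod (w j t) \<le> W j"
proof -
  note [measurable] = e_measurable[OF j]
  have "cmod (w j t) \<le> (\<integral>\<xi>. cmod (e j \<xi> * of_real (\<tau> \<xi> * \<mu> \<xi>) * ch t \<xi>) \<partial>lborel)"
    unfolding w_def by (rule integral_norm_bound)
  also have "\<dots> \<le> W j" unfolding W_def
  proof (rule integral_mono')
    show "integrable lborel (\<lambda>\<xi>. cmod (e j \<xi> * of_real (\<tau> \<xi> * \<mu> \<xi>)))"
      by (rule integrable_norm[OF integrable_e\<tau>\<mu>[OF j]])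
    show "cmod (e j \<xi> * of_real (\<tau> \<xi> * \<mu> \<xi>) * ch t \<xi>) \<le> cmod (e j \<xi> * of_real (\<tau> \<xi> * \<mu> \<xi>))" for \<xi>
      unfolding norm_mult[of _ "ch t \<xi>"] by (rule mult_left_le) (use ch in auto)
  qed simp
  finally show ?thesis .
qed

lemma w_measurable: "j \<in> J \<Longrightarrow> w j \<in> borel_measurable borel"
  using e_measurable unfolding w_def by measurable

lemma g_measurable: "j \<in> J \<Longrightarrow> g j \<in> borel_measurable borel"
  using w_measurable unfolding g_def by measurable

text \<open>The adjoint relation against an arbitrary bounded function of time. It is used with the
  conjugate of \<open>w j\<close> and with the conjugate of \<open>ch\<close> at a fixed
  frequency.\<close>

lemma fubini_w:
  assumes j: "j \<in> J" and c: "c \<in> borel_measurable borel" "\<And>t. cmod (c t) \<le> K"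
  shows "(\<integral>t. w j t * c t \<partial>N) = (\<integral>\<xi>. (e j \<xi> * of_real (\<tau> \<xi>)) * (of_real (\<mu> \<xi>) * (\<integral>t. ch t \<xi> * c t \<partial>N)) \<partial>lborel)"
proof -
  note [measurable] = e_measurable[OF j] c(1)
  have K0: "0 \<le> K" using c(2) norm_ge_zero order_trans by blast
  have i: "integrable (N \<Otimes>\<^sub>M lborel) (\<lambda>(t, \<xi>). e j \<xi> * of_real (\<tau> \<xi> * \<mu> \<xi>) * (ch t \<xi> * c t))"
  proof (rule NL.integrable_pair_nn)
    have "(\<integral>\<^sup>+t. \<integral>\<^sup>+\<xi>. ennreal (cmod (e j \<xi> * of_real (\<tau> \<xi> * \<mu> \<xi>) * (ch t \<xi> * c t))) \<partial>lborel \<partial>N)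
      \<le> (\<integral>\<^sup>+t. \<integral>\<^sup>+\<xi>. ennreal (cmod (e j \<xi> * of_real (\<tau> \<xi> * \<mu> \<xi>))) * ennreal K \<partial>lborel \<partial>N)"
    proof (intro nn_integral_mono)
      fix t \<xi>
      have "cmod (ch t \<xi> * c t) \<le> 1 * K" unfolding norm_mult by (intro mult_mono ch c) auto
      thus "ennreal (cmod (e j \<xi> * of_real (\<tau> \<xi> * \<mu> \<xi>) * (ch t \<xi> * c t))) \<le> ennreal (cmod (e j \<xi> * of_real (\<tau> \<xi> * \<mu> \<xi>))) * ennreal K"
        using K0 unfolding norm_mult[of _ "ch t \<xi> * c t"] by (subst ennreal_mult[symmetric]) (auto intro!: ennreal_leI mult_left_mono)
    qed
    also have "\<dots> = (\<integral>\<^sup>+t. ennreal (W j) * ennreal K \<partial>N)"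
      unfolding W_def by (subst nn_integral_multc, simp, subst nn_integral_eq_integral)
        (use integrable_e\<tau>\<mu>[OF j] in auto)
    also have "\<dots> < \<infinity>" using N.emeasure_finite[of "space N"] by (simp add: ennreal_mult_eq_top_iff less_top[symmetric])
    finally show "(\<integral>\<^sup>+t. \<integral>\<^sup>+\<xi>. ennreal (cmod (e j \<xi> * of_real (\<tau> \<xi> * \<mu> \<xi>) * (ch t \<xi> * c t))) \<partial>lborel \<partial>N) < \<infinity>" .
  qed measurable
  have "(\<integral>t. w j t * c t \<partial>N) = (\<integral>t. \<integral>\<xi>. e j \<xi> * of_real (\<tau> \<xi> * \<mu> \<xi>) * (ch t \<xi> * c t) \<partial>lborel \<partial>N)"
    unfolding w_def integral_mult_left_zero[symmetric] by (simp add: mult.assoc)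
  also have "\<dots> = (\<integral>\<xi>. \<integral>t. e j \<xi> * of_real (\<tau> \<xi> * \<mu> \<xi>) * (ch t \<xi> * c t) \<partial>N \<partial>lborel)"
    using NL.Fubini_integral[OF i] by simp
  also have "\<dots> = (\<integral>\<xi>. (e j \<xi> * of_real (\<tau> \<xi>)) * (of_real (\<mu> \<xi>) * (\<integral>t. ch t \<xi> * c t \<partial>N)) \<partial>lborel)"
    by (simp only: integral_mult_right_zero mult.assoc of_real_mult)
  finally show ?thesis .
qed

text \<open>Squared L2 norms: \<open>S j\<close> of \<open>w j\<close> on \<open>E\<close>,
  \<open>Q j\<close> of the adjoint of B applied to \<open>w j\<close> (the weight of
  \<open>P\<close> contains \<open>\<mu>\<close> twice), and \<open>n j\<close> of
  \<open>\<tau> * e j\<close>.\<close>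

definition S :: "nat \<Rightarrow> ennreal" where "S j = (\<integral>\<^sup>+t. ennreal ((cmod (w j t))\<^sup>2) \<partial>N)"
definition Q :: "nat \<Rightarrow> ennreal" where "Q j = (\<integral>\<^sup>+\<xi>. ennreal ((cmod (g j \<xi>))\<^sup>2) \<partial>P)"
definition n :: "nat \<Rightarrow> ennreal" where "n j = (\<integral>\<^sup>+\<xi>. ennreal ((\<tau> \<xi>)\<^sup>2 * (cmod (e j \<xi>))\<^sup>2) \<partial>lborel)"

lemma n_eq: "n j = (\<integral>\<^sup>+\<xi>. ennreal ((cmod (e j \<xi> * of_real (\<tau> \<xi>)))\<^sup>2) \<partial>lborel)"
  by (simp add: n_def norm_mult power_mult_distrib mult.commute)

lemma S_finite: assumes j: "j \<in> J" shows "S j < \<infinity>"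
proof -
  have "S j \<le> (\<integral>\<^sup>+t. ennreal ((W j)\<^sup>2) \<partial>N)" unfolding S_def
    by (intro nn_integral_mono ennreal_leI power_mono w_bound j) auto
  also have "\<dots> < \<infinity>" using N.emeasure_finite[of "space N"] by (simp add: ennreal_mult_eq_top_iff less_top[symmetric])
  finally show ?thesis .
qed

lemma Q_finite: assumes j: "j \<in> J" shows "Q j < \<infinity>"
proof -
  have W0: "0 \<le> W j" by (simp add: W_def)
  have gb: "cmod (g j \<xi>) \<le> W j * measure N (space N)" for \<xi>
  proof -
    have "cmod (g j \<xi>) \<le> (\<integral>t. cmod (cnj (ch t \<xi>) * w j t) \<partial>N)" unfolding g_def by (rule integral_norm_bound)
    also have "\<dots> \<le> (\<integral>t. W j \<partial>N)"
    proof (rule integral_mono')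
      fix t
      have "cmod (cnj (ch t \<xi>) * w j t) \<le> 1 * W j"
        unfolding norm_mult by (intro mult_mono) (use ch w_bound[OF j] in auto)
      thus "cmod (cnj (ch t \<xi>) * w j t) \<le> W j" by simp
    qed (use W0 in auto)
    finally show ?thesis by (simp add: mult.commute)
  qed
  have "Q j \<le> (\<integral>\<^sup>+\<xi>. ennreal ((W j * measure N (space N))\<^sup>2) \<partial>P)" unfolding Q_def
    by (intro nn_integral_mono ennreal_leI power_mono gb) auto
  also have "\<dots> < \<infinity>" using P.emeasure_finite[of "space P"] by (simp add: ennreal_mult_eq_top_iff less_top[symmetric])
  finally show ?thesis .
qed

text \<open>The number \<open>S j\<close> is the inner product of \<open>\<tau> * e j\<close> with
  the adjoint of B applied to \<open>w j\<close>, so Cauchy-Schwarz gives the claim.\<close>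

lemma S_square_le:
  assumes j: "j \<in> J"
  shows "(S j)\<^sup>2 \<le> n j * Q j"
proof -
  note [measurable] = e_measurable[OF j] w_measurable[OF j] g_measurable[OF j]
  have iw: "integrable N (\<lambda>t. (cmod (w j t))\<^sup>2)"
    by (rule N.integrable_const_bound[where B="(W j)\<^sup>2"]) (auto intro!: AE_I2 power_mono w_bound j)
  have "S j = ennreal (\<integral>t. (cmod (w j t))\<^sup>2 \<partial>N)"
    unfolding S_def by (rule nn_integral_eq_integral[OF iw]) simp
  also have "(\<integral>t. (cmod (w j t))\<^sup>2 \<partial>N) = cmod (complex_of_real (\<integral>t. (cmod (w j t))\<^sup>2 \<partial>N))"
    by (simp del: of_real_power)
  also have "complex_of_real (\<integral>t. (cmod (w j t))\<^sup>2 \<partial>N) = (\<integral>t. w j t * cnj (w j t) \<partial>N)"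
    unfolding integral_complex_of_real[symmetric]
    by (intro Bochner_Integration.integral_cong refl) (simp add: complex_norm_square del: of_real_power)
  also have "\<dots> = (\<integral>\<xi>. (e j \<xi> * of_real (\<tau> \<xi>)) * (of_real (\<mu> \<xi>) * (\<integral>t. ch t \<xi> * cnj (w j t) \<partial>N)) \<partial>lborel)"
    by (rule fubini_w[OF j, where K="W j"]) (use w_bound[OF j] in auto)
  also have "\<dots> = (\<integral>\<xi>. (e j \<xi> * of_real (\<tau> \<xi>)) * (of_real (\<mu> \<xi>) * cnj (g j \<xi>)) \<partial>lborel)"
  proof -
    have "(\<integral>t. ch t \<xi> * cnj (w j t) \<partial>N) = cnj (g j \<xi>)" for \<xi>
      unfolding g_def Bochner_Integration.integral_cnj[symmetric] by simp
    thus ?thesis by simp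
  qed
  finally have "(S j)\<^sup>2 = ennreal ((cmod (\<integral>\<xi>. (e j \<xi> * of_real (\<tau> \<xi>)) * (of_real (\<mu> \<xi>) * cnj (g j \<xi>)) \<partial>lborel))\<^sup>2)"
    by (simp add: ennreal_power)
  also have "\<dots> \<le> (\<integral>\<^sup>+\<xi>. ennreal ((cmod (e j \<xi> * of_real (\<tau> \<xi>)))\<^sup>2) \<partial>lborel) * (\<integral>\<^sup>+\<xi>. ennreal ((cmod (of_real (\<mu> \<xi>) * cnj (g j \<xi>)))\<^sup>2) \<partial>lborel)"
    by (rule cauchy_schwarz_integral) measurable
  also have "(\<integral>\<^sup>+\<xi>. ennreal ((cmod (of_real (\<mu> \<xi>) * cnj (g j \<xi>)))\<^sup>2) \<partial>lborel) = Q j"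
    unfolding Q_def P_def by (subst nn_integral_density) (auto simp: norm_mult power_mult_distrib ennreal_mult)
  finally show ?thesis by (simp add: n_eq)
qed

lemma kernel_le: "ennreal (cmod (\<integral>\<xi>. cnj (ch t \<xi>) * ch t' \<xi> \<partial>P)) \<le> kk (t - t')"
proof -
  have "(\<integral>\<xi>. cnj (ch t \<xi>) * ch t' \<xi> \<partial>P) = (\<integral>\<xi>. of_real ((\<mu> \<xi>)\<^sup>2) * (cnj (ch t \<xi>) * ch t' \<xi>) \<partial>lborel)"
    unfolding P_def by (subst integral_density) (auto simp: scaleR_conv_of_real)
  thus ?thesis using kk by simp
qed

text \<open>Expanding the square in \<open>Q j\<close> produces the kernel of B times its adjoint,
  bounded by \<open>kk\<close>; Schur's test gives \<open>Q j \<le> A * S j\<close>. Together with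
  \<open>S_square_le\<close> one factor \<open>S j\<close>, which is finite, cancels. Each
  \<open>j\<close> is treated on its own.\<close>

lemma schur_bound:
  assumes A: "\<And>t. (\<integral>\<^sup>+t'. kk (t - t') \<partial>N) \<le> A" and j: "j \<in> J"
  shows "S j \<le> A * n j"
proof -
  note [measurable] = e_measurable[OF j] w_measurable[OF j] g_measurable[OF j]
  let ?w = "\<lambda>t. ennreal (cmod (w j t))"
  have "Q j \<le> (\<integral>\<^sup>+t. \<integral>\<^sup>+t'. ennreal (cmod (\<integral>\<xi>. (cnj (ch t \<xi>) * w j t) * cnj (cnj (ch t' \<xi>) * w j t') \<partial>P)) \<partial>N \<partial>N)"
    unfolding Q_def g_def
  proof (rule square_integral_le[OF finite_N finite_P, where C="W j"])
    fix t \<xi>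
    have "cmod (cnj (ch t \<xi>) * w j t) \<le> 1 * W j"
      unfolding norm_mult by (intro mult_mono) (use ch w_bound[OF j] in auto)
    thus "cmod (cnj (ch t \<xi>) * w j t) \<le> W j" by simp
  qed measurable
  also have "\<dots> \<le> (\<integral>\<^sup>+t. \<integral>\<^sup>+t'. ?w t * ?w t' * kk (t - t') \<partial>N \<partial>N)"
  proof (intro nn_integral_mono)
    fix t t'
    have "(\<integral>\<xi>. (cnj (ch t \<xi>) * w j t) * cnj (cnj (ch t' \<xi>) * w j t') \<partial>P) = (w j t * cnj (w j t')) * (\<integral>\<xi>. cnj (ch t \<xi>) * ch t' \<xi> \<partial>P)"
      by (simp add: mult_ac flip: integral_mult_right_zero)
    hence "ennreal (cmod (\<integral>\<xi>. (cnj (ch t \<xi>) * w j t) * cnj (cnj (ch t' \<xi>) * w j t') \<partial>P)) = ?w t * ?w t' * ennreal (cmod (\<integral>\<xi>. cnj (ch t \<xi>) * ch t' \<xi> \<partial>P))"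
      by (simp add: norm_mult ennreal_mult)
    also have "\<dots> \<le> ?w t * ?w t' * kk (t - t')" by (intro mult_left_mono kernel_le) auto
    finally show "ennreal (cmod (\<integral>\<xi>. (cnj (ch t \<xi>) * w j t) * cnj (cnj (ch t' \<xi>) * w j t') \<partial>P)) \<le> ?w t * ?w t' * kk (t - t')" .
  qed
  also have "\<dots> \<le> (\<integral>\<^sup>+t. \<integral>\<^sup>+t'. (ennreal ((cmod (w j t))\<^sup>2 / 2) + ennreal ((cmod (w j t'))\<^sup>2 / 2)) * kk (t - t') \<partial>N \<partial>N)"
  proof (intro nn_integral_mono mult_right_mono)
    fix t t'
    have "cmod (w j t) * cmod (w j t') \<le> (cmod (w j t))\<^sup>2 / 2 + (cmod (w j t'))\<^sup>2 / 2"
      using sum_squares_bound[of "cmod (w j t)" "cmod (w j t')"] by simp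
    thus "?w t * ?w t' \<le> ennreal ((cmod (w j t))\<^sup>2 / 2) + ennreal ((cmod (w j t'))\<^sup>2 / 2)"
      by (simp add: ennreal_mult[symmetric] ennreal_plus[symmetric] del: ennreal_plus)
  qed simp
  also have "\<dots> = (\<integral>\<^sup>+t. \<integral>\<^sup>+t'. ennreal ((cmod (w j t))\<^sup>2 / 2) * kk (t - t') \<partial>N \<partial>N)
      + (\<integral>\<^sup>+t. \<integral>\<^sup>+t'. ennreal ((cmod (w j t'))\<^sup>2 / 2) * kk (t - t') \<partial>N \<partial>N)"
    by (simp add: distrib_right nn_integral_add)
  also have "(\<integral>\<^sup>+t. \<integral>\<^sup>+t'. ennreal ((cmod (w j t'))\<^sup>2 / 2) * kk (t - t') \<partial>N \<partial>N)
      = (\<integral>\<^sup>+t'. \<integral>\<^sup>+t. ennreal ((cmod (w j t'))\<^sup>2 / 2) * kk (t - t') \<partial>N \<partial>N)"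
    by (rule NN.Fubini') measurable
  also have "\<dots> = (\<integral>\<^sup>+t. \<integral>\<^sup>+t'. ennreal ((cmod (w j t))\<^sup>2 / 2) * kk (t - t') \<partial>N \<partial>N)"
    using kk_sym[of "t - t'" for t t'] by simp
  also have "(\<integral>\<^sup>+t. \<integral>\<^sup>+t'. ennreal ((cmod (w j t))\<^sup>2 / 2) * kk (t - t') \<partial>N \<partial>N) + (\<integral>\<^sup>+t. \<integral>\<^sup>+t'. ennreal ((cmod (w j t))\<^sup>2 / 2) * kk (t - t') \<partial>N \<partial>N)
     = (\<integral>\<^sup>+t. ennreal ((cmod (w j t))\<^sup>2) * (\<integral>\<^sup>+t'. kk (t - t') \<partial>N) \<partial>N)"
    by (subst nn_integral_add[symmetric])
       (auto intro!: nn_integral_cong simp: nn_integral_cmult distrib_right[symmetric] ennreal_plus[symmetric] simp del: ennreal_plus)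
  also have "\<dots> \<le> (\<integral>\<^sup>+t. ennreal ((cmod (w j t))\<^sup>2) * A \<partial>N)"
    by (intro nn_integral_mono mult_left_mono A) auto
  also have "\<dots> = S j * A" by (simp add: S_def nn_integral_multc)
  finally have "n j * Q j \<le> n j * (S j * A)" by (intro mult_left_mono) auto
  with S_square_le[OF j] have *: "S j * S j \<le> S j * (A * n j)"
    by (simp add: power2_eq_square mult_ac)
  show ?thesis
  proof (cases "S j = 0")
    case False
    thus ?thesis using * S_finite[OF j] ennreal_mult_le_mult_iff[of "S j"] by simp
  qed simp
qed

text \<open>For a fixed frequency, \<open>g j\<close> is the pairing of \<open>e j\<close> with a
  function built from \<open>L\<close>. Bessel's inequality therefore turns the sum over
  \<open>j\<close> into a Hilbert-Schmidt norm, and this is where orthogonality is gained. The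
  double frequency integral of the square of \<open>L\<close> is expanded in time over pairs of
  frequencies, where the inner integral factors into the squared modulus of the time kernel.\<close>

lemma Q_sum_bound: "(\<Sum>j\<in>J. Q j) \<le> ennreal (T\<^sup>2) * (\<integral>\<^sup>+t. \<integral>\<^sup>+t'. (kk (t - t'))\<^sup>2 \<partial>N \<partial>N)"
proof -
  define L where "L \<xi> \<eta> = (\<integral>t. cnj (ch t \<xi>) * ch t \<eta> \<partial>N)" for \<xi> \<eta>
  have [measurable]: "case_prod L \<in> borel_measurable (borel \<Otimes>\<^sub>M borel)" unfolding L_def by measurable
  have [measurable]: "L \<xi> \<in> borel_measurable borel" for \<xi> unfolding L_def by measurable
  have finPP: "finite_measure (P \<Otimes>\<^sub>M P)" by (rule finite_measure_pair_measure) (rule finite_P)+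
  have "(\<Sum>j\<in>J. Q j) = (\<integral>\<^sup>+\<xi>. (\<Sum>j\<in>J. ennreal ((cmod (g j \<xi>))\<^sup>2)) \<partial>P)"
    unfolding Q_def by (rule nn_integral_sum[symmetric]) (use g_measurable in measurable)
  also have "\<dots> \<le> (\<integral>\<^sup>+\<xi>. ennreal (T\<^sup>2) * (\<integral>\<^sup>+\<eta>. ennreal ((cmod (L \<xi> \<eta>))\<^sup>2) \<partial>P) \<partial>P)"
  proof (rule nn_integral_mono)
    fix \<xi> :: 'a
    let ?\<psi> = "\<lambda>\<eta>. of_real (\<tau> \<eta>) * (of_real (\<mu> \<eta>) * L \<xi> \<eta>)"
    have "g j \<xi> = (\<integral>\<eta>. e j \<eta> * ?\<psi> \<eta> \<partial>lborel)" if j: "j \<in> J" for j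
    proof -
      have "g j \<xi> = (\<integral>t. w j t * cnj (ch t \<xi>) \<partial>N)" by (simp add: g_def mult.commute)
      also have "\<dots> = (\<integral>\<eta>. (e j \<eta> * of_real (\<tau> \<eta>)) * (of_real (\<mu> \<eta>) * (\<integral>t. ch t \<eta> * cnj (ch t \<xi>) \<partial>N)) \<partial>lborel)"
        by (rule fubini_w[OF j, where K=1]) (use ch in auto)
      finally show ?thesis by (simp add: L_def mult_ac)
    qed
    hence "(\<Sum>j\<in>J. ennreal ((cmod (g j \<xi>))\<^sup>2)) = ennreal (\<Sum>j\<in>J. (cmod (\<integral>\<eta>. e j \<eta> * ?\<psi> \<eta> \<partial>lborel))\<^sup>2)"
      by simp
    also have "\<dots> \<le> (\<integral>\<^sup>+\<eta>. ennreal ((cmod (?\<psi> \<eta>))\<^sup>2) \<partial>lborel)"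
      by (rule bessel_inequality[OF e]) measurable
    also have "\<dots> \<le> (\<integral>\<^sup>+\<eta>. ennreal (T\<^sup>2) * (ennreal ((\<mu> \<eta>)\<^sup>2) * ennreal ((cmod (L \<xi> \<eta>))\<^sup>2)) \<partial>lborel)"
    proof (rule nn_integral_mono)
      fix \<eta> :: 'a
      have "(\<tau> \<eta>)\<^sup>2 \<le> T\<^sup>2" using \<tau> by (intro power_mono) auto
      thus "ennreal ((cmod (?\<psi> \<eta>))\<^sup>2) \<le> ennreal (T\<^sup>2) * (ennreal ((\<mu> \<eta>)\<^sup>2) * ennreal ((cmod (L \<xi> \<eta>))\<^sup>2))"
        by (simp add: norm_mult power_mult_distrib ennreal_mult[symmetric] mult_right_mono)
    qed
    also have "\<dots> = ennreal (T\<^sup>2) * (\<integral>\<^sup>+\<eta>. ennreal ((cmod (L \<xi> \<eta>))\<^sup>2) \<partial>P)"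
      unfolding P_def by (subst nn_integral_density) (simp_all add: nn_integral_cmult)
    finally show "(\<Sum>j\<in>J. ennreal ((cmod (g j \<xi>))\<^sup>2)) \<le> ennreal (T\<^sup>2) * (\<integral>\<^sup>+\<eta>. ennreal ((cmod (L \<xi> \<eta>))\<^sup>2) \<partial>P)" .
  qed
  also have "\<dots> = ennreal (T\<^sup>2) * (\<integral>\<^sup>+\<xi>. \<integral>\<^sup>+\<eta>. ennreal ((cmod (L \<xi> \<eta>))\<^sup>2) \<partial>P \<partial>P)"
    by (rule nn_integral_cmult) measurable
  also have "(\<integral>\<^sup>+\<xi>. \<integral>\<^sup>+\<eta>. ennreal ((cmod (L \<xi> \<eta>))\<^sup>2) \<partial>P \<partial>P) = (\<integral>\<^sup>+z. ennreal ((cmod (L (fst z) (snd z)))\<^sup>2) \<partial>(P \<Otimes>\<^sub>M P))"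
    using P.nn_integral_fst[of "\<lambda>z. ennreal ((cmod (L (fst z) (snd z)))\<^sup>2)" P] by simp
  also have "\<dots> \<le> (\<integral>\<^sup>+t. \<integral>\<^sup>+t'. ennreal (cmod (\<integral>z. (cnj (ch t (fst z)) * ch t (snd z)) * cnj (cnj (ch t' (fst z)) * ch t' (snd z)) \<partial>(P \<Otimes>\<^sub>M P))) \<partial>N \<partial>N)"
    unfolding L_def
  proof (rule square_integral_le[OF finite_N finPP, where C=1])
    fix t z
    have "cmod (cnj (ch t (fst z)) * ch t (snd z)) \<le> 1 * 1"
      unfolding norm_mult by (intro mult_mono) (use ch in auto)
    thus "cmod (cnj (ch t (fst z)) * ch t (snd z)) \<le> 1" by simp
  qed measurable
  also have "\<dots> \<le> (\<integral>\<^sup>+t. \<integral>\<^sup>+t'. (kk (t - t'))\<^sup>2 \<partial>N \<partial>N)"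
  proof (intro nn_integral_mono)
    fix t t'
    let ?F = "\<lambda>\<xi>. cnj (ch t \<xi>) * ch t' \<xi>"
    have Fb: "cmod (?F \<xi>) \<le> 1" for \<xi>
      using mult_mono[OF ch[of t \<xi>] ch[of t' \<xi>]] by (simp add: norm_mult)
    interpret PPf: finite_measure "P \<Otimes>\<^sub>M P" by (rule finPP)
    have iPP: "integrable (P \<Otimes>\<^sub>M P) (\<lambda>(\<xi>, \<eta>). ?F \<xi> * cnj (?F \<eta>))"
    proof (rule PPf.integrable_const_bound[where B=1])
      have "cmod (?F \<xi> * cnj (?F \<eta>)) \<le> 1 * 1" for \<xi> \<eta>
        unfolding norm_mult[of "?F \<xi>"] by (intro mult_mono) (use Fb in \<open>auto simp del: complex_cnj_mult\<close>)
      thus "AE z in P \<Otimes>\<^sub>M P. cmod (case z of (\<xi>, \<eta>) \<Rightarrow> ?F \<xi> * cnj (?F \<eta>)) \<le> 1" by auto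
    qed measurable
    have "(\<integral>z. (cnj (ch t (fst z)) * ch t (snd z)) * cnj (cnj (ch t' (fst z)) * ch t' (snd z)) \<partial>(P \<Otimes>\<^sub>M P))
        = (\<integral>z. (case z of (\<xi>, \<eta>) \<Rightarrow> ?F \<xi> * cnj (?F \<eta>)) \<partial>(P \<Otimes>\<^sub>M P))"
      by (intro Bochner_Integration.integral_cong refl) (auto simp: mult_ac)
    also have "\<dots> = (\<integral>\<xi>. \<integral>\<eta>. ?F \<xi> * cnj (?F \<eta>) \<partial>P \<partial>P)"
      using PP.integral_fst[OF iPP] by simp
    also have "\<dots> = (\<integral>\<xi>. ?F \<xi> \<partial>P) * cnj (\<integral>\<eta>. ?F \<eta> \<partial>P)"
      by (simp only: integral_mult_right_zero integral_mult_left_zero Bochner_Integration.integral_cnj)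
    finally have "ennreal (cmod (\<integral>z. (cnj (ch t (fst z)) * ch t (snd z)) * cnj (cnj (ch t' (fst z)) * ch t' (snd z)) \<partial>(P \<Otimes>\<^sub>M P)))
        = ennreal (cmod (\<integral>\<xi>. ?F \<xi> \<partial>P)) * ennreal (cmod (\<integral>\<xi>. ?F \<xi> \<partial>P))"
      by (simp only: norm_mult complex_mod_cnj ennreal_mult norm_ge_zero)
    also have "\<dots> \<le> kk (t - t') * kk (t - t')" by (intro mult_mono kernel_le) auto
    finally show "ennreal (cmod (\<integral>z. (cnj (ch t (fst z)) * ch t (snd z)) * cnj (cnj (ch t' (fst z)) * ch t' (snd z)) \<partial>(P \<Otimes>\<^sub>M P))) \<le> (kk (t - t'))\<^sup>2"
      by (simp add: power2_eq_square)
  qed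
  finally show ?thesis by (simp add: mult_left_mono)
qed

text \<open>Cauchy-Schwarz in \<open>j\<close> applied to the square roots in
  \<open>S_square_le\<close>; all quantities are finite, so the sums are computed over real
  numbers.\<close>

lemma hilbert_schmidt_bound:
  "(\<Sum>j\<in>J. S j)\<^sup>2 \<le> (\<Sum>j\<in>J. n j) * (ennreal (T\<^sup>2) * (\<integral>\<^sup>+t. \<integral>\<^sup>+t'. (kk (t - t'))\<^sup>2 \<partial>N \<partial>N))"
proof -
  have nf: "n j < \<infinity>" if "j \<in> J" for j using \<tau>e_L2[OF that] by (simp add: n_eq)
  define s' n' q' where "s' j = enn2real (S j)" and "n' j = enn2real (n j)" and "q' j = enn2real (Q j)" for j
  have eqs: "S j = ennreal (s' j)" "n j = ennreal (n' j)" "Q j = ennreal (q' j)" if "j \<in> J" for j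
    using S_finite[OF that] nf[OF that] Q_finite[OF that] by (auto simp: s'_def n'_def q'_def)
  have pos: "0 \<le> s' j" "0 \<le> n' j" "0 \<le> q' j" for j by (simp_all add: s'_def n'_def q'_def)
  have "s' j \<le> sqrt (n' j) * sqrt (q' j)" if "j \<in> J" for j
  proof -
    have "ennreal ((s' j)\<^sup>2) \<le> ennreal (n' j * q' j)"
      using S_square_le[OF that] by (simp add: eqs[OF that] ennreal_power pos ennreal_mult)
    hence "(s' j)\<^sup>2 \<le> n' j * q' j" using pos by (simp add: ennreal_le_iff)
    thus ?thesis using pos by (simp add: real_le_rsqrt real_sqrt_mult[symmetric])
  qed
  hence "(\<Sum>j\<in>J. s' j) \<le> (\<Sum>j\<in>J. sqrt (n' j) * sqrt (q' j))" by (rule sum_mono)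
  hence "(\<Sum>j\<in>J. s' j)\<^sup>2 \<le> (\<Sum>j\<in>J. sqrt (n' j) * sqrt (q' j))\<^sup>2"
    by (intro power_mono sum_nonneg pos)
  also have "\<dots> \<le> (\<Sum>j\<in>J. (sqrt (n' j))\<^sup>2) * (\<Sum>j\<in>J. (sqrt (q' j))\<^sup>2)"
    by (rule Cauchy_Schwarz_ineq_sum)
  also have "\<dots> = (\<Sum>j\<in>J. n' j) * (\<Sum>j\<in>J. q' j)" by (simp add: pos)
  finally have "ennreal ((\<Sum>j\<in>J. s' j)\<^sup>2) \<le> ennreal ((\<Sum>j\<in>J. n' j) * (\<Sum>j\<in>J. q' j))" by (rule ennreal_leI)
  hence "(\<Sum>j\<in>J. S j)\<^sup>2 \<le> (\<Sum>j\<in>J. n j) * (\<Sum>j\<in>J. Q j)"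
    by (simp add: eqs pos sum_nonneg ennreal_mult flip: ennreal_power)
  also have "\<dots> \<le> (\<Sum>j\<in>J. n j) * (ennreal (T\<^sup>2) * (\<integral>\<^sup>+t. \<integral>\<^sup>+t'. (kk (t - t'))\<^sup>2 \<partial>N \<partial>N))"
    by (intro mult_left_mono Q_sum_bound) simp
  finally show ?thesis .
qed

end

section \<open>High frequencies\<close>

text \<open>A superposition of Gaussians at the scales \<open>2\<^sup>k R\<close> that is comparable to \<open>|\<xi>|\<^sup>-\<^sup>2\<^sup>s\<^sup>1\<close> from below for \<open>R < |\<xi>|\<close> up to \<open>2\<^sup>K R\<close>.
  Its kernel is bounded by summing the explicit bounds for Gaussians, so stationary phase is not needed.\<close>

definition gauss_mult :: "real \<Rightarrow> real \<Rightarrow> nat \<Rightarrow> 'a::euclidean_space \<Rightarrow> real" where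
  "gauss_mult s1 R K \<xi> = (\<Sum>k\<le>K. (inverse (R\<^sup>2) / 4 ^ k) powr s1 * exp (- (inverse (R\<^sup>2) / 4 ^ k) * (norm \<xi>)\<^sup>2))"

lemma gauss_mult_measurable [measurable]: "gauss_mult s1 R K \<in> borel_measurable borel"
  unfolding gauss_mult_def by measurable

lemma gauss_mult_pos:
  assumes "0 < R" shows "0 < gauss_mult s1 R K \<xi>"
  unfolding gauss_mult_def by (rule sum_pos) (use assms in auto)

lemma gauss_mult_integrable:
  assumes "0 < R" shows "integrable lborel (gauss_mult s1 R K :: 'a::euclidean_space \<Rightarrow> real)"
  unfolding gauss_mult_def
  by (intro Bochner_Integration.integrable_sum integrable_mult_right gauss_integrable_and_ft(1)) (use assms in auto)

text \<open>One term of the sum suffices: for 2^k R < |\<xi>| \<le> 2^(k+1) R the parameter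
  \<open>a\<close> = (2^k R)^(-2) satisfies \<open>a * (norm \<xi>)\<^sup>2 \<le> 4\<close>, which
  is the origin of \<open>exp (-4)\<close>.\<close>

lemma gauss_mult_lower:
  fixes \<xi> :: "'a::euclidean_space"
  assumes R: "0 < R" and s1: "0 \<le> s1" and \<xi>: "R < norm \<xi>" "norm \<xi> \<le> R * 2 ^ K"
  shows "exp (-4) * norm \<xi> powr (- (2 * s1)) \<le> gauss_mult s1 R K \<xi>"
proof -
  let ?r = "norm \<xi>"
  have r0: "0 < ?r" using \<xi>(1) R by linarith
  have "1 < ?r / R" using \<xi>(1) R by simp
  then obtain k where k: "2 ^ k < ?r / R" "?r / R \<le> 2 ^ Suc k" using dyadic_scale by blast
  have kK: "k \<le> K"
  proof (rule ccontr)
    assume "\<not> k \<le> K"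
    hence "(2::real) ^ K \<le> 2 ^ k" by (intro power_increasing) auto
    moreover have "?r / R \<le> 2 ^ K" using \<xi>(2) R by (simp add: field_simps)
    ultimately show False using k(1) by linarith
  qed
  define a where "a = inverse (R\<^sup>2) / 4 ^ k"
  have a0: "0 < a" using R by (simp add: a_def)
  have a_eq: "a = 1 / (R * 2 ^ k)\<^sup>2"
  proof -
    have "(4::real) ^ k = (2 ^ k)\<^sup>2" unfolding power2_eq_square power_mult_distrib[symmetric] by simp
    thus ?thesis by (simp add: a_def power_mult_distrib field_simps)
  qed
  have p: "0 < R * 2 ^ k" using R by simp
  have 1: "R * 2 ^ k \<le> ?r" "?r \<le> 2 * (R * 2 ^ k)" using k R by (auto simp: field_simps)
  have lo: "inverse (?r\<^sup>2) \<le> a"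
    unfolding a_eq inverse_eq_divide[symmetric] 
  proof (rule le_imp_inverse_le)
    show "(R * 2 ^ k)\<^sup>2 \<le> ?r\<^sup>2" using p 1 by (intro power_mono) auto
    show "0 < (R * 2 ^ k)\<^sup>2" using p by (rule zero_less_power)
  qed
  have hi: "a * ?r\<^sup>2 \<le> 4"
  proof -
    have "?r\<^sup>2 \<le> (2 * (R * 2 ^ k))\<^sup>2" using 1 r0 by (intro power_mono) auto
    also have "\<dots> = 4 * (R * 2 ^ k)\<^sup>2" by (simp only: power_mult_distrib[of 2]) simp
    finally have "?r\<^sup>2 / (R * 2 ^ k)\<^sup>2 \<le> 4"
      by (intro pos_divide_le_eq[THEN iffD2] zero_less_power p)
    thus ?thesis unfolding a_eq by simp
  qed
  have "?r powr (- (2 * s1)) = inverse (?r\<^sup>2) powr s1"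
    using r0 by (simp add: powr_minus powr_powr[symmetric] powr_numeral inverse_powr)
  also have "\<dots> \<le> a powr s1" using lo r0 s1 by (intro powr_mono2) auto
  finally have "exp (-4) * ?r powr (- (2 * s1)) \<le> exp (- a * ?r\<^sup>2) * a powr s1"
    using hi by (intro mult_mono) auto
  also have "\<dots> \<le> gauss_mult s1 R K \<xi>"
    unfolding gauss_mult_def
    using member_le_sum[of k "{..K}" "\<lambda>k. (inverse (R\<^sup>2) / 4 ^ k) powr s1 * exp (- (inverse (R\<^sup>2) / 4 ^ k) * ?r\<^sup>2)"] kK
    by (simp add: a_def mult.commute)
  finally show ?thesis .
qed

lemma square_powr:
  assumes "0 < (x::real)" shows "(x\<^sup>2) powr y = x powr (2 * y)"
proof -
  have "x\<^sup>2 = x powr 2" using assms by simp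
  thus ?thesis by (simp only: powr_powr)
qed

text \<open>The power -d/4 of \<open>b\<^sup>2 + u\<^sup>2\<close> is split into the exponents (a -
  d/2)/2 and -a/2. Both are nonpositive, so \<open>u\<close> may be dropped in the first factor and
  \<open>b\<close> in the second: decay in time is traded against a power of the scale.\<close>

lemma gauss_kernel_decay:
  fixes y :: "'a::euclidean_space"
  assumes b: "0 < b" and u: "u \<noteq> 0" and a: "0 \<le> a" "a \<le> real DIM('a) / 2"
  shows "cmod (\<integral>\<xi>. cis (y \<bullet> \<xi> - u * (norm \<xi>)\<^sup>2) * of_real (exp (- b * (norm \<xi>)\<^sup>2)) \<partial>lborel)
     \<le> pi powr (real DIM('a) / 2) * b powr (a - real DIM('a) / 2) * \<bar>u\<bar> powr (- a)"
proof -
  define d where "d = real DIM('a)"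
  let ?q = "b\<^sup>2 + u\<^sup>2"
  have q: "0 < ?q" using b by (simp add: add_pos_nonneg)
  have e1: "(pi\<^sup>2 / ?q) powr (d / 4) = pi powr (d / 2) * ?q powr (- (d / 4))"
  proof -
    have "(pi\<^sup>2 / ?q) powr (d / 4) = (pi\<^sup>2) powr (d / 4) / ?q powr (d / 4)"
      by (rule powr_divide)
    thus ?thesis using square_powr[of pi "d / 4"] by (simp add: powr_minus_divide)
  qed
  have e2: "?q powr (- (d / 4)) = ?q powr ((a - d / 2) / 2) * ?q powr (- a / 2)"
    unfolding powr_add[symmetric] by (rule arg_cong[where f="\<lambda>z. ?q powr z"]) (simp add: field_simps)
  have e3: "?q powr ((a - d / 2) / 2) \<le> b powr (a - d / 2)"
  proof -
    have "?q powr ((a - d / 2) / 2) \<le> (b\<^sup>2) powr ((a - d / 2) / 2)"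
      using b a(2) unfolding d_def by (intro powr_mono2') simp_all
    moreover have "2 * ((a - d / 2) / 2) = a - d / 2" by simp
    ultimately show ?thesis by (simp only: square_powr[OF b])
  qed
  have e4: "?q powr (- a / 2) \<le> \<bar>u\<bar> powr (- a)"
  proof -
    have "?q powr (- a / 2) \<le> (\<bar>u\<bar>\<^sup>2) powr (- a / 2)"
      using u a(1) by (intro powr_mono2') simp_all
    moreover have "(\<bar>u\<bar>\<^sup>2) powr (- a / 2) = \<bar>u\<bar> powr (2 * (- a / 2))"
      using u by (intro square_powr) simp
    ultimately show ?thesis by simp
  qed
  have e5: "(pi\<^sup>2 / ?q) powr (d / 4) \<le> pi powr (d / 2) * (b powr (a - d / 2) * \<bar>u\<bar> powr (- a))"
    unfolding e1 e2 by (intro mult_left_mono mult_mono e3 e4) simp_all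
  show ?thesis
    using order_trans[OF gauss_kernel_bound[OF b, of y u] e5[unfolded d_def]] by (simp only: mult.assoc)
qed

text \<open>At the scale \<open>b\<close> the weight and the kernel together contribute
  \<open>b powr \<gamma>\<close>. Since \<open>\<gamma>\<close> is positive the scales sum to a
  geometric series with ratio \<open>4 powr (- \<gamma>)\<close>, uniformly in
  \<open>K\<close>.\<close>

lemma gauss_mult_kernel:
  fixes y :: "'a::euclidean_space"
  assumes R: "0 < R" and u: "u \<noteq> 0" and a: "0 \<le> a" "a \<le> real DIM('a) / 2"
    and \<gamma>: "0 < \<gamma>" "\<gamma> = s1 - real DIM('a) / 2 + a"
  shows "cmod (\<integral>\<xi>. of_real (gauss_mult s1 R K \<xi>) * cis (y \<bullet> \<xi> - u * (norm \<xi>)\<^sup>2) \<partial>lborel)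
     \<le> pi powr (real DIM('a) / 2) / (1 - 4 powr (- \<gamma>)) * R powr (- (2 * \<gamma>)) * \<bar>u\<bar> powr (- a)"
proof -
  define b where "b k = inverse (R\<^sup>2) / 4 ^ k" for k :: nat
  have b0: "0 < b k" for k using R by (simp add: b_def)
  let ?I = "\<lambda>k. \<integral>\<xi>. cis (y \<bullet> \<xi> - u * (norm \<xi>)\<^sup>2) * of_real (exp (- b k * (norm \<xi>)\<^sup>2)) \<partial>lborel"
  have int: "integrable lborel (\<lambda>\<xi>::'a. cis (y \<bullet> \<xi> - u * (norm \<xi>)\<^sup>2) * of_real (exp (- b k * (norm \<xi>)\<^sup>2)))" for k
    by (rule Bochner_Integration.integrable_bound[OF gauss_integrable_and_ft(1)[OF b0[of k]]]) (auto simp: norm_mult)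
  have "(\<integral>\<xi>. of_real (gauss_mult s1 R K \<xi>) * cis (y \<bullet> \<xi> - u * (norm \<xi>)\<^sup>2) \<partial>lborel)
     = (\<integral>\<xi>. (\<Sum>k\<le>K. of_real (b k powr s1) * (cis (y \<bullet> \<xi> - u * (norm \<xi>)\<^sup>2) * of_real (exp (- b k * (norm \<xi>)\<^sup>2)))) \<partial>lborel)"
    by (intro Bochner_Integration.integral_cong refl)
       (simp add: gauss_mult_def b_def sum_distrib_left sum_distrib_right mult_ac)
  also have "\<dots> = (\<Sum>k\<le>K. of_real (b k powr s1) * ?I k)"
    by (subst Bochner_Integration.integral_sum) (intro integrable_mult_right int, simp)
  finally have "cmod (\<integral>\<xi>. of_real (gauss_mult s1 R K \<xi>) * cis (y \<bullet> \<xi> - u * (norm \<xi>)\<^sup>2) \<partial>lborel)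
     \<le> (\<Sum>k\<le>K. cmod (of_real (b k powr s1) * ?I k))" by (simp only: norm_sum)
  also have "\<dots> \<le> (\<Sum>k\<le>K. b k powr s1 * (pi powr (real DIM('a) / 2) * b k powr (a - real DIM('a) / 2) * \<bar>u\<bar> powr (- a)))"
  proof (rule sum_mono)
    fix k
    from mult_left_mono[OF gauss_kernel_decay[OF b0[of k] u a, of y], of "b k powr s1"]
    show "cmod (of_real (b k powr s1) * ?I k) \<le> b k powr s1 * (pi powr (real DIM('a) / 2) * b k powr (a - real DIM('a) / 2) * \<bar>u\<bar> powr (- a))"
      by (simp only: norm_mult norm_of_real abs_of_nonneg powr_ge_zero)
  qed
  also have "\<dots> = (\<Sum>k\<le>K. (4 powr (- \<gamma>)) ^ k) * (pi powr (real DIM('a) / 2) * R powr (- (2 * \<gamma>)) * \<bar>u\<bar> powr (- a))"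
  proof -
    have "b k powr s1 * b k powr (a - real DIM('a) / 2) = (4 powr (- \<gamma>)) ^ k * R powr (- (2 * \<gamma>))" for k
    proof -
      have "b k powr s1 * b k powr (a - real DIM('a) / 2) = b k powr \<gamma>"
        by (simp add: powr_add[symmetric] \<gamma>(2) algebra_simps)
      also have "\<dots> = inverse (R\<^sup>2) powr \<gamma> / (4 ^ k) powr \<gamma>" using R by (simp add: b_def powr_divide)
      also have "inverse (R\<^sup>2) powr \<gamma> = R powr (- (2 * \<gamma>))"
        using R by (simp add: powr_minus powr_powr[symmetric] powr_numeral inverse_powr)
      also have "(4 ^ k) powr \<gamma> = (4 powr \<gamma>) ^ k"
        by (simp add: powr_realpow[symmetric] powr_powr mult.commute)
      finally show ?thesis by (simp add: powr_minus power_inverse field_simps)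
    qed
    note eq = this
    have "b k powr s1 * (pi powr (real DIM('a) / 2) * b k powr (a - real DIM('a) / 2) * \<bar>u\<bar> powr (- a))
       = (4 powr (- \<gamma>)) ^ k * (pi powr (real DIM('a) / 2) * R powr (- (2 * \<gamma>)) * \<bar>u\<bar> powr (- a))" for k
    proof -
      have "b k powr s1 * (pi powr (real DIM('a) / 2) * b k powr (a - real DIM('a) / 2) * \<bar>u\<bar> powr (- a))
        = (b k powr s1 * b k powr (a - real DIM('a) / 2)) * (pi powr (real DIM('a) / 2) * \<bar>u\<bar> powr (- a))" by (simp only: mult_ac)
      thus ?thesis unfolding eq by (simp only: mult_ac)
    qed
    thus ?thesis unfolding sum_distrib_right by (intro sum.cong refl)
  qed
  also have "\<dots> \<le> (1 / (1 - 4 powr (- \<gamma>))) * (pi powr (real DIM('a) / 2) * R powr (- (2 * \<gamma>)) * \<bar>u\<bar> powr (- a))"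
  proof (rule mult_right_mono)
    have q: "0 \<le> (4::real) powr (- \<gamma>)" "(4::real) powr (- \<gamma>) < 1"
      using powr_less_mono[of "- \<gamma>" 0 4] \<gamma>(1) by auto
    have "(\<Sum>k\<le>K. (4 powr (- \<gamma>)) ^ k) \<le> (\<Sum>k. ((4::real) powr (- \<gamma>)) ^ k)"
      using q by (intro sum_le_suminf summable_geometric) auto
    also have "\<dots> = 1 / (1 - 4 powr (- \<gamma>))" using q by (intro suminf_geometric) simp
    finally show "(\<Sum>k\<le>K. (4 powr (- \<gamma>)) ^ k) \<le> 1 / (1 - 4 powr (- \<gamma>))" .
  qed simp
  finally show ?thesis by simp
qed

section \<open>High-frequency energy along a curve\<close>

definition hf_tail :: "nat set \<Rightarrow> (nat \<Rightarrow> 'a::euclidean_space \<Rightarrow> complex) \<Rightarrow> real \<Rightarrow> real \<Rightarrow> ennreal" where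
  "hf_tail J e \<delta> R = (\<Sum>j\<in>J. \<integral>\<^sup>+\<xi>. ennreal (norm \<xi> powr (- (2 * \<delta>)) * (cmod (e j \<xi>))\<^sup>2) * indicator {\<xi>. R < norm \<xi>} \<xi> \<partial>lborel)"

text \<open>The frequencies between \<open>R\<close> and \<open>M\<close> of the evolution belonging
  to \<open>e j\<close>, evaluated along the curve \<open>X\<close> that linearises the supremum.
  The upper cutoff makes the integral absolutely convergent.\<close>

definition hf_part :: "(nat \<Rightarrow> 'a::euclidean_space \<Rightarrow> complex) \<Rightarrow> real \<Rightarrow> real \<Rightarrow> real \<Rightarrow> (real \<Rightarrow> 'a) \<Rightarrow> nat \<Rightarrow> real \<Rightarrow> complex" where
  "hf_part e s R M X j t = (\<integral>\<xi>. e j \<xi> * of_real (norm \<xi> powr (- s) * indicator {\<xi>. R < norm \<xi> \<and> norm \<xi> \<le> M} \<xi>) * cis (X t \<bullet> \<xi> - t * (norm \<xi>)\<^sup>2) \<partial>lborel)"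

text \<open>The first bound comes from the operator norm (Schur's test), the second one from the Hilbert-Schmidt norm.\<close>

lemma hf_bounds:
  fixes s a \<delta> :: real
  assumes a: "0 < a" "a < 1" "a \<le> real DIM('a::euclidean_space) / 2"
    and \<delta>: "0 < \<delta>" "\<delta> < s" and \<gamma>: "0 < \<gamma>" "\<gamma> = s - \<delta> - real DIM('a) / 2 + a"
  shows "\<exists>C>0. \<forall>J (e :: nat \<Rightarrow> 'a \<Rightarrow> complex) R M X E. bessel_system J e \<and> 0 < R \<and> 0 < M \<and> X \<in> borel_measurable borel \<and>
     E \<in> sets borel \<and> emeasure lborel E < \<infinity> \<longrightarrow>
     (\<Sum>j\<in>J. \<integral>\<^sup>+t. ennreal ((cmod (hf_part e s R M X j t))\<^sup>2) * indicator E t \<partial>lborel)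
       \<le> ennreal (C * R powr (- (2 * \<gamma>)) * measure lborel E powr (1 - a)) * hf_tail J e \<delta> R \<and>
     (2 * a < 1 \<longrightarrow> (\<Sum>j\<in>J. \<integral>\<^sup>+t. ennreal ((cmod (hf_part e s R M X j t))\<^sup>2) * indicator E t \<partial>lborel)\<^sup>2
       \<le> ennreal (C * R powr (- (4 * \<gamma>) - 2 * \<delta>) * measure lborel E powr (2 - 2 * a)) * hf_tail J e \<delta> R)"
proof -
  define Ck where "Ck = pi powr (real DIM('a) / 2) / (1 - 4 powr (- \<gamma>))"
  have Ck: "0 < Ck" using powr_less_mono[of "- \<gamma>" 0 4] \<gamma>(1) by (simp add: Ck_def)
  obtain Ca where Ca: "Ca > 0" "\<And>E t. E \<in> sets borel \<Longrightarrow> emeasure lborel E < \<infinity> \<Longrightarrow>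
     (\<integral>\<^sup>+t'. ennreal (\<bar>t - t'\<bar> powr (- a)) * indicator E t' \<partial>lborel) \<le> ennreal (Ca * measure lborel E powr (1 - a))"
    using riesz_potential_bound[of a] a by auto
  obtain Cb where Cb: "Cb > 0" "\<And>E t. E \<in> sets borel \<Longrightarrow> emeasure lborel E < \<infinity> \<Longrightarrow> 2 * a < 1 \<Longrightarrow>
     (\<integral>\<^sup>+t'. ennreal (\<bar>t - t'\<bar> powr (- (2 * a))) * indicator E t' \<partial>lborel) \<le> ennreal (Cb * measure lborel E powr (1 - 2 * a))"
  \<comment> \<open>For \<open>2 * a \<ge> 1\<close> the second property is vacuous, and 1 serves as
    a placeholder.\<close>
  proof (cases "2 * a < 1")
    case True
    with riesz_potential_bound[of "2 * a"] a that show ?thesis by auto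
  qed (use that[of 1] in auto)
  define C where "C = exp 4 * Ck * Ca + exp 8 * Ck\<^sup>2 * Cb"
  have C1: "exp 4 * Ck * Ca \<le> C" "exp 8 * Ck\<^sup>2 * Cb \<le> C" "C > 0"
    using Ck Ca Cb by (auto simp: C_def intro!: add_pos_pos)
  show ?thesis
  proof (intro exI[of _ C] conjI allI impI C1(3); elim conjE)
    fix J and e :: "nat \<Rightarrow> 'a \<Rightarrow> complex" and R M :: real and X :: "real \<Rightarrow> 'a" and E :: "real set"
    assume e: "bessel_system J e" and R: "0 < R" and M: "0 < M" and X [measurable]: "X \<in> borel_measurable borel"
      and Eset [measurable]: "E \<in> sets borel" and Efin: "emeasure lborel E < \<infinity>"
    define s1 where "s1 = s - \<delta>"
    have s1: "0 \<le> s1" "\<gamma> = s1 - real DIM('a) / 2 + a" using \<delta> \<gamma> by (auto simp: s1_def)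
    \<comment> \<open>Enough Gaussian scales to reach the cutoff \<open>M\<close>. The kernel bound
      is uniform in \<open>K\<close>, so \<open>C\<close> depends on neither \<open>K\<close> nor
      \<open>M\<close>.\<close>
    obtain K where K: "M \<le> R * 2 ^ K"
      using real_arch_pow[of 2 "M / R"] R by (auto simp: field_simps intro: less_imp_le)
    define m where "m = (gauss_mult s1 R K :: 'a \<Rightarrow> real)"
    have [measurable]: "m \<in> borel_measurable borel" unfolding m_def by measurable
    have m0: "0 < m \<xi>" for \<xi> unfolding m_def by (rule gauss_mult_pos[OF R])
    define \<mu> where "\<mu> \<xi> = sqrt (m \<xi>)" for \<xi>
    have \<mu>2: "(\<mu> \<xi>)\<^sup>2 = m \<xi>" "0 < \<mu> \<xi>" for \<xi> using m0[of \<xi>] by (auto simp: \<mu>_def)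
    have [measurable]: "{\<xi>::'a. R < norm \<xi> \<and> norm \<xi> \<le> M} \<in> sets borel" by measurable
    define h where "h \<xi> = norm \<xi> powr (- s) * indicator {\<xi>. R < norm \<xi> \<and> norm \<xi> \<le> M} \<xi>" for \<xi> :: 'a
    have [measurable]: "h \<in> borel_measurable borel" unfolding h_def by measurable
    \<comment> \<open>The multiplier \<open>h\<close> is factored as \<open>\<tau> * \<mu>\<close>.
      The lower bound for the Gaussian sum with \<open>s1 = s - \<delta>\<close> leaves the spared
      factor \<open>norm \<xi> powr (- \<delta>)\<close>, up to \<open>exp 2\<close>, in
      \<open>\<tau>\<close>.\<close>
    define \<tau> where "\<tau> \<xi> = h \<xi> / \<mu> \<xi>" for \<xi>
    have \<tau>0: "0 \<le> \<tau> \<xi>" for \<xi> using \<mu>2(2)[of \<xi>] by (simp add: \<tau>_def h_def)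
    have \<tau>sq: "(\<tau> \<xi>)\<^sup>2 \<le> exp 4 * norm \<xi> powr (- (2 * \<delta>)) * indicator {\<xi>. R < norm \<xi>} \<xi>" for \<xi>
    proof (cases "R < norm \<xi> \<and> norm \<xi> \<le> M")
      case True
      hence n0: "0 < norm \<xi>" using R by linarith
      have lo: "exp (-4) * norm \<xi> powr (- (2 * s1)) \<le> m \<xi>"
        unfolding m_def by (rule gauss_mult_lower[OF R s1(1)]) (use True K in auto)
      have "(h \<xi>)\<^sup>2 = norm \<xi> powr (- (2 * s))"
        using True n0 by (simp add: h_def powr_power)
      also have "\<dots> = norm \<xi> powr (- (2 * \<delta>)) * norm \<xi> powr (- (2 * s1))"
        by (simp add: powr_add[symmetric] s1_def)
      also have "\<dots> = (exp 4 * norm \<xi> powr (- (2 * \<delta>))) * (exp (-4) * norm \<xi> powr (- (2 * s1)))"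
        by (simp add: exp_minus)
      also have "\<dots> \<le> (exp 4 * norm \<xi> powr (- (2 * \<delta>))) * m \<xi>" by (intro mult_left_mono lo) auto
      finally have "(h \<xi>)\<^sup>2 / m \<xi> \<le> exp 4 * norm \<xi> powr (- (2 * \<delta>))"
        using m0[of \<xi>] by (simp add: divide_le_eq)
      thus ?thesis using True by (simp add: \<tau>_def power_divide \<mu>2)
    qed (auto simp: \<tau>_def h_def indicator_def)
    define T where "T = exp 2 * R powr (- \<delta>)"
    have T2: "T\<^sup>2 = exp 4 * R powr (- (2 * \<delta>))"
      using R by (simp add: T_def power_mult_distrib powr_power exp_double[symmetric])
    have \<tau>T: "\<tau> \<xi> \<le> T" for \<xi>
    proof (rule power2_le_imp_le)
      have "(\<tau> \<xi>)\<^sup>2 \<le> exp 4 * norm \<xi> powr (- (2 * \<delta>)) * indicator {\<xi>. R < norm \<xi>} \<xi>" by (rule \<tau>sq)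
      also have "\<dots> \<le> exp 4 * R powr (- (2 * \<delta>))"
        using R \<delta> by (auto simp: indicator_def intro!: powr_mono2')
      finally show "(\<tau> \<xi>)\<^sup>2 \<le> T\<^sup>2" by (simp add: T2)
    qed (simp add: T_def)
    define B where "B = Ck * R powr (- (2 * \<gamma>))"
    have B0: "0 \<le> B" using Ck by (simp add: B_def)
    \<comment> \<open>The kernel estimate needs distinct times. On the diagonal the value
      \<open>top\<close> makes the hypothesis trivial, and a single time is a null set in the
      integrals \<open>kkN\<close> and \<open>kk2\<close>.\<close>
    define kk where "kk u = (if u = 0 then top else ennreal (B * \<bar>u\<bar> powr (- a)))" for u :: real
    define ch where "ch t \<xi> = cis (X t \<bullet> \<xi> - t * (norm \<xi>)\<^sup>2)" for t \<xi>
    interpret tt_star J e \<tau> \<mu> T ch E kk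
    proof
      show "\<tau> \<in> borel_measurable borel" "\<mu> \<in> borel_measurable borel"
        unfolding \<tau>_def \<mu>_def by measurable
      show "case_prod ch \<in> borel_measurable (borel \<Otimes>\<^sub>M borel)" unfolding ch_def by measurable
      show "kk \<in> borel_measurable borel" unfolding kk_def by measurable
      have "(\<integral>\<^sup>+\<xi>. ennreal (m \<xi>) \<partial>lborel) = ennreal (\<integral>\<xi>. m \<xi> \<partial>lborel)"
        unfolding m_def by (rule nn_integral_eq_integral[OF gauss_mult_integrable[OF R]])
          (use m0 in \<open>auto simp: m_def intro: less_imp_le\<close>)
      thus "(\<integral>\<^sup>+\<xi>. ennreal ((\<mu> \<xi>)\<^sup>2) \<partial>lborel) < \<infinity>" by (simp add: \<mu>2)
      show "kk (- u) = kk u" for u by (simp add: kk_def)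
      show "ennreal (cmod (\<integral>\<xi>. of_real ((\<mu> \<xi>)\<^sup>2) * (cnj (ch t \<xi>) * ch t' \<xi>) \<partial>lborel)) \<le> kk (t - t')" for t t'
      proof (cases "t = t'")
        case False
        have "of_real ((\<mu> \<xi>)\<^sup>2) * (cnj (ch t \<xi>) * ch t' \<xi>) = of_real (gauss_mult s1 R K \<xi>) * cis ((X t' - X t) \<bullet> \<xi> - (t' - t) * (norm \<xi>)\<^sup>2)" for \<xi>
          unfolding \<mu>2 m_def ch_def cis_cnj cis_mult by (simp add: inner_diff_left algebra_simps)
        hence "cmod (\<integral>\<xi>. of_real ((\<mu> \<xi>)\<^sup>2) * (cnj (ch t \<xi>) * ch t' \<xi>) \<partial>lborel) \<le> B * \<bar>t' - t\<bar> powr (- a)"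
          unfolding B_def Ck_def using gauss_mult_kernel[OF R _ _ a(3) \<gamma>(1) s1(2), of "t' - t" K "X t' - X t"] False a(1) by simp
        thus ?thesis using False by (auto simp: kk_def abs_minus_commute intro: ennreal_leI)
      qed (simp add: kk_def)
      show "bessel_system J e" by (rule e)
      show "0 \<le> \<tau> \<xi>" "\<tau> \<xi> \<le> T" for \<xi> by (rule \<tau>0, rule \<tau>T)
      show "cmod (ch t \<xi>) \<le> 1" for t \<xi> by (simp add: ch_def)
      show "E \<in> sets borel" by (rule Eset)
      show "emeasure lborel E < \<infinity>" by (rule Efin)
    qed
    have w_eq: "w j t = hf_part e s R M X j t" for j t
      unfolding w_def hf_part_def h_def[symmetric] ch_def using \<mu>2(2) by (simp add: \<tau>_def less_imp_neq[symmetric])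
    have S_eq: "S j = (\<integral>\<^sup>+t. ennreal ((cmod (hf_part e s R M X j t))\<^sup>2) * indicator E t \<partial>lborel)" if j: "j \<in> J" for j
      unfolding S_def w_eq[symmetric] N_def using w_measurable[OF j]
      by (subst nn_integral_density) (auto simp: mult.commute)
    have n_le: "(\<Sum>j\<in>J. n j) \<le> ennreal (exp 4) * hf_tail J e \<delta> R"
      unfolding hf_tail_def sum_distrib_left
    proof (rule sum_mono)
      fix j assume j: "j \<in> J"
      note [measurable] = e_measurable[OF j]
      have "n j \<le> (\<integral>\<^sup>+\<xi>. ennreal (exp 4) * (ennreal (norm \<xi> powr (- (2 * \<delta>)) * (cmod (e j \<xi>))\<^sup>2) * indicator {\<xi>. R < norm \<xi>} \<xi>) \<partial>lborel)"
        unfolding n_def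
      proof (rule nn_integral_mono)
        fix \<xi> :: 'a
        have "(\<tau> \<xi>)\<^sup>2 * (cmod (e j \<xi>))\<^sup>2 \<le> (exp 4 * norm \<xi> powr (- (2 * \<delta>)) * indicator {\<xi>. R < norm \<xi>} \<xi>) * (cmod (e j \<xi>))\<^sup>2"
          by (intro mult_right_mono \<tau>sq) simp
        from ennreal_leI[OF this] show "ennreal ((\<tau> \<xi>)\<^sup>2 * (cmod (e j \<xi>))\<^sup>2) \<le> ennreal (exp 4) * (ennreal (norm \<xi> powr (- (2 * \<delta>)) * (cmod (e j \<xi>))\<^sup>2) * indicator {\<xi>. R < norm \<xi>} \<xi>)"
          using \<tau>sq[of \<xi>] by (cases "R < norm \<xi>") (auto simp: ennreal_mult[symmetric] mult_ac)
      qed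
      also have "\<dots> = ennreal (exp 4) * (\<integral>\<^sup>+\<xi>. (ennreal (norm \<xi> powr (- (2 * \<delta>)) * (cmod (e j \<xi>))\<^sup>2) * indicator {\<xi>. R < norm \<xi>} \<xi>) \<partial>lborel)"
        by (rule nn_integral_cmult) measurable
      finally show "n j \<le> ennreal (exp 4) * (\<integral>\<^sup>+\<xi>. (ennreal (norm \<xi> powr (- (2 * \<delta>)) * (cmod (e j \<xi>))\<^sup>2) * indicator {\<xi>. R < norm \<xi>} \<xi>) \<partial>lborel)" .
    qed
    let ?l = "measure lborel E"
    have kkN: "(\<integral>\<^sup>+t'. kk (t - t') \<partial>N) \<le> ennreal (B * Ca * ?l powr (1 - a))" for t
    proof -
      have "(\<integral>\<^sup>+t'. kk (t - t') \<partial>N) = (\<integral>\<^sup>+t'. indicator E t' * kk (t - t') \<partial>lborel)"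
        unfolding N_def by (subst nn_integral_density) auto
      also have "\<dots> = (\<integral>\<^sup>+t'. ennreal B * (ennreal (\<bar>t - t'\<bar> powr (- a)) * indicator E t') \<partial>lborel)"
        using AE_lborel_singleton[of t] B0
        by (intro nn_integral_cong_AE) (auto elim!: eventually_mono simp: kk_def ennreal_mult mult_ac)
      also have "\<dots> = ennreal B * (\<integral>\<^sup>+t'. ennreal (\<bar>t - t'\<bar> powr (- a)) * indicator E t' \<partial>lborel)"
        by (rule nn_integral_cmult) measurable
      also have "\<dots> \<le> ennreal B * ennreal (Ca * ?l powr (1 - a))" by (rule mult_left_mono[OF Ca(2)[OF Eset Efin] zero_le])
      finally show ?thesis using B0 Ca(1) by (simp add: ennreal_mult[symmetric] mult.assoc)
    qed
    let ?S = "\<Sum>j\<in>J. \<integral>\<^sup>+t. ennreal ((cmod (hf_part e s R M X j t))\<^sup>2) * indicator E t \<partial>lborel"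
    have S_sum: "?S = (\<Sum>j\<in>J. S j)" using S_eq by simp
    have "?S \<le> (\<Sum>j\<in>J. ennreal (B * Ca * ?l powr (1 - a)) * n j)"
      unfolding S_sum by (intro sum_mono schur_bound kkN)
    also have "\<dots> = ennreal (B * Ca * ?l powr (1 - a)) * (\<Sum>j\<in>J. n j)" by (simp add: sum_distrib_left)
    also have "\<dots> \<le> ennreal (B * Ca * ?l powr (1 - a)) * (ennreal (exp 4) * hf_tail J e \<delta> R)"
      by (intro mult_left_mono n_le) simp
    also have "\<dots> = ennreal (exp 4 * Ck * Ca * (R powr (- (2 * \<gamma>)) * ?l powr (1 - a))) * hf_tail J e \<delta> R"
      using B0 Ca(1) by (simp add: mult.assoc[symmetric] ennreal_mult[symmetric]) (simp add: B_def mult_ac)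
    also have "\<dots> \<le> ennreal (C * (R powr (- (2 * \<gamma>)) * ?l powr (1 - a))) * hf_tail J e \<delta> R"
      by (intro mult_right_mono ennreal_leI C1) auto
    finally show "?S \<le> ennreal (C * R powr (- (2 * \<gamma>)) * ?l powr (1 - a)) * hf_tail J e \<delta> R"
      by (simp add: mult.assoc)
    assume a2: "2 * a < 1"
    have kk2: "(\<integral>\<^sup>+t'. (kk (t - t'))\<^sup>2 \<partial>N) \<le> ennreal (B\<^sup>2 * Cb * ?l powr (1 - 2 * a))" for t
    proof -
      have "(\<integral>\<^sup>+t'. (kk (t - t'))\<^sup>2 \<partial>N) = (\<integral>\<^sup>+t'. indicator E t' * (kk (t - t'))\<^sup>2 \<partial>lborel)"
        unfolding N_def by (subst nn_integral_density) auto
      also have "\<dots> = (\<integral>\<^sup>+t'. ennreal (B\<^sup>2) * (ennreal (\<bar>t - t'\<bar> powr (- (2 * a))) * indicator E t') \<partial>lborel)"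
      proof (rule nn_integral_cong_AE, use AE_lborel_singleton[of t] in eventually_elim)
        fix t' assume "t' \<noteq> t"
        hence "(kk (t - t'))\<^sup>2 = ennreal ((B * \<bar>t - t'\<bar> powr (- a))\<^sup>2)"
          using B0 by (simp add: kk_def ennreal_power)
        also have "(B * \<bar>t - t'\<bar> powr (- a))\<^sup>2 = B\<^sup>2 * \<bar>t - t'\<bar> powr (- (2 * a))"
          using \<open>t' \<noteq> t\<close> by (simp add: power_mult_distrib powr_power mult.commute)
        finally show "indicator E t' * (kk (t - t'))\<^sup>2 = ennreal (B\<^sup>2) * (ennreal (\<bar>t - t'\<bar> powr (- (2 * a))) * indicator E t')"
          by (simp add: ennreal_mult mult_ac)
      qed
      also have "\<dots> = ennreal (B\<^sup>2) * (\<integral>\<^sup>+t'. ennreal (\<bar>t - t'\<bar> powr (- (2 * a))) * indicator E t' \<partial>lborel)"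
        by (rule nn_integral_cmult) measurable
      also have "\<dots> \<le> ennreal (B\<^sup>2) * ennreal (Cb * ?l powr (1 - 2 * a))" by (rule mult_left_mono[OF Cb(2)[OF Eset Efin a2] zero_le])
      finally show ?thesis using Cb(1) by (simp add: ennreal_mult[symmetric] mult.assoc)
    qed
    have "(\<integral>\<^sup>+t. \<integral>\<^sup>+t'. (kk (t - t'))\<^sup>2 \<partial>N \<partial>N) \<le> (\<integral>\<^sup>+t. ennreal (B\<^sup>2 * Cb * ?l powr (1 - 2 * a)) \<partial>N)"
      by (intro nn_integral_mono kk2)
    also have "\<dots> = ennreal (B\<^sup>2 * Cb * ?l powr (1 - 2 * a)) * ennreal ?l"
    proof -
      have "emeasure N (space N) = emeasure lborel E"
        unfolding N_def by (subst emeasure_density) auto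
      also have "\<dots> = ennreal ?l" using Efin by (intro emeasure_eq_ennreal_measure) simp
      finally have "emeasure N (space N) = ennreal ?l" .
      thus ?thesis by simp
    qed
    also have "\<dots> = ennreal (B\<^sup>2 * Cb * ?l powr (2 - 2 * a))"
    proof (cases "?l = 0")
      case False
      hence "?l > 0" by (simp add: less_le)
      hence "?l powr (1 - 2 * a) * ?l = ?l powr (2 - 2 * a)"
        using powr_add[of ?l "1 - 2 * a" 1] by simp
      thus ?thesis using Cb(1) by (subst ennreal_mult[symmetric]) (auto simp: mult.assoc)
    qed simp
    finally have kk3: "(\<integral>\<^sup>+t. \<integral>\<^sup>+t'. (kk (t - t'))\<^sup>2 \<partial>N \<partial>N) \<le> ennreal (B\<^sup>2 * Cb * ?l powr (2 - 2 * a))" .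
    have "?S\<^sup>2 \<le> (\<Sum>j\<in>J. n j) * (ennreal (T\<^sup>2) * (\<integral>\<^sup>+t. \<integral>\<^sup>+t'. (kk (t - t'))\<^sup>2 \<partial>N \<partial>N))"
      unfolding S_sum by (rule hilbert_schmidt_bound)
    also have "\<dots> \<le> (ennreal (exp 4) * hf_tail J e \<delta> R) * (ennreal (T\<^sup>2) * ennreal (B\<^sup>2 * Cb * ?l powr (2 - 2 * a)))"
      by (intro mult_mono n_le kk3 mult_left_mono) auto
    also have "\<dots> = ennreal (exp 4 * T\<^sup>2 * (B\<^sup>2 * Cb * ?l powr (2 - 2 * a))) * hf_tail J e \<delta> R"
      using Cb(1) by (simp add: ennreal_mult mult_ac)
    also have "\<dots> \<le> ennreal (C * R powr (- (4 * \<gamma>) - 2 * \<delta>) * ?l powr (2 - 2 * a)) * hf_tail J e \<delta> R"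
    proof (rule mult_right_mono[OF ennreal_leI])
      have "exp 4 * T\<^sup>2 * (B\<^sup>2 * Cb * ?l powr (2 - 2 * a)) = exp 8 * Ck\<^sup>2 * Cb * (R powr (- (4 * \<gamma>) - 2 * \<delta>) * ?l powr (2 - 2 * a))"
      proof -
        have x1: "exp 8 = exp 4 * exp (4::real)" by (simp add: exp_add[symmetric])
        have x2: "B\<^sup>2 = Ck\<^sup>2 * R powr (- (4 * \<gamma>))" using R by (simp add: B_def power_mult_distrib powr_power)
        have x3: "R powr (- (4 * \<gamma>) - 2 * \<delta>) = R powr (- (4 * \<gamma>)) * R powr (- (2 * \<delta>))" by (simp add: powr_add[symmetric])
        show ?thesis unfolding T2 x1 x2 x3 by (simp only: mult_ac)
      qed
      also have "\<dots> \<le> C * (R powr (- (4 * \<gamma>) - 2 * \<delta>) * ?l powr (2 - 2 * a))"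
        by (intro mult_right_mono C1) auto
      finally show "exp 4 * T\<^sup>2 * (B\<^sup>2 * Cb * ?l powr (2 - 2 * a)) \<le> C * R powr (- (4 * \<gamma>) - 2 * \<delta>) * ?l powr (2 - 2 * a)"
        by (simp only: mult.assoc)
    qed simp
    finally show "?S\<^sup>2 \<le> ennreal (C * R powr (- (4 * \<gamma>) - 2 * \<delta>) * ?l powr (2 - 2 * a)) * hf_tail J e \<delta> R" .
  qed
qed

section \<open>Level sets of the truncated maximal function\<close>

text \<open>Up to the factor \<open>ft_unit\<close>, the evolution of the function with transform
  \<open>e j\<close> times \<open>norm \<xi> powr (- s)\<close>, cut off at \<open>M\<close>. The
  cutoff makes it continuous in \<open>y\<close>, so that a supremum over a dense sequence controls
  every point.\<close>

definition trunc_evol :: "(nat \<Rightarrow> 'a::euclidean_space \<Rightarrow> complex) \<Rightarrow> real \<Rightarrow> real \<Rightarrow> nat \<Rightarrow> real \<Rightarrow> 'a \<Rightarrow> complex" where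
  "trunc_evol e s M j t y = (\<integral>\<xi>. e j \<xi> * of_real (norm \<xi> powr (- s) * indicator {\<xi>. norm \<xi> \<le> M} \<xi>) * cis (y \<bullet> \<xi> - t * (norm \<xi>)\<^sup>2) \<partial>lborel)"

lemma nn_integral_powr_from_0:
  assumes "- 1 < b" "0 \<le> \<rho>"
  shows "(\<integral>\<^sup>+R. ennreal (R powr b) * indicator {0..\<rho>} R \<partial>lborel) = ennreal (\<rho> powr (b + 1) / (b + 1))"
  by (rule nn_integral_has_integral_lebesgue'[OF _ has_integral_powr_from_0]) (use assms in auto)

lemma L2_weight_cball:
  fixes s :: real
  assumes s: "0 \<le> s" "2 * s < real DIM('a::euclidean_space)"
  obtains C where "C > 0" "\<And>R. 0 < R \<Longrightarrow> (\<integral>\<^sup>+\<xi>. ennreal ((norm \<xi> powr (- s) * indicator {\<xi>::'a. norm \<xi> \<le> R} \<xi>)\<^sup>2) \<partial>lborel)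
     \<le> ennreal (C * R powr (real DIM('a) - 2 * s))"
proof -
  obtain C where C: "C > 0" "\<And>R. 0 < R \<Longrightarrow> (\<integral>\<^sup>+x. ennreal (norm x powr (- (2 * s))) * indicator (cball (0::'a) R) x \<partial>lborel) \<le> ennreal (C * R powr (real DIM('a) - 2 * s))"
    using nn_integral_norm_powr_cball[of "2 * s", where 'a='a] s by auto
  show ?thesis
  proof (rule that[OF C(1)])
    fix R :: real assume R: "0 < R"
    have "(\<integral>\<^sup>+\<xi>. ennreal ((norm \<xi> powr (- s) * indicator {\<xi>::'a. norm \<xi> \<le> R} \<xi>)\<^sup>2) \<partial>lborel)
      = (\<integral>\<^sup>+x. ennreal (norm x powr (- (2 * s))) * indicator (cball (0::'a) R) x \<partial>lborel)"
    proof (rule nn_integral_cong)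
      fix \<xi> :: 'a
      show "ennreal ((norm \<xi> powr (- s) * indicator {\<xi>::'a. norm \<xi> \<le> R} \<xi>)\<^sup>2) = ennreal (norm \<xi> powr (- (2 * s))) * indicator (cball (0::'a) R) \<xi>"
        by (cases "\<xi> = 0") (auto simp: indicator_def powr_power)
    qed
    with C(2)[OF R] show "(\<integral>\<^sup>+\<xi>. ennreal ((norm \<xi> powr (- s) * indicator {\<xi>::'a. norm \<xi> \<le> R} \<xi>)\<^sup>2) \<partial>lborel)
     \<le> ennreal (C * R powr (real DIM('a) - 2 * s))" by simp
  qed
qed

lemma trunc_evol_integrable:
  fixes s :: real and e :: "nat \<Rightarrow> 'a::euclidean_space \<Rightarrow> complex"
  assumes e: "bessel_system J e" and j: "j \<in> J" and s: "0 \<le> s" "2 * s < real DIM('a)" and M: "0 < M"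
  shows "integrable lborel (\<lambda>\<xi>. e j \<xi> * of_real (norm \<xi> powr (- s) * indicator {\<xi>. norm \<xi> \<le> M} \<xi>))"
proof -
  note [measurable] = bessel_systemD(2)[OF e j]
  obtain C where C: "C > 0" "\<And>R. 0 < R \<Longrightarrow> (\<integral>\<^sup>+\<xi>. ennreal ((norm \<xi> powr (- s) * indicator {\<xi>::'a. norm \<xi> \<le> R} \<xi>)\<^sup>2) \<partial>lborel)
     \<le> ennreal (C * R powr (real DIM('a) - 2 * s))"
    using L2_weight_cball[OF s] by blast
  show ?thesis
  proof (rule integrable_mult_L2)
    show "(\<integral>\<^sup>+\<xi>. ennreal ((cmod (e j \<xi>))\<^sup>2) \<partial>lborel) < \<infinity>"
      using bessel_systemD(4)[OF e j] by (rule le_less_trans) simp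
    have "(\<integral>\<^sup>+\<xi>. ennreal ((cmod (of_real (norm \<xi> powr (- s) * indicator {\<xi>::'a. norm \<xi> \<le> M} \<xi>)))\<^sup>2) \<partial>lborel) \<le> ennreal (C * M powr (real DIM('a) - 2 * s))"
      using C(2)[OF M] by (simp only: norm_of_real power2_abs)
    thus "(\<integral>\<^sup>+\<xi>. ennreal ((cmod (of_real (norm \<xi> powr (- s) * indicator {\<xi>::'a. norm \<xi> \<le> M} \<xi>)))\<^sup>2) \<partial>lborel) < \<infinity>"
      by (rule le_less_trans) simp
  qed measurable
qed

lemma integrable_mult_cis:
  fixes F :: "'a::euclidean_space \<Rightarrow> complex"
  assumes F: "integrable lborel F" and [measurable]: "h \<in> borel_measurable borel"
  shows "integrable lborel (\<lambda>\<xi>. F \<xi> * cis (h \<xi>))"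
proof (rule Bochner_Integration.integrable_bound[OF F])
  have [measurable]: "F \<in> borel_measurable borel" using F borel_measurable_integrable by fastforce
  show "(\<lambda>\<xi>. F \<xi> * cis (h \<xi>)) \<in> borel_measurable lborel" by measurable
qed (simp add: norm_mult)

text \<open>The radius \<open>min R M\<close> covers \<open>M \<le> R\<close> as well: there the
  high part is zero and the low part is everything.\<close>

lemma trunc_evol_split:
  fixes s :: real and e :: "nat \<Rightarrow> 'a::euclidean_space \<Rightarrow> complex"
  assumes e: "bessel_system J e" and j: "j \<in> J" and s: "0 \<le> s" "2 * s < real DIM('a)" and M: "0 < M" and R: "0 < R"
  shows "trunc_evol e s M j t (X t) = trunc_evol e s (min R M) j t (X t) + hf_part e s R M X j t"
proof -
  let ?W = "\<lambda>A \<xi>. e j \<xi> * complex_of_real (norm \<xi> powr (- s) * indicator A \<xi>)"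
  let ?c = "\<lambda>\<xi>. cis (X t \<bullet> \<xi> - t * (norm \<xi>)\<^sup>2)"
  let ?A = "{\<xi>::'a. norm \<xi> \<le> M}" and ?B = "{\<xi>::'a. norm \<xi> \<le> min R M}" and ?D = "{\<xi>::'a. R < norm \<xi> \<and> norm \<xi> \<le> M}"
  have iA: "integrable lborel (?W ?A)" by (rule trunc_evol_integrable[OF e j s M])
  have iB: "integrable lborel (?W ?B)" by (rule trunc_evol_integrable[OF e j s]) (use M R in auto)
  have eqD: "?W ?D = (\<lambda>\<xi>. ?W ?A \<xi> - ?W ?B \<xi>)" by (rule ext) (auto split: split_indicator)
  have iD: "integrable lborel (?W ?D)" unfolding eqD by (rule Bochner_Integration.integrable_diff[OF iA iB])
  have "(\<lambda>\<xi>. ?W ?A \<xi> * ?c \<xi>) = (\<lambda>\<xi>. ?W ?B \<xi> * ?c \<xi> + ?W ?D \<xi> * ?c \<xi>)" by (rule ext) (auto split: split_indicator)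
  hence "trunc_evol e s M j t (X t) = (\<integral>\<xi>. ?W ?B \<xi> * ?c \<xi> + ?W ?D \<xi> * ?c \<xi> \<partial>lborel)"
    unfolding trunc_evol_def by simp
  also have "\<dots> = (\<integral>\<xi>. ?W ?B \<xi> * ?c \<xi> \<partial>lborel) + (\<integral>\<xi>. ?W ?D \<xi> * ?c \<xi> \<partial>lborel)"
    by (rule Bochner_Integration.integral_add) (rule integrable_mult_cis[OF iB] integrable_mult_cis[OF iD], measurable)+
  finally show ?thesis by (simp only: trunc_evol_def hf_part_def)
qed

lemma hf_tail_le:
  assumes e: "bessel_system J e" and R: "0 < R" and \<delta>: "0 \<le> \<delta>"
  shows "hf_tail J e \<delta> R \<le> ennreal (R powr (- (2 * \<delta>)) * real (card J))"
proof -
  have "hf_tail J e \<delta> R \<le> (\<Sum>j\<in>J. ennreal (R powr (- (2 * \<delta>))))"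
    unfolding hf_tail_def
  proof (rule sum_mono)
    fix j assume j: "j \<in> J"
    note [measurable] = bessel_systemD(2)[OF e j]
    have "(\<integral>\<^sup>+\<xi>. ennreal (norm \<xi> powr (- (2 * \<delta>)) * (cmod (e j \<xi>))\<^sup>2) * indicator {\<xi>. R < norm \<xi>} \<xi> \<partial>lborel)
      \<le> (\<integral>\<^sup>+\<xi>. ennreal (R powr (- (2 * \<delta>))) * ennreal ((cmod (e j \<xi>))\<^sup>2) \<partial>lborel)"
      using R \<delta> by (intro nn_integral_mono)
        (auto simp: indicator_def ennreal_mult[symmetric] intro!: ennreal_leI mult_right_mono powr_mono2')
    also have "\<dots> = ennreal (R powr (- (2 * \<delta>))) * (\<integral>\<^sup>+\<xi>. ennreal ((cmod (e j \<xi>))\<^sup>2) \<partial>lborel)"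
      by (rule nn_integral_cmult) measurable
    also have "\<dots> \<le> ennreal (R powr (- (2 * \<delta>))) * 1" by (intro mult_left_mono bessel_systemD(4)[OF e j]) simp
    finally show "(\<integral>\<^sup>+\<xi>. ennreal (norm \<xi> powr (- (2 * \<delta>)) * (cmod (e j \<xi>))\<^sup>2) * indicator {\<xi>. R < norm \<xi>} \<xi> \<partial>lborel) \<le> ennreal (R powr (- (2 * \<delta>)))"
      by simp
  qed
  thus ?thesis by (simp add: ennreal_mult ennreal_of_nat_eq_real_of_nat mult.commute)
qed

text \<open>This size is at most the number of functions, but its integral against \<open>dR / R\<close> also is bounded by a multiple of that number.\<close>

definition tail_size :: "nat set \<Rightarrow> (nat \<Rightarrow> 'a::euclidean_space \<Rightarrow> complex) \<Rightarrow> real \<Rightarrow> real \<Rightarrow> real" where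
  "tail_size J e \<delta> R = R powr (2 * \<delta>) * enn2real (hf_tail J e \<delta> R)"

lemma tail_size_nonneg: "0 \<le> tail_size J e \<delta> R"
  by (simp add: tail_size_def)

lemma hf_tail_eq:
  assumes e: "bessel_system J e" and R: "0 < R" and \<delta>: "0 \<le> \<delta>"
  shows "hf_tail J e \<delta> R = ennreal (R powr (- (2 * \<delta>)) * tail_size J e \<delta> R)"
proof -
  have "hf_tail J e \<delta> R < \<infinity>" using hf_tail_le[OF assms] by (rule le_less_trans) simp
  hence "hf_tail J e \<delta> R = ennreal (enn2real (hf_tail J e \<delta> R))" by simp
  moreover have "R powr (- (2 * \<delta>)) * tail_size J e \<delta> R = enn2real (hf_tail J e \<delta> R)"
    unfolding tail_size_def mult.assoc[symmetric] powr_add[symmetric] using R by simp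
  ultimately show ?thesis by simp
qed

lemma tail_size_le:
  assumes e: "bessel_system J e" and R: "0 < R" and \<delta>: "0 \<le> \<delta>"
  shows "tail_size J e \<delta> R \<le> real (card J)"
proof -
  have "R powr (- (2 * \<delta>)) * tail_size J e \<delta> R \<le> R powr (- (2 * \<delta>)) * real (card J)"
    using hf_tail_le[OF assms] unfolding hf_tail_eq[OF assms] by (simp add: ennreal_le_iff)
  thus ?thesis using R by simp
qed

text \<open>A measure estimated by a smaller power of itself is bounded outright. The measure is a
  real number here, hence finite.\<close>

lemma powr_absorb:
  fixes l A B c :: real
  assumes A: "0 < A" and B: "0 \<le> B" and c: "0 < c" and l: "0 \<le> l" and le: "A * l powr m \<le> B * l powr (m - c)"
  shows "l \<le> (B / A) powr (1 / c)"
proof (cases "l = 0")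
  case False
  hence l0: "0 < l" using l by simp
  have "A * l powr c * l powr (m - c) \<le> B * l powr (m - c)"
    using le l0 by (simp add: powr_add[symmetric] mult.assoc)
  hence "A * l powr c \<le> B" using l0 by simp
  hence "l powr c \<le> B / A" using A by (simp add: field_simps)
  hence "(l powr c) powr (1 / c) \<le> (B / A) powr (1 / c)" using c by (intro powr_mono2) auto
  thus ?thesis using c l0 by (simp add: powr_powr)
qed simp

text \<open>Low frequencies cannot create values of this height, by Bessel's inequality. On the
  level set the high frequencies must therefore be large, while \<open>hf_bounds\<close> limits
  their square integral by a smaller power of the measure of the set; solving for the measure gives
  the bound.\<close>

lemma level_set_bound:
  fixes s a \<delta> \<kappa> :: real
  assumes s: "0 < s" "2 * s < real DIM('a::euclidean_space)"
    and a: "0 < a" "a < 1" "a \<le> real DIM('a) / 2"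
    and \<delta>: "0 < \<delta>" "\<delta> < s" and \<gamma>: "0 < s - \<delta> - real DIM('a) / 2 + a"
    and \<kappa>: "\<kappa> = 1 / a \<or> (2 * a < 1 \<and> \<kappa> = 1 / (2 * a))"
  obtains C0 C where "C0 > 0" "C > 0"
    "\<And>J (e :: nat \<Rightarrow> 'a \<Rightarrow> complex) R M x. bessel_system J e \<Longrightarrow> 0 < R \<Longrightarrow> 0 < M \<Longrightarrow>
     emeasure lborel {t. \<exists>n::nat. (\<Sum>j\<in>J. (cmod (trunc_evol e s M j t (x n)))\<^sup>2) > 4 * C0 * R powr (real DIM('a) - 2 * s)}
       \<le> ennreal (C * R powr (- 2) * tail_size J e \<delta> R powr \<kappa>)"
proof -
  define P where "P = real DIM('a) - 2 * s"
  define \<gamma>' where "\<gamma>' = s - \<delta> - real DIM('a) / 2 + a"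
  \<comment> \<open>With this relation the powers of \<open>R\<close> on the right-hand sides are
    \<open>P - 2 * a\<close> for the operator norm and twice that for the Hilbert-Schmidt norm.
    After division by the lower bound and the root 1/a or 1/(2a), both cases end with
    \<open>R powr (- 2)\<close>.\<close>
  have \<gamma>P: "2 * \<gamma>' = 2 * a - P - 2 * \<delta>" by (simp add: \<gamma>'_def P_def)
  have s': "0 \<le> s" using s by simp
  obtain C0 where C0: "C0 > 0" "\<And>R. 0 < R \<Longrightarrow> (\<integral>\<^sup>+\<xi>. ennreal ((norm \<xi> powr (- s) * indicator {\<xi>::'a. norm \<xi> \<le> R} \<xi>)\<^sup>2) \<partial>lborel)
     \<le> ennreal (C0 * R powr P)"
    unfolding P_def using L2_weight_cball[OF s' s(2)] by blast
  obtain C1 where C1: "C1 > 0" and hf: "\<And>J (e :: nat \<Rightarrow> 'a \<Rightarrow> complex) R M X E. bessel_system J e \<and> 0 < R \<and> 0 < M \<and> X \<in> borel_measurable borel \<and>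
     E \<in> sets borel \<and> emeasure lborel E < \<infinity> \<Longrightarrow>
     (\<Sum>j\<in>J. \<integral>\<^sup>+t. ennreal ((cmod (hf_part e s R M X j t))\<^sup>2) * indicator E t \<partial>lborel)
       \<le> ennreal (C1 * R powr (- (2 * \<gamma>')) * measure lborel E powr (1 - a)) * hf_tail J e \<delta> R \<and>
     (2 * a < 1 \<longrightarrow> (\<Sum>j\<in>J. \<integral>\<^sup>+t. ennreal ((cmod (hf_part e s R M X j t))\<^sup>2) * indicator E t \<partial>lborel)\<^sup>2
       \<le> ennreal (C1 * R powr (- (4 * \<gamma>') - 2 * \<delta>) * measure lborel E powr (2 - 2 * a)) * hf_tail J e \<delta> R)"
    using hf_bounds[OF a \<delta> \<gamma> refl] unfolding \<gamma>'_def by blast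
  define C where "C = max ((C1 / C0) powr (1 / a)) ((C1 / C0\<^sup>2) powr (1 / (2 * a)))"
  have C: "C > 0" using C0(1) C1 by (auto simp: C_def less_max_iff_disj)
  show ?thesis
  proof (rule that[OF C0(1) C])
    fix J and e :: "nat \<Rightarrow> 'a \<Rightarrow> complex" and R M :: real and x :: "nat \<Rightarrow> 'a"
    assume e: "bessel_system J e" and R: "0 < R" and M: "0 < M"
    note eD = bessel_systemD[OF e]
    define lev where "lev = 4 * C0 * R powr P"
    define F where "F n t = (\<Sum>j\<in>J. (cmod (trunc_evol e s M j t (x n)))\<^sup>2)" for n t
    have Fm [measurable]: "F n \<in> borel_measurable borel" for n
      unfolding F_def trunc_evol_def using eD(2) by measurable
    define E where "E = {t. \<exists>n. F n t > lev}"
    have Em [measurable]: "E \<in> sets borel" unfolding E_def by measurable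
    \<comment> \<open>The first index that exceeds the level is a measurable choice; outside
      \<open>E\<close> the value of \<open>X\<close> does not matter.\<close>
    define X where "X t = x (LEAST n. F n t > lev)" for t
    have Xm: "X \<in> borel_measurable borel"
      unfolding X_def by (rule measurable_compose[where g=x and N="count_space UNIV"]) measurable
    have FX: "lev < (\<Sum>j\<in>J. (cmod (trunc_evol e s M j t (X t)))\<^sup>2)" if "t \<in> E" for t
      using that LeastI_ex[of "\<lambda>n. F n t > lev"] by (simp add: E_def X_def F_def)
    have low: "(\<Sum>j\<in>J. (cmod (trunc_evol e s (min R M) j t y))\<^sup>2) \<le> lev / 4" for t y
    proof -
      let ?h = "\<lambda>\<xi>::'a. complex_of_real (norm \<xi> powr (- s) * indicator {\<xi>. norm \<xi> \<le> min R M} \<xi>) * cis (y \<bullet> \<xi> - t * (norm \<xi>)\<^sup>2)"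
      have "ennreal (\<Sum>j\<in>J. (cmod (trunc_evol e s (min R M) j t y))\<^sup>2) = ennreal (\<Sum>j\<in>J. (cmod (\<integral>\<xi>. e j \<xi> * ?h \<xi> \<partial>lborel))\<^sup>2)"
        by (simp add: trunc_evol_def mult.assoc)
      also have "\<dots> \<le> (\<integral>\<^sup>+\<xi>. ennreal ((cmod (?h \<xi>))\<^sup>2) \<partial>lborel)"
        by (rule bessel_inequality[OF e]) measurable
      also have "\<dots> \<le> (\<integral>\<^sup>+\<xi>. ennreal ((norm \<xi> powr (- s) * indicator {\<xi>::'a. norm \<xi> \<le> R} \<xi>)\<^sup>2) \<partial>lborel)"
        by (intro nn_integral_mono ennreal_leI) (auto simp: norm_mult indicator_def)
      also have "\<dots> \<le> ennreal (C0 * R powr P)" by (rule C0(2)[OF R])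
      finally show ?thesis using C0(1) by (simp add: lev_def ennreal_le_iff)
    qed
    \<comment> \<open>The factor 4 in the level: \<open>lev < 2 * (lev / 4) + 2 * H\<close>, with
      \<open>H\<close> the high part, leaves \<open>H > lev / 4\<close>.\<close>
    have high: "lev / 4 \<le> (\<Sum>j\<in>J. (cmod (hf_part e s R M X j t))\<^sup>2)" if t: "t \<in> E" for t
    proof -
      let ?b = "\<lambda>j. trunc_evol e s (min R M) j t (X t)"
      have "lev < (\<Sum>j\<in>J. (cmod (?b j + hf_part e s R M X j t))\<^sup>2)"
        using FX[OF t] trunc_evol_split[OF e _ s' s(2) M R] by simp
      also have "\<dots> \<le> (\<Sum>j\<in>J. 2 * (cmod (?b j))\<^sup>2 + 2 * (cmod (hf_part e s R M X j t))\<^sup>2)"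
      proof (rule sum_mono)
        fix j
        have "(cmod (?b j + hf_part e s R M X j t))\<^sup>2 \<le> (cmod (?b j) + cmod (hf_part e s R M X j t))\<^sup>2"
          by (intro power_mono norm_triangle_ineq) simp
        also have "\<dots> \<le> 2 * (cmod (?b j))\<^sup>2 + 2 * (cmod (hf_part e s R M X j t))\<^sup>2"
          using sum_squares_bound[of "cmod (?b j)" "cmod (hf_part e s R M X j t)"] by (simp add: power2_sum)
        finally show "(cmod (?b j + hf_part e s R M X j t))\<^sup>2 \<le> 2 * (cmod (?b j))\<^sup>2 + 2 * (cmod (hf_part e s R M X j t))\<^sup>2" .
      qed
      also have "\<dots> = 2 * (\<Sum>j\<in>J. (cmod (?b j))\<^sup>2) + 2 * (\<Sum>j\<in>J. (cmod (hf_part e s R M X j t))\<^sup>2)"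
        by (simp add: sum.distrib sum_distrib_left)
      finally show ?thesis using low[of t "X t"] by linarith
    qed
    \<comment> \<open>The measure of \<open>E\<close> is not yet known to be finite, so
      \<open>powr_absorb\<close> is applied to subsets of finite measure. The bound does not depend
      on the subset, and bounded pieces exhaust \<open>E\<close> afterwards.\<close>
    have bound: "measure lborel E' \<le> C * R powr (- 2) * tail_size J e \<delta> R powr \<kappa>"
      if E': "E' \<subseteq> E" "E' \<in> sets borel" "emeasure lborel E' < \<infinity>" for E'
    proof -
      note [measurable] = E'(2)
      let ?l = "measure lborel E'" and ?T = "tail_size J e \<delta> R"
      let ?S = "\<Sum>j\<in>J. \<integral>\<^sup>+t. ennreal ((cmod (hf_part e s R M X j t))\<^sup>2) * indicator E' t \<partial>lborel"
      have [measurable]: "hf_part e s R M X j \<in> borel_measurable borel" if "j \<in> J" for j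
        unfolding hf_part_def using eD(2)[OF that] Xm by measurable
      have l: "emeasure lborel E' = ennreal ?l" using E'(3) by (intro emeasure_eq_ennreal_measure) simp
      have "ennreal (C0 * R powr P * ?l) = (\<integral>\<^sup>+t. ennreal (lev / 4) * indicator E' t \<partial>lborel)"
        using C0(1) E'(2) by (simp add: nn_integral_cmult_indicator l lev_def ennreal_mult[symmetric])
      also have "\<dots> \<le> (\<integral>\<^sup>+t. (\<Sum>j\<in>J. ennreal ((cmod (hf_part e s R M X j t))\<^sup>2) * indicator E' t) \<partial>lborel)"
        using high E'(1) by (intro nn_integral_mono) (auto simp: indicator_def intro!: ennreal_leI)
      also have "\<dots> = ?S" by (rule nn_integral_sum) measurable
      finally have SL: "ennreal (C0 * R powr P * ?l) \<le> ?S" .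
      have T0: "0 \<le> ?T" by (rule tail_size_nonneg)
      note tl = hf_tail_eq[OF e R less_imp_le[OF \<delta>(1)]]
      note hf' = hf[of J e R M X E', OF conjI[OF e conjI[OF R conjI[OF M conjI[OF Xm conjI[OF E'(2,3)]]]]]]
      show ?thesis using \<kappa>
      proof
        assume k: "\<kappa> = 1 / a"
        have "ennreal (C0 * R powr P * ?l) \<le> ennreal (C1 * R powr (- (2 * \<gamma>')) * ?l powr (1 - a)) * ennreal (R powr (- (2 * \<delta>)) * ?T)"
          using order_trans[OF SL conjunct1[OF hf']] by (simp only: tl)
        also have "\<dots> = ennreal (C1 * R powr (- (2 * \<gamma>')) * ?l powr (1 - a) * (R powr (- (2 * \<delta>)) * ?T))"
          using C1 T0 by (intro ennreal_mult[symmetric]) auto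
        finally have "C0 * R powr P * ?l \<le> C1 * R powr (- (2 * \<gamma>')) * ?l powr (1 - a) * (R powr (- (2 * \<delta>)) * ?T)"
          using C1 T0 by (subst (asm) ennreal_le_iff) auto
        hence "(C0 * R powr P) * ?l powr 1 \<le> (C1 * (R powr (- (2 * \<gamma>')) * R powr (- (2 * \<delta>))) * ?T) * ?l powr (1 - a)"
          by (simp add: mult_ac)
        hence "?l \<le> ((C1 * (R powr (- (2 * \<gamma>')) * R powr (- (2 * \<delta>))) * ?T) / (C0 * R powr P)) powr (1 / a)"
          by (intro powr_absorb[where m=1]) (use C0 C1 T0 R a in auto)
        also have "(C1 * (R powr (- (2 * \<gamma>')) * R powr (- (2 * \<delta>))) * ?T) / (C0 * R powr P) = (C1 / C0) * R powr (- (2 * a)) * ?T"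
        proof -
          have "R powr (- (2 * \<gamma>')) * R powr (- (2 * \<delta>)) = R powr (- (2 * a)) * R powr P"
            unfolding powr_add[symmetric] using \<gamma>P by simp
          thus ?thesis using R by simp
        qed
        also have "((C1 / C0) * R powr (- (2 * a)) * ?T) powr (1 / a) = (C1 / C0) powr (1 / a) * R powr (- 2) * ?T powr \<kappa>"
        proof -
          have eq: "- (2 * a) * (1 / a) = - 2" using a by simp
          show ?thesis by (simp only: powr_mult powr_powr k eq)
        qed
        also have "\<dots> \<le> C * R powr (- 2) * ?T powr \<kappa>"
          unfolding C_def by (intro mult_right_mono) auto
        finally show ?thesis .
      next
        assume k: "2 * a < 1 \<and> \<kappa> = 1 / (2 * a)"
        have "ennreal ((C0 * R powr P * ?l)\<^sup>2) = (ennreal (C0 * R powr P * ?l))\<^sup>2"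
          using C0(1) by (simp add: ennreal_power)
        also have "\<dots> \<le> ?S\<^sup>2" by (intro power_mono SL) simp
        also have "\<dots> \<le> ennreal (C1 * R powr (- (4 * \<gamma>') - 2 * \<delta>) * ?l powr (2 - 2 * a)) * ennreal (R powr (- (2 * \<delta>)) * ?T)"
          using conjunct2[OF hf'] k by (simp only: tl)
        also have "\<dots> = ennreal (C1 * R powr (- (4 * \<gamma>') - 2 * \<delta>) * ?l powr (2 - 2 * a) * (R powr (- (2 * \<delta>)) * ?T))"
          using C1 T0 by (intro ennreal_mult[symmetric]) auto
        finally have le: "(C0 * R powr P * ?l)\<^sup>2 \<le> C1 * R powr (- (4 * \<gamma>') - 2 * \<delta>) * ?l powr (2 - 2 * a) * (R powr (- (2 * \<delta>)) * ?T)"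
          using C1 T0 by (subst (asm) ennreal_le_iff) auto
        have "?l\<^sup>2 = ?l powr 2" by simp
        hence "(C0 * R powr P * ?l)\<^sup>2 = (C0 * R powr P)\<^sup>2 * ?l powr 2" by (simp only: power_mult_distrib)
        with le have "(C0 * R powr P)\<^sup>2 * ?l powr 2 \<le> (C1 * (R powr (- (4 * \<gamma>') - 2 * \<delta>) * R powr (- (2 * \<delta>))) * ?T) * ?l powr (2 - 2 * a)"
          by (simp only: mult_ac)
        hence "?l \<le> ((C1 * (R powr (- (4 * \<gamma>') - 2 * \<delta>) * R powr (- (2 * \<delta>))) * ?T) / (C0 * R powr P)\<^sup>2) powr (1 / (2 * a))"
          by (intro powr_absorb[where m=2]) (use C0 C1 T0 R a in auto)
        also have "(C1 * (R powr (- (4 * \<gamma>') - 2 * \<delta>) * R powr (- (2 * \<delta>))) * ?T) / (C0 * R powr P)\<^sup>2 = (C1 / C0\<^sup>2) * R powr (- (4 * a)) * ?T"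
        proof -
          have 1: "R powr (- (4 * \<gamma>') - 2 * \<delta>) * R powr (- (2 * \<delta>)) = R powr (- (4 * a)) * R powr (2 * P)"
            unfolding powr_add[symmetric] using \<gamma>P by (intro arg_cong[where f="\<lambda>z. R powr z"]) linarith
          have 2: "(R powr P)\<^sup>2 = R powr (2 * P)" using R by (simp add: powr_power mult.commute)
          show ?thesis unfolding 1 power_mult_distrib 2 using R by simp
        qed
        also have "((C1 / C0\<^sup>2) * R powr (- (4 * a)) * ?T) powr (1 / (2 * a)) = (C1 / C0\<^sup>2) powr (1 / (2 * a)) * R powr (- 2) * ?T powr \<kappa>"
        proof -
          have eq: "- (4 * a) * (1 / (2 * a)) = - 2" using a by simp
          have k': "\<kappa> = 1 / (2 * a)" using k by simp
          show ?thesis by (simp only: powr_mult powr_powr k' eq)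
        qed
        also have "\<dots> \<le> C * R powr (- 2) * ?T powr \<kappa>"
          unfolding C_def by (intro mult_right_mono) auto
        finally show ?thesis .
      qed
    qed
    have "emeasure lborel E \<le> ennreal (C * R powr (- 2) * tail_size J e \<delta> R powr \<kappa>)"
    proof -
      define A where "A k = E \<inter> {- real k..real k}" for k
      have Am: "A k \<in> sets borel" for k unfolding A_def by measurable
      have "E = (\<Union>k. A k)"
      proof -
        have "\<exists>k. t \<in> {- real k..real k}" for t :: real
        proof -
          obtain k where "\<bar>t\<bar> \<le> real k" using real_arch_simple by blast
          thus ?thesis by (intro exI[of _ k]) (auto simp: abs_le_iff)
        qed
        thus ?thesis by (auto simp: A_def)
      qed
      moreover have "(SUP k. emeasure lborel (A k)) = emeasure lborel (\<Union>k. A k)"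
        by (rule SUP_emeasure_incseq) (use Am in \<open>auto simp: A_def incseq_def\<close>)
      moreover have "emeasure lborel (A k) \<le> ennreal (C * R powr (- 2) * tail_size J e \<delta> R powr \<kappa>)" for k
      proof -
        have "emeasure lborel (A k) \<le> emeasure lborel {- real k..real k}"
          by (rule emeasure_mono) (auto simp: A_def)
        also have "\<dots> < \<infinity>" by simp
        finally have fin: "emeasure lborel (A k) < \<infinity>" .
        hence "emeasure lborel (A k) = ennreal (measure lborel (A k))" by (intro emeasure_eq_ennreal_measure) simp
        also have "\<dots> \<le> ennreal (C * R powr (- 2) * tail_size J e \<delta> R powr \<kappa>)"
          by (intro ennreal_leI bound Am fin) (auto simp: A_def)
        finally show ?thesis .
      qed
      ultimately show ?thesis by (metis SUP_least)
    qed
    thus "emeasure lborel {t. \<exists>n::nat. (\<Sum>j\<in>J. (cmod (trunc_evol e s M j t (x n)))\<^sup>2) > 4 * C0 * R powr (real DIM('a) - 2 * s)}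
       \<le> ennreal (C * R powr (- 2) * tail_size J e \<delta> R powr \<kappa>)"
      by (simp add: E_def F_def lev_def P_def)
  qed
qed

text \<open>With \<rho> = (z/c)^(p/2), the number z^p is c^p times \<rho>^2, and \<rho>^2 is the
  integral of 2R over 0 < R < \<rho>. The level is parametrised by a frequency \<open>R\<close> so
  as to match \<open>level_set_bound\<close>. For infinite \<open>z\<close> the integral
  diverges.\<close>

lemma layer_cake_powr:
  fixes z :: ennreal
  assumes c: "0 < c" and p: "0 < p"
  shows "ennreal_powr z p \<le> ennreal (c powr p) * (\<integral>\<^sup>+R. ennreal (2 * R) * indicator {R. 0 < R \<and> ennreal (c * R powr (2 / p)) < z} R \<partial>lborel)"
proof -
  have aux: "ennreal (\<rho>\<^sup>2) \<le> (\<integral>\<^sup>+R. ennreal (2 * R) * indicator {R. 0 < R \<and> ennreal (c * R powr (2 / p)) < z} R \<partial>lborel)"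
    if \<rho>: "0 < \<rho>" "\<And>R. 0 < R \<Longrightarrow> R < \<rho> \<Longrightarrow> ennreal (c * R powr (2 / p)) < z" for \<rho>
  proof -
    have "(\<integral>\<^sup>+R. ennreal (R powr 1) * indicator {0..\<rho>} R \<partial>lborel) = ennreal (\<rho> powr 2 / 2)"
      using nn_integral_powr_from_0[of 1 \<rho>] \<rho>(1) by simp
    hence "ennreal 2 * ennreal (\<rho> powr 2 / 2) = (\<integral>\<^sup>+R. ennreal 2 * (ennreal (R powr 1) * indicator {0..\<rho>} R) \<partial>lborel)"
      by (subst nn_integral_cmult) auto
    moreover have "ennreal 2 * ennreal (\<rho> powr 2 / 2) = ennreal (\<rho>\<^sup>2)"
      using \<rho>(1) by (subst ennreal_mult[symmetric]) auto
    ultimately have "ennreal (\<rho>\<^sup>2) = (\<integral>\<^sup>+R. ennreal 2 * (ennreal (R powr 1) * indicator {0..\<rho>} R) \<partial>lborel)" by simp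
    also have "\<dots> = (\<integral>\<^sup>+R. ennreal (2 * R) * indicator {0<..<\<rho>} R \<partial>lborel)"
      using AE_lborel_singleton[of "0::real"] AE_lborel_singleton[of \<rho>]
      by (intro nn_integral_cong_AE, eventually_elim) (auto simp: indicator_def ennreal_mult)
    also have "\<dots> \<le> (\<integral>\<^sup>+R. ennreal (2 * R) * indicator {R. 0 < R \<and> ennreal (c * R powr (2 / p)) < z} R \<partial>lborel)"
      using \<rho>(2) by (intro nn_integral_mono) (auto simp: indicator_def)
    finally show ?thesis .
  qed
  show ?thesis
  proof (cases "z = \<infinity>")
    case True
    have sq: "ennreal ((real (Suc k))\<^sup>2) \<le> (\<integral>\<^sup>+R. ennreal (2 * R) * indicator {R. 0 < R \<and> ennreal (c * R powr (2 / p)) < z} R \<partial>lborel)" for k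
      by (rule aux) (simp_all add: True)
    have big: "ennreal (real k) \<le> (\<integral>\<^sup>+R. ennreal (2 * R) * indicator {R. 0 < R \<and> ennreal (c * R powr (2 / p)) < z} R \<partial>lborel)" for k
    proof -
      have "real k \<le> real (Suc k) * 1" by simp
      also have "\<dots> \<le> (real (Suc k))\<^sup>2" unfolding power2_eq_square by (intro mult_left_mono) auto
      finally show ?thesis by (intro order_trans[OF ennreal_leI sq[of k]])
    qed
    have "(\<integral>\<^sup>+R. ennreal (2 * R) * indicator {R. 0 < R \<and> ennreal (c * R powr (2 / p)) < z} R \<partial>lborel) = \<infinity>"
    proof (rule ccontr)
      assume "\<not> ?thesis"
      then obtain r where r: "(\<integral>\<^sup>+R. ennreal (2 * R) * indicator {R. 0 < R \<and> ennreal (c * R powr (2 / p)) < z} R \<partial>lborel) = ennreal r" "0 \<le> r"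
        by (cases "\<integral>\<^sup>+R. ennreal (2 * R) * indicator {R. 0 < R \<and> ennreal (c * R powr (2 / p)) < z} R \<partial>lborel") auto
      obtain k where "r < real k" using reals_Archimedean2 by blast
      with big[of k] r show False by (simp add: ennreal_le_iff)
    qed
    thus ?thesis using c by (simp add: ennreal_mult_top)
  next
    case False
    then obtain x where x: "z = ennreal x" "0 \<le> x" by (cases z) auto
    show ?thesis
    proof (cases "x = 0")
      case True thus ?thesis using x p by (simp add: ennreal_powr_def)
    next
      case x0: False
      define \<rho> where "\<rho> = (x / c) powr (p / 2)"
      have \<rho>0: "0 < \<rho>" using x x0 c by (simp add: \<rho>_def)
      have "ennreal (\<rho>\<^sup>2) \<le> (\<integral>\<^sup>+R. ennreal (2 * R) * indicator {R. 0 < R \<and> ennreal (c * R powr (2 / p)) < z} R \<partial>lborel)"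
      proof (rule aux[OF \<rho>0])
        fix R assume R: "0 < R" "R < \<rho>"
        have "R powr (2 / p) < \<rho> powr (2 / p)" using R p by (intro powr_less_mono2) auto
        also have "\<rho> powr (2 / p) = x / c" using p x x0 c by (simp add: \<rho>_def powr_powr)
        finally have "c * R powr (2 / p) < x" using c by (simp add: field_simps)
        thus "ennreal (c * R powr (2 / p)) < z" unfolding x(1) using c by (simp add: ennreal_less_iff)
      qed
      hence "ennreal (c powr p) * ennreal (\<rho>\<^sup>2) \<le> ennreal (c powr p) * (\<integral>\<^sup>+R. ennreal (2 * R) * indicator {R. 0 < R \<and> ennreal (c * R powr (2 / p)) < z} R \<partial>lborel)"
        by (intro mult_left_mono) auto
      moreover have "c powr p * \<rho>\<^sup>2 = x powr p"
      proof -
        have "\<rho>\<^sup>2 = (x / c) powr p" using x x0 c by (simp add: \<rho>_def powr_power)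
        thus ?thesis using x c by (simp add: powr_divide)
      qed
      hence "ennreal (c powr p) * ennreal (\<rho>\<^sup>2) = ennreal_powr z p"
        using x by (subst ennreal_mult[symmetric]) (auto simp: ennreal_powr_def)
      ultimately show ?thesis by simp
    qed
  qed
qed

text \<open>After exchanging the integrals, R^(2\<delta> - 1) is integrated up to |\<xi>| and gives
  |\<xi>|^(2\<delta>)/(2\<delta>), which cancels the spared power in \<open>hf_tail\<close>. This is
  the gain for which \<open>\<delta>\<close> was held back: all scales together cost only
  \<open>card J / (2 * \<delta>)\<close>.\<close>

lemma hf_tail_integral:
  fixes e :: "nat \<Rightarrow> 'a::euclidean_space \<Rightarrow> complex"
  assumes e: "bessel_system J e" and \<delta>: "0 < \<delta>"
  shows "(\<integral>\<^sup>+R. ennreal (R powr (2 * \<delta> - 1)) * hf_tail J e \<delta> R * indicator {0<..} R \<partial>lborel) \<le> ennreal (real (card J) / (2 * \<delta>))"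
proof -
  note eD = bessel_systemD[OF e]
  let ?u = "\<lambda>j \<xi>. ennreal (norm \<xi> powr (- (2 * \<delta>)) * (cmod (e j \<xi>))\<^sup>2)"
  let ?I = "\<lambda>R \<xi>::'a. indicator {0<..} R * indicator {0<..<norm \<xi>} R :: ennreal"
  have mI: "(\<lambda>(R, \<xi>). indicator {0<..<norm \<xi>} R :: ennreal) \<in> borel_measurable (borel \<Otimes>\<^sub>M (borel :: 'a measure))"
  proof -
    have "(\<lambda>(R, \<xi>::'a). indicator {0<..<norm \<xi>} R :: ennreal) = (\<lambda>(R, \<xi>). if 0 < R \<and> R < norm \<xi> then 1 else 0)"
      by (auto simp: indicator_def)
    thus ?thesis by simp
  qed
  have "(\<integral>\<^sup>+R. ennreal (R powr (2 * \<delta> - 1)) * hf_tail J e \<delta> R * indicator {0<..} R \<partial>lborel)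
     = (\<integral>\<^sup>+R. (\<Sum>j\<in>J. \<integral>\<^sup>+\<xi>. ?u j \<xi> * (ennreal (R powr (2 * \<delta> - 1)) * indicator {0<..<norm \<xi>} R) \<partial>lborel) \<partial>lborel)"
  proof (rule nn_integral_cong)
    fix R :: real
    show "ennreal (R powr (2 * \<delta> - 1)) * hf_tail J e \<delta> R * indicator {0<..} R
      = (\<Sum>j\<in>J. \<integral>\<^sup>+\<xi>. ?u j \<xi> * (ennreal (R powr (2 * \<delta> - 1)) * indicator {0<..<norm \<xi>} R) \<partial>lborel)"
    proof (cases "0 < R")
      case True
      have "(\<integral>\<^sup>+\<xi>. ?u j \<xi> * (ennreal (R powr (2 * \<delta> - 1)) * indicator {0<..<norm \<xi>} R) \<partial>lborel)
        = ennreal (R powr (2 * \<delta> - 1)) * (\<integral>\<^sup>+\<xi>. ?u j \<xi> * indicator {\<xi>. R < norm \<xi>} \<xi> \<partial>lborel)" if "j \<in> J" for j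
      proof -
        note [measurable] = eD(2)[OF that]
        have "(\<integral>\<^sup>+\<xi>. ?u j \<xi> * (ennreal (R powr (2 * \<delta> - 1)) * indicator {0<..<norm \<xi>} R) \<partial>lborel)
          = (\<integral>\<^sup>+\<xi>. ennreal (R powr (2 * \<delta> - 1)) * (?u j \<xi> * indicator {\<xi>. R < norm \<xi>} \<xi>) \<partial>lborel)"
          using True by (intro nn_integral_cong) (auto simp: indicator_def mult_ac)
        thus ?thesis by (simp add: nn_integral_cmult)
      qed
      thus ?thesis using True by (simp add: hf_tail_def sum_distrib_left)
    qed (auto simp: indicator_def)
  qed
  also have "\<dots> = (\<Sum>j\<in>J. \<integral>\<^sup>+R. \<integral>\<^sup>+\<xi>. ?u j \<xi> * (ennreal (R powr (2 * \<delta> - 1)) * indicator {0<..<norm \<xi>} R) \<partial>lborel \<partial>lborel)"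
  proof (rule nn_integral_sum)
    fix j assume "j \<in> J"
    note [measurable] = eD(2)[OF this] mI
    show "(\<lambda>R. \<integral>\<^sup>+\<xi>. ?u j \<xi> * (ennreal (R powr (2 * \<delta> - 1)) * indicator {0<..<norm \<xi>} R) \<partial>lborel) \<in> borel_measurable lborel"
      by measurable
  qed
  also have "\<dots> \<le> (\<Sum>j\<in>J. ennreal (1 / (2 * \<delta>)))"
  proof (rule sum_mono)
    fix j assume j: "j \<in> J"
    note [measurable] = eD(2)[OF j] mI
    have "(\<integral>\<^sup>+R. \<integral>\<^sup>+\<xi>. ?u j \<xi> * (ennreal (R powr (2 * \<delta> - 1)) * indicator {0<..<norm \<xi>} R) \<partial>lborel \<partial>lborel)
      = (\<integral>\<^sup>+\<xi>. \<integral>\<^sup>+R. ?u j \<xi> * (ennreal (R powr (2 * \<delta> - 1)) * indicator {0<..<norm \<xi>} R) \<partial>lborel \<partial>lborel)"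
      by (rule lborel_pair.Fubini') measurable
    also have "\<dots> \<le> (\<integral>\<^sup>+\<xi>. ennreal ((cmod (e j \<xi>))\<^sup>2) * ennreal (1 / (2 * \<delta>)) \<partial>lborel)"
    proof (rule nn_integral_mono)
      fix \<xi> :: 'a
      have "(\<integral>\<^sup>+R. ?u j \<xi> * (ennreal (R powr (2 * \<delta> - 1)) * indicator {0<..<norm \<xi>} R) \<partial>lborel)
         = ?u j \<xi> * (\<integral>\<^sup>+R. ennreal (R powr (2 * \<delta> - 1)) * indicator {0<..<norm \<xi>} R \<partial>lborel)"
        by (rule nn_integral_cmult) measurable
      also have "\<dots> \<le> ?u j \<xi> * (\<integral>\<^sup>+R. ennreal (R powr (2 * \<delta> - 1)) * indicator {0..norm \<xi>} R \<partial>lborel)"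
        by (intro mult_left_mono nn_integral_mono) (auto simp: indicator_def)
      also have "\<dots> = ?u j \<xi> * ennreal (norm \<xi> powr (2 * \<delta>) / (2 * \<delta>))"
        using nn_integral_powr_from_0[of "2 * \<delta> - 1" "norm \<xi>"] \<delta> by simp
      also have "\<dots> = ennreal ((norm \<xi> powr (- (2 * \<delta>)) * (cmod (e j \<xi>))\<^sup>2) * (norm \<xi> powr (2 * \<delta>) / (2 * \<delta>)))"
        using \<delta> by (intro ennreal_mult[symmetric]) auto
      also have "\<dots> \<le> ennreal ((cmod (e j \<xi>))\<^sup>2 * (1 / (2 * \<delta>)))"
      proof (rule ennreal_leI)
        \<comment> \<open>Only an inequality: at the origin the product is 0, since
          \<open>0 powr y = 0\<close>.\<close>
        have "norm \<xi> powr (- (2 * \<delta>)) * norm \<xi> powr (2 * \<delta>) \<le> 1"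
          unfolding powr_add[symmetric] by simp
        from mult_right_mono[OF this, of "(cmod (e j \<xi>))\<^sup>2 * (1 / (2 * \<delta>))"] \<delta>
        show "(norm \<xi> powr (- (2 * \<delta>)) * (cmod (e j \<xi>))\<^sup>2) * (norm \<xi> powr (2 * \<delta>) / (2 * \<delta>)) \<le> (cmod (e j \<xi>))\<^sup>2 * (1 / (2 * \<delta>))"
          by (simp add: mult_ac)
      qed
      also have "\<dots> = ennreal ((cmod (e j \<xi>))\<^sup>2) * ennreal (1 / (2 * \<delta>))" using \<delta> by (intro ennreal_mult) auto
      finally show "(\<integral>\<^sup>+R. ?u j \<xi> * (ennreal (R powr (2 * \<delta> - 1)) * indicator {0<..<norm \<xi>} R) \<partial>lborel) \<le> ennreal ((cmod (e j \<xi>))\<^sup>2) * ennreal (1 / (2 * \<delta>))" .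
    qed
    also have "\<dots> = (\<integral>\<^sup>+\<xi>. ennreal ((cmod (e j \<xi>))\<^sup>2) \<partial>lborel) * ennreal (1 / (2 * \<delta>))"
      by (rule nn_integral_multc) measurable
    also have "\<dots> \<le> 1 * ennreal (1 / (2 * \<delta>))" by (intro mult_right_mono eD(4)[OF j]) simp
    finally show "(\<integral>\<^sup>+R. \<integral>\<^sup>+\<xi>. ?u j \<xi> * (ennreal (R powr (2 * \<delta> - 1)) * indicator {0<..<norm \<xi>} R) \<partial>lborel \<partial>lborel) \<le> ennreal (1 / (2 * \<delta>))" by simp
  qed
  also have "\<dots> = ennreal (real (card J) / (2 * \<delta>))"
    using \<delta> by (simp add: ennreal_of_nat_eq_real_of_nat ennreal_mult[symmetric])
  finally show ?thesis .
qed

text \<open>Fatou's lemma for indicators of level sets. The strict inequality matters: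
  \<open>y\<close> below the lower limit implies \<open>y < H i t\<close> for all large
  \<open>i\<close>.\<close>

lemma emeasure_liminf_level_le:
  fixes H :: "nat \<Rightarrow> 'b \<Rightarrow> ennreal"
  assumes [measurable]: "\<And>i. H i \<in> borel_measurable M" and K: "\<And>i. emeasure M {t \<in> space M. y < H i t} \<le> K"
  shows "emeasure M {t \<in> space M. y < liminf (\<lambda>i. H i t)} \<le> K"
proof -
  have "emeasure M {t \<in> space M. y < liminf (\<lambda>i. H i t)} = (\<integral>\<^sup>+t. indicator {t \<in> space M. y < liminf (\<lambda>i. H i t)} t \<partial>M)"
    by (rule nn_integral_indicator[symmetric]) measurable
  also have "\<dots> \<le> (\<integral>\<^sup>+t. liminf (\<lambda>i. indicator {t \<in> space M. y < H i t} t) \<partial>M)"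
  proof (rule nn_integral_mono)
    fix t assume t: "t \<in> space M"
    show "indicator {t \<in> space M. y < liminf (\<lambda>i. H i t)} t \<le> liminf (\<lambda>i. indicator {t \<in> space M. y < H i t} t :: ennreal)"
    proof (cases "y < liminf (\<lambda>i. H i t)")
      case True
      hence "\<forall>\<^sub>F i in sequentially. y < H i t" by (rule less_LiminfD)
      hence "\<forall>\<^sub>F i in sequentially. (1::ennreal) \<le> indicator {t \<in> space M. y < H i t} t"
        by eventually_elim (use t in simp)
      hence "1 \<le> liminf (\<lambda>i. indicator {t \<in> space M. y < H i t} t :: ennreal)" by (rule Liminf_bounded)
      thus ?thesis using True t by simp
    qed simp
  qed
  also have "\<dots> \<le> liminf (\<lambda>i. \<integral>\<^sup>+t. indicator {t \<in> space M. y < H i t} t \<partial>M)"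
    by (rule nn_integral_liminf) measurable
  also have "\<dots> = liminf (\<lambda>i. emeasure M {t \<in> space M. y < H i t})" by (subst nn_integral_indicator) auto
  also have "\<dots> \<le> liminf (\<lambda>i::nat. K)" by (intro Liminf_mono always_eventually allI K)
  finally show ?thesis by (simp add: Liminf_const)
qed

text \<open>Write N for \<open>card J\<close> and T(R) for \<open>tail_size\<close>. The level-set
  bound in the layer cake formula leaves the integral of T(R)^\<kappa> against dR/R. Since T(R)
  \<le> N and \<kappa> \<ge> 1, the integrand is at most N^(\<kappa> - 1) T(R), and the integral of
  T(R) is bounded by \<open>hf_tail_integral\<close>.\<close>

lemma truncated_maximal_estimate:
  fixes s a \<delta> \<kappa> p :: real
  assumes s: "0 < s" "2 * s < real DIM('a::euclidean_space)" and p: "2 / p = real DIM('a) - 2 * s"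
    and a: "0 < a" "a < 1" "a \<le> real DIM('a) / 2" "1 / p < a"
    and \<kappa>: "\<kappa> = 1 / a \<or> (2 * a < 1 \<and> \<kappa> = 1 / (2 * a))"
  shows "\<exists>C>0. \<forall>J (e :: nat \<Rightarrow> 'a \<Rightarrow> complex) M x. bessel_system J e \<and> (\<forall>i. 0 < M i) \<longrightarrow>
    (\<integral>\<^sup>+t. ennreal_powr (liminf (\<lambda>i::nat. SUP n::nat. ennreal (\<Sum>j\<in>J. (cmod (trunc_evol e s (M i) j t (x n)))\<^sup>2))) p \<partial>lborel)
     \<le> ennreal (C * real (card J) powr \<kappa>)"
proof -
  \<comment> \<open>Below \<open>s\<close> because the Gaussian multiplier uses the order
    \<open>s - \<delta>\<close>, and below \<open>a - 1 / p\<close> so that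
    \<open>s - \<delta> - d/2 + a\<close>, which equals \<open>a - 1/p - \<delta>\<close>, is
    positive.\<close>
  define \<delta> where "\<delta> = min s (a - 1 / p) / 2"
  have \<delta>: "0 < \<delta>" "\<delta> < s" "\<delta> < a - 1 / p" using s a by (auto simp: \<delta>_def min_def)
  have p0: "0 < p"
  proof -
    have "0 < 2 / p" using s p by simp
    thus ?thesis by (simp add: zero_less_divide_iff)
  qed
  have p': "1 / p = real DIM('a) / 2 - s" using p by (simp add: field_simps)
  have \<gamma>: "0 < s - \<delta> - real DIM('a) / 2 + a" using \<delta>(3) p' by linarith
  have \<kappa>1: "1 \<le> \<kappa>" using \<kappa> a by auto
  obtain C0 C1 where C: "C0 > 0" "C1 > 0" and lev:
    "\<And>J (e :: nat \<Rightarrow> 'a \<Rightarrow> complex) R M x. bessel_system J e \<Longrightarrow> 0 < R \<Longrightarrow> 0 < M \<Longrightarrow>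
     emeasure lborel {t. \<exists>n::nat. (\<Sum>j\<in>J. (cmod (trunc_evol e s M j t (x n)))\<^sup>2) > 4 * C0 * R powr (real DIM('a) - 2 * s)}
       \<le> ennreal (C1 * R powr (- 2) * tail_size J e \<delta> R powr \<kappa>)"
    by (rule level_set_bound[OF s a(1-3) \<delta>(1,2) \<gamma> \<kappa>]) blast
  define c where "c = 4 * C0"
  have c: "0 < c" using C by (simp add: c_def)
  define C' where "C' = c powr p * (2 * C1 / (2 * \<delta>))"
  have C': "0 < C'" using c C \<delta> by (simp add: C'_def)
  show ?thesis
  proof (intro exI[of _ C'] conjI C' allI impI; elim conjE)
    fix J and e :: "nat \<Rightarrow> 'a \<Rightarrow> complex" and M :: "nat \<Rightarrow> real" and x :: "nat \<Rightarrow> 'a"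
    assume e: "bessel_system J e" and "\<forall>i. 0 < M i"
    hence M: "0 < M i" for i by auto
    note eD = bessel_systemD[OF e]
    define H where "H i t = (SUP n::nat. ennreal (\<Sum>j\<in>J. (cmod (trunc_evol e s (M i) j t (x n)))\<^sup>2))" for i t
    define z where "z t = liminf (\<lambda>i::nat. H i t)" for t
    have Fm: "(\<lambda>t. \<Sum>j\<in>J. (cmod (trunc_evol e s (M i) j t (x n)))\<^sup>2) \<in> borel_measurable borel" for i n
      unfolding trunc_evol_def using eD(2) by measurable
    have [measurable]: "H i \<in> borel_measurable borel" for i
      unfolding H_def by (intro borel_measurable_SUP measurable_compose[OF Fm measurable_ennreal]) simp
    have [measurable]: "z \<in> borel_measurable borel" unfolding z_def by measurable
    have level: "emeasure lborel {t. ennreal (c * R powr (2 / p)) < z t} \<le> ennreal (C1 * R powr (- 2) * tail_size J e \<delta> R powr \<kappa>)" if R: "0 < R" for R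
    proof -
      have "emeasure lborel {t \<in> space lborel. ennreal (c * R powr (2 / p)) < liminf (\<lambda>i. H i t)} \<le> ennreal (C1 * R powr (- 2) * tail_size J e \<delta> R powr \<kappa>)"
      proof (rule emeasure_liminf_level_le)
        fix i
        have "{t \<in> space lborel. ennreal (c * R powr (2 / p)) < H i t} = {t. \<exists>n::nat. (\<Sum>j\<in>J. (cmod (trunc_evol e s (M i) j t (x n)))\<^sup>2) > 4 * C0 * R powr (real DIM('a) - 2 * s)}"
          using c unfolding H_def less_SUP_iff p[symmetric] by (auto simp: ennreal_less_iff c_def)
        thus "emeasure lborel {t \<in> space lborel. ennreal (c * R powr (2 / p)) < H i t} \<le> ennreal (C1 * R powr (- 2) * tail_size J e \<delta> R powr \<kappa>)"
          using lev[OF e R M] by simp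
      qed measurable
      thus ?thesis by (simp add: z_def)
    qed
    have "(\<integral>\<^sup>+t. ennreal_powr (z t) p \<partial>lborel) \<le> (\<integral>\<^sup>+t. ennreal (c powr p) * (\<integral>\<^sup>+R. ennreal (2 * R) * indicator {R. 0 < R \<and> ennreal (c * R powr (2 / p)) < z t} R \<partial>lborel) \<partial>lborel)"
      by (intro nn_integral_mono layer_cake_powr c p0)
    also have "\<dots> = (\<integral>\<^sup>+t. ennreal (c powr p) * (\<integral>\<^sup>+R. (if 0 < R \<and> ennreal (c * R powr (2 / p)) < z t then ennreal (2 * R) else 0) \<partial>lborel) \<partial>lborel)"
      by (intro nn_integral_cong arg_cong2[where f="(*)"] refl) (auto simp: indicator_def)
    also have "\<dots> = ennreal (c powr p) * (\<integral>\<^sup>+t. \<integral>\<^sup>+R. (if 0 < R \<and> ennreal (c * R powr (2 / p)) < z t then ennreal (2 * R) else 0) \<partial>lborel \<partial>lborel)"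
      by (rule nn_integral_cmult) measurable
    also have "(\<integral>\<^sup>+t. \<integral>\<^sup>+R. (if 0 < R \<and> ennreal (c * R powr (2 / p)) < z t then ennreal (2 * R) else 0) \<partial>lborel \<partial>lborel)
      = (\<integral>\<^sup>+R. \<integral>\<^sup>+t. (if 0 < R \<and> ennreal (c * R powr (2 / p)) < z t then ennreal (2 * R) else 0) \<partial>lborel \<partial>lborel)"
      by (rule lborel_pair.Fubini') measurable
    also have "\<dots> = (\<integral>\<^sup>+R. indicator {0<..} R * (ennreal (2 * R) * emeasure lborel {t. ennreal (c * R powr (2 / p)) < z t}) \<partial>lborel)"
    proof (rule nn_integral_cong)
      fix R :: real
      have "(\<integral>\<^sup>+t. (if 0 < R \<and> ennreal (c * R powr (2 / p)) < z t then ennreal (2 * R) else 0) \<partial>lborel)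
         = (\<integral>\<^sup>+t. (indicator {0<..} R * ennreal (2 * R)) * indicator {t. ennreal (c * R powr (2 / p)) < z t} t \<partial>lborel)"
        by (intro nn_integral_cong) (auto simp: indicator_def)
      also have "\<dots> = (indicator {0<..} R * ennreal (2 * R)) * emeasure lborel {t. ennreal (c * R powr (2 / p)) < z t}"
        by (rule nn_integral_cmult_indicator) measurable
      finally show "(\<integral>\<^sup>+t. (if 0 < R \<and> ennreal (c * R powr (2 / p)) < z t then ennreal (2 * R) else 0) \<partial>lborel) = indicator {0<..} R * (ennreal (2 * R) * emeasure lborel {t. ennreal (c * R powr (2 / p)) < z t})"
        by (simp add: mult.assoc)
    qed
    also have "\<dots> \<le> (\<integral>\<^sup>+R. ennreal (2 * C1 * real (card J) powr (\<kappa> - 1)) * (ennreal (R powr (2 * \<delta> - 1)) * hf_tail J e \<delta> R * indicator {0<..} R) \<partial>lborel)"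
    proof (rule nn_integral_mono)
      fix R :: real
      show "indicator {0<..} R * (ennreal (2 * R) * emeasure lborel {t. ennreal (c * R powr (2 / p)) < z t})
        \<le> ennreal (2 * C1 * real (card J) powr (\<kappa> - 1)) * (ennreal (R powr (2 * \<delta> - 1)) * hf_tail J e \<delta> R * indicator {0<..} R)"
      proof (cases "0 < R")
        case R: True
        let ?T = "tail_size J e \<delta> R"
        have T: "0 \<le> ?T" "?T \<le> real (card J)"
          using tail_size_nonneg tail_size_le[OF e R] \<delta> by auto
        have "?T powr \<kappa> \<le> real (card J) powr (\<kappa> - 1) * ?T"
        proof (cases "?T = 0")
          case False
          hence "?T powr \<kappa> = ?T powr (\<kappa> - 1) * ?T powr 1" using powr_add[of ?T "\<kappa> - 1" 1] by simp
          also have "\<dots> \<le> real (card J) powr (\<kappa> - 1) * ?T powr 1" using T \<kappa>1 by (intro mult_right_mono powr_mono2) auto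
          finally show ?thesis using T by simp
        qed simp
        hence "C1 * R powr (- 2) * ?T powr \<kappa> \<le> C1 * R powr (- 2) * (real (card J) powr (\<kappa> - 1) * ?T)"
          using C by (intro mult_left_mono) auto
        hence "emeasure lborel {t. ennreal (c * R powr (2 / p)) < z t} \<le> ennreal (C1 * R powr (- 2) * (real (card J) powr (\<kappa> - 1) * ?T))"
          using order_trans[OF level[OF R] ennreal_leI] by blast
        hence "ennreal (2 * R) * emeasure lborel {t. ennreal (c * R powr (2 / p)) < z t} \<le> ennreal (2 * R) * ennreal (C1 * R powr (- 2) * (real (card J) powr (\<kappa> - 1) * ?T))"
          by (intro mult_left_mono) auto
        also have "\<dots> = ennreal (2 * R * (C1 * R powr (- 2) * (real (card J) powr (\<kappa> - 1) * ?T)))"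
          using R C T by (intro ennreal_mult[symmetric]) auto
        also have "2 * R * (C1 * R powr (- 2) * (real (card J) powr (\<kappa> - 1) * ?T)) = (2 * C1 * real (card J) powr (\<kappa> - 1)) * (R powr (2 * \<delta> - 1) * (R powr (- (2 * \<delta>)) * ?T))"
        proof -
          have "R powr (2 * \<delta> - 1) * R powr (- (2 * \<delta>)) = R powr (- 1)" by (simp add: powr_add[symmetric])
          moreover have "R * R powr (- 2) = R powr (- 1)" using R powr_add[of R 1 "- 2"] by simp
          ultimately have eq: "R * R powr (- 2) = R powr (2 * \<delta> - 1) * R powr (- (2 * \<delta>))" by (simp only:)
          have "2 * R * (C1 * R powr (- 2) * (real (card J) powr (\<kappa> - 1) * ?T)) = (2 * C1 * real (card J) powr (\<kappa> - 1)) * ((R * R powr (- 2)) * ?T)"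
            by (simp only: mult_ac)
          thus ?thesis unfolding eq by (simp only: mult.assoc)
        qed
        also have "ennreal \<dots> = ennreal (2 * C1 * real (card J) powr (\<kappa> - 1)) * (ennreal (R powr (2 * \<delta> - 1)) * hf_tail J e \<delta> R)"
          unfolding hf_tail_eq[OF e R less_imp_le[OF \<delta>(1)]] using C T
          by (simp add: ennreal_mult[symmetric])
        finally show ?thesis using R by simp
      qed simp
    qed
    also have "\<dots> = ennreal (2 * C1 * real (card J) powr (\<kappa> - 1)) * (\<integral>\<^sup>+R. ennreal (R powr (2 * \<delta> - 1)) * hf_tail J e \<delta> R * indicator {0<..} R \<partial>lborel)"
    proof (rule nn_integral_cmult)
      have "hf_tail J e \<delta> \<in> borel_measurable borel"
        unfolding hf_tail_def
      proof (rule borel_measurable_sum)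
        fix j assume "j \<in> J"
        note [measurable] = eD(2)[OF this]
        have eq: "(\<lambda>R. \<integral>\<^sup>+\<xi>. ennreal (norm \<xi> powr (- (2 * \<delta>)) * (cmod (e j \<xi>))\<^sup>2) * indicator {\<xi>. R < norm \<xi>} \<xi> \<partial>lborel)
          = (\<lambda>R. \<integral>\<^sup>+\<xi>. (if R < norm \<xi> then ennreal (norm \<xi> powr (- (2 * \<delta>)) * (cmod (e j \<xi>))\<^sup>2) else 0) \<partial>lborel)"
          by (intro ext nn_integral_cong) (auto simp: indicator_def)
        show "(\<lambda>R. \<integral>\<^sup>+\<xi>. ennreal (norm \<xi> powr (- (2 * \<delta>)) * (cmod (e j \<xi>))\<^sup>2) * indicator {\<xi>. R < norm \<xi>} \<xi> \<partial>lborel) \<in> borel_measurable borel"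
          unfolding eq by measurable
      qed
      thus "(\<lambda>R. ennreal (R powr (2 * \<delta> - 1)) * hf_tail J e \<delta> R * indicator {0<..} R) \<in> borel_measurable lborel" by simp
    qed
    also have "\<dots> \<le> ennreal (2 * C1 * real (card J) powr (\<kappa> - 1)) * ennreal (real (card J) / (2 * \<delta>))"
      by (intro mult_left_mono hf_tail_integral[OF e \<delta>(1)]) simp
    finally have "(\<integral>\<^sup>+t. ennreal_powr (z t) p \<partial>lborel) \<le> ennreal (c powr p) * (ennreal (2 * C1 * real (card J) powr (\<kappa> - 1)) * ennreal (real (card J) / (2 * \<delta>)))"
      by (simp add: mult_left_mono)
    also have "\<dots> = ennreal (c powr p * ((2 * C1 * real (card J) powr (\<kappa> - 1)) * (real (card J) / (2 * \<delta>))))"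
      using C \<delta> by (simp add: ennreal_mult[symmetric])
    also have "c powr p * ((2 * C1 * real (card J) powr (\<kappa> - 1)) * (real (card J) / (2 * \<delta>))) = C' * real (card J) powr \<kappa>"
    proof -
      have "real (card J) powr (\<kappa> - 1) * real (card J) = real (card J) powr \<kappa>"
        using powr_add[of "real (card J)" "\<kappa> - 1" 1] by simp
      thus ?thesis by (simp add: C'_def mult_ac)
    qed
    finally show "(\<integral>\<^sup>+t. ennreal_powr (liminf (\<lambda>i::nat. SUP n::nat. ennreal (\<Sum>j\<in>J. (cmod (trunc_evol e s (M i) j t (x n)))\<^sup>2))) p \<partial>lborel)
     \<le> ennreal (C' * real (card J) powr \<kappa>)"
      by (simp add: z_def H_def)
  qed
qed

section \<open>Gaussians as test functions\<close>

text \<open>Polynomial factors make the class closed under differentiation: each partial derivative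
  of a polynomial multiple of a \<open>gauss_wave\<close> is again such a multiple of the same
  wave.\<close>

inductive poly_fun :: "('a::euclidean_space \<Rightarrow> complex) \<Rightarrow> bool" where
  const: "poly_fun (\<lambda>x. c)"
| inner: "poly_fun (\<lambda>x. of_real (x \<bullet> b))"
| add: "poly_fun P \<Longrightarrow> poly_fun Q \<Longrightarrow> poly_fun (\<lambda>x. P x + Q x)"
| mult: "poly_fun P \<Longrightarrow> poly_fun Q \<Longrightarrow> poly_fun (\<lambda>x. P x * Q x)"

lemma poly_fun_derivative:
  assumes "poly_fun P"
  shows "\<exists>D. (\<forall>x. (P has_derivative D x) (at x)) \<and> (\<forall>b. poly_fun (\<lambda>x. D x b))"
  using assms
proof induction
  case (const c)
  show ?case by (intro exI[of _ "\<lambda>x h. 0"]) (auto intro: poly_fun.const)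
next
  case (inner b)
  have "((\<lambda>x. complex_of_real (x \<bullet> b)) has_derivative (\<lambda>h. of_real (h \<bullet> b))) (at x)" for x
    by (auto intro!: derivative_eq_intros)
  thus ?case by (intro exI[of _ "\<lambda>x h. of_real (h \<bullet> b)"]) (auto intro: poly_fun.const)
next
  case (add P Q)
  then obtain D E where "\<And>x. (P has_derivative D x) (at x)" "\<And>b. poly_fun (\<lambda>x. D x b)"
    "\<And>x. (Q has_derivative E x) (at x)" "\<And>b. poly_fun (\<lambda>x. E x b)" by blast
  thus ?case by (intro exI[of _ "\<lambda>x h. D x h + E x h"]) (auto intro: poly_fun.add has_derivative_add)
next
  case (mult P Q)
  then obtain D E where *: "\<And>x. (P has_derivative D x) (at x)" "\<And>b. poly_fun (\<lambda>x. D x b)"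
    "\<And>x. (Q has_derivative E x) (at x)" "\<And>b. poly_fun (\<lambda>x. E x b)" by blast
  show ?case
    by (intro exI[of _ "\<lambda>x h. P x * E x h + D x h * Q x"] conjI allI has_derivative_mult * poly_fun.add poly_fun.mult mult)
qed

lemma poly_fun_bound:
  assumes "poly_fun (P :: 'a::euclidean_space \<Rightarrow> complex)"
  shows "\<exists>C n. \<forall>x. cmod (P x) \<le> C * (1 + norm x) ^ n"
  using assms
proof induction
  case (const c)
  show ?case by (intro exI[of _ "cmod c"] exI[of _ 0]) simp
next
  case (inner b)
  have "cmod (of_real (x \<bullet> b)) \<le> norm b * (1 + norm x) ^ 1" for x :: 'a
  proof -
    have "\<bar>x \<bullet> b\<bar> \<le> norm b * norm x" using Cauchy_Schwarz_ineq2[of x b] by (simp add: mult.commute)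
    also have "\<dots> \<le> norm b * (1 + norm x) ^ 1" by (simp add: mult_left_mono)
    finally show ?thesis by simp
  qed
  thus ?case by blast
next
  case (add P Q)
  then obtain C n D m where *: "\<And>x. cmod (P x) \<le> C * (1 + norm x) ^ n" "\<And>x. cmod (Q x) \<le> D * (1 + norm x) ^ m" by blast
  have C0: "0 \<le> C" using order_trans[OF norm_ge_zero *(1)[of 0]] by simp
  have D0: "0 \<le> D" using order_trans[OF norm_ge_zero *(2)[of 0]] by simp
  have "cmod (P x + Q x) \<le> (C + D) * (1 + norm x) ^ (n + m)" for x
  proof -
    have "cmod (P x + Q x) \<le> C * (1 + norm x) ^ n + D * (1 + norm x) ^ m"
      by (rule order_trans[OF norm_triangle_ineq add_mono[OF *]])
    also have "\<dots> \<le> C * (1 + norm x) ^ (n + m) + D * (1 + norm x) ^ (n + m)"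
      by (intro add_mono mult_left_mono power_increasing C0 D0) auto
    finally show ?thesis by (simp add: distrib_right)
  qed
  thus ?case by blast
next
  case (mult P Q)
  then obtain C n D m where *: "\<And>x. cmod (P x) \<le> C * (1 + norm x) ^ n" "\<And>x. cmod (Q x) \<le> D * (1 + norm x) ^ m" by blast
  have C0: "0 \<le> C" using order_trans[OF norm_ge_zero *(1)[of 0]] by simp
  have "cmod (P x * Q x) \<le> (C * D) * (1 + norm x) ^ (n + m)" for x
  proof -
    have "cmod (P x * Q x) \<le> (C * (1 + norm x) ^ n) * (D * (1 + norm x) ^ m)"
      unfolding norm_mult by (intro mult_mono *) (use C0 in auto)
    thus ?thesis by (simp add: power_add mult_ac)
  qed
  thus ?case by blast
qed

text \<open>One family contains both kinds of test functions: modulated Gaussians for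
  \<open>c = 0\<close> and, up to a constant, translated heat kernels for
  \<open>y = 0\<close>.\<close>

definition gauss_wave :: "real \<Rightarrow> 'a::euclidean_space \<Rightarrow> 'a \<Rightarrow> 'a \<Rightarrow> complex" where
  "gauss_wave a c y x = exp (\<i> * of_real (x \<bullet> y) - of_real (a * ((x - c) \<bullet> (x - c))))"

lemma gauss_wave_derivative:
  "(gauss_wave a c y has_derivative (\<lambda>h. (\<i> * of_real (h \<bullet> y) - of_real (2 * a * ((x - c) \<bullet> h))) * gauss_wave a c y x)) (at x)"
proof -
  have "((\<lambda>x. \<i> * of_real (x \<bullet> y) - complex_of_real (a * ((x - c) \<bullet> (x - c)))) has_derivative
     (\<lambda>h. \<i> * of_real (h \<bullet> y) - of_real (2 * a * ((x - c) \<bullet> h)))) (at x)"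
    by (auto intro!: derivative_eq_intros simp: inner_commute)
  from has_derivative_compose[OF this DERIV_exp[unfolded has_field_derivative_def]] show ?thesis
    unfolding gauss_wave_def by (simp only: mult.commute)
qed

lemma iter_partial_gauss_wave:
  assumes "poly_fun P"
  shows "\<exists>Q. poly_fun Q \<and> iter_partial bs (\<lambda>x. P x * gauss_wave a c y x) = (\<lambda>x. Q x * gauss_wave a c y x)"
proof (induction bs)
  case Nil thus ?case using assms by auto
next
  case (Cons b bs)
  then obtain Q where Q: "poly_fun Q" "iter_partial bs (\<lambda>x. P x * gauss_wave a c y x) = (\<lambda>x. Q x * gauss_wave a c y x)" by blast
  obtain D where D: "\<And>x. (Q has_derivative D x) (at x)" "\<And>b. poly_fun (\<lambda>x. D x b)"
    using poly_fun_derivative[OF Q(1)] by blast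
  define L where "L x = \<i> * of_real (b \<bullet> y) - of_real (2 * a * ((x - c) \<bullet> b))" for x
  have L: "poly_fun L"
  proof -
    have "L = (\<lambda>x. (\<i> * of_real (b \<bullet> y) + of_real (2 * a * (c \<bullet> b))) + of_real (- 2 * a) * of_real (x \<bullet> b))"
      by (auto simp: L_def inner_diff_left algebra_simps)
    thus ?thesis by (simp only:) (intro poly_fun.intros)
  qed
  have "((\<lambda>x. Q x * gauss_wave a c y x) has_derivative
      (\<lambda>h. Q x * ((\<i> * of_real (h \<bullet> y) - of_real (2 * a * ((x - c) \<bullet> h))) * gauss_wave a c y x) + D x h * gauss_wave a c y x)) (at x)" for x
    by (rule has_derivative_mult[OF D(1) gauss_wave_derivative])
  from frechet_derivative_at[OF this]
  have "iter_partial (b # bs) (\<lambda>x. P x * gauss_wave a c y x) = (\<lambda>x. (Q x * L x + D x b) * gauss_wave a c y x)"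
    unfolding iter_partial.simps Q(2) by (auto simp: fun_eq_iff L_def algebra_simps dest: sym)
  moreover have "poly_fun (\<lambda>x. Q x * L x + D x b)" by (intro poly_fun.add poly_fun.mult Q(1) L D(2))
  ultimately show ?case by blast
qed

lemma norm_gauss_wave: "cmod (gauss_wave a c y x) = exp (- a * (norm (x - c))\<^sup>2)"
  by (simp add: gauss_wave_def power2_norm_eq_inner)

text \<open>From v \<le> exp(v) with v = (1 + u)/m the power is at most m^m exp(1 + u), and
  completing the square bounds u - a u^2 by 1/(4a).\<close>

lemma power_mult_gauss_bounded:
  assumes a: "0 < a"
  shows "\<exists>B. \<forall>u\<ge>0. (1 + u) ^ m * exp (- a * u\<^sup>2) \<le> (B::real)"
proof (cases "m = 0")
  case True
  thus ?thesis using a by (intro exI[of _ 1]) auto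
next
  case False
  show ?thesis
  proof (intro exI allI impI)
    fix u :: real assume u: "0 \<le> u"
    have "(1 + u) / m \<le> exp ((1 + u) / m)"
      using exp_ge_add_one_self[of "(1 + u) / m"] by linarith
    hence "((1 + u) / m) ^ m \<le> exp ((1 + u) / m) ^ m" using u by (intro power_mono) auto
    also have "\<dots> = exp (1 + u)" using False by (simp add: exp_of_nat_mult[symmetric])
    finally have "(1 + u) ^ m \<le> real m ^ m * exp (1 + u)" using False by (simp add: power_divide field_simps)
    hence "(1 + u) ^ m * exp (- a * u\<^sup>2) \<le> real m ^ m * exp (1 + u) * exp (- a * u\<^sup>2)" by (intro mult_right_mono) auto
    also have "\<dots> = real m ^ m * exp (1 + u - a * u\<^sup>2)" by (simp add: mult.assoc exp_add[symmetric])
    also have "\<dots> \<le> real m ^ m * exp (1 + 1 / (4 * a))"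
    proof -
      have "0 \<le> (2 * a * u - 1)\<^sup>2" by simp
      hence "4 * a * u - 4 * a * (a * u\<^sup>2) \<le> 1" by (simp add: power2_eq_square algebra_simps)
      hence "u - a * u\<^sup>2 \<le> 1 / (4 * a)" using a by (simp add: field_simps)
      thus ?thesis by (intro mult_left_mono) auto
    qed
    finally show "(1 + u) ^ m * exp (- a * u\<^sup>2) \<le> real m ^ m * exp (1 + 1 / (4 * a))" .
  qed
qed

lemma schwartz_gauss_wave:
  fixes c y :: "'a::euclidean_space"
  assumes a: "0 < a" and P: "poly_fun P"
  shows "schwartz (\<lambda>x. P x * gauss_wave a c y x)"
  unfolding schwartz_def
proof (intro allI impI conjI)
  fix bs :: "'a list"
  obtain Q where Q: "poly_fun Q" "iter_partial bs (\<lambda>x. P x * gauss_wave a c y x) = (\<lambda>x. Q x * gauss_wave a c y x)"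
    using iter_partial_gauss_wave[OF P] by blast
  show "iter_partial bs (\<lambda>x. P x * gauss_wave a c y x) differentiable at x" for x
  proof -
    obtain D where "\<And>x. (Q has_derivative D x) (at x)" using poly_fun_derivative[OF Q(1)] by blast
    from has_derivative_mult[OF this gauss_wave_derivative] show ?thesis
      unfolding Q(2) differentiable_def by blast
  qed
  fix k :: nat
  obtain C n where C: "\<And>x. cmod (Q x) \<le> C * (1 + norm x) ^ n" using poly_fun_bound[OF Q(1)] by blast
  have C0: "0 \<le> C" using order_trans[OF norm_ge_zero C[of 0]] by simp
  obtain B where B: "\<And>u. 0 \<le> u \<Longrightarrow> (1 + u) ^ (k + n) * exp (- a * u\<^sup>2) \<le> B"
    using power_mult_gauss_bounded[OF a] by blast
  show "\<exists>M. \<forall>x. norm x ^ k * cmod (iter_partial bs (\<lambda>x. P x * gauss_wave a c y x) x) \<le> M"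
  proof (intro exI allI)
    fix x :: 'a
    \<comment> \<open>The aim is \<open>1 + norm x \<le> (1 + norm c) * (1 + norm (x - c))\<close>,
      which moves the polynomial growth to the centre of the Gaussian.\<close>
    have "0 \<le> norm c * norm (x - c)" by simp
    hence "1 + norm x \<le> 1 + norm (x - c) + norm c + norm c * norm (x - c)"
      using norm_triangle_ineq[of "x - c" c] unfolding diff_add_cancel by linarith
    also have "\<dots> = (1 + norm c) * (1 + norm (x - c))" by (simp add: algebra_simps)
    finally have "1 + norm x \<le> (1 + norm c) * (1 + norm (x - c))" .
    hence pw: "(1 + norm x) ^ (k + n) \<le> (1 + norm c) ^ (k + n) * (1 + norm (x - c)) ^ (k + n)"
      unfolding power_mult_distrib[symmetric] by (intro power_mono) auto
    have "norm x ^ k * cmod (Q x * gauss_wave a c y x) \<le> (1 + norm x) ^ k * ((C * (1 + norm x) ^ n) * exp (- a * (norm (x - c))\<^sup>2))"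
      unfolding norm_mult norm_gauss_wave by (intro mult_mono power_mono C) (use C0 in auto)
    also have "\<dots> = C * ((1 + norm x) ^ (k + n) * exp (- a * (norm (x - c))\<^sup>2))" by (simp add: power_add mult_ac)
    also have "\<dots> \<le> C * (((1 + norm c) ^ (k + n) * (1 + norm (x - c)) ^ (k + n)) * exp (- a * (norm (x - c))\<^sup>2))"
      by (intro mult_left_mono mult_right_mono pw C0) auto
    also have "\<dots> = C * (1 + norm c) ^ (k + n) * ((1 + norm (x - c)) ^ (k + n) * exp (- a * (norm (x - c))\<^sup>2))"
      by (simp only: mult.assoc)
    also have "\<dots> \<le> C * (1 + norm c) ^ (k + n) * B" by (intro mult_left_mono B) (use C0 in auto)
    finally show "norm x ^ k * cmod (iter_partial bs (\<lambda>x. P x * gauss_wave a c y x) x) \<le> C * (1 + norm c) ^ (k + n) * B"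
      unfolding Q(2) .
  qed
qed

lemma schwartz_gauss_cis:
  assumes "0 < \<epsilon>"
  shows "schwartz (\<lambda>\<xi>. cis (\<xi> \<bullet> y) * of_real (exp (- \<epsilon> * (norm \<xi>)\<^sup>2)))"
proof -
  have "(\<lambda>\<xi>. cis (\<xi> \<bullet> y) * of_real (exp (- \<epsilon> * (norm \<xi>)\<^sup>2))) = (\<lambda>\<xi>. 1 * gauss_wave \<epsilon> 0 y \<xi>)"
    by (auto simp: gauss_wave_def cis_conv_exp exp_diff exp_minus power2_norm_eq_inner divide_inverse exp_of_real simp del: of_real_mult)
  thus ?thesis using schwartz_gauss_wave[OF assms poly_fun.const[of 1], of 0 y] by simp
qed

lemma schwartz_heat:
  assumes "0 < \<epsilon>"
  shows "schwartz (\<lambda>\<xi>::'a::euclidean_space. complex_of_real (heat \<epsilon> (\<xi> - y)))"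
proof -
  have "(\<lambda>\<xi>::'a. complex_of_real (heat \<epsilon> (\<xi> - y))) = (\<lambda>\<xi>. of_real ((4 * pi * \<epsilon>) powr (- (DIM('a) / 2))) * gauss_wave (1 / (4 * \<epsilon>)) y 0 \<xi>)"
    by (auto simp: gauss_wave_def heat_def power2_norm_eq_inner exp_of_real[symmetric])
  thus ?thesis using schwartz_gauss_wave[OF _ poly_fun.const, of "1 / (4 * \<epsilon>)" _ y 0] assms by simp
qed

lemma cis_heat_integral:
  fixes x y :: "'a::euclidean_space"
  assumes e: "0 < \<epsilon>"
  shows "(\<integral>\<xi>. cis (\<xi> \<bullet> x) * of_real (heat \<epsilon> (\<xi> - y)) \<partial>lborel) = cis (x \<bullet> y) * of_real (exp (- \<epsilon> * (norm x)\<^sup>2))"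
proof -
  let ?k = "(4 * pi * \<epsilon>) powr (- (real DIM('a) / 2))"
  have p: "0 < 1 / (4 * \<epsilon>)" using e by simp
  have "(\<integral>\<xi>. cis (\<xi> \<bullet> x) * of_real (heat \<epsilon> (\<xi> - y)) \<partial>lborel) = (\<integral>\<xi>. cis ((y + \<xi>) \<bullet> x) * of_real (heat \<epsilon> (y + \<xi> - y)) \<partial>lborel)"
    by (rule integral_lborel_translate[symmetric]) measurable
  also have "\<dots> = (\<integral>\<xi>. (cis (x \<bullet> y) * of_real ?k) * (cis (\<xi> \<bullet> x) * of_real (exp (- (1 / (4 * \<epsilon>)) * (norm \<xi>)\<^sup>2))) \<partial>lborel)"
    by (intro Bochner_Integration.integral_cong refl)
       (simp add: heat_def inner_add_left cis_mult[symmetric] inner_commute[of y x] mult_ac)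
  also have "\<dots> = (cis (x \<bullet> y) * of_real ?k) * of_real ((pi / (1 / (4 * \<epsilon>))) powr (real DIM('a) / 2) * exp (- (norm x)\<^sup>2 / (4 * (1 / (4 * \<epsilon>)))))"
    by (simp only: integral_mult_right_zero gauss_integrable_and_ft(2)[OF p])
  also have "\<dots> = cis (x \<bullet> y) * of_real (?k * (4 * pi * \<epsilon>) powr (real DIM('a) / 2)) * of_real (exp (- \<epsilon> * (norm x)\<^sup>2))"
    using e by (simp add: mult_ac)
  also have "?k * (4 * pi * \<epsilon>) powr (real DIM('a) / 2) = 1" using e by (simp add: powr_minus)
  finally show ?thesis by simp
qed

lemma fourier_heat:
  assumes e: "0 < \<epsilon>"
  shows "fourier (\<lambda>\<xi>. complex_of_real (heat \<epsilon> (\<xi> - y))) x = cis (- (x \<bullet> y)) * of_real (exp (- \<epsilon> * (norm x)\<^sup>2))"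
  unfolding fourier_def using cis_heat_integral[OF e, of "- x" y] by simp

lemma fourier_gauss_cis:
  fixes x y :: "'a::euclidean_space"
  assumes e: "0 < \<epsilon>"
  shows "fourier (\<lambda>\<xi>. cis (\<xi> \<bullet> y) * of_real (exp (- \<epsilon> * (norm \<xi>)\<^sup>2))) x = of_real ((2 * pi) ^ DIM('a)) * of_real (heat \<epsilon> (x - y))"
proof -
  have "fourier (\<lambda>\<xi>. cis (\<xi> \<bullet> y) * of_real (exp (- \<epsilon> * (norm \<xi>)\<^sup>2))) x
     = (\<integral>\<xi>. cis (\<xi> \<bullet> (y - x)) * of_real (exp (- \<epsilon> * (norm \<xi>)\<^sup>2)) \<partial>lborel)"
    unfolding fourier_def mult.assoc[symmetric] cis_mult by (simp add: inner_diff_right)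
  also have "\<dots> = of_real ((2 * pi) ^ DIM('a) * heat \<epsilon> (y - x))" by (rule heat_ft[OF e])
  also have "heat \<epsilon> (y - x) = heat \<epsilon> (x - y)" using heat_minus[of \<epsilon> "x - y"] by simp
  finally show ?thesis by simp
qed

section \<open>Fourier transforms tested against Gaussians\<close>

lemma tempered_fun_measurable: "tempered_fun f \<Longrightarrow> f \<in> borel_measurable borel"
  by (simp add: tempered_fun_def)

lemma tempered_fun_gauss:
  assumes "tempered_fun f" "0 < a"
  shows "integrable lborel (\<lambda>x. f x * of_real (exp (- a * (norm x)\<^sup>2)))"
  using assms schwartz_gauss_cis[of a 0] unfolding tempered_fun_def by fastforce

lemma tempered_fun_heat:
  assumes "tempered_fun f" "0 < \<epsilon>"
  shows "integrable lborel (\<lambda>x. f x * of_real (heat \<epsilon> (x - y)))"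
  using assms schwartz_heat[of \<epsilon> y] unfolding tempered_fun_def by fastforce

lemma tempered_fun_gauss_cis:
  fixes f :: "'a::euclidean_space \<Rightarrow> complex"
  assumes "tempered_fun f" "0 < a" and [measurable]: "h \<in> borel_measurable borel"
  shows "integrable lborel (\<lambda>x. f x * of_real (exp (- a * (norm x)\<^sup>2)) * cis (h x))"
  by (rule integrable_mult_cis[OF tempered_fun_gauss[OF assms(1,2)]]) measurable

text \<open>The definition tested with a translated heat kernel. It has the form required by
  \<open>gauss_plancherel_bound\<close> with \<sigma> = -1 and c = 1, and bounds the transform by
  the function.\<close>

lemma has_ft_heat:
  assumes "has_fourier_transform f F" "0 < \<epsilon>"
  shows "(\<integral>x. f x * of_real (exp (- \<epsilon> * (norm x)\<^sup>2)) * cis (- 1 * (x \<bullet> y)) \<partial>lborel) = (\<integral>\<xi>. F \<xi> * of_real (heat \<epsilon> (\<xi> - y)) \<partial>lborel)"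
proof -
  have "(\<integral>x. f x * fourier (\<lambda>\<xi>. complex_of_real (heat \<epsilon> (\<xi> - y))) x \<partial>lborel) = (\<integral>\<xi>. F \<xi> * of_real (heat \<epsilon> (\<xi> - y)) \<partial>lborel)"
    using assms(1) schwartz_heat[OF assms(2)] unfolding has_fourier_transform_def by blast
  thus ?thesis unfolding fourier_heat[OF assms(2)] by (simp add: mult_ac)
qed

text \<open>The definition tested with a modulated Gaussian: the form required by
  \<open>gauss_plancherel_bound\<close> with \<sigma> = 1 and c = (2 pi)^d, which bounds the
  function by its transform.\<close>

lemma has_ft_gauss:
  fixes f :: "'a::euclidean_space \<Rightarrow> complex"
  assumes "has_fourier_transform f F" "0 < \<epsilon>"
  shows "(\<integral>\<xi>. F \<xi> * of_real (exp (- \<epsilon> * (norm \<xi>)\<^sup>2)) * cis (1 * (\<xi> \<bullet> y)) \<partial>lborel) = of_real ((2 * pi) ^ DIM('a)) * (\<integral>x. f x * of_real (heat \<epsilon> (x - y)) \<partial>lborel)"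
proof -
  have "(\<integral>x. f x * fourier (\<lambda>\<xi>. cis (\<xi> \<bullet> y) * of_real (exp (- \<epsilon> * (norm \<xi>)\<^sup>2))) x \<partial>lborel) = (\<integral>\<xi>. F \<xi> * (cis (\<xi> \<bullet> y) * of_real (exp (- \<epsilon> * (norm \<xi>)\<^sup>2))) \<partial>lborel)"
    using assms(1) schwartz_gauss_cis[OF assms(2), of y] unfolding has_fourier_transform_def by blast
  thus ?thesis unfolding fourier_gauss_cis[OF assms(2)]
    by (simp only: mult.left_commute[of "f _" "of_real ((2 * pi) ^ DIM('a))"] integral_mult_right_zero mult_1 mult.assoc mult.commute[of "cis _"])
qed

text \<open>The Plancherel inequality with \<open>A = 0\<close> and \<open>B\<close> the difference
  of the two transforms. Uniqueness reconciles the witnesses that different uses of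
  \<open>fourier_multiplier\<close> provide for the same function.\<close>

lemma has_ft_unique:
  fixes f :: "'a::euclidean_space \<Rightarrow> complex"
  assumes "has_fourier_transform f F" "has_fourier_transform f G"
  shows "AE \<xi> in lborel. F \<xi> = G \<xi>"
proof -
  have t: "tempered_fun F" "tempered_fun G" using assms by (auto simp: has_fourier_transform_def)
  note [measurable] = t[THEN tempered_fun_measurable]
  have "ennreal (1\<^sup>2) * (\<integral>\<^sup>+x. ennreal ((cmod (F x - G x))\<^sup>2) \<partial>lborel)
    \<le> ennreal ((2 * pi) ^ DIM('a)) * (\<integral>\<^sup>+x. ennreal ((cmod 0)\<^sup>2) \<partial>(lborel :: 'a measure))"
  proof (rule gauss_plancherel_bound[where \<sigma>=1 and A="\<lambda>x::'a. 0"])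
    show "integrable lborel (\<lambda>x. (F x - G x) * of_real (exp (- a * (norm x)\<^sup>2)))" if "0 < a" for a
      unfolding left_diff_distrib using t that by (intro Bochner_Integration.integrable_diff tempered_fun_gauss)
    fix \<epsilon> :: real and y :: 'a assume e: "0 < \<epsilon>"
    have "(\<integral>x. (F x - G x) * of_real (heat \<epsilon> (x - y)) \<partial>lborel) = 0"
      unfolding left_diff_distrib using t e assms[THEN has_ft_heat[OF _ e], of y]
      by (subst Bochner_Integration.integral_diff) (auto intro: tempered_fun_heat)
    thus "(\<integral>x. 0 * of_real (exp (- \<epsilon> * (norm x)\<^sup>2)) * cis (1 * (x \<bullet> y)) \<partial>lborel) = of_real 1 * (\<integral>x. (F x - G x) * of_real (heat \<epsilon> (x - y)) \<partial>lborel)"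
      by simp
  qed auto
  hence "(\<integral>\<^sup>+x. ennreal ((cmod (F x - G x))\<^sup>2) \<partial>lborel) = 0" by simp
  hence "AE x in lborel. ennreal ((cmod (F x - G x))\<^sup>2) = 0" by (subst (asm) nn_integral_0_iff_AE) measurable
  thus ?thesis by eventually_elim (simp add: ennreal_eq_0_iff)
qed

lemma has_ft_sum_L2:
  fixes g G :: "nat \<Rightarrow> 'a::euclidean_space \<Rightarrow> complex"
  assumes ft: "\<And>j. j \<in> J \<Longrightarrow> has_fourier_transform (g j) (G j)" and J: "finite J"
    and fin: "(\<integral>\<^sup>+x. ennreal ((cmod (\<Sum>j\<in>J. a j * g j x))\<^sup>2) \<partial>lborel) < \<infinity>"
  shows "(\<integral>\<^sup>+x. ennreal ((cmod (\<Sum>j\<in>J. a j * G j x))\<^sup>2) \<partial>lborel)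
    \<le> ennreal ((2 * pi) ^ DIM('a)) * (\<integral>\<^sup>+x. ennreal ((cmod (\<Sum>j\<in>J. a j * g j x))\<^sup>2) \<partial>lborel)"
proof -
  have t: "tempered_fun (g j)" "tempered_fun (G j)" if "j \<in> J" for j
    using ft[OF that] by (auto simp: has_fourier_transform_def)
  have m [measurable]: "(\<lambda>x. \<Sum>j\<in>J. a j * g j x) \<in> borel_measurable borel" "(\<lambda>x. \<Sum>j\<in>J. a j * G j x) \<in> borel_measurable borel"
    using t[THEN tempered_fun_measurable] by (auto intro!: borel_measurable_sum borel_measurable_times)
  have "ennreal (1\<^sup>2) * (\<integral>\<^sup>+x. ennreal ((cmod (\<Sum>j\<in>J. a j * G j x))\<^sup>2) \<partial>lborel)
    \<le> ennreal ((2 * pi) ^ DIM('a)) * (\<integral>\<^sup>+x. ennreal ((cmod (\<Sum>j\<in>J. a j * g j x))\<^sup>2) \<partial>lborel)"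
  proof (rule gauss_plancherel_bound[OF m fin, where \<sigma>="-1"])
    show "integrable lborel (\<lambda>x. (\<Sum>j\<in>J. a j * G j x) * of_real (exp (- b * (norm x)\<^sup>2)))" if "0 < b" for b
      unfolding sum_distrib_right mult.assoc using t that
      by (intro Bochner_Integration.integrable_sum integrable_mult_right tempered_fun_gauss)
    fix \<epsilon> :: real and y :: 'a assume e: "0 < \<epsilon>"
    have i1: "integrable lborel (\<lambda>x. a j * (g j x * of_real (exp (- \<epsilon> * (norm x)\<^sup>2)) * cis (- 1 * (x \<bullet> y))))" if "j \<in> J" for j
      by (intro integrable_mult_right tempered_fun_gauss_cis t that e) measurable
    have i2: "integrable lborel (\<lambda>x. a j * (G j x * of_real (heat \<epsilon> (x - y))))" if "j \<in> J" for j
      by (intro integrable_mult_right tempered_fun_heat t that e)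
    have "(\<integral>x. (\<Sum>j\<in>J. a j * g j x) * of_real (exp (- \<epsilon> * (norm x)\<^sup>2)) * cis (- 1 * (x \<bullet> y)) \<partial>lborel)
       = (\<integral>x. (\<Sum>j\<in>J. a j * (g j x * of_real (exp (- \<epsilon> * (norm x)\<^sup>2)) * cis (- 1 * (x \<bullet> y)))) \<partial>lborel)"
      by (simp only: sum_distrib_right mult.assoc)
    also have "\<dots> = (\<Sum>j\<in>J. a j * (\<integral>x. g j x * of_real (exp (- \<epsilon> * (norm x)\<^sup>2)) * cis (- 1 * (x \<bullet> y)) \<partial>lborel))"
      by (subst Bochner_Integration.integral_sum[OF i1]) (simp_all only: integral_mult_right_zero)
    also have "\<dots> = (\<Sum>j\<in>J. a j * (\<integral>x. G j x * of_real (heat \<epsilon> (x - y)) \<partial>lborel))"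
      by (intro sum.cong refl arg_cong2[where f="(*)"] has_ft_heat ft e)
    also have "\<dots> = (\<integral>x. (\<Sum>j\<in>J. a j * (G j x * of_real (heat \<epsilon> (x - y)))) \<partial>lborel)"
      by (subst Bochner_Integration.integral_sum[OF i2]) (simp_all only: integral_mult_right_zero)
    also have "\<dots> = of_real 1 * (\<integral>x. (\<Sum>j\<in>J. a j * G j x) * of_real (heat \<epsilon> (x - y)) \<partial>lborel)"
      by (simp only: sum_distrib_right mult.assoc of_real_1 mult_1)
    finally show "(\<integral>x. (\<Sum>j\<in>J. a j * g j x) * of_real (exp (- \<epsilon> * (norm x)\<^sup>2)) * cis (- 1 * (x \<bullet> y)) \<partial>lborel)
       = of_real 1 * (\<integral>x. (\<Sum>j\<in>J. a j * G j x) * of_real (heat \<epsilon> (x - y)) \<partial>lborel)" .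
  qed auto
  thus ?thesis by simp
qed

section \<open>Approximation by truncated evolutions\<close>

text \<open>The factor that makes the Fourier transform of \<open>Defs\<close> unitary.\<close>

definition ft_unit :: "'a::euclidean_space itself \<Rightarrow> real" where
  "ft_unit _ = 1 / sqrt ((2 * pi) ^ DIM('a))"

lemma ft_unit:
  "0 < ft_unit TYPE('a::euclidean_space)" "(ft_unit TYPE('a))\<^sup>2 * (2 * pi) ^ DIM('a) = 1" "(ft_unit TYPE('a))\<^sup>2 \<le> 1"
proof -
  show "0 < ft_unit TYPE('a)" by (simp add: ft_unit_def)
  have sq: "(ft_unit TYPE('a))\<^sup>2 = 1 / (2 * pi) ^ DIM('a)"
    by (simp add: ft_unit_def power_divide)
  thus "(ft_unit TYPE('a))\<^sup>2 * (2 * pi) ^ DIM('a) = 1" by simp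
  have "1 \<le> 2 * pi" using pi_gt3 by linarith
  hence "1 \<le> (2 * pi) ^ DIM('a)" by (rule one_le_power)
  thus "(ft_unit TYPE('a))\<^sup>2 \<le> 1" unfolding sq by simp
qed

section \<open>From orthonormality to Bessel systems\<close>

lemma orthonormal_sum_norm:
  fixes g :: "nat \<Rightarrow> 'a::euclidean_space \<Rightarrow> complex"
  assumes K: "finite K" and g: "\<And>j. j \<in> K \<Longrightarrow> square_integrable (g j)"
    and on: "\<And>i j. i \<in> K \<Longrightarrow> j \<in> K \<Longrightarrow> (\<integral>x. g i x * cnj (g j x) \<partial>lborel) = (if i = j then 1 else 0)"
  shows "(\<integral>\<^sup>+x. ennreal ((cmod (\<Sum>j\<in>K. a j * g j x))\<^sup>2) \<partial>lborel) = ennreal (\<Sum>j\<in>K. (cmod (a j))\<^sup>2)"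
proof -
  have gm: "g j \<in> borel_measurable borel" if "j \<in> K" for j using g[OF that] by (simp add: square_integrable_def)
  have gL: "(\<integral>\<^sup>+x. ennreal ((cmod (g j x))\<^sup>2) \<partial>lborel) < \<infinity>" if "j \<in> K" for j
    using g[OF that] by (auto simp: square_integrable_def integrable_iff_bounded)
  have int: "integrable lborel (\<lambda>x. g i x * cnj (g j x))" if "i \<in> K" "j \<in> K" for i j
    by (rule integrable_mult_L2) (use gm[OF that(1)] gm[OF that(2)] gL[OF that(1)] gL[OF that(2)] in auto)
  have sq: "of_real ((cmod (\<Sum>j\<in>K. a j * g j x))\<^sup>2) = (\<Sum>i\<in>K. \<Sum>j\<in>K. (a i * cnj (a j)) * (g i x * cnj (g j x)))" for x
    by (simp add: complex_norm_square cnj_sum sum_product mult_ac del: of_real_power)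
  have ii: "integrable lborel (\<lambda>x. \<Sum>i\<in>K. \<Sum>j\<in>K. (a i * cnj (a j)) * (g i x * cnj (g j x)))"
    by (intro Bochner_Integration.integrable_sum integrable_mult_right int)
  hence i2: "integrable lborel (\<lambda>x. (cmod (\<Sum>j\<in>K. a j * g j x))\<^sup>2)"
    unfolding sq[symmetric] by (simp only: complex_of_real_integrable_eq)
  have "complex_of_real (\<integral>x. (cmod (\<Sum>j\<in>K. a j * g j x))\<^sup>2 \<partial>lborel) = (\<integral>x. (\<Sum>i\<in>K. \<Sum>j\<in>K. (a i * cnj (a j)) * (g i x * cnj (g j x))) \<partial>lborel)"
    unfolding integral_complex_of_real[symmetric] sq ..
  also have "\<dots> = (\<Sum>i\<in>K. \<Sum>j\<in>K. (a i * cnj (a j)) * (\<integral>x. g i x * cnj (g j x) \<partial>lborel))"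
    by (subst Bochner_Integration.integral_sum, intro Bochner_Integration.integrable_sum integrable_mult_right int, assumption+,
        intro sum.cong refl, subst Bochner_Integration.integral_sum, intro integrable_mult_right int, assumption+) simp
  also have "\<dots> = (\<Sum>i\<in>K. \<Sum>j\<in>K. if i = j then a i * cnj (a j) else 0)"
    by (intro sum.cong refl) (simp add: on)
  also have "\<dots> = (\<Sum>i\<in>K. a i * cnj (a i))" using K by simp
  also have "\<dots> = complex_of_real (\<Sum>i\<in>K. (cmod (a i))\<^sup>2)"
    by (simp add: complex_norm_square del: of_real_power)
  finally have "(\<integral>x. (cmod (\<Sum>j\<in>K. a j * g j x))\<^sup>2 \<partial>lborel) = (\<Sum>i\<in>K. (cmod (a i))\<^sup>2)"
    by (simp only: of_real_eq_iff)
  thus ?thesis by (subst nn_integral_eq_integral[OF i2]) auto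
qed

text \<open>The squared L2 norm of a combination of the orthonormal \<open>g j\<close> is the sum of
  the squared coefficients, and Plancherel's inequality carries this over to the transforms as an
  upper bound, with \<open>ft_unit\<close> absorbing (2 pi)^d.\<close>

lemma orthonormal_hom_sobolev_bessel:
  fixes f :: "nat \<Rightarrow> 'a::euclidean_space \<Rightarrow> complex"
  assumes "orthonormal_hom_sobolev s J f"
  obtains F where "\<And>j. j \<in> J \<Longrightarrow> has_fourier_transform (f j) (F j)"
    "\<And>K. finite K \<Longrightarrow> K \<subseteq> J \<Longrightarrow> bessel_system K (\<lambda>j \<xi>. of_real (ft_unit TYPE('a)) * (of_real (norm \<xi> powr s) * F j \<xi>))"
proof -
  let ?k = "ft_unit TYPE('a)"
  obtain g where g: "\<And>j. j \<in> J \<Longrightarrow> abs_D_powr s (f j) (g j)" "\<And>j. j \<in> J \<Longrightarrow> square_integrable (g j)"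
    "\<And>i j. i \<in> J \<Longrightarrow> j \<in> J \<Longrightarrow> (\<integral>x. g i x * cnj (g j x) \<partial>lborel) = (if i = j then 1 else 0)"
    using assms unfolding orthonormal_hom_sobolev_def by blast
  have "\<forall>j\<in>J. \<exists>F. has_fourier_transform (f j) F \<and> has_fourier_transform (g j) (\<lambda>\<xi>. of_real (norm \<xi> powr s) * F \<xi>)"
    using g(1) by (auto simp: abs_D_powr_def fourier_multiplier_def)
  then obtain F where F: "\<And>j. j \<in> J \<Longrightarrow> has_fourier_transform (f j) (F j)"
    "\<And>j. j \<in> J \<Longrightarrow> has_fourier_transform (g j) (\<lambda>\<xi>. of_real (norm \<xi> powr s) * F j \<xi>)" by metis
  show ?thesis
  proof (rule that[OF F(1)])
    fix K assume K: "finite K" "K \<subseteq> J"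
    let ?G = "\<lambda>j \<xi>. of_real (norm \<xi> powr s) * F j \<xi>"
    have Gm: "?G j \<in> borel_measurable borel" if "j \<in> K" for j
      using F(2)[of j] that K by (auto simp: has_fourier_transform_def intro: tempered_fun_measurable)
    show "bessel_system K (\<lambda>j \<xi>. of_real ?k * ?G j \<xi>)"
      unfolding bessel_system_def
    proof (intro conjI ballI allI K(1))
      show "(\<lambda>\<xi>. of_real ?k * ?G j \<xi>) \<in> borel_measurable borel" if "j \<in> K" for j
        by (rule borel_measurable_times[OF borel_measurable_const Gm[OF that]])
      fix a :: "nat \<Rightarrow> complex"
      let ?b = "\<lambda>j. a j * of_real ?k"
      have nb: "(\<Sum>j\<in>K. (cmod (?b j))\<^sup>2) = ?k\<^sup>2 * (\<Sum>j\<in>K. (cmod (a j))\<^sup>2)"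
        by (simp add: norm_mult power_mult_distrib sum_distrib_left mult.commute)
      have on: "(\<integral>\<^sup>+x. ennreal ((cmod (\<Sum>j\<in>K. ?b j * g j x))\<^sup>2) \<partial>lborel) = ennreal (\<Sum>j\<in>K. (cmod (?b j))\<^sup>2)"
      proof (rule orthonormal_sum_norm[OF K(1)])
        show "square_integrable (g j)" if "j \<in> K" for j using g(2) K(2) that by blast
        show "(\<integral>x. g i x * cnj (g j x) \<partial>lborel) = (if i = j then 1 else 0)" if "i \<in> K" "j \<in> K" for i j
          by (rule g(3)[OF subsetD[OF K(2) that(1)] subsetD[OF K(2) that(2)]])
      qed
      have "(\<integral>\<^sup>+x. ennreal ((cmod (\<Sum>j\<in>K. a j * (of_real ?k * ?G j x)))\<^sup>2) \<partial>lborel) = (\<integral>\<^sup>+x. ennreal ((cmod (\<Sum>j\<in>K. ?b j * ?G j x))\<^sup>2) \<partial>lborel)"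
        by (simp only: mult.assoc)
      also have "\<dots> \<le> ennreal ((2 * pi) ^ DIM('a)) * (\<integral>\<^sup>+x. ennreal ((cmod (\<Sum>j\<in>K. ?b j * g j x))\<^sup>2) \<partial>lborel)"
        by (rule has_ft_sum_L2) (use F(2) K on in auto)
      also have "\<dots> = ennreal ((2 * pi) ^ DIM('a) * (?k\<^sup>2 * (\<Sum>j\<in>K. (cmod (a j))\<^sup>2)))"
        unfolding on nb by (intro ennreal_mult[symmetric]) (auto intro!: mult_nonneg_nonneg sum_nonneg)
      also have "(2 * pi) ^ DIM('a) * (?k\<^sup>2 * (\<Sum>j\<in>K. (cmod (a j))\<^sup>2)) = (?k\<^sup>2 * (2 * pi) ^ DIM('a)) * (\<Sum>j\<in>K. (cmod (a j))\<^sup>2)"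
        by (simp only: mult_ac)
      finally show "(\<integral>\<^sup>+x. ennreal ((cmod (\<Sum>j\<in>K. a j * (of_real ?k * ?G j x)))\<^sup>2) \<partial>lborel) \<le> ennreal (\<Sum>j\<in>K. (cmod (a j))\<^sup>2)"
        unfolding ft_unit(2) by simp
    qed
  qed
qed

lemma inverse_ft_heat:
  fixes W :: "'a::euclidean_space \<Rightarrow> complex"
  assumes W: "integrable lborel W" and e: "0 < \<epsilon>"
  shows "(\<integral>x. (\<integral>\<xi>. W \<xi> * cis (x \<bullet> \<xi>) \<partial>lborel) * of_real (heat \<epsilon> (x - y)) \<partial>lborel)
    = (\<integral>\<xi>. W \<xi> * of_real (exp (- \<epsilon> * (norm \<xi>)\<^sup>2)) * cis (\<xi> \<bullet> y) \<partial>lborel)"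
proof -
  have [measurable]: "W \<in> borel_measurable borel" using W borel_measurable_integrable by fastforce
  have hs: "(\<integral>\<^sup>+x. ennreal (heat \<epsilon> (x - y)) \<partial>lborel) = 1"
    using nn_integral_lborel_translate[of "\<lambda>z. ennreal (heat \<epsilon> z)" "-y"] heat_integral(2)[OF e, where 'a='a] by simp
  have Wf: "(\<integral>\<^sup>+\<xi>. ennreal (cmod (W \<xi>)) \<partial>lborel) < \<infinity>" using W by (simp add: integrable_iff_bounded)
  have "integrable (lborel \<Otimes>\<^sub>M lborel) (\<lambda>(x, \<xi>). W \<xi> * cis (x \<bullet> \<xi>) * of_real (heat \<epsilon> (x - y)))"
  proof (rule lborel_pair.integrable_pair_nn)
    have "(\<integral>\<^sup>+x. \<integral>\<^sup>+\<xi>. ennreal (cmod (W \<xi> * cis (x \<bullet> \<xi>) * of_real (heat \<epsilon> (x - y)))) \<partial>lborel \<partial>lborel)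
      = (\<integral>\<^sup>+\<xi>. ennreal (cmod (W \<xi>)) \<partial>lborel) * (\<integral>\<^sup>+x. ennreal (heat \<epsilon> (x - y)) \<partial>lborel)"
      by (simp add: norm_mult heat_nonneg ennreal_mult nn_integral_multc nn_integral_cmult)
    also have "\<dots> < \<infinity>" using Wf by (simp add: hs)
    finally show "(\<integral>\<^sup>+x. \<integral>\<^sup>+\<xi>. ennreal (cmod (W \<xi> * cis (x \<bullet> \<xi>) * of_real (heat \<epsilon> (x - y)))) \<partial>lborel \<partial>lborel) < \<infinity>" .
  qed measurable
  from lborel_pair.Fubini_integral[OF this]
  have "(\<integral>x. \<integral>\<xi>. W \<xi> * cis (x \<bullet> \<xi>) * of_real (heat \<epsilon> (x - y)) \<partial>lborel \<partial>lborel) = (\<integral>\<xi>. \<integral>x. W \<xi> * (cis (x \<bullet> \<xi>) * of_real (heat \<epsilon> (x - y))) \<partial>lborel \<partial>lborel)"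
    by (simp add: mult.assoc)
  also have "\<dots> = (\<integral>\<xi>. W \<xi> * (cis (\<xi> \<bullet> y) * of_real (exp (- \<epsilon> * (norm \<xi>)\<^sup>2))) \<partial>lborel)"
    by (simp only: integral_mult_right_zero cis_heat_integral[OF e])
  finally have "(\<integral>x. \<integral>\<xi>. W \<xi> * cis (x \<bullet> \<xi>) * of_real (heat \<epsilon> (x - y)) \<partial>lborel \<partial>lborel)
    = (\<integral>\<xi>. W \<xi> * (cis (\<xi> \<bullet> y) * of_real (exp (- \<epsilon> * (norm \<xi>)\<^sup>2))) \<partial>lborel)" .
  thus ?thesis unfolding integral_mult_left_zero by (simp only: mult.assoc mult.commute[of "cis _"])
qed

text \<open>The truncation error has its transform in |\<xi>| > M, where
  \<open>norm \<xi> powr (- s)\<close> is at most \<open>M powr (- s)\<close>. Two transforms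
  \<open>F\<close> and \<open>F'\<close> of \<open>f\<close> occur because the Sobolev hypothesis
  and the evolution supply separate witnesses.\<close>

lemma evolution_approx:
  fixes f u :: "'a::euclidean_space \<Rightarrow> complex" and F F' :: "'a \<Rightarrow> complex" and s :: real
  defines "k \<equiv> ft_unit TYPE('a)"
  defines "e \<equiv> \<lambda>\<xi>. of_real k * (of_real (norm \<xi> powr s) * F \<xi>)"
  assumes f: "has_fourier_transform f F" "has_fourier_transform f F'"
    and u: "has_fourier_transform u (\<lambda>\<xi>. cis (- (t * (norm \<xi>)\<^sup>2)) * F' \<xi>)"
    and eL: "(\<integral>\<^sup>+\<xi>. ennreal ((cmod (e \<xi>))\<^sup>2) \<partial>lborel) \<le> 1"
    and W: "integrable lborel (\<lambda>\<xi>. e \<xi> * of_real (norm \<xi> powr (- s) * indicator {\<xi>. norm \<xi> \<le> M} \<xi>))"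
    and s: "0 < s" and M: "0 < M"
  shows "(\<integral>\<^sup>+x. ennreal ((cmod (u x - of_real k * (\<integral>\<xi>. e \<xi> * of_real (norm \<xi> powr (- s) * indicator {\<xi>. norm \<xi> \<le> M} \<xi>) * cis (x \<bullet> \<xi> - t * (norm \<xi>)\<^sup>2) \<partial>lborel)))\<^sup>2) \<partial>lborel)
     \<le> ennreal (M powr (- (2 * s)))"
proof -
  have k: "0 < k" "k\<^sup>2 * (2 * pi) ^ DIM('a) = 1" using ft_unit[where 'a='a] by (auto simp: k_def)
  define c where "c = (2 * pi) ^ DIM('a)"
  have c: "0 < c" "k * (k * c) = 1" using k by (auto simp: c_def power2_eq_square mult.assoc)
  have t: "tempered_fun F" "tempered_fun F'" "tempered_fun u" "tempered_fun (\<lambda>\<xi>. cis (- (t * (norm \<xi>)\<^sup>2)) * F' \<xi>)"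
    using f u by (auto simp: has_fourier_transform_def)
  note [measurable] = t(1-3)[THEN tempered_fun_measurable]
  have [measurable]: "e \<in> borel_measurable borel" unfolding e_def by measurable
  define V where "V \<xi> = e \<xi> * of_real (norm \<xi> powr (- s) * indicator {\<xi>. norm \<xi> \<le> M} \<xi>) * cis (- (t * (norm \<xi>)\<^sup>2))" for \<xi>
  have V: "integrable lborel V" unfolding V_def by (rule integrable_mult_cis[OF W]) measurable
  have [measurable]: "V \<in> borel_measurable borel" using V borel_measurable_integrable by fastforce
  define T where "T x = (\<integral>\<xi>. V \<xi> * cis (x \<bullet> \<xi>) \<partial>lborel)" for x
  have [measurable]: "T \<in> borel_measurable borel" unfolding T_def by measurable
  have T_eq: "(\<integral>\<xi>. e \<xi> * of_real (norm \<xi> powr (- s) * indicator {\<xi>. norm \<xi> \<le> M} \<xi>) * cis (x \<bullet> \<xi> - t * (norm \<xi>)\<^sup>2) \<partial>lborel) = T x" for x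
  proof -
    have "cis (x \<bullet> \<xi> - t * (norm \<xi>)\<^sup>2) = cis (- (t * (norm \<xi>)\<^sup>2)) * cis (x \<bullet> \<xi>)" for \<xi> by (simp add: cis_mult)
    thus ?thesis unfolding T_def V_def by (simp only: mult.assoc)
  qed
  have Tb: "cmod (T x) \<le> (\<integral>\<xi>. cmod (V \<xi>) \<partial>lborel)" for x
    unfolding T_def by (rule order_trans[OF integral_norm_bound]) (simp add: norm_mult)
  \<comment> \<open>The transform of \<open>u - k * T\<close>: as \<open>k * (k * c) = 1\<close>,
    the function \<open>k * T\<close> has the transform \<open>k * c * V\<close>. The two terms
    cancel almost everywhere on \<open>norm \<xi> \<le> M\<close>.\<close>
  define A where "A \<xi> = cis (- (t * (norm \<xi>)\<^sup>2)) * F' \<xi> - of_real (k * c) * V \<xi>" for \<xi>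
  have [measurable]: "A \<in> borel_measurable borel" unfolding A_def by measurable
  have Aeq: "(\<integral>\<^sup>+\<xi>. ennreal ((cmod (A \<xi>))\<^sup>2) \<partial>lborel) \<le> (\<integral>\<^sup>+\<xi>. ennreal (M powr (- (2 * s)) * c) * ennreal ((cmod (e \<xi>))\<^sup>2) \<partial>lborel)"
  proof (rule nn_integral_mono_AE)
    show "AE \<xi> in lborel. ennreal ((cmod (A \<xi>))\<^sup>2) \<le> ennreal (M powr (- (2 * s)) * c) * ennreal ((cmod (e \<xi>))\<^sup>2)"
      using has_ft_unique[OF f] AE_lborel_singleton[of "0::'a"]
    proof eventually_elim
      fix \<xi> :: 'a assume F: "F \<xi> = F' \<xi>" and \<xi>: "\<xi> \<noteq> 0"
      have ne: "norm \<xi> powr s * norm \<xi> powr (- s) = 1" using \<xi> by (simp add: powr_add[symmetric])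
      have eF: "of_real (k * c) * e \<xi> * of_real (norm \<xi> powr (- s)) = F' \<xi>"
      proof -
        have "of_real (k * c) * e \<xi> * of_real (norm \<xi> powr (- s)) = of_real (k * (k * c)) * of_real (norm \<xi> powr s * norm \<xi> powr (- s)) * F \<xi>"
          by (simp add: e_def mult_ac)
        thus ?thesis by (simp only: c(2) ne F of_real_1 mult_1)
      qed
      show "ennreal ((cmod (A \<xi>))\<^sup>2) \<le> ennreal (M powr (- (2 * s)) * c) * ennreal ((cmod (e \<xi>))\<^sup>2)"
      proof (cases "norm \<xi> \<le> M")
        case True
        have "A \<xi> = cis (- (t * (norm \<xi>)\<^sup>2)) * (F' \<xi> - of_real (k * c) * e \<xi> * of_real (norm \<xi> powr (- s)))"
          using True by (simp add: A_def V_def algebra_simps)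
        thus ?thesis unfolding eF by simp
      next
        case False
        have "A \<xi> = cis (- (t * (norm \<xi>)\<^sup>2)) * (of_real (k * c) * e \<xi> * of_real (norm \<xi> powr (- s)))"
          using False unfolding eF by (simp add: A_def V_def)
        hence "(cmod (A \<xi>))\<^sup>2 = (k * c)\<^sup>2 * (cmod (e \<xi>))\<^sup>2 * (norm \<xi> powr (- s))\<^sup>2"
          by (simp add: norm_mult power_mult_distrib)
        also have "(k * c)\<^sup>2 = c" using c(2) by (simp add: power2_eq_square mult_ac)
        also have "(norm \<xi> powr (- s))\<^sup>2 = norm \<xi> powr (- (2 * s))" using \<xi> by (simp add: powr_power)
        finally have "(cmod (A \<xi>))\<^sup>2 = c * (cmod (e \<xi>))\<^sup>2 * norm \<xi> powr (- (2 * s))" .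
        also have "\<dots> \<le> c * (cmod (e \<xi>))\<^sup>2 * M powr (- (2 * s))"
          using False M s c by (intro mult_left_mono powr_mono2') auto
        finally show ?thesis using c by (simp add: ennreal_mult[symmetric] mult_ac ennreal_leI)
      qed
    qed
  qed
  also have "\<dots> = ennreal (M powr (- (2 * s)) * c) * (\<integral>\<^sup>+\<xi>. ennreal ((cmod (e \<xi>))\<^sup>2) \<partial>lborel)"
    by (rule nn_integral_cmult) measurable
  also have "\<dots> \<le> ennreal (M powr (- (2 * s)) * c) * 1" by (intro mult_left_mono eL) simp
  finally have AL: "(\<integral>\<^sup>+\<xi>. ennreal ((cmod (A \<xi>))\<^sup>2) \<partial>lborel) \<le> ennreal (M powr (- (2 * s)) * c)" by simp
  have "ennreal (c\<^sup>2) * (\<integral>\<^sup>+x. ennreal ((cmod (u x - of_real k * T x))\<^sup>2) \<partial>lborel)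
     \<le> ennreal ((2 * pi) ^ DIM('a)) * (\<integral>\<^sup>+x. ennreal ((cmod (A x))\<^sup>2) \<partial>lborel)"
  proof (rule gauss_plancherel_bound[where \<sigma>=1])
    show "(\<integral>\<^sup>+x. ennreal ((cmod (A x))\<^sup>2) \<partial>lborel) < \<infinity>" using AL by (rule le_less_trans) simp
    show "integrable lborel (\<lambda>x. (u x - of_real k * T x) * of_real (exp (- a * (norm x)\<^sup>2)))" if a: "0 < a" for a
      unfolding left_diff_distrib
    proof (rule Bochner_Integration.integrable_diff[OF tempered_fun_gauss[OF t(3) a]])
      show "integrable lborel (\<lambda>x. of_real k * T x * of_real (exp (- a * (norm x)\<^sup>2)))"
      proof (rule Bochner_Integration.integrable_bound)
        show "integrable lborel (\<lambda>x::'a. k * (\<integral>\<xi>. cmod (V \<xi>) \<partial>lborel) * exp (- a * (norm x)\<^sup>2))"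
          by (intro integrable_mult_right gauss_integrable_and_ft(1) a)
        show "AE x in lborel. cmod (of_real k * T x * of_real (exp (- a * (norm x)\<^sup>2))) \<le> norm (k * (\<integral>\<xi>. cmod (V \<xi>) \<partial>lborel) * exp (- a * (norm x)\<^sup>2))"
          using Tb k(1) by (auto simp: norm_mult abs_mult intro!: mult_right_mono mult_left_mono)
      qed measurable
    qed
    fix \<epsilon> :: real and y :: 'a assume e: "0 < \<epsilon>"
    have i1: "integrable lborel (\<lambda>x. (cis (- (t * (norm x)\<^sup>2)) * F' x) * of_real (exp (- \<epsilon> * (norm x)\<^sup>2)) * cis (1 * (x \<bullet> y)))"
      by (rule tempered_fun_gauss_cis[OF t(4) e]) measurable
    have i2: "integrable lborel (\<lambda>x. V x * of_real (exp (- \<epsilon> * (norm x)\<^sup>2)) * cis (1 * (x \<bullet> y)))"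
    proof (rule integrable_mult_cis)
      show "integrable lborel (\<lambda>x. V x * of_real (exp (- \<epsilon> * (norm x)\<^sup>2)))"
        by (rule Bochner_Integration.integrable_bound[OF V]) (use e in \<open>auto simp: norm_mult intro!: mult_left_le\<close>)
    qed measurable
    have i3: "integrable lborel (\<lambda>x. T x * of_real (heat \<epsilon> (x - y)))"
    proof (rule Bochner_Integration.integrable_bound)
      have "integrable lborel (\<lambda>x. complex_of_real (heat \<epsilon> (-y + x)))"
        by (rule integrable_shift[of "\<lambda>x. complex_of_real (heat \<epsilon> x)"]) (rule integrable_of_real[OF heat_integral(1)[OF e]])
      thus "integrable lborel (\<lambda>x. of_real (\<integral>\<xi>. cmod (V \<xi>) \<partial>lborel) * complex_of_real (heat \<epsilon> (x - y)))" by simp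
      show "AE x in lborel. cmod (T x * of_real (heat \<epsilon> (x - y))) \<le> cmod (of_real (\<integral>\<xi>. cmod (V \<xi>) \<partial>lborel) * complex_of_real (heat \<epsilon> (x - y)))"
        using Tb by (auto simp: norm_mult heat_nonneg intro!: mult_right_mono)
    qed measurable
    have "(\<integral>x. A x * of_real (exp (- \<epsilon> * (norm x)\<^sup>2)) * cis (1 * (x \<bullet> y)) \<partial>lborel)
      = (\<integral>x. (cis (- (t * (norm x)\<^sup>2)) * F' x) * of_real (exp (- \<epsilon> * (norm x)\<^sup>2)) * cis (1 * (x \<bullet> y)) - of_real (k * c) * (V x * of_real (exp (- \<epsilon> * (norm x)\<^sup>2)) * cis (1 * (x \<bullet> y))) \<partial>lborel)"
      by (simp only: A_def left_diff_distrib mult.assoc)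
    also have "\<dots> = (\<integral>x. (cis (- (t * (norm x)\<^sup>2)) * F' x) * of_real (exp (- \<epsilon> * (norm x)\<^sup>2)) * cis (1 * (x \<bullet> y)) \<partial>lborel)
      - of_real (k * c) * (\<integral>x. V x * of_real (exp (- \<epsilon> * (norm x)\<^sup>2)) * cis (1 * (x \<bullet> y)) \<partial>lborel)"
      by (subst Bochner_Integration.integral_diff[OF i1 integrable_mult_right[OF i2]]) (simp only: integral_mult_right_zero)
    also have "\<dots> = of_real c * (\<integral>x. u x * of_real (heat \<epsilon> (x - y)) \<partial>lborel) - of_real (k * c) * (\<integral>x. T x * of_real (heat \<epsilon> (x - y)) \<partial>lborel)"
      using has_ft_gauss[OF u e, of y] inverse_ft_heat[OF V e, of y] by (simp add: c_def T_def)
    also have "\<dots> = of_real c * ((\<integral>x. u x * of_real (heat \<epsilon> (x - y)) \<partial>lborel) - (\<integral>x. of_real k * (T x * of_real (heat \<epsilon> (x - y))) \<partial>lborel))"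
      by (simp add: algebra_simps)
    also have "\<dots> = of_real c * (\<integral>x. u x * of_real (heat \<epsilon> (x - y)) - of_real k * (T x * of_real (heat \<epsilon> (x - y))) \<partial>lborel)"
      by (subst Bochner_Integration.integral_diff[OF tempered_fun_heat[OF t(3) e] integrable_mult_right[OF i3]]) simp
    finally show "(\<integral>x. A x * of_real (exp (- \<epsilon> * (norm x)\<^sup>2)) * cis (1 * (x \<bullet> y)) \<partial>lborel) = of_real c * (\<integral>x. (u x - of_real k * T x) * of_real (heat \<epsilon> (x - y)) \<partial>lborel)"
      by (simp only: left_diff_distrib mult.assoc)
  qed (use c in auto)
  also have "\<dots> \<le> ennreal c * ennreal (M powr (- (2 * s)) * c)" unfolding c_def[symmetric] by (intro mult_left_mono AL) simp
  also have "\<dots> = ennreal (c\<^sup>2) * ennreal (M powr (- (2 * s)))"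
    using c by (simp add: ennreal_mult[symmetric] power2_eq_square mult_ac)
  finally have "(\<integral>\<^sup>+x. ennreal ((cmod (u x - of_real k * T x))\<^sup>2) \<partial>lborel) \<le> ennreal (M powr (- (2 * s)))"
    using c by (subst (asm) ennreal_mult_le_mult_iff) auto
  thus ?thesis unfolding T_eq .
qed

section \<open>Finite systems and mixed norms\<close>

lemma SUP_dense_ge:
  fixes \<phi> :: "'a::euclidean_space \<Rightarrow> real"
  assumes \<phi>: "continuous_on UNIV \<phi>" "\<And>y. 0 \<le> \<phi> y" and x: "\<And>X. open X \<Longrightarrow> X \<noteq> {} \<Longrightarrow> \<exists>n::nat. x n \<in> X"
  shows "ennreal (\<phi> y) \<le> (SUP n. ennreal (\<phi> (x n)))"
proof (rule ccontr)
  assume "\<not> ?thesis"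
  hence lt: "(SUP n. ennreal (\<phi> (x n))) < ennreal (\<phi> y)" by simp
  then obtain r where r: "(SUP n. ennreal (\<phi> (x n))) = ennreal r" "0 \<le> r"
    by (cases "SUP n. ennreal (\<phi> (x n))") auto
  have "r < \<phi> y" using lt r by (simp add: ennreal_less_iff)
  moreover have "open {z. r < \<phi> z}" by (intro open_Collect_less continuous_on_const \<phi>(1))
  ultimately obtain n where "r < \<phi> (x n)" using x[of "{z. r < \<phi> z}"] by auto
  moreover have "ennreal (\<phi> (x n)) \<le> ennreal r" unfolding r(1)[symmetric] by (rule SUP_upper) simp
  ultimately show False using r(2) \<phi>(2) by (simp add: ennreal_le_iff)
qed

lemma continuous_on_inverse_ft:
  fixes W :: "'a::euclidean_space \<Rightarrow> complex"
  assumes W: "integrable lborel W" and [measurable]: "h \<in> borel_measurable borel"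
  shows "continuous_on UNIV (\<lambda>x. \<integral>\<xi>. W \<xi> * cis (x \<bullet> \<xi> - h \<xi>) \<partial>lborel)"
  unfolding continuous_on_sequentially o_def
proof (intro ballI allI impI; elim conjE)
  fix x and y :: "nat \<Rightarrow> 'a" assume y: "y \<longlonglongrightarrow> x"
  have [measurable]: "W \<in> borel_measurable borel" using W borel_measurable_integrable by fastforce
  show "(\<lambda>n. \<integral>\<xi>. W \<xi> * cis (y n \<bullet> \<xi> - h \<xi>) \<partial>lborel) \<longlonglongrightarrow> (\<integral>\<xi>. W \<xi> * cis (x \<bullet> \<xi> - h \<xi>) \<partial>lborel)"
  proof (rule integral_dominated_convergence[where w="\<lambda>\<xi>. cmod (W \<xi>)"])
    show "AE \<xi> in lborel. (\<lambda>n. W \<xi> * cis (y n \<bullet> \<xi> - h \<xi>)) \<longlonglongrightarrow> W \<xi> * cis (x \<bullet> \<xi> - h \<xi>)"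
      by (intro AE_I2 tendsto_intros y)
  qed (use W in \<open>auto simp: norm_mult\<close>)
qed

text \<open>The series of the squared moduli has a finite integral, so it converges almost
  everywhere and its terms tend to zero.\<close>

lemma AE_tendsto_of_L2_geometric:
  fixes v :: "nat \<Rightarrow> 'a::euclidean_space \<Rightarrow> complex"
  assumes [measurable]: "\<And>i. v i \<in> borel_measurable borel" and q: "0 \<le> q" "q < 1"
    and v: "\<And>i. (\<integral>\<^sup>+x. ennreal ((cmod (v i x))\<^sup>2) \<partial>lborel) \<le> ennreal (q ^ i)"
  shows "AE x in lborel. (\<lambda>i. v i x) \<longlonglongrightarrow> 0"
proof -
  have "(\<integral>\<^sup>+x. (\<Sum>i. ennreal ((cmod (v i x))\<^sup>2)) \<partial>lborel) = (\<Sum>i. \<integral>\<^sup>+x. ennreal ((cmod (v i x))\<^sup>2) \<partial>lborel)"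
    by (rule nn_integral_suminf) measurable
  also have "\<dots> \<le> (\<Sum>i. ennreal (1 * q ^ i))" by (intro suminf_le) (use v in auto)
  also have "\<dots> = ennreal (1 / (1 - q))" by (rule suminf_ennreal_geometric) (use q in auto)
  also have "\<dots> < \<infinity>" by simp
  finally have "AE x in lborel. (\<Sum>i. ennreal ((cmod (v i x))\<^sup>2)) \<noteq> \<infinity>"
    by (intro nn_integral_noteq_infinite) auto
  thus ?thesis
  proof eventually_elim
    fix x assume "(\<Sum>i. ennreal ((cmod (v i x))\<^sup>2)) \<noteq> \<infinity>"
    hence "summable (\<lambda>i. (cmod (v i x))\<^sup>2)" by (intro summable_suminf_not_top) auto
    hence "(\<lambda>i. (cmod (v i x))\<^sup>2) \<longlonglongrightarrow> 0" by (rule summable_LIMSEQ_zero)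
    hence "(\<lambda>i. sqrt ((cmod (v i x))\<^sup>2)) \<longlonglongrightarrow> sqrt 0" by (rule tendsto_real_sqrt)
    thus "(\<lambda>i. v i x) \<longlonglongrightarrow> 0" by (simp add: tendsto_norm_zero_iff)
  qed
qed

text \<open>The evolution is a limit of truncated ones almost everywhere in space, for each fixed
  time, and each truncated one is continuous in space. The majorant \<open>Z\<close> is a lower
  limit of suprema over a dense sequence, so it is measurable in time by construction; the
  exceptional set of \<open>x\<close> may depend on \<open>t\<close>.\<close>

lemma finite_system_estimate:
  fixes s a \<kappa> p :: real
  assumes s: "0 < s" "2 * s < real DIM('a::euclidean_space)" and p: "2 / p = real DIM('a) - 2 * s"
    and a: "0 < a" "a < 1" "a \<le> real DIM('a) / 2" "1 / p < a"
    and \<kappa>: "\<kappa> = 1 / a \<or> (2 * a < 1 \<and> \<kappa> = 1 / (2 * a))"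
  obtains C where "C > 0" "\<And>J (f :: nat \<Rightarrow> 'a \<Rightarrow> complex) u K. orthonormal_hom_sobolev s J f \<Longrightarrow>
     (\<And>j. j \<in> J \<Longrightarrow> schroedinger_evolution (f j) (u j)) \<Longrightarrow> finite K \<Longrightarrow> K \<subseteq> J \<Longrightarrow>
     \<exists>Z. Z \<in> borel_measurable borel \<and> (\<forall>t. AE x in lborel. ennreal (\<Sum>j\<in>K. (cmod (u j t x))\<^sup>2) \<le> Z t) \<and>
       (\<integral>\<^sup>+t. ennreal_powr (Z t) p \<partial>lborel) \<le> ennreal (C * real (card K) powr \<kappa>)"
proof -
  obtain C where C: "C > 0" and est: "\<And>J (e :: nat \<Rightarrow> 'a \<Rightarrow> complex) M x. bessel_system J e \<and> (\<forall>i. 0 < M i) \<Longrightarrow>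
    (\<integral>\<^sup>+t. ennreal_powr (liminf (\<lambda>i::nat. SUP n::nat. ennreal (\<Sum>j\<in>J. (cmod (trunc_evol e s (M i) j t (x n)))\<^sup>2))) p \<partial>lborel)
     \<le> ennreal (C * real (card J) powr \<kappa>)"
    using truncated_maximal_estimate[OF s p a \<kappa>] by blast
  show ?thesis
  proof (rule that[OF C])
    fix J and f :: "nat \<Rightarrow> 'a \<Rightarrow> complex" and u :: "nat \<Rightarrow> real \<Rightarrow> 'a \<Rightarrow> complex" and K
    assume on: "orthonormal_hom_sobolev s J f" and ev: "\<And>j. j \<in> J \<Longrightarrow> schroedinger_evolution (f j) (u j)"
      and K: "finite K" "K \<subseteq> J"
    obtain F where F: "\<And>j. j \<in> J \<Longrightarrow> has_fourier_transform (f j) (F j)"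
      and bs: "\<And>K. finite K \<Longrightarrow> K \<subseteq> J \<Longrightarrow> bessel_system K (\<lambda>j \<xi>. of_real (ft_unit TYPE('a)) * (of_real (norm \<xi> powr s) * F j \<xi>))"
      using orthonormal_hom_sobolev_bessel[OF on] by blast
    define k where "k = ft_unit TYPE('a)"
    have k: "0 < k" "k\<^sup>2 \<le> 1" unfolding k_def by (rule ft_unit)+
    define e where "e j \<xi> = of_real k * (of_real (norm \<xi> powr s) * F j \<xi>)" for j \<xi>
    have e: "bessel_system K e" using bs[OF K] unfolding e_def k_def .
    note eD = bessel_systemD[OF e]
    \<comment> \<open>Along powers of two the squared L2 errors \<open>M powr (- (2 * s))\<close>
      are geometric. The convergence almost everywhere thus holds along one sequence for all times,
      whereas an extracted subsequence could depend on \<open>t\<close>.\<close>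
    define M where "M i = (2::real) ^ i" for i :: nat
    have M: "0 < M i" for i by (simp add: M_def)
    obtain D :: "'a set" where D: "countable D" "\<And>X. open X \<Longrightarrow> X \<noteq> {} \<Longrightarrow> \<exists>d\<in>D. d \<in> X"
      using countable_dense_exists by blast
    have D0: "D \<noteq> {}" using D(2)[of UNIV] by auto
    define x where "x = from_nat_into D"
    have x: "\<exists>n. x n \<in> X" if "open X" "X \<noteq> {}" for X
      using D(2)[OF that] from_nat_into_surj[OF D(1)] unfolding x_def by metis
    define H where "H i t = (SUP n::nat. ennreal (\<Sum>j\<in>K. (cmod (trunc_evol e s (M i) j t (x n)))\<^sup>2))" for i t
    define Z where "Z t = liminf (\<lambda>i::nat. H i t)" for t
    have Fm: "(\<lambda>t. \<Sum>j\<in>K. (cmod (trunc_evol e s (M i) j t (x n)))\<^sup>2) \<in> borel_measurable borel" for i n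
      unfolding trunc_evol_def using eD(2) by measurable
    have [measurable]: "H i \<in> borel_measurable borel" for i
      unfolding H_def by (intro borel_measurable_SUP measurable_compose[OF Fm measurable_ennreal]) simp
    have Zm: "Z \<in> borel_measurable borel" unfolding Z_def by measurable
    have s': "0 \<le> s" using s by simp
    have W: "integrable lborel (\<lambda>\<xi>. e j \<xi> * of_real (norm \<xi> powr (- s) * indicator {\<xi>. norm \<xi> \<le> M i} \<xi>))" if "j \<in> K" for i j
      by (rule trunc_evol_integrable[OF e that s' s(2) M])
    have cont: "continuous_on UNIV (trunc_evol e s (M i) j t)" if "j \<in> K" for i j t
      unfolding trunc_evol_def by (rule continuous_on_inverse_ft[OF W[OF that]]) measurable
    have bound: "AE y in lborel. ennreal (\<Sum>j\<in>K. (cmod (u j t y))\<^sup>2) \<le> Z t" for t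
    proof -
      have conv: "AE y in lborel. (\<lambda>i. u j t y - of_real k * trunc_evol e s (M i) j t y) \<longlonglongrightarrow> 0" if j: "j \<in> K" for j
      proof -
        have jJ: "j \<in> J" using j K by auto
        obtain F' where F': "has_fourier_transform (f j) F'" "has_fourier_transform (u j t) (\<lambda>\<xi>. cis (- (t * (norm \<xi>)\<^sup>2)) * F' \<xi>)"
          using ev[OF jJ] unfolding schroedinger_evolution_def fourier_multiplier_def by blast
        have [measurable]: "u j t \<in> borel_measurable borel"
          using F'(2) by (auto simp: has_fourier_transform_def intro: tempered_fun_measurable)
        have [measurable]: "trunc_evol e s (M i) j t \<in> borel_measurable borel" for i
          by (rule borel_measurable_continuous_onI[OF cont[OF j]])
        define q where "q = (2::real) powr (- (2 * s))"
        have q: "0 \<le> q" "q < 1" using powr_less_mono[of "- (2 * s)" 0 2] s by (auto simp: q_def)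
        have Mq: "M i powr (- (2 * s)) = q ^ i" for i
          unfolding M_def pow2_powr q_def by (simp add: powr_power mult.commute)
        show ?thesis
        proof (rule AE_tendsto_of_L2_geometric[OF _ q])
          fix i
          show "(\<integral>\<^sup>+y. ennreal ((cmod (u j t y - of_real k * trunc_evol e s (M i) j t y))\<^sup>2) \<partial>lborel) \<le> ennreal (q ^ i)"
            unfolding Mq[symmetric] trunc_evol_def e_def k_def
            by (rule evolution_approx[OF F[OF jJ] F' _ _ s(1) M])
               (use eD(4)[OF j] W[OF j, of i] in \<open>simp_all only: e_def k_def\<close>)
        qed measurable
      qed
      have "AE y in lborel. \<forall>j\<in>K. (\<lambda>i. u j t y - of_real k * trunc_evol e s (M i) j t y) \<longlonglongrightarrow> 0"
        by (rule AE_finite_allI[OF K(1) conv])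
      thus ?thesis
      proof eventually_elim
        fix y assume A: "\<forall>j\<in>K. (\<lambda>i. u j t y - of_real k * trunc_evol e s (M i) j t y) \<longlonglongrightarrow> 0"
        have "(\<lambda>i. of_real k * trunc_evol e s (M i) j t y) \<longlonglongrightarrow> u j t y" if "j \<in> K" for j
          using tendsto_diff[OF tendsto_const[of "u j t y"] A[rule_format, OF that]] by simp
        hence "(\<lambda>i. \<Sum>j\<in>K. (cmod (of_real k * trunc_evol e s (M i) j t y))\<^sup>2) \<longlonglongrightarrow> (\<Sum>j\<in>K. (cmod (u j t y))\<^sup>2)"
          by (intro tendsto_intros)
        hence "(\<lambda>i. ennreal (\<Sum>j\<in>K. (cmod (of_real k * trunc_evol e s (M i) j t y))\<^sup>2)) \<longlonglongrightarrow> ennreal (\<Sum>j\<in>K. (cmod (u j t y))\<^sup>2)"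
          by (rule tendsto_ennrealI)
        hence "ennreal (\<Sum>j\<in>K. (cmod (u j t y))\<^sup>2) = liminf (\<lambda>i. ennreal (\<Sum>j\<in>K. (cmod (of_real k * trunc_evol e s (M i) j t y))\<^sup>2))"
          by (intro lim_imp_Liminf[symmetric]) auto
        also have "\<dots> \<le> Z t" unfolding Z_def
        proof (intro Liminf_mono always_eventually allI)
          fix i
          have "(\<Sum>j\<in>K. (cmod (of_real k * trunc_evol e s (M i) j t y))\<^sup>2) = k\<^sup>2 * (\<Sum>j\<in>K. (cmod (trunc_evol e s (M i) j t y))\<^sup>2)"
            by (simp add: norm_mult power_mult_distrib sum_distrib_left)
          also have "\<dots> \<le> (\<Sum>j\<in>K. (cmod (trunc_evol e s (M i) j t y))\<^sup>2)"
            using mult_right_mono[OF k(2), of "\<Sum>j\<in>K. (cmod (trunc_evol e s (M i) j t y))\<^sup>2"] by (simp add: sum_nonneg)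
          finally have "ennreal (\<Sum>j\<in>K. (cmod (of_real k * trunc_evol e s (M i) j t y))\<^sup>2) \<le> ennreal (\<Sum>j\<in>K. (cmod (trunc_evol e s (M i) j t y))\<^sup>2)"
            by (rule ennreal_leI)
          also have "\<dots> \<le> H i t" unfolding H_def
            by (rule SUP_dense_ge[where \<phi>="\<lambda>y. \<Sum>j\<in>K. (cmod (trunc_evol e s (M i) j t y))\<^sup>2" and x=x])
               (auto intro!: continuous_intros cont sum_nonneg x)
          finally show "ennreal (\<Sum>j\<in>K. (cmod (of_real k * trunc_evol e s (M i) j t y))\<^sup>2) \<le> H i t" .
        qed
        finally show "ennreal (\<Sum>j\<in>K. (cmod (u j t y))\<^sup>2) \<le> Z t" .
      qed
    qed
    have "(\<integral>\<^sup>+t. ennreal_powr (Z t) p \<partial>lborel) \<le> ennreal (C * real (card K) powr \<kappa>)"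
      unfolding Z_def H_def by (rule est) (use e M in auto)
    thus "\<exists>Z. Z \<in> borel_measurable borel \<and> (\<forall>t. AE x in lborel. ennreal (\<Sum>j\<in>K. (cmod (u j t x))\<^sup>2) \<le> Z t) \<and>
       (\<integral>\<^sup>+t. ennreal_powr (Z t) p \<partial>lborel) \<le> ennreal (C * real (card K) powr \<kappa>)"
      using Zm bound by blast
  qed
qed

text \<open>For complex families summability is absolute summability. The unordered sum is therefore
  the ordinary series where the series of moduli is finite, and the default value 0 elsewhere; both
  pieces are measurable.\<close>

lemma infsum_borel_measurable:
  fixes f :: "nat \<Rightarrow> 'b \<Rightarrow> complex"
  assumes f: "\<And>j. j \<in> J \<Longrightarrow> f j \<in> borel_measurable M"
  shows "(\<lambda>x. \<Sum>\<^sub>\<infinity>j\<in>J. f j x) \<in> borel_measurable M"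
proof -
  define g where "g j x = (if j \<in> J then f j x else 0)" for j x
  have [measurable]: "g j \<in> borel_measurable M" for j
    unfolding g_def by (cases "j \<in> J") (use f in auto)
  have eq_suminf: "(\<Sum>\<^sub>\<infinity>j\<in>J. f j x) = (if (\<Sum>j. ennreal (cmod (g j x))) < top then (\<Sum>j. g j x) else 0)" for x
  proof -
    have eq: "(\<Sum>\<^sub>\<infinity>j\<in>J. f j x) = (\<Sum>\<^sub>\<infinity>j\<in>UNIV. g j x)"
      by (rule infsum_cong_neutral) (auto simp: g_def)
    show ?thesis
    proof (cases "summable (\<lambda>j. cmod (g j x))")
      case True
      have "((\<lambda>j. g j x) has_sum (\<Sum>j. g j x)) UNIV"
        by (rule norm_summable_imp_has_sum[OF True summable_sums[OF summable_norm_cancel[OF True]]])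
      hence "(\<Sum>\<^sub>\<infinity>j\<in>UNIV. g j x) = (\<Sum>j. g j x)" by (rule infsumI)
      moreover have "(\<Sum>j. ennreal (cmod (g j x))) < top"
        using True by (subst suminf_ennreal2) auto
      ultimately show ?thesis using eq by simp
    next
      case ns: False
      have "\<not> (\<Sum>j. ennreal (cmod (g j x))) < top"
      proof
        assume "(\<Sum>j. ennreal (cmod (g j x))) < top"
        hence "(\<Sum>j. ennreal (cmod (g j x))) \<noteq> top" by (rule less_imp_neq)
        from summable_suminf_not_top[OF norm_ge_zero this] ns show False by contradiction
      qed
      moreover have "\<not> (\<lambda>j. g j x) summable_on UNIV"
      proof
        assume "(\<lambda>j. g j x) summable_on UNIV"
        hence "(\<lambda>j. cmod (g j x)) summable_on UNIV" by (rule iffD1[OF summable_on_iff_abs_summable_on_complex])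
        hence "summable (\<lambda>j. cmod (g j x))" by (rule summable_on_imp_summable)
        with ns show False by contradiction
      qed
      ultimately show ?thesis unfolding eq by (simp add: infsum_not_exists)
    qed
  qed
  show ?thesis unfolding eq_suminf by measurable
qed

section \<open>Powers of extended nonnegative reals\<close>

lemma ennreal_powr_mono:
  assumes "0 \<le> p" "x \<le> y" shows "ennreal_powr x p \<le> ennreal_powr y p"
proof (cases "y = \<infinity>")
  case False
  hence "x \<noteq> \<infinity>" using assms(2) by (auto simp: top_unique)
  moreover have "enn2real x \<le> enn2real y" using assms(2) False by (intro enn2real_mono) (auto simp: less_top)
  ultimately show ?thesis using False assms(1) by (auto simp: ennreal_powr_def intro!: ennreal_leI powr_mono2)
qed (simp add: ennreal_powr_def)

lemma ennreal_powr_ennreal: "0 \<le> r \<Longrightarrow> ennreal_powr (ennreal r) p = ennreal (r powr p)"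
  by (simp add: ennreal_powr_def)

lemma ennreal_powr_cmult:
  assumes "0 < c"
  shows "ennreal_powr (ennreal c * x) p = ennreal (c powr p) * ennreal_powr x p"
proof (cases "x = \<infinity>")
  case True
  thus ?thesis using assms by (simp add: ennreal_powr_def ennreal_mult_top)
next
  case False
  then obtain r where r: "x = ennreal r" "0 \<le> r" by (cases x) auto
  have eq: "ennreal c * x = ennreal (c * r)" using r assms by (simp add: ennreal_mult)
  have "ennreal_powr (ennreal c * x) p = ennreal ((c * r) powr p)"
    unfolding eq by (rule ennreal_powr_ennreal) (use r assms in auto)
  also have "\<dots> = ennreal (c powr p) * ennreal (r powr p)" by (simp add: powr_mult ennreal_mult)
  also have "ennreal (r powr p) = ennreal_powr x p" unfolding r(1) by (rule ennreal_powr_ennreal[OF r(2), symmetric])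
  finally show ?thesis .
qed

lemma ennreal_powr_powr:
  assumes "p \<noteq> 0" shows "ennreal_powr (ennreal_powr x (1 / p)) p = x"
proof (cases "x = \<infinity>")
  case False
  then obtain r where r: "x = ennreal r" "0 \<le> r" by (cases x) auto
  thus ?thesis using assms by (cases "r = 0") (simp_all add: ennreal_powr_def powr_powr)
qed (simp add: ennreal_powr_def)

lemma borel_measurable_ennreal_powr [measurable (raw)]:
  assumes [measurable]: "f \<in> borel_measurable M"
  shows "(\<lambda>x. ennreal_powr (f x) p) \<in> borel_measurable M"
  unfolding ennreal_powr_def by measurable

text \<open>A crude form of the triangle inequality in Lp: every \<open>y l\<close> is at most
  \<open>S powr (1 / p)\<close>, with \<open>S\<close> the sum of all p-th powers, and the weights
  \<open>q ^ l\<close> sum to \<open>1 / (1 - q)\<close>. The loss is harmless when the p-th powers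
  decay geometrically after integration.\<close>

lemma ennreal_powr_suminf_le:
  fixes y :: "nat \<Rightarrow> ennreal"
  assumes p: "0 < p" and q: "0 < q" "q < 1"
  shows "ennreal_powr (\<Sum>l. ennreal (q ^ l) * y l) p \<le> ennreal ((1 / (1 - q)) powr p) * (\<Sum>l. ennreal_powr (y l) p)"
proof -
  define S where "S = (\<Sum>l. ennreal_powr (y l) p)"
  have "y l \<le> ennreal_powr S (1 / p)" for l
  proof -
    have "ennreal_powr (y l) p \<le> S" unfolding S_def using sum_le_suminf[of "\<lambda>l. ennreal_powr (y l) p" "{l}"] by simp
    hence "ennreal_powr (ennreal_powr (y l) p) (1 / p) \<le> ennreal_powr S (1 / p)" using p by (intro ennreal_powr_mono) auto
    moreover have "ennreal_powr (ennreal_powr (y l) p) (1 / p) = y l"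
      using ennreal_powr_powr[of "1 / p" "y l"] p by simp
    ultimately show ?thesis by simp
  qed
  hence "(\<Sum>l. ennreal (q ^ l) * y l) \<le> (\<Sum>l. ennreal (q ^ l) * ennreal_powr S (1 / p))"
    by (intro suminf_le mult_left_mono) auto
  also have "\<dots> = (\<Sum>l. ennreal (1 * q ^ l)) * ennreal_powr S (1 / p)" by simp
  also have "\<dots> = ennreal (1 / (1 - q)) * ennreal_powr S (1 / p)"
    by (subst suminf_ennreal_geometric) (use q in auto)
  finally have "ennreal_powr (\<Sum>l. ennreal (q ^ l) * y l) p \<le> ennreal_powr (ennreal (1 / (1 - q)) * ennreal_powr S (1 / p)) p"
    using p by (intro ennreal_powr_mono) auto
  also have "\<dots> = ennreal ((1 / (1 - q)) powr p) * S"
    using p q by (simp add: ennreal_powr_cmult ennreal_powr_powr)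
  finally show ?thesis by (simp add: S_def)
qed

section \<open>The estimate below the critical exponent\<close>

text \<open>A majorant of all finite sums of moduli gives absolute summability wherever it is
  finite, and it dominates the infinite sum there. Its integrability makes it finite for almost
  every time.\<close>

lemma mixed_norm_bound:
  fixes u :: "nat \<Rightarrow> real \<Rightarrow> 'a::euclidean_space \<Rightarrow> complex" and c :: "nat \<Rightarrow> complex"
  assumes um: "\<And>j t. j \<in> J \<Longrightarrow> u j t \<in> borel_measurable borel" and H [measurable]: "H \<in> borel_measurable borel"
    and bd: "\<And>t. AE x in lborel. \<forall>S. finite S \<longrightarrow> S \<subseteq> J \<longrightarrow> ennreal (\<Sum>j\<in>S. cmod (c j) * (cmod (u j t x))\<^sup>2) \<le> H t"
    and p: "0 < p" and V: "(\<integral>\<^sup>+t. ennreal_powr (H t) p \<partial>lborel) \<le> ennreal V" "0 \<le> V"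
  shows "(AE t in lborel. AE x in lborel. (\<lambda>j. c j * of_real ((cmod (u j t x))\<^sup>2)) summable_on J)"
    and "Lp_Linf_norm p (\<lambda>t x. \<Sum>\<^sub>\<infinity>j\<in>J. c j * of_real ((cmod (u j t x))\<^sup>2)) \<le> ennreal (V powr (1 / p))"
proof -
  have n: "cmod (c j * of_real ((cmod (u j t x))\<^sup>2)) = cmod (c j) * (cmod (u j t x))\<^sup>2" for j t x
    by (simp add: norm_mult norm_power)
  have key: "(\<lambda>j. c j * of_real ((cmod (u j t x))\<^sup>2)) summable_on J \<and> ennreal (cmod (\<Sum>\<^sub>\<infinity>j\<in>J. c j * of_real ((cmod (u j t x))\<^sup>2))) \<le> H t"
    if h: "H t < \<infinity>" and b: "\<forall>S. finite S \<longrightarrow> S \<subseteq> J \<longrightarrow> ennreal (\<Sum>j\<in>S. cmod (c j) * (cmod (u j t x))\<^sup>2) \<le> H t" for t x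
  proof -
    obtain r where r: "H t = ennreal r" "0 \<le> r" using h by (cases "H t") auto
    have S: "(\<Sum>j\<in>S. cmod (c j * of_real ((cmod (u j t x))\<^sup>2))) \<le> r" if "finite S" "S \<subseteq> J" for S
      using b that r unfolding n by (simp add: ennreal_le_iff)
    have abs: "(\<lambda>j. cmod (c j * of_real ((cmod (u j t x))\<^sup>2))) summable_on J"
    proof (rule nonneg_bdd_above_summable_on)
      show "bdd_above (sum (\<lambda>j. cmod (c j * of_real ((cmod (u j t x))\<^sup>2))) ` {F. F \<subseteq> J \<and> finite F})"
        by (rule bdd_aboveI2[where M=r]) (use S in blast)
    qed simp
    have "cmod (\<Sum>\<^sub>\<infinity>j\<in>J. c j * of_real ((cmod (u j t x))\<^sup>2)) \<le> (\<Sum>\<^sub>\<infinity>j\<in>J. cmod (c j * of_real ((cmod (u j t x))\<^sup>2)))"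
      by (rule norm_infsum_bound[OF abs])
    also have "\<dots> \<le> r" by (rule infsum_le_finite_sums[OF abs S])
    finally show ?thesis using abs_summable_summable[OF abs] r by (simp add: ennreal_leI)
  qed
  have "(\<integral>\<^sup>+t. ennreal_powr (H t) p \<partial>lborel) < \<infinity>" using V(1) by (rule le_less_trans) simp
  hence "AE t in lborel. ennreal_powr (H t) p \<noteq> \<infinity>" by (intro nn_integral_noteq_infinite) auto
  hence fin: "AE t in lborel. H t < \<infinity>"
    by eventually_elim (auto simp: ennreal_powr_def less_top split: if_splits)
  show "AE t in lborel. AE x in lborel. (\<lambda>j. c j * of_real ((cmod (u j t x))\<^sup>2)) summable_on J"
    using fin
  proof eventually_elim
    fix t assume h: "H t < \<infinity>"
    show "AE x in lborel. (\<lambda>j. c j * of_real ((cmod (u j t x))\<^sup>2)) summable_on J"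
      using bd[of t] by eventually_elim (use key[OF h] in blast)
  qed
  have ess: "AE t in lborel. esssup lborel (\<lambda>x. ennreal (cmod (\<Sum>\<^sub>\<infinity>j\<in>J. c j * of_real ((cmod (u j t x))\<^sup>2)))) \<le> H t"
    using fin
  proof eventually_elim
    fix t assume h: "H t < \<infinity>"
    have m: "(\<lambda>x. \<Sum>\<^sub>\<infinity>j\<in>J. c j * of_real ((cmod (u j t x))\<^sup>2)) \<in> borel_measurable borel"
    proof (rule infsum_borel_measurable)
      fix j assume "j \<in> J"
      note [measurable] = um[OF this]
      show "(\<lambda>x. c j * of_real ((cmod (u j t x))\<^sup>2)) \<in> borel_measurable borel" by measurable
    qed
    show "esssup lborel (\<lambda>x. ennreal (cmod (\<Sum>\<^sub>\<infinity>j\<in>J. c j * of_real ((cmod (u j t x))\<^sup>2)))) \<le> H t"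
    proof (rule esssup_I)
      show "(\<lambda>x. ennreal (cmod (\<Sum>\<^sub>\<infinity>j\<in>J. c j * of_real ((cmod (u j t x))\<^sup>2)))) \<in> borel_measurable lborel"
        using m by (intro measurable_compose[OF _ measurable_ennreal] borel_measurable_norm) simp
      show "AE x in lborel. ennreal (cmod (\<Sum>\<^sub>\<infinity>j\<in>J. c j * of_real ((cmod (u j t x))\<^sup>2))) \<le> H t"
        using bd[of t] by eventually_elim (use key[OF h] in blast)
    qed
  qed
  have "(\<integral>\<^sup>+t. ennreal_powr (esssup lborel (\<lambda>x. ennreal (cmod (\<Sum>\<^sub>\<infinity>j\<in>J. c j * of_real ((cmod (u j t x))\<^sup>2))))) p \<partial>lborel) \<le> (\<integral>\<^sup>+t. ennreal_powr (H t) p \<partial>lborel)"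
    by (rule nn_integral_mono_AE, use ess in eventually_elim) (intro ennreal_powr_mono less_imp_le[OF p])
  also have "\<dots> \<le> ennreal V" by fact
  finally have "ennreal_powr (\<integral>\<^sup>+t. ennreal_powr (esssup lborel (\<lambda>x. ennreal (cmod (\<Sum>\<^sub>\<infinity>j\<in>J. c j * of_real ((cmod (u j t x))\<^sup>2))))) p \<partial>lborel) (1 / p) \<le> ennreal_powr (ennreal V) (1 / p)"
    using p by (intro ennreal_powr_mono) auto
  thus "Lp_Linf_norm p (\<lambda>t x. \<Sum>\<^sub>\<infinity>j\<in>J. c j * of_real ((cmod (u j t x))\<^sup>2)) \<le> ennreal (V powr (1 / p))"
    unfolding Lp_Linf_norm_def using V(2) by (simp add: ennreal_powr_ennreal)
qed

section \<open>Coefficients and their dyadic levels\<close>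

lemma finite_sum_le_infsum_ennreal:
  fixes f :: "'b \<Rightarrow> ennreal"
  assumes "finite S" "S \<subseteq> J"
  shows "sum f S \<le> infsum f J"
proof -
  have "infsum f S \<le> infsum f J"
    by (rule infsum_mono_neutral) (use assms in \<open>auto intro: nonneg_summable_on_complete\<close>)
  thus ?thesis using assms(1) by simp
qed

lemma seq_lp_norm_finite:
  assumes \<beta>: "1 \<le> \<beta>" and fin: "seq_lp_norm (ereal \<beta>) J c < \<infinity>"
  obtains A where "0 \<le> A" "seq_lp_norm (ereal \<beta>) J c = ennreal A"
    "\<And>S. finite S \<Longrightarrow> S \<subseteq> J \<Longrightarrow> (\<Sum>j\<in>S. cmod (c j) powr \<beta>) \<le> A powr \<beta>"
proof -
  define N where "N = (\<Sum>\<^sub>\<infinity>j\<in>J. ennreal (cmod (c j) powr \<beta>))"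
  have sn: "seq_lp_norm (ereal \<beta>) J c = ennreal_powr N (1 / \<beta>)" by (simp add: seq_lp_norm_def N_def)
  have "N \<noteq> \<infinity>" using fin unfolding sn by (auto simp: ennreal_powr_def)
  then obtain n where n: "N = ennreal n" "0 \<le> n" by (cases N) auto
  have np: "(n powr (1 / \<beta>)) powr \<beta> = n" using n \<beta> by (cases "n = 0") (simp_all add: powr_powr)
  show ?thesis
  proof (rule that)
    show "0 \<le> n powr (1 / \<beta>)" by simp
    show "seq_lp_norm (ereal \<beta>) J c = ennreal (n powr (1 / \<beta>))"
      unfolding sn n(1) by (rule ennreal_powr_ennreal[OF n(2)])
    fix S assume S: "finite S" "S \<subseteq> J"
    have "ennreal (\<Sum>j\<in>S. cmod (c j) powr \<beta>) = (\<Sum>j\<in>S. ennreal (cmod (c j) powr \<beta>))" by simp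
    also have "\<dots> \<le> N" unfolding N_def by (rule finite_sum_le_infsum_ennreal[OF S])
    finally show "(\<Sum>j\<in>S. cmod (c j) powr \<beta>) \<le> (n powr (1 / \<beta>)) powr \<beta>"
      unfolding np n(1) using n(2) by (simp add: ennreal_le_iff)
  qed
qed

text \<open>Chebyshev's inequality for each finite subset of a level bounds its cardinality
  uniformly, which also shows that the level is finite. No coefficient exceeds \<open>A\<close>, so
  each nonzero one falls into a level with a nonnegative index.\<close>

lemma dyadic_level_card:
  assumes A: "0 < A" and \<beta>: "1 \<le> \<beta>"
    and sum: "\<And>S. finite S \<Longrightarrow> S \<subseteq> J \<Longrightarrow> (\<Sum>j\<in>S. cmod (c j) powr \<beta>) \<le> A powr \<beta>"
  defines "L \<equiv> \<lambda>l::nat. {j \<in> J. A / 2 ^ Suc l < cmod (c j) \<and> cmod (c j) \<le> A / 2 ^ l}"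
  shows "finite (L l)" "real (card (L l)) \<le> (2 ^ Suc l) powr \<beta>" "\<And>j. j \<in> J \<Longrightarrow> c j \<noteq> 0 \<Longrightarrow> \<exists>l. j \<in> L l"
proof -
  have bd: "real (card G) \<le> (2 ^ Suc l) powr \<beta>" if G: "G \<subseteq> L l" "finite G" for G
  proof -
    have "real (card G) * (A / 2 ^ Suc l) powr \<beta> = (\<Sum>j\<in>G. (A / 2 ^ Suc l) powr \<beta>)" by simp
    also have "\<dots> \<le> (\<Sum>j\<in>G. cmod (c j) powr \<beta>)"
      using G(1) A \<beta> by (intro sum_mono powr_mono2) (auto simp: L_def)
    also have "\<dots> \<le> A powr \<beta>" by (rule sum[OF G(2)]) (use G(1) in \<open>auto simp: L_def\<close>)
    finally have "real (card G) * (A powr \<beta> / (2 ^ Suc l) powr \<beta>) \<le> A powr \<beta>"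
      by (simp only: powr_divide)
    hence "real (card G) * A powr \<beta> \<le> (2 ^ Suc l) powr \<beta> * A powr \<beta>"
      by (simp add: divide_le_eq mult.commute)
    thus ?thesis using A by simp
  qed
  have "card G \<le> nat \<lfloor>(2 ^ Suc l) powr \<beta>\<rfloor>" if "G \<subseteq> L l" "finite G" for G
    using bd[OF that] by (simp add: le_nat_floor)
  hence "finite (L l) \<and> card (L l) \<le> nat \<lfloor>(2 ^ Suc l) powr \<beta>\<rfloor>" by (rule finite_if_finite_subsets_card_bdd)
  thus fin: "finite (L l)" by simp
  show "real (card (L l)) \<le> (2 ^ Suc l) powr \<beta>" by (rule bd[OF subset_refl fin])
  fix j assume j: "j \<in> J" "c j \<noteq> 0"
  have le: "cmod (c j) powr \<beta> \<le> A powr \<beta>" using sum[of "{j}"] j by simp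
  have "cmod (c j) \<le> A"
  proof (rule ccontr)
    assume "\<not> cmod (c j) \<le> A"
    hence "A powr \<beta> < cmod (c j) powr \<beta>" using A \<beta> by (intro powr_less_mono2) auto
    with le show False by simp
  qed
  hence "1 \<le> A / cmod (c j)" using j by simp
  then obtain l where l: "2 ^ l \<le> A / cmod (c j)" "A / cmod (c j) < 2 ^ Suc l" using dyadic_scale' by blast
  have "0 < cmod (c j)" using j by simp
  hence "A / 2 ^ Suc l < cmod (c j)" "cmod (c j) \<le> A / 2 ^ l" using l by (simp_all add: field_simps)
  thus "\<exists>l. j \<in> L l" using j by (auto simp: L_def)
qed

text \<open>The level \<open>l\<close> has coefficients of size A/2^l and at most 2^((l+1)\<beta>)
  members, so its p-th power costs about 2^(-l(p - \<beta>\<kappa>)). Half of this gap pays for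
  summing the levels inside the p-th power; the other half makes the integrated contributions a
  convergent geometric series.\<close>

lemma maximal_estimate_of_exponent:
  fixes s a \<kappa> p \<beta> :: real
  assumes s: "0 < s" "2 * s < real DIM('a::euclidean_space)" and p: "2 / p = real DIM('a) - 2 * s" "0 < p"
    and a: "0 < a" "a < 1" "a \<le> real DIM('a) / 2" "1 / p < a"
    and \<kappa>: "\<kappa> = 1 / a \<or> (2 * a < 1 \<and> \<kappa> = 1 / (2 * a))"
    and \<beta>: "1 \<le> \<beta>" "\<beta> * \<kappa> < p"
  shows "\<exists>C. orthonormal_maximal_estimate TYPE('a) s (2 * p) (ereal \<beta>) C"
proof -
  obtain C where C: "C > 0" and est: "\<And>J (f :: nat \<Rightarrow> 'a \<Rightarrow> complex) u K. orthonormal_hom_sobolev s J f \<Longrightarrow>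
     (\<And>j. j \<in> J \<Longrightarrow> schroedinger_evolution (f j) (u j)) \<Longrightarrow> finite K \<Longrightarrow> K \<subseteq> J \<Longrightarrow>
     \<exists>Z. Z \<in> borel_measurable borel \<and> (\<forall>t. AE x in lborel. ennreal (\<Sum>j\<in>K. (cmod (u j t x))\<^sup>2) \<le> Z t) \<and>
       (\<integral>\<^sup>+t. ennreal_powr (Z t) p \<partial>lborel) \<le> ennreal (C * real (card K) powr \<kappa>)"
    by (rule finite_system_estimate[OF s p(1) a \<kappa>]) blast
  have \<kappa>0: "0 < \<kappa>" using \<kappa> a by auto
  \<comment> \<open>Chosen so that \<open>\<eta> * p\<close> is half of the gap
    \<open>p - \<beta> * \<kappa>\<close>; the ratio \<open>v\<close> below is two to the power of
    minus the other half.\<close>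
  define \<eta> where "\<eta> = (p - \<beta> * \<kappa>) / (2 * p)"
  have \<eta>: "0 < \<eta>" using \<beta> p by (simp add: \<eta>_def)
  define q where "q = (2::real) powr (- \<eta>)"
  have q: "0 < q" "q < 1" using powr_less_mono[of "- \<eta>" 0 2] \<eta> by (auto simp: q_def)
  define v where "v = (2::real) powr (- ((p - \<beta> * \<kappa>) / 2))"
  have v: "0 < v" "v < 1" using powr_less_mono[of "- ((p - \<beta> * \<kappa>) / 2)" 0 2] \<beta> by (auto simp: v_def)
  define K where "K = (1 / (1 - q)) powr p * (C * 2 powr (\<beta> * \<kappa>) / (1 - v))"
  have K: "0 < K" using q v C by (simp add: K_def)
  show ?thesis
  proof (intro exI[of _ "K powr (1 / p)"], unfold orthonormal_maximal_estimate_def, intro allI impI)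
    fix J and f :: "nat \<Rightarrow> 'a \<Rightarrow> complex" and u and c :: "nat \<Rightarrow> complex"
    assume on: "orthonormal_hom_sobolev s J f" and ev: "\<forall>j\<in>J. schroedinger_evolution (f j) (u j)"
      and fin: "seq_lp_norm (ereal \<beta>) J c < \<infinity>"
    obtain A where A: "0 \<le> A" "seq_lp_norm (ereal \<beta>) J c = ennreal A"
      "\<And>S. finite S \<Longrightarrow> S \<subseteq> J \<Longrightarrow> (\<Sum>j\<in>S. cmod (c j) powr \<beta>) \<le> A powr \<beta>"
      using seq_lp_norm_finite[OF \<beta>(1) fin] by blast
    have um: "u j t \<in> borel_measurable borel" if j: "j \<in> J" for j t
    proof -
      obtain F' where "has_fourier_transform (u j t) (\<lambda>\<xi>. cis (- (t * (norm \<xi>)\<^sup>2)) * F' \<xi>)"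
        using ev j unfolding schroedinger_evolution_def fourier_multiplier_def by blast
      thus ?thesis by (auto simp: has_fourier_transform_def intro: tempered_fun_measurable)
    qed
    have "\<exists>H. H \<in> borel_measurable borel \<and> (\<forall>t. AE x in lborel. \<forall>S. finite S \<longrightarrow> S \<subseteq> J \<longrightarrow> ennreal (\<Sum>j\<in>S. cmod (c j) * (cmod (u j t x))\<^sup>2) \<le> H t)
       \<and> (\<integral>\<^sup>+t. ennreal_powr (H t) p \<partial>lborel) \<le> ennreal (K * A powr p)"
    proof (cases "A = 0")
      \<comment> \<open>All coefficients on \<open>J\<close> vanish. The dyadic levels are measured
        relative to \<open>A\<close>, so the other case needs \<open>A > 0\<close>.\<close>
      case True
      have "c j = 0" if "j \<in> J" for j using A(3)[of "{j}"] that True \<beta> by simp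
      hence "(\<Sum>j\<in>S. cmod (c j) * (cmod (u j t x))\<^sup>2) = 0" if "S \<subseteq> J" for S t x
        by (intro sum.neutral) (use that in auto)
      thus ?thesis using p(2) by (intro exI[of _ "\<lambda>_. 0"]) (auto simp: ennreal_powr_def)
    next
      case False
      hence A0: "0 < A" using A(1) by simp
      define L where "L l = {j \<in> J. A / 2 ^ Suc l < cmod (c j) \<and> cmod (c j) \<le> A / 2 ^ l}" for l :: nat
      have L1: "finite (L l)" for l
        unfolding L_def by (rule dyadic_level_card(1)[OF A0 \<beta>(1)], rule A(3))
      have L2: "real (card (L l)) \<le> (2 ^ Suc l) powr \<beta>" for l
        unfolding L_def by (rule dyadic_level_card(2)[OF A0 \<beta>(1)], rule A(3))
      have L3: "\<exists>l. j \<in> L l" if "j \<in> J" "c j \<noteq> 0" for j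
        unfolding L_def
      proof (rule dyadic_level_card(3)[OF A0 \<beta>(1)])
        show "(\<Sum>j\<in>S. cmod (c j) powr \<beta>) \<le> A powr \<beta>" if "finite S" "S \<subseteq> J" for S by (rule A(3)[OF that])
      qed (fact that)+
      have LJ: "L l \<subseteq> J" for l by (auto simp: L_def)
      have "\<forall>l. \<exists>Z. Z \<in> borel_measurable borel \<and> (\<forall>t. AE x in lborel. ennreal (\<Sum>j\<in>L l. (cmod (u j t x))\<^sup>2) \<le> Z t) \<and>
         (\<integral>\<^sup>+t. ennreal_powr (Z t) p \<partial>lborel) \<le> ennreal (C * real (card (L l)) powr \<kappa>)"
        using est[OF on _ L1 LJ] ev by blast
      then obtain Z where Zm [measurable]: "\<And>l. Z l \<in> borel_measurable borel"
        and Zb: "\<And>l t. AE x in lborel. ennreal (\<Sum>j\<in>L l. (cmod (u j t x))\<^sup>2) \<le> Z l t"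
        and Zi: "\<And>l. (\<integral>\<^sup>+t. ennreal_powr (Z l t) p \<partial>lborel) \<le> ennreal (C * real (card (L l)) powr \<kappa>)"
        by metis
      \<comment> \<open>The size \<open>A / 2 ^ l\<close> of the level is written as
        \<open>q ^ l * r l\<close>, which brings the sum over levels into the form of
        \<open>ennreal_powr_suminf_le\<close>.\<close>
      define r where "r l = A / 2 ^ l / q ^ l" for l
      have r: "0 < r l" for l using A0 q by (simp add: r_def)
      define H where "H t = (\<Sum>l. ennreal (q ^ l) * (ennreal (r l) * Z l t))" for t
      have Hm: "H \<in> borel_measurable borel" unfolding H_def by measurable
      have qr: "ennreal (q ^ l) * (ennreal (r l) * z) = ennreal (A / 2 ^ l) * z" for l z
      proof -
        have "q ^ l * r l = A / 2 ^ l" using q by (simp add: r_def)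
        thus ?thesis using q r[of l] by (simp add: mult.assoc[symmetric] ennreal_mult[symmetric])
      qed
      have Hb: "AE x in lborel. \<forall>S. finite S \<longrightarrow> S \<subseteq> J \<longrightarrow> ennreal (\<Sum>j\<in>S. cmod (c j) * (cmod (u j t x))\<^sup>2) \<le> H t" for t
      proof -
        have "AE x in lborel. \<forall>l. ennreal (\<Sum>j\<in>L l. (cmod (u j t x))\<^sup>2) \<le> Z l t"
          unfolding AE_all_countable using Zb by blast
        thus ?thesis
        proof (eventually_elim, intro allI impI)
          fix x S assume zb: "\<forall>l. ennreal (\<Sum>j\<in>L l. (cmod (u j t x))\<^sup>2) \<le> Z l t" and S: "finite S" "S \<subseteq> J"
          have "ennreal (\<Sum>j\<in>S. cmod (c j) * (cmod (u j t x))\<^sup>2) = (\<Sum>j\<in>S. ennreal (cmod (c j) * (cmod (u j t x))\<^sup>2))"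
            by (subst sum_ennreal) auto
          also have "\<dots> \<le> (\<Sum>j\<in>S. \<Sum>l. ennreal (A / 2 ^ l) * (ennreal ((cmod (u j t x))\<^sup>2) * indicator (L l) j))"
          proof (rule sum_mono)
            fix j assume j: "j \<in> S"
            show "ennreal (cmod (c j) * (cmod (u j t x))\<^sup>2) \<le> (\<Sum>l. ennreal (A / 2 ^ l) * (ennreal ((cmod (u j t x))\<^sup>2) * indicator (L l) j))"
            proof (cases "c j = 0")
              case False
              then obtain l where l: "j \<in> L l" using L3 j S by blast
              have "ennreal (cmod (c j) * (cmod (u j t x))\<^sup>2) \<le> ennreal (A / 2 ^ l * (cmod (u j t x))\<^sup>2)"
                using l by (intro ennreal_leI mult_right_mono) (auto simp: L_def)
              also have "\<dots> = ennreal (A / 2 ^ l) * (ennreal ((cmod (u j t x))\<^sup>2) * indicator (L l) j)"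
              proof -
                have ind: "indicator (L l) j = (1::ennreal)" using l by simp
                show ?thesis unfolding ind using A0 by (simp add: ennreal_mult[symmetric])
              qed
              also have "\<dots> \<le> (\<Sum>l. ennreal (A / 2 ^ l) * (ennreal ((cmod (u j t x))\<^sup>2) * indicator (L l) j))"
                using sum_le_suminf[of "\<lambda>l. ennreal (A / 2 ^ l) * (ennreal ((cmod (u j t x))\<^sup>2) * indicator (L l) j)" "{l}"] by simp
              finally show ?thesis .
            qed simp
          qed
          also have "\<dots> = (\<Sum>l. \<Sum>j\<in>S. ennreal (A / 2 ^ l) * (ennreal ((cmod (u j t x))\<^sup>2) * indicator (L l) j))"
            by (rule suminf_sum[symmetric]) simp
          also have "\<dots> \<le> H t" unfolding H_def
          proof (rule suminf_le)
            fix l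
            have "(\<Sum>j\<in>S. ennreal ((cmod (u j t x))\<^sup>2) * indicator (L l) j) = (\<Sum>j\<in>S \<inter> L l. ennreal ((cmod (u j t x))\<^sup>2))"
              using S(1) by (simp add: sum.inter_restrict indicator_def if_distrib cong: if_cong)
            also have "\<dots> \<le> (\<Sum>j\<in>L l. ennreal ((cmod (u j t x))\<^sup>2))"
              by (rule sum_mono2[OF L1]) auto
            also have "\<dots> = ennreal (\<Sum>j\<in>L l. (cmod (u j t x))\<^sup>2)" by simp
            also have "\<dots> \<le> Z l t" using zb by blast
            finally have "ennreal (A / 2 ^ l) * (\<Sum>j\<in>S. ennreal ((cmod (u j t x))\<^sup>2) * indicator (L l) j) \<le> ennreal (A / 2 ^ l) * Z l t"
              by (intro mult_left_mono) auto
            thus "(\<Sum>j\<in>S. ennreal (A / 2 ^ l) * (ennreal ((cmod (u j t x))\<^sup>2) * indicator (L l) j)) \<le> ennreal (q ^ l) * (ennreal (r l) * Z l t)"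
              unfolding qr by (simp add: sum_distrib_left)
          qed auto
          finally show "ennreal (\<Sum>j\<in>S. cmod (c j) * (cmod (u j t x))\<^sup>2) \<le> H t" .
        qed
      qed
      have rl: "r l powr p * (C * (2 ^ Suc l) powr (\<beta> * \<kappa>)) = (C * 2 powr (\<beta> * \<kappa>) * A powr p) * v ^ l" for l
      proof -
        have "r l = A * 2 powr (real l * (\<eta> - 1))"
        proof -
          have "q ^ l = 2 powr (real l * (- \<eta>))" by (simp add: q_def powr_power mult.commute)
          moreover have "(2::real) ^ l = 2 powr (real l)" by (simp add: powr_realpow)
          ultimately have "r l = A / (2 powr real l * 2 powr (real l * (- \<eta>)))" by (simp add: r_def)
          also have "2 powr real l * 2 powr (real l * (- \<eta>)) = 2 powr (- (real l * (\<eta> - 1)))"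
            unfolding powr_add[symmetric] by (simp add: algebra_simps)
          finally show ?thesis by (simp only: powr_minus divide_inverse inverse_inverse_eq)
        qed
        hence 1: "r l powr p = A powr p * 2 powr (real l * (\<eta> - 1) * p)" by (simp add: powr_mult powr_powr)
        have 2: "(2 ^ Suc l) powr (\<beta> * \<kappa>) = 2 powr (\<beta> * \<kappa>) * 2 powr (real l * (\<beta> * \<kappa>))"
          unfolding pow2_powr powr_add[symmetric] by (simp add: algebra_simps)
        have 3: "v ^ l = 2 powr (real l * (\<eta> - 1) * p) * 2 powr (real l * (\<beta> * \<kappa>))"
        proof -
          have e: "\<eta> * p = (p - \<beta> * \<kappa>) / 2" using p by (simp add: \<eta>_def)
          have "(\<eta> - 1) * p + \<beta> * \<kappa> = - ((p - \<beta> * \<kappa>) / 2)"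
            unfolding left_diff_distrib e by (simp add: field_simps)
          hence "real l * (\<eta> - 1) * p + real l * (\<beta> * \<kappa>) = real l * (- ((p - \<beta> * \<kappa>) / 2))"
            by (metis distrib_left mult.assoc)
          thus ?thesis unfolding powr_add[symmetric] by (simp add: v_def powr_power mult.commute)
        qed
        show ?thesis unfolding 1 2 3 by (simp only: mult_ac)
      qed
      have "(\<integral>\<^sup>+t. ennreal_powr (H t) p \<partial>lborel) \<le> (\<integral>\<^sup>+t. ennreal ((1 / (1 - q)) powr p) * (\<Sum>l. ennreal_powr (ennreal (r l) * Z l t) p) \<partial>lborel)"
        unfolding H_def by (intro nn_integral_mono ennreal_powr_suminf_le p(2) q)
      also have "\<dots> = ennreal ((1 / (1 - q)) powr p) * (\<integral>\<^sup>+t. (\<Sum>l. ennreal_powr (ennreal (r l) * Z l t) p) \<partial>lborel)"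
        by (rule nn_integral_cmult) measurable
      also have "(\<integral>\<^sup>+t. (\<Sum>l. ennreal_powr (ennreal (r l) * Z l t) p) \<partial>lborel) = (\<Sum>l. \<integral>\<^sup>+t. ennreal_powr (ennreal (r l) * Z l t) p \<partial>lborel)"
        by (rule nn_integral_suminf) measurable
      also have "(\<Sum>l. \<integral>\<^sup>+t. ennreal_powr (ennreal (r l) * Z l t) p \<partial>lborel) \<le> (\<Sum>l. ennreal ((C * 2 powr (\<beta> * \<kappa>) * A powr p) * v ^ l))"
      proof (rule suminf_le)
        fix l
        have "(\<integral>\<^sup>+t. ennreal_powr (ennreal (r l) * Z l t) p \<partial>lborel) = ennreal (r l powr p) * (\<integral>\<^sup>+t. ennreal_powr (Z l t) p \<partial>lborel)"
          unfolding ennreal_powr_cmult[OF r] by (rule nn_integral_cmult) measurable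
        also have "\<dots> \<le> ennreal (r l powr p) * ennreal (C * real (card (L l)) powr \<kappa>)"
          by (intro mult_left_mono Zi) simp
        also have "\<dots> \<le> ennreal (r l powr p) * ennreal (C * (2 ^ Suc l) powr (\<beta> * \<kappa>))"
        proof (intro mult_left_mono ennreal_leI)
          have "real (card (L l)) powr \<kappa> \<le> ((2 ^ Suc l) powr \<beta>) powr \<kappa>"
            using L2[of l] \<kappa>0 by (intro powr_mono2) auto
          thus "real (card (L l)) powr \<kappa> \<le> (2 ^ Suc l) powr (\<beta> * \<kappa>)" by (simp only: powr_powr)
        qed (use C in auto)
        also have "\<dots> = ennreal (r l powr p * (C * (2 ^ Suc l) powr (\<beta> * \<kappa>)))"
          using C by (intro ennreal_mult[symmetric]) auto
        finally show "(\<integral>\<^sup>+t. ennreal_powr (ennreal (r l) * Z l t) p \<partial>lborel) \<le> ennreal ((C * 2 powr (\<beta> * \<kappa>) * A powr p) * v ^ l)"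
          unfolding rl .
      qed auto
      also have "\<dots> = ennreal ((C * 2 powr (\<beta> * \<kappa>) * A powr p) / (1 - v))"
        by (rule suminf_ennreal_geometric) (use C v in auto)
      finally have "(\<integral>\<^sup>+t. ennreal_powr (H t) p \<partial>lborel) \<le> ennreal ((1 / (1 - q)) powr p) * ennreal ((C * 2 powr (\<beta> * \<kappa>) * A powr p) / (1 - v))"
        by (simp add: mult_left_mono)
      also have "\<dots> = ennreal ((1 / (1 - q)) powr p * ((C * 2 powr (\<beta> * \<kappa>) * A powr p) / (1 - v)))"
        using C v by (intro ennreal_mult[symmetric]) auto
      also have "(1 / (1 - q)) powr p * ((C * 2 powr (\<beta> * \<kappa>) * A powr p) / (1 - v)) = K * A powr p"
        by (simp add: K_def)
      finally show ?thesis using Hm Hb by blast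
    qed
    then obtain H where H: "H \<in> borel_measurable borel" "\<And>t. AE x in lborel. \<forall>S. finite S \<longrightarrow> S \<subseteq> J \<longrightarrow> ennreal (\<Sum>j\<in>S. cmod (c j) * (cmod (u j t x))\<^sup>2) \<le> H t"
       "(\<integral>\<^sup>+t. ennreal_powr (H t) p \<partial>lborel) \<le> ennreal (K * A powr p)" by blast
    have nn: "0 \<le> K * A powr p" using K by simp
    have fin_norm: "ennreal ((K * A powr p) powr (1 / p)) = ennreal (K powr (1 / p)) * seq_lp_norm (ereal \<beta>) J c"
    proof -
      have "(A powr p) powr (1 / p) = A" using A(1) p(2) by (cases "A = 0") (simp_all add: powr_powr)
      thus ?thesis unfolding A(2) using A(1) by (simp add: powr_mult ennreal_mult)
    qed
    show "(AE t in lborel. AE x in lborel. (\<lambda>j. c j * of_real ((cmod (u j t x))\<^sup>2)) summable_on J) \<and>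
        Lp_Linf_norm (2 * p / 2) (\<lambda>t x. \<Sum>\<^sub>\<infinity>j\<in>J. c j * of_real ((cmod (u j t x))\<^sup>2))
          \<le> ennreal (K powr (1 / p)) * seq_lp_norm (ereal \<beta>) J c"
      using mixed_norm_bound[OF um H(1,2) p(2) H(3) nn] unfolding fin_norm by simp
  qed
qed

lemma maximal_estimate_holds:
  fixes q s \<beta> :: real
  assumes dim: "(DIM('a::euclidean_space) = 1 \<and> 4 < q) \<or> (2 \<le> DIM('a) \<and> 2 < q)"
    and s: "s = real DIM('a) / 2 - 2 / q" and \<beta>: "1 \<le> \<beta>" "\<beta> < q / 2"
  shows "\<exists>C. orthonormal_maximal_estimate TYPE('a) s q (ereal \<beta>) C"
proof -
  define p where "p = q / 2"
  have q: "q = 2 * p" by (simp add: p_def)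
  have p: "1 < p" using dim by (auto simp: p_def)
  have s': "2 * s < real DIM('a)" "2 / p = real DIM('a) - 2 * s" using s p by (auto simp: q)
  have s0: "0 < s"
    using dim
  proof
    assume d: "DIM('a) = 1 \<and> 4 < q"
    hence "2 / q < 1 / 2" by (simp add: field_simps)
    thus ?thesis using d s by simp
  next
    assume d: "2 \<le> DIM('a) \<and> 2 < q"
    hence "2 / q < 1" "1 \<le> real DIM('a) / 2" by (simp_all add: field_simps)
    thus ?thesis using s by linarith
  qed
  have \<beta>p: "\<beta> / p < 1" "1 / p \<le> \<beta> / p" using \<beta> p by (auto simp: p_def divide_right_mono)
  show ?thesis
    using dim
  proof
    assume d: "2 \<le> DIM('a) \<and> 2 < q"
    \<comment> \<open>The midpoint between \<beta>/p and 1. Above \<beta>/p the exponent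
      \<open>1 / a\<close> satisfies \<open>\<beta> * (1 / a) < p\<close>; below 1 the kernel is
      locally integrable and \<open>a\<close> is at most d/2.\<close>
    define a where "a = (\<beta> / p + 1) / 2"
    have "x < (x + 1) / 2 \<and> (x + 1) / 2 < 1" if "x < 1" for x :: real using that by simp
    from this[OF \<beta>p(1)] have a: "\<beta> / p < a" "a < 1" by (auto simp only: a_def)
    have p1: "0 < 1 / p" using p by simp
    have a0: "1 / p < a" by (rule order.strict_trans1[OF \<beta>p(2) a(1)])
    have a1: "0 < a" by (rule order.strict_trans[OF p1 a0])
    have "\<beta> < p * a" using a(1) p by (simp add: field_simps)
    hence "\<beta> * (1 / a) < p" using a1 by (simp add: field_simps)
    moreover have "a \<le> real DIM('a) / 2" using d a(2) by linarith
    ultimately show ?thesis unfolding q using p a a0 a1 s0 s' \<beta>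
      by (intro maximal_estimate_of_exponent[where a=a and \<kappa>="1 / a"]) auto
  next
    assume d: "DIM('a) = 1 \<and> 4 < q"
    \<comment> \<open>The two lower bounds for \<open>a\<close>: 1/p for convergence at high
      frequencies and \<beta>/(2p) for \<open>\<beta> * \<kappa> < p\<close> with
      \<open>\<kappa> = 1 / (2 * a)\<close>. Below 1/2 the square of the kernel is locally
      integrable in time; q > 4 puts 1/p below 1/2.\<close>
    define b where "b = max (1 / p) (\<beta> / (2 * p))"
    have "1 / p < 1 / 2" using d by (simp add: p_def field_simps)
    moreover have "\<beta> / (2 * p) < 1 / 2" using \<beta>(2) p by (simp add: q field_simps)
    ultimately have b: "b < 1 / 2" unfolding b_def by simp
    define a where "a = (b + 1 / 2) / 2"
    have a: "b < a" "a < 1 / 2" using b by (auto simp: a_def)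
    have a0: "1 / p < a" "\<beta> / (2 * p) < a" using a(1) by (auto simp: b_def)
    have p1: "0 < 1 / p" using p by simp
    have a1: "0 < a" by (rule order.strict_trans[OF p1 a0(1)])
    have "\<beta> < p * (2 * a)" using a0(2) p by (simp add: field_simps)
    hence "\<beta> * (1 / (2 * a)) < p" using a1 by (simp add: field_simps)
    thus ?thesis unfolding q using p a a0 a1 s0 s' \<beta> d
      by (intro maximal_estimate_of_exponent[where a=a and \<kappa>="1 / (2 * a)"]) auto
  qed
qed

section \<open>Inverse Fourier transforms of functions in \<open>L\<^sup>1 \<inter> L\<^sup>2\<close>\<close>

lemma schwartz_integrable:
  fixes \<phi> :: "'a::euclidean_space \<Rightarrow> complex"
  assumes "schwartz \<phi>"
  shows "\<phi> \<in> borel_measurable borel" "integrable lborel \<phi>" "\<exists>B\<ge>0. \<forall>x. cmod (\<phi> x) \<le> B"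
    "(\<integral>\<^sup>+x. ennreal ((cmod (\<phi> x))\<^sup>2) \<partial>lborel) < \<infinity>"
proof -
  have nil: "\<And>x. \<phi> differentiable (at x)" "\<And>k::nat. \<exists>M. \<forall>x. norm x ^ k * cmod (\<phi> x) \<le> M"
    using assms unfolding schwartz_def by (auto dest: spec[of _ "[]"])
  have "continuous_on UNIV \<phi>"
    using nil(1) by (auto intro!: continuous_at_imp_continuous_on differentiable_imp_continuous_within)
  thus m [measurable]: "\<phi> \<in> borel_measurable borel" by (rule borel_measurable_continuous_onI)
  obtain B where B: "\<And>x. cmod (\<phi> x) \<le> B" using nil(2)[of 0] by auto
  have B0: "0 \<le> B" using B norm_ge_zero order_trans by blast
  show "\<exists>B\<ge>0. \<forall>x. cmod (\<phi> x) \<le> B" using B B0 by blast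
  \<comment> \<open>The decay exponent d + 1 exceeds the dimension, which gives integrability
    outside the unit ball.\<close>
  define m where "m = DIM('a) + 1"
  obtain D where D: "\<And>x. norm x ^ m * cmod (\<phi> x) \<le> D" using nil(2)[of m] by auto
  have D0: "0 \<le> D" using D[of 0] by (simp add: m_def)
  have "(\<integral>\<^sup>+x. ennreal (cmod (\<phi> x)) \<partial>lborel) \<le> (\<integral>\<^sup>+x. ennreal B * indicator (cball 0 1) x + ennreal D * (ennreal (norm x powr (- real m)) * indicator {x. 1 < norm x} x) \<partial>(lborel::'a measure))"
  proof (rule nn_integral_mono)
    fix x :: 'a
    show "ennreal (cmod (\<phi> x)) \<le> ennreal B * indicator (cball 0 1) x + ennreal D * (ennreal (norm x powr (- real m)) * indicator {x. 1 < norm x} x)"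
    proof (cases "1 < norm x")
      case True
      have n0: "0 < norm x" using True by linarith
      have "norm x powr real m * cmod (\<phi> x) \<le> D" using D[of x] n0 by (simp only: powr_realpow)
      hence "cmod (\<phi> x) \<le> D * norm x powr (- real m)" using n0 by (simp add: powr_minus field_simps)
      thus ?thesis using True D0 by (simp add: ennreal_mult[symmetric] ennreal_leI)
    qed (use B in \<open>auto intro!: ennreal_leI\<close>)
  qed
  also have "\<dots> = (\<integral>\<^sup>+x. ennreal B * indicator (cball 0 1) x \<partial>(lborel::'a measure)) + (\<integral>\<^sup>+x. ennreal D * (ennreal (norm x powr (- real m)) * indicator {x. 1 < norm x} x) \<partial>(lborel::'a measure))"
  proof (rule nn_integral_add)
    show "(\<lambda>x. ennreal B * indicator (cball 0 1) x) \<in> borel_measurable (lborel::'a measure)"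
      by (intro borel_measurable_times_ennreal borel_measurable_indicator borel_measurable_const) simp
  qed measurable
  also have "(\<integral>\<^sup>+x. ennreal B * indicator (cball 0 1) x \<partial>(lborel::'a measure)) = ennreal B * emeasure lborel (cball (0::'a) 1)"
    by (rule nn_integral_cmult_indicator) simp
  also have "(\<integral>\<^sup>+x. ennreal D * (ennreal (norm x powr (- real m)) * indicator {x. 1 < norm x} x) \<partial>(lborel::'a measure)) = ennreal D * (\<integral>\<^sup>+x. (ennreal (norm x powr (- real m)) * indicator {x. 1 < norm x} x) \<partial>(lborel::'a measure))"
    by (rule nn_integral_cmult) measurable
  also have "ennreal B * emeasure lborel (cball (0::'a) 1) + ennreal D * (\<integral>\<^sup>+x. (ennreal (norm x powr (- real m)) * indicator {x. 1 < norm x} x) \<partial>(lborel::'a measure)) < \<infinity>"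
    using nn_integral_norm_powr_outside[of "real m", where 'a='a] emeasure_lborel_cball_finite[of "0::'a" 1]
    by (simp add: m_def ennreal_mult_less_top)
  finally have fin: "(\<integral>\<^sup>+x. ennreal (cmod (\<phi> x)) \<partial>lborel) < \<infinity>" .
  thus "integrable lborel \<phi>" by (intro integrableI_bounded) auto
  have "(\<integral>\<^sup>+x. ennreal ((cmod (\<phi> x))\<^sup>2) \<partial>lborel) \<le> (\<integral>\<^sup>+x. ennreal B * ennreal (cmod (\<phi> x)) \<partial>lborel)"
  proof (rule nn_integral_mono)
    fix x
    have "(cmod (\<phi> x))\<^sup>2 \<le> B * cmod (\<phi> x)" unfolding power2_eq_square by (intro mult_right_mono B) auto
    thus "ennreal ((cmod (\<phi> x))\<^sup>2) \<le> ennreal B * ennreal (cmod (\<phi> x))"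
      using B0 by (simp add: ennreal_mult[symmetric] ennreal_leI)
  qed
  also have "\<dots> = ennreal B * (\<integral>\<^sup>+x. ennreal (cmod (\<phi> x)) \<partial>lborel)" by (rule nn_integral_cmult) measurable
  also have "\<dots> < \<infinity>" using fin by (simp add: ennreal_mult_less_top)
  finally show "(\<integral>\<^sup>+x. ennreal ((cmod (\<phi> x))\<^sup>2) \<partial>lborel) < \<infinity>" .
qed

lemma L2_tempered_fun:
  fixes F :: "'a::euclidean_space \<Rightarrow> complex"
  assumes "F \<in> borel_measurable borel" "(\<integral>\<^sup>+x. ennreal ((cmod (F x))\<^sup>2) \<partial>lborel) < \<infinity>"
  shows "tempered_fun F"
  unfolding tempered_fun_def
proof (intro conjI allI impI)
  fix \<phi> :: "'a \<Rightarrow> complex" assume s: "schwartz \<phi>"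
  show "integrable lborel (\<lambda>x. F x * \<phi> x)"
    by (rule integrable_mult_L2[OF _ _ assms(2) schwartz_integrable(4)[OF s]])
       (use assms(1) schwartz_integrable(1)[OF s] in simp_all)
qed (rule assms(1))

text \<open>The squared factor is (2 pi)^(-d), which makes this the inverse of
  \<open>fourier\<close>.\<close>

definition inv_ft :: "('a::euclidean_space \<Rightarrow> complex) \<Rightarrow> 'a \<Rightarrow> complex" where
  "inv_ft F x = of_real ((ft_unit TYPE('a))\<^sup>2) * (\<integral>\<xi>. F \<xi> * cis (x \<bullet> \<xi>) \<partial>lborel)"

lemma inv_ft_measurable [measurable]:
  assumes [measurable]: "F \<in> borel_measurable borel"
  shows "inv_ft F \<in> borel_measurable borel"
  unfolding inv_ft_def[abs_def] by measurable

lemma inv_ft_L2_le: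
  fixes F :: "'a::euclidean_space \<Rightarrow> complex"
  assumes F: "integrable lborel F"
  shows "(\<integral>\<^sup>+x. ennreal ((cmod (inv_ft F x))\<^sup>2) \<partial>lborel) \<le> ennreal ((ft_unit TYPE('a))\<^sup>2) * (\<integral>\<^sup>+x. ennreal ((cmod (F x))\<^sup>2) \<partial>lborel)"
proof -
  let ?k = "(ft_unit TYPE('a))\<^sup>2"
  have [measurable]: "F \<in> borel_measurable borel" using F borel_measurable_integrable by fastforce
  have "(\<integral>\<^sup>+x. ennreal ((cmod (inv_ft F x))\<^sup>2) \<partial>lborel) = (\<integral>\<^sup>+x. ennreal (?k\<^sup>2) * ennreal ((cmod (\<integral>\<xi>. F \<xi> * cis (1 * (\<xi> \<bullet> x)) \<partial>lborel))\<^sup>2) \<partial>lborel)"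
    by (intro nn_integral_cong) (simp add: inv_ft_def norm_mult power_mult_distrib ennreal_mult inner_commute norm_power)
  also have "\<dots> = ennreal (?k\<^sup>2) * (\<integral>\<^sup>+x. ennreal ((cmod (\<integral>\<xi>. F \<xi> * cis (1 * (\<xi> \<bullet> x)) \<partial>lborel))\<^sup>2) \<partial>lborel)"
    by (rule nn_integral_cmult) measurable
  also have "\<dots> \<le> ennreal (?k\<^sup>2) * (ennreal ((2 * pi) ^ DIM('a)) * (\<integral>\<^sup>+x. ennreal ((cmod (F x))\<^sup>2) \<partial>lborel))"
    by (intro mult_left_mono ft_L2_bound F) auto
  also have "\<dots> = ennreal (?k * (?k * (2 * pi) ^ DIM('a))) * (\<integral>\<^sup>+x. ennreal ((cmod (F x))\<^sup>2) \<partial>lborel)"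
  proof -
    have e: "ennreal (?k * (?k * (2 * pi) ^ DIM('a))) = ennreal (?k\<^sup>2) * ennreal ((2 * pi) ^ DIM('a))"
      unfolding power2_eq_square[of ?k] mult.assoc[symmetric] by (rule ennreal_mult) auto
    show ?thesis unfolding e by (simp only: mult.assoc)
  qed
  finally show ?thesis unfolding ft_unit(2) by simp
qed

text \<open>With a Gaussian inserted into the pairing, Fubini's theorem replaces the test function
  by its heat mollification (\<open>reg\<close>). The Gaussian is removed by dominated convergence:
  on the left because \<open>inv_ft F\<close> and the transform of the test function are in L2, on
  the right because the mollifications are bounded by \<open>B\<close> and converge almost
  everywhere along a subsequence.\<close>

lemma inv_ft_has_ft:
  fixes F :: "'a::euclidean_space \<Rightarrow> complex"
  assumes F: "integrable lborel F" and F2: "(\<integral>\<^sup>+x. ennreal ((cmod (F x))\<^sup>2) \<partial>lborel) < \<infinity>"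
  shows "has_fourier_transform (inv_ft F) F"
  unfolding has_fourier_transform_def
proof (intro conjI allI impI)
  have [measurable]: "F \<in> borel_measurable borel" using F borel_measurable_integrable by fastforce
  let ?k = "(ft_unit TYPE('a))\<^sup>2"
  have f2: "(\<integral>\<^sup>+x. ennreal ((cmod (inv_ft F x))\<^sup>2) \<partial>lborel) < \<infinity>"
    using F2 by (intro le_less_trans[OF inv_ft_L2_le[OF F]]) (simp add: ennreal_mult_less_top)
  show "tempered_fun F" "tempered_fun (inv_ft F)" by (rule L2_tempered_fun; use F2 f2 in simp)+
  fix \<phi> :: "'a \<Rightarrow> complex" assume "schwartz \<phi>"
  note \<phi> = schwartz_integrable[OF this]
  note [measurable] = \<phi>(1)
  obtain B where B: "0 \<le> B" "\<And>x. cmod (\<phi> x) \<le> B" using \<phi>(3) by blast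
  define \<phi>' where "\<phi>' = fourier \<phi>"
  have \<phi>'_eq: "\<phi>' x = (\<integral>y. \<phi> y * cis (- 1 * (y \<bullet> x)) \<partial>lborel)" for x
    by (simp add: \<phi>'_def fourier_def mult.commute)
  have [measurable]: "\<phi>' \<in> borel_measurable borel" unfolding \<phi>'_eq[abs_def] by measurable
  have "(\<integral>\<^sup>+x. ennreal ((cmod (\<phi>' x))\<^sup>2) \<partial>lborel) \<le> ennreal ((2 * pi) ^ DIM('a)) * (\<integral>\<^sup>+x. ennreal ((cmod (\<phi> x))\<^sup>2) \<partial>lborel)"
    unfolding \<phi>'_eq by (rule ft_L2_bound[OF \<phi>(2)]) simp
  also have "\<dots> < \<infinity>" using \<phi>(4) by (simp add: ennreal_mult_less_top)
  finally have \<phi>'2: "(\<integral>\<^sup>+x. ennreal ((cmod (\<phi>' x))\<^sup>2) \<partial>lborel) < \<infinity>" .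
  have if\<phi>: "integrable lborel (\<lambda>x. inv_ft F x * \<phi>' x)"
    by (rule integrable_mult_L2[OF _ _ f2 \<phi>'2]) measurable
  define K where "K = (\<integral>y. cmod (\<phi> y) \<partial>lborel)"
  have \<phi>'b: "cmod (\<phi>' x) \<le> K" for x
    unfolding \<phi>'_eq K_def by (rule order_trans[OF integral_norm_bound]) (simp add: norm_mult)
  have reg: "(\<integral>x. inv_ft F x * \<phi>' x * of_real (exp (- \<epsilon> * (norm x)\<^sup>2)) \<partial>lborel) = (\<integral>\<xi>. F \<xi> * (\<integral>y. \<phi> y * of_real (heat \<epsilon> (y - \<xi>)) \<partial>lborel) \<partial>lborel)"
    if e: "0 < \<epsilon>" for \<epsilon>
  proof -
    let ?g = "\<lambda>x::'a. complex_of_real (exp (- \<epsilon> * (norm x)\<^sup>2))"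
    have gn: "(\<integral>\<^sup>+x. ennreal (cmod (?g x)) \<partial>lborel) < \<infinity>"
      using gauss_nn_integral[OF e, where 'a='a] by simp
    have Fn: "(\<integral>\<^sup>+x. ennreal (cmod (F x)) \<partial>lborel) < \<infinity>" using F by (simp add: integrable_iff_bounded)
    have pn: "(\<integral>\<^sup>+x. ennreal (cmod (\<phi> x)) \<partial>lborel) < \<infinity>" using \<phi>(2) by (simp add: integrable_iff_bounded)
    have i1: "integrable (lborel \<Otimes>\<^sub>M lborel) (\<lambda>(x, \<xi>). F \<xi> * (cis (x \<bullet> \<xi>) * (\<phi>' x * ?g x)))"
    proof (rule lborel_pair.integrable_pair_nn)
      have "(\<integral>\<^sup>+x. \<integral>\<^sup>+\<xi>. ennreal (cmod (F \<xi> * (cis (x \<bullet> \<xi>) * (\<phi>' x * ?g x)))) \<partial>lborel \<partial>lborel)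
        \<le> (\<integral>\<^sup>+x. \<integral>\<^sup>+\<xi>. ennreal (cmod (F \<xi>)) * (ennreal K * ennreal (cmod (?g x))) \<partial>lborel \<partial>lborel)"
      proof (intro nn_integral_mono)
        fix x \<xi> :: 'a
        have "cmod (F \<xi>) * (cmod (\<phi>' x) * cmod (?g x)) \<le> cmod (F \<xi>) * (K * cmod (?g x))"
          by (intro mult_left_mono mult_right_mono \<phi>'b) auto
        thus "ennreal (cmod (F \<xi> * (cis (x \<bullet> \<xi>) * (\<phi>' x * ?g x)))) \<le> ennreal (cmod (F \<xi>)) * (ennreal K * ennreal (cmod (?g x)))"
          by (simp add: norm_mult ennreal_mult[symmetric] K_def ennreal_leI)
      qed
      also have "\<dots> = (\<integral>\<^sup>+\<xi>. ennreal (cmod (F \<xi>)) \<partial>lborel) * (ennreal K * (\<integral>\<^sup>+x. ennreal (cmod (?g x)) \<partial>lborel))"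
        by (simp add: nn_integral_multc nn_integral_cmult del: norm_of_real)
      also have "\<dots> < \<infinity>" using Fn gn by (simp add: ennreal_mult_less_top del: norm_of_real)
      finally show "(\<integral>\<^sup>+x. \<integral>\<^sup>+\<xi>. ennreal (cmod (F \<xi> * (cis (x \<bullet> \<xi>) * (\<phi>' x * ?g x)))) \<partial>lborel \<partial>lborel) < \<infinity>" .
    qed measurable
    have inner: "(\<integral>x. cis (x \<bullet> \<xi>) * (\<phi>' x * ?g x) \<partial>lborel) = of_real ((2 * pi) ^ DIM('a)) * (\<integral>y. \<phi> y * of_real (heat \<epsilon> (y - \<xi>)) \<partial>lborel)" for \<xi>
    proof -
      have i2: "integrable (lborel \<Otimes>\<^sub>M lborel) (\<lambda>(x, y). \<phi> y * (cis (x \<bullet> (\<xi> - y)) * ?g x))"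
      proof (rule lborel_pair.integrable_pair_nn)
        have "(\<integral>\<^sup>+x. \<integral>\<^sup>+y. ennreal (cmod (\<phi> y * (cis (x \<bullet> (\<xi> - y)) * ?g x))) \<partial>lborel \<partial>lborel)
          = (\<integral>\<^sup>+y. ennreal (cmod (\<phi> y)) \<partial>lborel) * (\<integral>\<^sup>+x. ennreal (cmod (?g x)) \<partial>lborel)"
          by (simp add: norm_mult ennreal_mult nn_integral_multc nn_integral_cmult)
        also have "\<dots> < \<infinity>" using pn gn by (simp add: ennreal_mult_less_top del: norm_of_real)
        finally show "(\<integral>\<^sup>+x. \<integral>\<^sup>+y. ennreal (cmod (\<phi> y * (cis (x \<bullet> (\<xi> - y)) * ?g x))) \<partial>lborel \<partial>lborel) < \<infinity>" .
      qed measurable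
      have "cis (x \<bullet> \<xi>) * (\<phi>' x * ?g x) = (\<integral>y. \<phi> y * (cis (x \<bullet> (\<xi> - y)) * ?g x) \<partial>lborel)" for x
      proof -
        have "\<phi> y * (cis (x \<bullet> (\<xi> - y)) * ?g x) = (cis (x \<bullet> \<xi>) * ?g x) * (\<phi> y * cis (- 1 * (y \<bullet> x)))" for y
        proof -
          have "cis (x \<bullet> (\<xi> - y)) = cis (x \<bullet> \<xi>) * cis (- 1 * (y \<bullet> x))"
            unfolding cis_mult by (simp add: inner_diff_right inner_commute)
          thus ?thesis by (simp only: mult_ac)
        qed
        note P = this
        show ?thesis unfolding \<phi>'_eq P integral_mult_right_zero by (simp only: mult_ac)
      qed
      hence "(\<integral>x. cis (x \<bullet> \<xi>) * (\<phi>' x * ?g x) \<partial>lborel) = (\<integral>x. \<integral>y. \<phi> y * (cis (x \<bullet> (\<xi> - y)) * ?g x) \<partial>lborel \<partial>lborel)" by simp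
      also have "\<dots> = (\<integral>y. \<integral>x. \<phi> y * (cis (x \<bullet> (\<xi> - y)) * ?g x) \<partial>lborel \<partial>lborel)"
        using lborel_pair.Fubini_integral[OF i2] by simp
      also have "\<dots> = (\<integral>y. of_real ((2 * pi) ^ DIM('a)) * (\<phi> y * of_real (heat \<epsilon> (y - \<xi>))) \<partial>lborel)"
      proof (rule Bochner_Integration.integral_cong[OF refl])
        fix y
        have "heat \<epsilon> (\<xi> - y) = heat \<epsilon> (y - \<xi>)" using heat_minus[of \<epsilon> "y - \<xi>"] by simp
        thus "(\<integral>x. \<phi> y * (cis (x \<bullet> (\<xi> - y)) * ?g x) \<partial>lborel) = of_real ((2 * pi) ^ DIM('a)) * (\<phi> y * of_real (heat \<epsilon> (y - \<xi>)))"
          unfolding integral_mult_right_zero heat_ft[OF e] by simp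
      qed
      finally show ?thesis by (simp only: integral_mult_right_zero)
    qed
    have "(\<integral>x. inv_ft F x * \<phi>' x * ?g x \<partial>lborel) = of_real ?k * (\<integral>x. \<integral>\<xi>. F \<xi> * (cis (x \<bullet> \<xi>) * (\<phi>' x * ?g x)) \<partial>lborel \<partial>lborel)"
      unfolding inv_ft_def integral_mult_right_zero[symmetric] integral_mult_left_zero[symmetric] by (simp only: mult.assoc)
    also have "\<dots> = of_real ?k * (\<integral>\<xi>. F \<xi> * (\<integral>x. cis (x \<bullet> \<xi>) * (\<phi>' x * ?g x) \<partial>lborel) \<partial>lborel)"
      using lborel_pair.Fubini_integral[OF i1] by simp
    also have "\<dots> = of_real (?k * (2 * pi) ^ DIM('a)) * (\<integral>\<xi>. F \<xi> * (\<integral>y. \<phi> y * of_real (heat \<epsilon> (y - \<xi>)) \<partial>lborel) \<partial>lborel)"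
      unfolding inner mult.left_commute[of "F _"] integral_mult_right_zero by (simp only: of_real_mult mult.assoc)
    finally show ?thesis unfolding ft_unit(2) by simp
  qed
  define \<epsilon> where "\<epsilon> n = 1 / real (Suc n)" for n
  have e: "0 < \<epsilon> n" for n by (simp add: \<epsilon>_def)
  have el: "\<epsilon> \<longlonglongrightarrow> 0" unfolding \<epsilon>_def using LIMSEQ_inverse_real_of_nat by (simp add: inverse_eq_divide)
  obtain \<rho> where \<rho>: "strict_mono \<rho>" "AE \<xi> in lborel. (\<lambda>n. \<integral>y. \<phi> y * of_real (heat (\<epsilon> (\<rho> n)) (y - \<xi>)) \<partial>lborel) \<longlonglongrightarrow> \<phi> \<xi>"
    using heat_mollify_AE[OF \<phi>(2) e el] by blast
  have el\<rho>: "(\<lambda>n. \<epsilon> (\<rho> n)) \<longlonglongrightarrow> 0" using LIMSEQ_subseq_LIMSEQ[OF el \<rho>(1)] by (simp add: o_def)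
  have hb: "cmod (\<integral>y. \<phi> y * of_real (heat \<epsilon>' (y - \<xi>)) \<partial>lborel) \<le> B" if e': "0 < \<epsilon>'" for \<epsilon>' \<xi>
  proof -
    have hs: "(\<integral>\<^sup>+y. ennreal (heat \<epsilon>' (y - \<xi>)) \<partial>lborel) = 1"
      using nn_integral_lborel_translate[of "\<lambda>z. ennreal (heat \<epsilon>' z)" "-\<xi>"] heat_integral(2)[OF e', where 'a='a] by simp
    have "ennreal (cmod (\<integral>y. \<phi> y * of_real (heat \<epsilon>' (y - \<xi>)) \<partial>lborel)) \<le> (\<integral>\<^sup>+y. ennreal (cmod (\<phi> y * of_real (heat \<epsilon>' (y - \<xi>)))) \<partial>lborel)"
      by (rule norm_integral_le_nn_integral)
    also have "\<dots> \<le> (\<integral>\<^sup>+y. ennreal B * ennreal (heat \<epsilon>' (y - \<xi>)) \<partial>lborel)"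
      using B by (intro nn_integral_mono) (auto simp: norm_mult heat_nonneg ennreal_mult[symmetric] intro!: ennreal_leI mult_right_mono)
    also have "\<dots> = ennreal B * (\<integral>\<^sup>+y. ennreal (heat \<epsilon>' (y - \<xi>)) \<partial>lborel)" by (rule nn_integral_cmult) measurable
    finally show ?thesis using B(1) by (simp add: hs ennreal_le_iff)
  qed
  have l1: "(\<lambda>n. \<integral>\<xi>. F \<xi> * (\<integral>y. \<phi> y * of_real (heat (\<epsilon> (\<rho> n)) (y - \<xi>)) \<partial>lborel) \<partial>lborel) \<longlonglongrightarrow> (\<integral>\<xi>. F \<xi> * \<phi> \<xi> \<partial>lborel)"
  proof (rule integral_dominated_convergence[where w="\<lambda>\<xi>. cmod (F \<xi>) * B"])
    show "integrable lborel (\<lambda>\<xi>. cmod (F \<xi>) * B)" using F by (intro integrable_mult_left integrable_norm)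
    show "AE \<xi> in lborel. (\<lambda>n. F \<xi> * (\<integral>y. \<phi> y * of_real (heat (\<epsilon> (\<rho> n)) (y - \<xi>)) \<partial>lborel)) \<longlonglongrightarrow> F \<xi> * \<phi> \<xi>"
      using \<rho>(2) by eventually_elim (intro tendsto_intros)
    show "AE \<xi> in lborel. cmod (F \<xi> * (\<integral>y. \<phi> y * of_real (heat (\<epsilon> (\<rho> n)) (y - \<xi>)) \<partial>lborel)) \<le> cmod (F \<xi>) * B" for n
      unfolding norm_mult by (intro AE_I2 mult_left_mono hb e) auto
  qed measurable
  have l2: "(\<lambda>n. \<integral>x. inv_ft F x * \<phi>' x * of_real (exp (- \<epsilon> (\<rho> n) * (norm x)\<^sup>2)) \<partial>lborel) \<longlonglongrightarrow> (\<integral>x. inv_ft F x * \<phi>' x \<partial>lborel)"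
  proof (rule integral_dominated_convergence[where w="\<lambda>x. cmod (inv_ft F x * \<phi>' x)"])
    show "AE x in lborel. (\<lambda>n. inv_ft F x * \<phi>' x * of_real (exp (- \<epsilon> (\<rho> n) * (norm x)\<^sup>2))) \<longlonglongrightarrow> inv_ft F x * \<phi>' x"
    proof (rule AE_I2)
      fix x :: 'a
      have "(\<lambda>n. inv_ft F x * \<phi>' x * of_real (exp (- \<epsilon> (\<rho> n) * (norm x)\<^sup>2))) \<longlonglongrightarrow> inv_ft F x * \<phi>' x * of_real (exp (- 0 * (norm x)\<^sup>2))"
        by (intro tendsto_intros el\<rho>)
      thus "(\<lambda>n. inv_ft F x * \<phi>' x * of_real (exp (- \<epsilon> (\<rho> n) * (norm x)\<^sup>2))) \<longlonglongrightarrow> inv_ft F x * \<phi>' x" by simp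
    qed
    show "AE x in lborel. cmod (inv_ft F x * \<phi>' x * of_real (exp (- \<epsilon> (\<rho> n) * (norm x)\<^sup>2))) \<le> cmod (inv_ft F x * \<phi>' x)" for n
    proof (rule AE_I2)
      fix x :: 'a
      have "exp (- \<epsilon> (\<rho> n) * (norm x)\<^sup>2) \<le> 1" using e[of "\<rho> n"] by simp
      thus "cmod (inv_ft F x * \<phi>' x * of_real (exp (- \<epsilon> (\<rho> n) * (norm x)\<^sup>2))) \<le> cmod (inv_ft F x * \<phi>' x)"
        unfolding norm_mult[of "inv_ft F x * \<phi>' x"] by (intro mult_left_le) auto
    qed
  qed (use if\<phi> in \<open>auto intro: integrable_norm\<close>)
  show "(\<integral>x. inv_ft F x * fourier \<phi> x \<partial>lborel) = (\<integral>\<xi>. F \<xi> * \<phi> \<xi> \<partial>lborel)"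
    using LIMSEQ_unique[OF l2 l1[folded reg[OF e]]] by (simp add: \<phi>'_def)
qed

text \<open>The converse inequality is \<open>has_ft_sum_L2\<close> for the one-element system, now
  that \<open>F\<close> is known to be the transform of \<open>inv_ft F\<close>.\<close>

lemma inv_ft_L2_eq:
  fixes F :: "'a::euclidean_space \<Rightarrow> complex"
  assumes F: "integrable lborel F" and F2: "(\<integral>\<^sup>+x. ennreal ((cmod (F x))\<^sup>2) \<partial>lborel) < \<infinity>"
  shows "(\<integral>\<^sup>+x. ennreal ((cmod (inv_ft F x))\<^sup>2) \<partial>lborel) = ennreal ((ft_unit TYPE('a))\<^sup>2) * (\<integral>\<^sup>+x. ennreal ((cmod (F x))\<^sup>2) \<partial>lborel)"
proof (rule antisym[OF inv_ft_L2_le[OF F]])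
  let ?k = "(ft_unit TYPE('a))\<^sup>2"
  have f2: "(\<integral>\<^sup>+x. ennreal ((cmod (inv_ft F x))\<^sup>2) \<partial>lborel) < \<infinity>"
    using F2 by (intro le_less_trans[OF inv_ft_L2_le[OF F]]) (simp add: ennreal_mult_less_top)
  have "(\<integral>\<^sup>+x. ennreal ((cmod (F x))\<^sup>2) \<partial>lborel) \<le> ennreal ((2 * pi) ^ DIM('a)) * (\<integral>\<^sup>+x. ennreal ((cmod (inv_ft F x))\<^sup>2) \<partial>lborel)"
    using has_ft_sum_L2[of "{0}" "\<lambda>_. inv_ft F" "\<lambda>_. F" "\<lambda>_. 1"] inv_ft_has_ft[OF F F2] f2 by simp
  hence "ennreal ?k * (\<integral>\<^sup>+x. ennreal ((cmod (F x))\<^sup>2) \<partial>lborel) \<le> ennreal ?k * (ennreal ((2 * pi) ^ DIM('a)) * (\<integral>\<^sup>+x. ennreal ((cmod (inv_ft F x))\<^sup>2) \<partial>lborel))"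
    by (rule mult_left_mono) simp
  also have "\<dots> = ennreal (?k * (2 * pi) ^ DIM('a)) * (\<integral>\<^sup>+x. ennreal ((cmod (inv_ft F x))\<^sup>2) \<partial>lborel)"
    by (simp add: mult.assoc[symmetric] ennreal_mult[symmetric])
  finally show "ennreal ?k * (\<integral>\<^sup>+x. ennreal ((cmod (F x))\<^sup>2) \<partial>lborel) \<le> (\<integral>\<^sup>+x. ennreal ((cmod (inv_ft F x))\<^sup>2) \<partial>lborel)"
    unfolding ft_unit(2) by simp
qed

lemma inv_ft_linear:
  assumes "integrable lborel F" "integrable lborel G"
  shows "inv_ft (\<lambda>\<xi>. F \<xi> + b * G \<xi>) x = inv_ft F x + b * inv_ft G x"
proof -
  have i: "integrable lborel (\<lambda>\<xi>. F \<xi> * cis (x \<bullet> \<xi>))" "integrable lborel (\<lambda>\<xi>. G \<xi> * cis (x \<bullet> \<xi>))"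
    by (rule integrable_mult_cis[OF assms(1)] integrable_mult_cis[OF assms(2)], measurable)+
  have "(\<integral>\<xi>. (F \<xi> + b * G \<xi>) * cis (x \<bullet> \<xi>) \<partial>lborel) = (\<integral>\<xi>. F \<xi> * cis (x \<bullet> \<xi>) + b * (G \<xi> * cis (x \<bullet> \<xi>)) \<partial>lborel)"
    by (simp only: distrib_right mult.assoc)
  also have "\<dots> = (\<integral>\<xi>. F \<xi> * cis (x \<bullet> \<xi>) \<partial>lborel) + b * (\<integral>\<xi>. G \<xi> * cis (x \<bullet> \<xi>) \<partial>lborel)"
    by (subst Bochner_Integration.integral_add[OF i(1) integrable_mult_right[OF i(2)]]) simp
  finally show ?thesis by (simp add: inv_ft_def algebra_simps)
qed

lemma cmod_add_mult_square: "(cmod (z + b * w))\<^sup>2 = (cmod z)\<^sup>2 + (cmod b)\<^sup>2 * (cmod w)\<^sup>2 + 2 * Re (cnj b * (z * cnj w))"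
  unfolding cmod_power2 by (simp add: algebra_simps power2_eq_square)

text \<open>Polarisation. Disjoint supports give F i + b F j the squared norm (2 pi)^d (1 + |b|^2),
  and \<open>inv_ft_L2_eq\<close> transfers this to the inverse transforms. Comparison with the
  expanded square yields \<open>Re (cnj b * I) = 0\<close> for the inner product \<open>I\<close>;
  the choices 1 and \<open>\<i>\<close> of \<open>b\<close> show that \<open>I\<close>
  vanishes.\<close>

lemma inv_ft_orthonormal:
  fixes F :: "nat \<Rightarrow> 'a::euclidean_space \<Rightarrow> complex"
  assumes F: "\<And>j. j \<in> J \<Longrightarrow> integrable lborel (F j)"
    and F2: "\<And>j. j \<in> J \<Longrightarrow> (\<integral>\<^sup>+x. ennreal ((cmod (F j x))\<^sup>2) \<partial>lborel) = ennreal ((2 * pi) ^ DIM('a))"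
    and disj: "\<And>i j x. i \<in> J \<Longrightarrow> j \<in> J \<Longrightarrow> i \<noteq> j \<Longrightarrow> F i x = 0 \<or> F j x = 0"
    and ij: "i \<in> J" "j \<in> J"
  shows "square_integrable (inv_ft (F i))" "(\<integral>x. inv_ft (F i) x * cnj (inv_ft (F j) x) \<partial>lborel) = (if i = j then 1 else 0)"
proof -
  let ?k = "(ft_unit TYPE('a))\<^sup>2"
  have Fm [measurable]: "F i \<in> borel_measurable borel" if "i \<in> J" for i using F[OF that] borel_measurable_integrable by fastforce
  have n1: "(\<integral>\<^sup>+x. ennreal ((cmod (inv_ft (F i) x))\<^sup>2) \<partial>lborel) = 1" if "i \<in> J" for i
  proof -
    have "(\<integral>\<^sup>+x. ennreal ((cmod (inv_ft (F i) x))\<^sup>2) \<partial>lborel) = ennreal ?k * ennreal ((2 * pi) ^ DIM('a))"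
      unfolding F2[OF that, symmetric] by (rule inv_ft_L2_eq[OF F[OF that]]) (simp add: F2[OF that])
    also have "\<dots> = ennreal (?k * (2 * pi) ^ DIM('a))" by (intro ennreal_mult[symmetric]) auto
    finally show ?thesis unfolding ft_unit(2) by simp
  qed
  have sq: "integrable lborel (\<lambda>x. (cmod (inv_ft (F i) x))\<^sup>2)" if "i \<in> J" for i
    by (rule integrableI_bounded) (use n1[OF that] Fm[OF that] in auto)
  have s1: "(\<integral>x. (cmod (inv_ft (F i) x))\<^sup>2 \<partial>lborel) = 1" if "i \<in> J" for i
  proof -
    have "ennreal (\<integral>x. (cmod (inv_ft (F i) x))\<^sup>2 \<partial>lborel) = 1"
      using nn_integral_eq_integral[OF sq[OF that]] n1[OF that] by simp
    thus ?thesis by (simp add: ennreal_eq_1)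
  qed
  show "square_integrable (inv_ft (F i))"
    unfolding square_integrable_def using Fm sq ij by auto
  show "(\<integral>x. inv_ft (F i) x * cnj (inv_ft (F j) x) \<partial>lborel) = (if i = j then 1 else 0)"
  proof (cases "i = j")
    case True
    have "(\<integral>x. inv_ft (F i) x * cnj (inv_ft (F i) x) \<partial>lborel) = (\<integral>x. complex_of_real ((cmod (inv_ft (F i) x))\<^sup>2) \<partial>lborel)"
      by (intro Bochner_Integration.integral_cong refl) (simp add: complex_norm_square del: of_real_power)
    also have "\<dots> = 1" unfolding integral_complex_of_real s1[OF ij(1)] by simp
    finally show ?thesis using True by simp
  next
    case ne: False
    let ?f = "inv_ft (F i)" and ?h = "inv_ft (F j)"
    define I where "I = (\<integral>x. ?f x * cnj (?h x) \<partial>lborel)"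
    have ifh: "integrable lborel (\<lambda>x. ?f x * cnj (?h x))"
      by (rule integrable_mult_L2) (use n1[OF ij(1)] n1[OF ij(2)] Fm[OF ij(1)] Fm[OF ij(2)] in auto)
    have re: "Re (cnj b * I) = 0" for b
    proof -
      let ?G = "\<lambda>\<xi>. F i \<xi> + b * F j \<xi>"
      have iG: "integrable lborel ?G" by (intro Bochner_Integration.integrable_add integrable_mult_right F ij)
      have Gsq: "(cmod (?G \<xi>))\<^sup>2 = (cmod (F i \<xi>))\<^sup>2 + (cmod b)\<^sup>2 * (cmod (F j \<xi>))\<^sup>2" for \<xi>
        using disj[OF ij ne, of \<xi>] by (auto simp: norm_mult power_mult_distrib)
      have G2: "(\<integral>\<^sup>+x. ennreal ((cmod (?G x))\<^sup>2) \<partial>lborel) = ennreal ((1 + (cmod b)\<^sup>2) * (2 * pi) ^ DIM('a))"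
      proof -
        have "(\<integral>\<^sup>+x. ennreal ((cmod (?G x))\<^sup>2) \<partial>lborel) = (\<integral>\<^sup>+x. ennreal ((cmod (F i x))\<^sup>2) + ennreal ((cmod b)\<^sup>2) * ennreal ((cmod (F j x))\<^sup>2) \<partial>lborel)"
          unfolding Gsq by (simp add: ennreal_mult)
        also have "\<dots> = (\<integral>\<^sup>+x. ennreal ((cmod (F i x))\<^sup>2) \<partial>lborel) + ennreal ((cmod b)\<^sup>2) * (\<integral>\<^sup>+x. ennreal ((cmod (F j x))\<^sup>2) \<partial>lborel)"
          using Fm[OF ij(1)] Fm[OF ij(2)] by (simp add: nn_integral_add nn_integral_cmult)
        also have "\<dots> = ennreal ((1 + (cmod b)\<^sup>2) * (2 * pi) ^ DIM('a))"
          unfolding F2[OF ij(1)] F2[OF ij(2)] by (simp add: ennreal_mult[symmetric] ennreal_plus[symmetric] distrib_right del: ennreal_plus)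
        finally show ?thesis .
      qed
      have "(\<integral>\<^sup>+x. ennreal ((cmod (?f x + b * ?h x))\<^sup>2) \<partial>lborel) = ennreal ?k * ennreal ((1 + (cmod b)\<^sup>2) * (2 * pi) ^ DIM('a))"
        unfolding inv_ft_linear[OF F[OF ij(1)] F[OF ij(2)], symmetric] G2[symmetric] by (rule inv_ft_L2_eq[OF iG]) (simp add: G2)
      also have "\<dots> = ennreal (?k * ((1 + (cmod b)\<^sup>2) * (2 * pi) ^ DIM('a)))" by (intro ennreal_mult[symmetric]) auto
      also have "?k * ((1 + (cmod b)\<^sup>2) * (2 * pi) ^ DIM('a)) = (?k * (2 * pi) ^ DIM('a)) * (1 + (cmod b)\<^sup>2)" by (simp only: mult_ac)
      finally have nn: "(\<integral>\<^sup>+x. ennreal ((cmod (?f x + b * ?h x))\<^sup>2) \<partial>lborel) = ennreal (1 + (cmod b)\<^sup>2)" unfolding ft_unit(2) by simp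
      have ex: "(cmod (?f x + b * ?h x))\<^sup>2 = (cmod (?f x))\<^sup>2 + (cmod b)\<^sup>2 * (cmod (?h x))\<^sup>2 + 2 * Re (cnj b * (?f x * cnj (?h x)))" for x
        by (rule cmod_add_mult_square)
      have i3: "integrable lborel (\<lambda>x. Re (cnj b * (?f x * cnj (?h x))))" by (intro integrable_Re integrable_mult_right ifh)
      have i4: "integrable lborel (\<lambda>x. (cmod (?f x + b * ?h x))\<^sup>2)"
        unfolding ex by (intro Bochner_Integration.integrable_add integrable_mult_right sq ij i3)
      have "ennreal (\<integral>x. (cmod (?f x + b * ?h x))\<^sup>2 \<partial>lborel) = ennreal (1 + (cmod b)\<^sup>2)"
        using nn_integral_eq_integral[OF i4] nn by (simp del: ennreal_plus)
      hence "(\<integral>x. (cmod (?f x + b * ?h x))\<^sup>2 \<partial>lborel) = 1 + (cmod b)\<^sup>2"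
        by (subst (asm) ennreal_inj) auto
      moreover have "(\<integral>x. (cmod (?f x + b * ?h x))\<^sup>2 \<partial>lborel) = 1 + (cmod b)\<^sup>2 * 1 + 2 * (\<integral>x. Re (cnj b * (?f x * cnj (?h x))) \<partial>lborel)"
      proof -
        have "(\<integral>x. X x + c * Y x + 2 * W x \<partial>lborel) = (\<integral>x. X x \<partial>lborel) + c * (\<integral>x. Y x \<partial>lborel) + 2 * (\<integral>x. W x \<partial>lborel)"
          if "integrable lborel X" "integrable lborel Y" "integrable lborel W" for X Y W :: "'a \<Rightarrow> real" and c
          using that by simp
        note this[OF sq[OF ij(1)] sq[OF ij(2)] i3]
        thus ?thesis unfolding ex s1[OF ij(1)] s1[OF ij(2)] .
      qed
      moreover have "(\<integral>x. Re (cnj b * (?f x * cnj (?h x))) \<partial>lborel) = Re (cnj b * I)"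
        unfolding I_def integral_mult_right_zero[symmetric] by (rule integral_Re[OF integrable_mult_right[OF ifh]])
      ultimately show ?thesis by simp
    qed
    have "I = 0" using re[of 1] re[of \<i>] by (simp add: complex_eq_iff)
    thus ?thesis using ne by (simp add: I_def)
  qed
qed

section \<open>Dyadic shells and failure above the critical exponent\<close>

lemma bounded_on_ball_integrable:
  fixes F :: "'a::euclidean_space \<Rightarrow> complex"
  assumes [measurable]: "F \<in> borel_measurable borel"
    and B: "\<And>x. cmod (F x) \<le> B" and supp: "\<And>x. r \<le> norm x \<Longrightarrow> F x = 0"
  shows "integrable lborel F" "(\<integral>\<^sup>+x. ennreal ((cmod (F x))\<^sup>2) \<partial>lborel) < \<infinity>"
proof -
  have bd: "(\<integral>\<^sup>+x. ennreal (h x) \<partial>lborel) < \<infinity>"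
    if "\<And>x. h x \<le> b" "\<And>x. r \<le> norm x \<Longrightarrow> h x = 0" for h :: "'a \<Rightarrow> real" and b
  proof -
    have "(\<integral>\<^sup>+x. ennreal (h x) \<partial>lborel) \<le> (\<integral>\<^sup>+x. ennreal b * indicator (cball 0 r) x \<partial>(lborel::'a measure))"
    proof (rule nn_integral_mono)
      fix x :: 'a
      show "ennreal (h x) \<le> ennreal b * indicator (cball 0 r) x"
        using that(1)[of x] that(2)[of x] by (cases "r \<le> norm x") (auto simp: indicator_def intro!: ennreal_leI)
    qed
    also have "\<dots> = ennreal b * emeasure lborel (cball (0::'a) r)" by (rule nn_integral_cmult_indicator) simp
    also have "\<dots> < \<infinity>" using emeasure_lborel_cball_finite[of "0::'a" r] by (simp add: ennreal_mult_less_top)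
    finally show ?thesis .
  qed
  show "integrable lborel F" using bd[of "\<lambda>x. cmod (F x)" B] B supp by (intro integrableI_bounded) auto
  show "(\<integral>\<^sup>+x. ennreal ((cmod (F x))\<^sup>2) \<partial>lborel) < \<infinity>"
    using B supp by (intro bd[of _ "B\<^sup>2"]) (auto intro!: power_mono)
qed

section \<open>The system of shell functions\<close>

definition dyadic_shell :: "nat \<Rightarrow> 'a::euclidean_space set" where
  "dyadic_shell j = {\<xi>. 2 ^ j \<le> norm \<xi> \<and> norm \<xi> < 2 ^ Suc j}"

lemma dyadic_shell_borel [measurable]: "dyadic_shell j \<in> sets borel"
  unfolding dyadic_shell_def by measurable

lemma dyadic_shell_disjoint:
  assumes "\<xi> \<in> dyadic_shell i" "\<xi> \<in> dyadic_shell j"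
  shows "i = j"
proof -
  have "\<not> i < j" if "\<xi> \<in> dyadic_shell i" "\<xi> \<in> dyadic_shell j" for i j
  proof
    assume "i < j"
    hence "(2::real) ^ Suc i \<le> 2 ^ j" by (intro power_increasing) auto
    thus False using that by (auto simp: dyadic_shell_def)
  qed
  thus ?thesis using assms by (meson linorder_neqE_nat)
qed

lemma dyadic_shell_volume:
  "emeasure lborel (dyadic_shell j :: 'a::euclidean_space set) < \<infinity>"
  "measure lborel (dyadic_shell j :: 'a set) = unit_ball_vol (real DIM('a)) * (2 ^ DIM('a) - 1) * (2 ^ j) ^ DIM('a)"
proof -
  have e: "(dyadic_shell j :: 'a set) = ball 0 (2 ^ Suc j) - ball 0 (2 ^ j)"
    by (auto simp: dyadic_shell_def)
  have "emeasure lborel (dyadic_shell j :: 'a set) \<le> emeasure lborel (ball (0::'a) (2 ^ Suc j))"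
    by (rule emeasure_mono) (auto simp: e)
  also have "\<dots> < \<infinity>" using emeasure_lborel_ball_finite[of "0::'a"] by simp
  finally show "emeasure lborel (dyadic_shell j :: 'a set) < \<infinity>" .
  have "measure lborel (dyadic_shell j :: 'a set) = measure lborel (ball (0::'a) (2 ^ Suc j)) - measure lborel (ball (0::'a) (2 ^ j))"
    unfolding e using emeasure_lborel_ball_finite[of "0::'a" "2 ^ Suc j"] by (intro measure_Diff) (auto simp: subset_ball)
  also have "\<dots> = unit_ball_vol (real DIM('a)) * (2 ^ DIM('a) - 1) * (2 ^ j) ^ DIM('a)"
    by (simp add: content_ball power_mult_distrib algebra_simps)
  finally show "measure lborel (dyadic_shell j :: 'a set) = unit_ball_vol (real DIM('a)) * (2 ^ DIM('a) - 1) * (2 ^ j) ^ DIM('a)" .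
qed

lemma shell_volume_pos: "0 < measure lborel (dyadic_shell j :: 'a::euclidean_space set)"
proof -
  have "(1::real) < 2 ^ DIM('a)" by (rule one_less_power) auto
  thus ?thesis unfolding dyadic_shell_volume by simp
qed

lemma cos_ge_half: "\<bar>\<theta>::real\<bar> \<le> 1 \<Longrightarrow> 1 / 2 \<le> cos \<theta>"
proof -
  assume "\<bar>\<theta>\<bar> \<le> 1"
  hence "cos (pi / 3) \<le> cos \<bar>\<theta>\<bar>" using pi_gt3 by (intro cos_monotone_0_pi_le) auto
  thus ?thesis by (simp add: cos_60)
qed

text \<open>For such \<open>x\<close> and \<open>t\<close> each of the two terms of the phase is at
  most 1/2 on the shell, where |\<xi>| < 2^(j+1). The cosine of the phase is then at least 1/2, so
  the integral has no cancellation.\<close>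

lemma shell_wave_lower_bound:
  fixes x :: "'a::euclidean_space"
  assumes x: "norm x \<le> 1 / (4 * 2 ^ j)" and t: "0 \<le> t" "t \<le> 1 / (8 * 4 ^ j)" and a: "0 \<le> a"
  shows "(ft_unit TYPE('a))\<^sup>2 * (a * measure lborel (dyadic_shell j :: 'a set) / 2)
    \<le> cmod (inv_ft (\<lambda>\<xi>. cis (- (t * (norm \<xi>)\<^sup>2)) * of_real (a * indicator (dyadic_shell j) \<xi>)) x)"
proof -
  let ?S = "dyadic_shell j :: 'a set"
  let ?k = "(ft_unit TYPE('a))\<^sup>2"
  let ?h = "\<lambda>\<xi>. cis (- (t * (norm \<xi>)\<^sup>2)) * of_real (a * indicator ?S \<xi>) * cis (x \<bullet> \<xi>)"
  have ih: "integrable lborel ?h"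
    by (rule bounded_on_ball_integrable(1)[where B=a and r="2 ^ Suc j"])
       (use a in \<open>auto simp: norm_mult indicator_def dyadic_shell_def\<close>)
  have ph: "\<bar>x \<bullet> \<xi> - t * (norm \<xi>)\<^sup>2\<bar> \<le> 1" if "\<xi> \<in> ?S" for \<xi>
  proof -
    have n: "norm \<xi> \<le> 2 * 2 ^ j" using that by (auto simp: dyadic_shell_def)
    have "\<bar>x \<bullet> \<xi>\<bar> \<le> norm x * norm \<xi>" by (rule Cauchy_Schwarz_ineq2)
    also have "\<dots> \<le> (1 / (4 * 2 ^ j)) * (2 * 2 ^ j)" by (intro mult_mono x n) auto
    also have "\<dots> = 1 / 2" by simp
    finally have 1: "\<bar>x \<bullet> \<xi>\<bar> \<le> 1 / 2" .
    have "(norm \<xi>)\<^sup>2 \<le> (2 * 2 ^ j)\<^sup>2" by (intro power_mono n) auto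
    also have "(2 * 2 ^ j :: real)\<^sup>2 = 4 * 4 ^ j" by (simp add: power_mult_distrib power2_eq_square flip: power_mult_distrib)
    finally have n2: "(norm \<xi>)\<^sup>2 \<le> 4 * 4 ^ j" .
    have "t * (norm \<xi>)\<^sup>2 \<le> (1 / (8 * 4 ^ j)) * (4 * 4 ^ j)" by (intro mult_mono t n2) auto
    also have "\<dots> = 1 / 2" by simp
    finally have 2: "t * (norm \<xi>)\<^sup>2 \<le> 1 / 2" .
    have "0 \<le> t * (norm \<xi>)\<^sup>2" using t by simp
    thus ?thesis using 1 2 by linarith
  qed
  have re: "Re (?h \<xi>) = a * indicator ?S \<xi> * cos (x \<bullet> \<xi> - t * (norm \<xi>)\<^sup>2)" for \<xi>
  proof -
    have eq: "?h \<xi> = of_real (a * indicator ?S \<xi>) * cis (x \<bullet> \<xi> - t * (norm \<xi>)\<^sup>2)"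
    proof -
      have "cis (x \<bullet> \<xi> - t * (norm \<xi>)\<^sup>2) = cis (- (t * (norm \<xi>)\<^sup>2)) * cis (x \<bullet> \<xi>)" by (simp add: cis_mult)
      thus ?thesis by (simp only: mult_ac)
    qed
    show ?thesis unfolding eq by simp
  qed
  have "(a / 2) * measure lborel ?S = (\<integral>\<xi>. a / 2 * indicator ?S \<xi> \<partial>lborel)" by simp
  also have "\<dots> \<le> (\<integral>\<xi>. Re (?h \<xi>) \<partial>lborel)"
  proof (rule integral_mono)
    show "integrable lborel (\<lambda>\<xi>. a / 2 * indicator ?S \<xi>)"
      using dyadic_shell_volume(1)[of j, where 'a='a] by (intro integrable_mult_right integrable_real_indicator) auto
    show "integrable lborel (\<lambda>\<xi>. Re (?h \<xi>))" by (rule integrable_Re[OF ih])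
    fix \<xi> :: 'a
    show "a / 2 * indicator ?S \<xi> \<le> Re (?h \<xi>)"
    proof (cases "\<xi> \<in> ?S")
      case True
      thus ?thesis unfolding re using mult_left_mono[OF cos_ge_half[OF ph[OF True]] a] by simp
    qed (simp add: re)
  qed
  also have "\<dots> = Re (\<integral>\<xi>. ?h \<xi> \<partial>lborel)" by (rule integral_Re[OF ih])
  also have "\<dots> \<le> cmod (\<integral>\<xi>. ?h \<xi> \<partial>lborel)" by (rule complex_Re_le_cmod)
  finally have "?k * ((a / 2) * measure lborel ?S) \<le> ?k * cmod (\<integral>\<xi>. ?h \<xi> \<partial>lborel)" by (rule mult_left_mono) simp
  thus ?thesis by (simp add: inv_ft_def norm_mult norm_power)
qed

lemma inv_ft_multiplier:
  fixes F :: "'a::euclidean_space \<Rightarrow> complex"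
  assumes [measurable]: "F \<in> borel_measurable borel" "m \<in> borel_measurable borel"
    and F: "\<And>x. cmod (F x) \<le> B" and mF: "\<And>x. cmod (m x * F x) \<le> B'" and supp: "\<And>x. r \<le> norm x \<Longrightarrow> F x = 0"
  shows "fourier_multiplier m (inv_ft F) (inv_ft (\<lambda>\<xi>. m \<xi> * F \<xi>))"
  unfolding fourier_multiplier_def
proof (intro exI conjI)
  show "has_fourier_transform (inv_ft F) F"
    by (intro inv_ft_has_ft bounded_on_ball_integrable[where B=B and r=r] F supp) measurable
  have m: "(\<lambda>\<xi>. m \<xi> * F \<xi>) \<in> borel_measurable borel" by measurable
  have s: "m x * F x = 0" if "r \<le> norm x" for x using supp[OF that] by simp
  show "has_fourier_transform (inv_ft (\<lambda>\<xi>. m \<xi> * F \<xi>)) (\<lambda>\<xi>. m \<xi> * F \<xi>)"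
    by (intro inv_ft_has_ft bounded_on_ball_integrable[OF m mF s])
qed

lemma inv_ft_schroedinger:
  fixes F :: "'a::euclidean_space \<Rightarrow> complex"
  assumes [measurable]: "F \<in> borel_measurable borel"
    and F: "\<And>x. cmod (F x) \<le> B" and supp: "\<And>x. r \<le> norm x \<Longrightarrow> F x = 0"
  shows "schroedinger_evolution (inv_ft F) (\<lambda>t. inv_ft (\<lambda>\<xi>. cis (- (t * (norm \<xi>)\<^sup>2)) * F \<xi>))"
  unfolding schroedinger_evolution_def
proof (intro conjI allI)
  have "(\<lambda>z::real \<times> 'a. inv_ft (\<lambda>\<xi>. cis (- (fst z * (norm \<xi>)\<^sup>2)) * F \<xi>) (snd z)) \<in> borel_measurable (borel \<Otimes>\<^sub>M borel)"
    unfolding inv_ft_def by measurable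
  thus "(\<lambda>(t, x). inv_ft (\<lambda>\<xi>. cis (- (t * (norm \<xi>)\<^sup>2)) * F \<xi>) x) \<in> borel_measurable borel"
    by (simp add: borel_prod split_beta')
  show "fourier_multiplier (\<lambda>\<xi>. cis (- (t * (norm \<xi>)\<^sup>2))) (inv_ft F) (inv_ft (\<lambda>\<xi>. cis (- (t * (norm \<xi>)\<^sup>2)) * F \<xi>))" for t
    by (rule inv_ft_multiplier[OF _ _ F _ supp, where B'=B]) (use F in \<open>auto simp: norm_mult\<close>)
qed

text \<open>Normalisation in the Sobolev space makes the amplitude a(j)^2 of order 2^(-j(d + 2s)),
  and the shell has a volume of order 2^(jd). At the focus the squared modulus is of order (a(j)
  2^(jd))^2, that is 2^(j(d - 2s)). Disjointness of the shells gives orthogonality.\<close>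

lemma dyadic_shell_system:
  assumes s: "0 \<le> s"
  obtains f :: "nat \<Rightarrow> 'a::euclidean_space \<Rightarrow> complex" and u c where "0 < c"
    "\<And>J. orthonormal_hom_sobolev s J f" "\<And>j. schroedinger_evolution (f j) (u j)"
    "\<And>j t x. norm x \<le> 1 / (4 * 2 ^ j) \<Longrightarrow> 0 \<le> t \<Longrightarrow> t \<le> 1 / (8 * 4 ^ j) \<Longrightarrow>
       c * (2 ^ j) powr (real DIM('a) - 2 * s) \<le> (cmod (u j t x))\<^sup>2"
proof -
  let ?S = "dyadic_shell :: nat \<Rightarrow> 'a set"
  let ?k = "(ft_unit TYPE('a))\<^sup>2"
  define V where "V j = measure lborel (?S j)" for j
  define V0 where "V0 = unit_ball_vol (real DIM('a)) * (2 ^ DIM('a) - 1)"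
  have V: "V j = V0 * (2 ^ j) ^ DIM('a)" for j unfolding V_def V0_def dyadic_shell_volume ..
  have Vp: "0 < V j" for j unfolding V_def by (rule shell_volume_pos)
  have V0p: "0 < V0" using Vp[of 0] V[of 0] by simp
  define h where "h j \<xi> = indicator (?S j) \<xi> * norm \<xi> powr (2 * s)" for j \<xi>
  define I where "I j = (\<integral>\<xi>. h j \<xi> \<partial>lborel)" for j
  have hm [measurable]: "h j \<in> borel_measurable borel" for j unfolding h_def by measurable
  have h_up: "h j \<xi> \<le> (2 ^ Suc j) powr (2 * s) * indicator (?S j) \<xi>" for j \<xi>
    using s by (auto simp: h_def indicator_def dyadic_shell_def intro!: powr_mono2)
  have h_lo: "(2 ^ j) powr (2 * s) * indicator (?S j) \<xi> \<le> h j \<xi>" for j \<xi>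
    using s by (auto simp: h_def indicator_def dyadic_shell_def intro!: powr_mono2)
  have h0: "0 \<le> h j \<xi>" for j \<xi> by (simp add: h_def)
  have iS: "integrable lborel (\<lambda>\<xi>. b * indicator (?S j) \<xi> :: real)" for j b
    using dyadic_shell_volume(1)[of j, where 'a='a] by (intro integrable_mult_right integrable_real_indicator) auto
  have ih: "integrable lborel (h j)" for j
    by (rule Bochner_Integration.integrable_bound[OF iS[of "(2 ^ Suc j) powr (2 * s)" j]])
       (use h_up[of j] h0[of j] in \<open>auto simp: abs_of_nonneg intro!: AE_I2\<close>)
  have I_up: "I j \<le> (2 ^ Suc j) powr (2 * s) * V j" for j
    using integral_mono[OF ih iS h_up, of j] by (simp add: I_def V_def)
  have "(2 ^ j) powr (2 * s) * V j \<le> I j" for j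
    using integral_mono[OF iS ih h_lo, of j] by (simp add: I_def V_def)
  hence Ip: "0 < I j" for j using Vp[of j] by (smt (verit) mult_pos_pos powr_gt_zero zero_less_power)
  \<comment> \<open>Chosen so that \<open>G j\<close>, the transform of the L2 function belonging to
    \<open>f j\<close>, has the squared norm (2 pi)^d required by
    \<open>inv_ft_orthonormal\<close>.\<close>
  define a where "a j = sqrt ((2 * pi) ^ DIM('a) / I j)" for j
  have a0: "0 \<le> a j" for j using Ip[of j] by (simp add: a_def)
  have a2: "(a j)\<^sup>2 = (2 * pi) ^ DIM('a) / I j" for j using Ip[of j] by (simp add: a_def)
  define F where "F j \<xi> = complex_of_real (a j * indicator (?S j) \<xi>)" for j \<xi>
  have Fm [measurable]: "F j \<in> borel_measurable borel" for j unfolding F_def by measurable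
  have Fb: "cmod (F j \<xi>) \<le> a j" for j \<xi> using a0[of j] by (simp add: F_def indicator_def)
  have Fs: "F j \<xi> = 0" if "2 ^ Suc j \<le> norm \<xi>" for j \<xi> using that by (simp add: F_def dyadic_shell_def)
  define G where "G j \<xi> = complex_of_real (norm \<xi> powr s) * F j \<xi>" for j \<xi>
  have Gm [measurable]: "G j \<in> borel_measurable borel" for j unfolding G_def by measurable
  have Gb: "cmod (G j \<xi>) \<le> (2 ^ Suc j) powr s * a j" for j \<xi>
    using s a0[of j] by (auto simp: G_def F_def norm_mult indicator_def dyadic_shell_def intro!: mult_right_mono powr_mono2)
  have Gs: "G j \<xi> = 0" if "2 ^ Suc j \<le> norm \<xi>" for j \<xi> using Fs[OF that] by (simp add: G_def)
  have G2: "(\<integral>\<^sup>+\<xi>. ennreal ((cmod (G j \<xi>))\<^sup>2) \<partial>lborel) = ennreal ((2 * pi) ^ DIM('a))" for j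
  proof -
    have "(cmod (G j \<xi>))\<^sup>2 = (a j)\<^sup>2 * h j \<xi>" for \<xi>
    proof -
      have "(norm \<xi> powr s)\<^sup>2 = norm \<xi> powr (2 * s)" unfolding mult_2 powr_add by (rule power2_eq_square)
      thus ?thesis by (simp add: G_def F_def h_def norm_mult power_mult_distrib indicator_def)
    qed
    hence "(\<integral>\<^sup>+\<xi>. ennreal ((cmod (G j \<xi>))\<^sup>2) \<partial>lborel) = (\<integral>\<^sup>+\<xi>. ennreal ((a j)\<^sup>2 * h j \<xi>) \<partial>lborel)" by simp
    also have "\<dots> = ennreal (\<integral>\<xi>. (a j)\<^sup>2 * h j \<xi> \<partial>lborel)"
      using ih h0 by (intro nn_integral_eq_integral integrable_mult_right) auto
    also have "(\<integral>\<xi>. (a j)\<^sup>2 * h j \<xi> \<partial>lborel) = (2 * pi) ^ DIM('a)"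
      using Ip[of j] by (simp add: I_def[symmetric] a2)
    finally show ?thesis .
  qed
  let ?f = "\<lambda>j. inv_ft (F j)" and ?u = "\<lambda>j t. inv_ft (\<lambda>\<xi>. cis (- (t * (norm \<xi>)\<^sup>2)) * F j \<xi>)"
  have o: "orthonormal_hom_sobolev s J ?f" for J
    unfolding orthonormal_hom_sobolev_def
  proof (intro exI conjI ballI)
    have iG: "integrable lborel (G j)" for j by (rule bounded_on_ball_integrable(1)[OF Gm Gb Gs])
    have disj: "G i x = 0 \<or> G j x = 0" if "i \<noteq> j" for i j x
      using dyadic_shell_disjoint[of x i j] that by (auto simp: G_def F_def indicator_def)
    fix j
    show "abs_D_powr s (?f j) (inv_ft (G j))"
      unfolding abs_D_powr_def G_def
      by (rule inv_ft_multiplier[OF Fm _ Fb _ Fs]) (use Gb in \<open>auto simp: G_def\<close>)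
    show "square_integrable (inv_ft (G j))"
      using inv_ft_orthonormal(1)[of UNIV G j j] iG G2 disj by auto
    show "(\<integral>x. inv_ft (G i) x * cnj (inv_ft (G j) x) \<partial>lborel) = (if i = j then 1 else 0)" for i
      using inv_ft_orthonormal(2)[of UNIV G i j] iG G2 disj by auto
  qed
  have e: "schroedinger_evolution (?f j) (?u j)" for j by (rule inv_ft_schroedinger[OF Fm Fb Fs])
  define c where "c = ?k * V0 / (4 * 2 powr (2 * s))"
  have cp: "0 < c" using V0p ft_unit(1)[where 'a='a] by (simp add: c_def)
  have "c * (2 ^ j) powr (real DIM('a) - 2 * s) \<le> (cmod (?u j t x))\<^sup>2"
    if "norm x \<le> 1 / (4 * 2 ^ j)" "0 \<le> t" "t \<le> 1 / (8 * 4 ^ j)" for j t x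
  proof -
    let ?M = "(2 ^ Suc j) powr (2 * s) :: real"
    \<comment> \<open>A factor \<open>?k * (2 * pi) ^ DIM('a)\<close>, which is 1, is inserted so
      that the square of \<open>a j\<close> can be recognised; \<open>I_up\<close> replaces the
      exact normalisation by its bound.\<close>
    have "c * (2 ^ j) powr (real DIM('a) - 2 * s) = ?k * (V j / (4 * ?M))"
      by (simp add: c_def V powr_diff powr_mult powr_realpow)
    also have "\<dots> = ?k * (?k * (2 * pi) ^ DIM('a)) * (V j / (4 * ?M))" unfolding ft_unit(2) by simp
    also have "\<dots> = ?k\<^sup>2 * (((2 * pi) ^ DIM('a) / (?M * V j)) * ((V j)\<^sup>2 / 4))"
      using Vp[of j] by (simp add: power2_eq_square)
    also have "\<dots> \<le> ?k\<^sup>2 * ((a j)\<^sup>2 * ((V j)\<^sup>2 / 4))"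
      unfolding a2 using I_up[of j] Ip[of j] Vp[of j] by (intro mult_left_mono mult_right_mono divide_left_mono) auto
    also have "\<dots> = (?k * (a j * V j / 2))\<^sup>2" by (simp add: power_mult_distrib power_divide)
    also have "\<dots> \<le> (cmod (?u j t x))\<^sup>2"
      using shell_wave_lower_bound[OF that a0[of j]] a0[of j] Vp[of j]
      by (intro power_mono) (auto simp: F_def V_def)
    finally show ?thesis .
  qed
  from that[OF cp o e this] show thesis .
qed

section \<open>Growth of the mixed norm against the coefficient norm\<close>

lemma esssup_ge_on_cball:
  fixes h :: "'a::euclidean_space \<Rightarrow> ennreal"
  assumes r: "0 < r" and h: "\<And>x. norm x \<le> r \<Longrightarrow> b \<le> h x"
  shows "b \<le> esssup lborel h"
proof (rule ccontr)
  assume n: "\<not> b \<le> esssup lborel h"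
  have "AE x in (lborel::'a measure). x \<notin> cball 0 r"
    using esssup_AE[of h lborel] by eventually_elim (use n h in \<open>auto intro: order_trans\<close>)
  hence "emeasure lborel {x::'a. norm x \<le> r} = 0" by (subst (asm) AE_iff_measurable[OF _ refl]) auto
  moreover have "cball (0::'a) r = {x. norm x \<le> r}" by auto
  moreover have "0 < measure lborel (cball (0::'a) r)" using r by (simp add: content_cball)
  ultimately show False by (simp add: measure_def)
qed

text \<open>On the part of the j-th interval outside the next one, of length 3/(32 * 4^j), the
  function is at least c 4^j. Each of these \<open>N\<close> disjoint pieces contributes the same
  amount 3c/32.\<close>

lemma dyadic_intervals_lower_bound:
  fixes g :: "real \<Rightarrow> ennreal"
  assumes c: "0 \<le> c" and g: "\<And>j t. j < N \<Longrightarrow> 0 \<le> t \<Longrightarrow> t \<le> 1 / (8 * 4 ^ j) \<Longrightarrow> ennreal (c * 4 ^ j) \<le> g t"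
  shows "ennreal (real N * (c * 3 / 32)) \<le> (\<integral>\<^sup>+t. g t \<partial>lborel)"
proof -
  let ?I = "\<lambda>j::nat. {1 / (8 * 4 ^ Suc j) <.. 1 / (8 * 4 ^ j)} :: real set"
  have disj: "i = j" if "t \<in> ?I i" "t \<in> ?I j" for i j t
  proof -
    have "\<not> i < j" if "t \<in> ?I i" "t \<in> ?I j" for i j
    proof
      assume "i < j"
      hence "(4::real) ^ Suc i \<le> 4 ^ j" by (intro power_increasing) auto
      hence "1 / (8 * 4 ^ j) \<le> 1 / (8 * 4 ^ Suc i :: real)" by (intro divide_left_mono mult_left_mono) auto
      thus False using that by auto
    qed
    thus ?thesis using that by (meson linorder_neqE_nat)
  qed
  have I: "emeasure lborel (?I j) = ennreal (3 / (32 * 4 ^ j))" for j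
    by (subst emeasure_lborel_Ioc) (simp_all add: field_simps)
  have "ennreal (real N * (c * 3 / 32)) = (\<Sum>j<N. ennreal (c * 4 ^ j) * emeasure lborel (?I j))"
    unfolding I using c by (simp add: ennreal_mult[symmetric] ennreal_of_nat_eq_real_of_nat)
  also have "\<dots> = (\<Sum>j<N. \<integral>\<^sup>+t. ennreal (c * 4 ^ j) * indicator (?I j) t \<partial>lborel)"
    by (intro sum.cong refl nn_integral_cmult_indicator[symmetric]) simp
  also have "\<dots> = (\<integral>\<^sup>+t. (\<Sum>j<N. ennreal (c * 4 ^ j) * indicator (?I j) t) \<partial>lborel)"
    by (rule nn_integral_sum[symmetric]) simp
  also have "\<dots> \<le> (\<integral>\<^sup>+t. g t \<partial>lborel)"
  proof (rule nn_integral_mono)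
    fix t :: real
    show "(\<Sum>j<N. ennreal (c * 4 ^ j) * indicator (?I j) t) \<le> g t"
    proof (cases "\<exists>j<N. t \<in> ?I j")
      case True
      then obtain i where i: "i < N" "t \<in> ?I i" by blast
      have "(\<Sum>j<N. ennreal (c * 4 ^ j) * indicator (?I j) t) = (\<Sum>j<N. if j = i then ennreal (c * 4 ^ i) else 0)"
        by (intro sum.cong refl) (use disj i(2) in \<open>auto simp: indicator_def\<close>)
      also have "\<dots> = ennreal (c * 4 ^ i)" using i by simp
      also have "\<dots> \<le> g t"
      proof (rule g[OF i(1)])
        have "0 < 1 / (8 * 4 ^ Suc i :: real)" by simp
        also have "\<dots> < t" using i(2) by simp
        finally show "0 \<le> t" by simp
        show "t \<le> 1 / (8 * 4 ^ i)" using i(2) by simp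
      qed
      finally show ?thesis .
    next
      case False
      hence "(\<Sum>j<N. ennreal (c * 4 ^ j) * indicator (?I j) t) = 0" by (intro sum.neutral) (auto simp: indicator_def)
      thus ?thesis by simp
    qed
  qed
  finally show ?thesis .
qed

text \<open>The exponent \<open>e\<close> is 1/\<beta> for finite \<beta> and 0 for \<beta> =
  \<infinity>, so both cases reduce to the strict inequality e < 1/p.\<close>

lemma seq_lp_norm_one_le:
  assumes p: "0 < p" and \<beta>: "ereal p < \<beta>"
  obtains e where "e < 1 / p" "\<And>N. 0 < N \<Longrightarrow> seq_lp_norm \<beta> {..<N} (\<lambda>_. 1) \<le> ennreal (real N powr e)"
proof (cases \<beta>)
  case (real b)
  hence b: "p < b" using \<beta> by simp
  have "seq_lp_norm \<beta> {..<N} (\<lambda>_. 1) \<le> ennreal (real N powr (1 / b))" for N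
  proof -
    have "seq_lp_norm \<beta> {..<N} (\<lambda>_. 1) = ennreal_powr (ennreal (real N)) (1 / b)"
      by (simp add: seq_lp_norm_def real ennreal_of_nat_eq_real_of_nat)
    thus ?thesis by (simp add: ennreal_powr_ennreal)
  qed
  moreover have "1 / b < 1 / p" using p b by (intro divide_strict_left_mono) auto
  ultimately show thesis using that by blast
next
  case PInf
  show thesis by (rule that[of 0]) (use p in \<open>auto simp: seq_lp_norm_def PInf intro!: SUP_least\<close>)
next
  case MInf
  thus thesis using \<beta> by simp
qed

text \<open>With unit coefficients on the first \<open>N\<close> shell functions the mixed norm
  grows at least like N^(1/p), since every dyadic time scale contributes equally; the coefficient
  norm grows at most like N^e with e < 1/p. For large \<open>N\<close> no constant can hold.\<close>

lemma maximal_estimate_fails: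
  fixes q s :: real and \<beta> :: ereal
  assumes dq: "(DIM('a::euclidean_space) = 1 \<and> 4 < q) \<or> (2 \<le> DIM('a) \<and> 2 < q)"
    and s: "s = real DIM('a) / 2 - 2 / q" and \<beta>: "ereal (q / 2) < \<beta>"
  shows "\<not> orthonormal_maximal_estimate TYPE('a) s q \<beta> C"
proof
  assume est: "orthonormal_maximal_estimate TYPE('a) s q \<beta> C"
  define p where "p = q / 2"
  have p: "0 < p" using dq by (auto simp: p_def)
  have q: "0 < q" using dq by auto
  have "4 \<le> q * real DIM('a)"
  proof (cases "DIM('a) = 1")
    case False
    hence "2 * 2 \<le> q * real DIM('a)" using dq by (intro mult_mono) auto
    thus ?thesis by simp
  qed (use dq in auto)
  hence "2 / q \<le> real DIM('a) / 2" using q by (simp add: field_simps)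
  hence s0: "0 \<le> s" using s by simp
  obtain f :: "nat \<Rightarrow> 'a \<Rightarrow> complex" and u c where c: "0 < c"
    and o: "\<And>J. orthonormal_hom_sobolev s J f" and ev: "\<And>j. schroedinger_evolution (f j) (u j)"
    and lb: "\<And>j t x. norm x \<le> 1 / (4 * 2 ^ j) \<Longrightarrow> 0 \<le> t \<Longrightarrow> t \<le> 1 / (8 * 4 ^ j) \<Longrightarrow>
       c * (2 ^ j) powr (real DIM('a) - 2 * s) \<le> (cmod (u j t x))\<^sup>2"
    using dyadic_shell_system[OF s0, where 'a='a] by metis
  have ex: "real DIM('a) - 2 * s = 2 / p" using q by (simp add: s p_def)
  have pw: "(c * (2 ^ j) powr (real DIM('a) - 2 * s)) powr p = c powr p * 4 ^ j" for j :: nat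
  proof -
    have "((2 ^ j) powr (2 / p)) powr p = ((2::real) ^ j) powr 2" unfolding powr_powr using p by simp
    also have "\<dots> = 4 ^ j" by (simp add: power_mult[symmetric] mult.commute[of j] power_mult)
    finally show ?thesis unfolding ex using c by (simp add: powr_mult)
  qed
  define c2 where "c2 = c powr p * 3 / 32"
  have c2: "0 < c2" using c by (simp add: c2_def)
  obtain e where e: "e < 1 / p" and se: "\<And>N. 0 < N \<Longrightarrow> seq_lp_norm \<beta> {..<N} (\<lambda>_. 1) \<le> ennreal (real N powr e)"
    using seq_lp_norm_one_le[OF p \<beta>[folded p_def]] by metis
  have key: "real N powr (1 / p - e) \<le> max C 0 / c2 powr (1 / p)" if N: "0 < N" for N
  proof -
    let ?F = "\<lambda>t x. \<Sum>\<^sub>\<infinity>j\<in>{..<N}. (1::complex) * of_real ((cmod (u j t x))\<^sup>2)"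
    have low: "ennreal (c powr p * 4 ^ j) \<le> ennreal_powr (esssup lborel (\<lambda>x. ennreal (cmod (?F t x)))) p"
      if j: "j < N" and t: "0 \<le> t" "t \<le> 1 / (8 * 4 ^ j)" for j t
    proof -
      have "ennreal (c * (2 ^ j) powr (real DIM('a) - 2 * s)) \<le> esssup lborel (\<lambda>x. ennreal (cmod (?F t x)))"
      proof (rule esssup_ge_on_cball)
        show "0 < 1 / (4 * 2 ^ j :: real)" by simp
        fix x :: 'a assume x: "norm x \<le> 1 / (4 * 2 ^ j)"
        have "c * (2 ^ j) powr (real DIM('a) - 2 * s) \<le> (cmod (u j t x))\<^sup>2" by (rule lb[OF x t])
        also have "\<dots> \<le> (\<Sum>i<N. (cmod (u i t x))\<^sup>2)" using j by (intro member_le_sum) auto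
        also have "\<dots> = cmod (of_real (\<Sum>i<N. (cmod (u i t x))\<^sup>2))"
          unfolding norm_of_real by (simp add: sum_nonneg)
        also have "complex_of_real (\<Sum>i<N. (cmod (u i t x))\<^sup>2) = ?F t x" by simp
        finally show "ennreal (c * (2 ^ j) powr (real DIM('a) - 2 * s)) \<le> ennreal (cmod (?F t x))" by (rule ennreal_leI)
      qed
      from ennreal_powr_mono[OF less_imp_le[OF p] this] show ?thesis
        using c by (simp add: ennreal_powr_ennreal pw)
    qed
    have "ennreal ((real N * c2) powr (1 / p)) = ennreal_powr (ennreal (real N * c2)) (1 / p)"
      using c2 by (simp add: ennreal_powr_ennreal)
    also have "\<dots> \<le> Lp_Linf_norm p ?F"
      unfolding Lp_Linf_norm_def c2_def using p
      by (intro ennreal_powr_mono dyadic_intervals_lower_bound low) auto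
    also have "\<dots> \<le> ennreal C * seq_lp_norm \<beta> {..<N} (\<lambda>_. 1)"
    proof -
      have "seq_lp_norm \<beta> {..<N} (\<lambda>_. 1) < \<infinity>" using le_less_trans[OF se[OF N]] by simp
      thus ?thesis using est o[of "{..<N}"] ev unfolding orthonormal_maximal_estimate_def p_def by blast
    qed
    also have "\<dots> \<le> ennreal C * ennreal (real N powr e)" by (intro mult_left_mono se N) simp
    \<comment> \<open>The constant is an arbitrary real number; \<open>ennreal\<close> sends
      negative ones to 0, and \<open>max C 0\<close> permits the return to real
      inequalities.\<close>
    also have "\<dots> \<le> ennreal (max C 0) * ennreal (real N powr e)" by (intro mult_right_mono ennreal_leI) auto
    also have "\<dots> = ennreal (max C 0 * real N powr e)" by (rule ennreal_mult[symmetric]) auto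
    finally have "(real N * c2) powr (1 / p) \<le> max C 0 * real N powr e" by (subst (asm) ennreal_le_iff) auto
    hence "real N powr (1 / p) * c2 powr (1 / p) \<le> max C 0 * real N powr e" using c2 by (simp add: powr_mult)
    thus ?thesis using N c2 by (simp add: powr_diff field_simps)
  qed
  define e' where "e' = 1 / p - e"
  have e': "0 < e'" using e by (simp add: e'_def)
  have "filterlim (\<lambda>N::nat. real N powr e') at_top sequentially" using e' by real_asymp
  hence "eventually (\<lambda>N::nat. max C 0 / c2 powr (1 / p) < real N powr e') sequentially"
    by (rule filterlim_at_top_dense[THEN iffD1, rule_format])
  from eventually_happens[OF eventually_conj[OF this eventually_gt_at_top[of 0]]]
  obtain N :: nat where "0 < N" "max C 0 / c2 powr (1 / p) < real N powr e'" by auto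
  thus False using key[of N] by (simp add: e'_def)
qed

theorem theorem2p1:
  fixes q s :: real and \<beta> :: ereal
  assumes "(DIM('a::euclidean_space) = 1 \<and> 4 < q) \<or> (2 \<le> DIM('a) \<and> 2 < q)"
    and "s = real DIM('a) / 2 - 2 / q"
    and "1 \<le> \<beta>"
  shows "(\<beta> < ereal (q / 2) \<longrightarrow> (\<exists>C. orthonormal_maximal_estimate TYPE('a) s q \<beta> C)) \<and>
         (\<beta> > ereal (q / 2) \<longrightarrow> \<not> (\<exists>C. orthonormal_maximal_estimate TYPE('a) s q \<beta> C))"
proof (intro conjI impI)
  assume lt: "\<beta> < ereal (q / 2)"
  then obtain b where b: "\<beta> = ereal b" using assms(3) by (cases \<beta>) auto
  show "\<exists>C. orthonormal_maximal_estimate TYPE('a) s q \<beta> C"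
    unfolding b by (rule maximal_estimate_holds[OF assms(1,2)]) (use lt assms(3) b in auto)
qed (use maximal_estimate_fails[OF assms(1,2)] in blast)

end
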